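(* Let $\alpha\in(1,2]$, let $k\ge4$ be an integer, $\mu\in\{\pm1\}$, $s_k=\frac12-\frac{\alpha}{k}$, and let $u_0\in\dot H^s_x(\mathbb R)\cap\dot H^{s_k}_x(\mathbb R)$ for $s\ge0$. Let $u\in\dot X^{s_k}_T\cap S^{s_k}_T$ be the solution on $[0,T]$ with initial data $u_0$ of $$u_t+D_x^\alpha u_x+\mu\,u^ku_x=0$$ given by the critical local theory in $\dot H^{s_k}_x(\mathbb R)$ (recalled in the context). Then $u$ belongs to $\dot X^s_T\cap S^s_T$.
   Context: $u=u(t,x)$ is real-valued, $(t,x)\in\mathbb R\times\mathbb R$. For real $s$, $D_x^s$ is the Fourier multiplier in $x$ with symbol $|\xi|^s$, and $\|f\|_{\dot H^s_x}=\|D_x^s f\|_{L^2_x}$. The linear group is $V_\alpha(t)f=\mathcal F_x^{-1}\big(e^{-it|\xi|^\alpha\xi}\widehat f(\xi)\big)$. For an interval $I$, $\|u\|_{L^p_xL^q_t(I\times\mathbb R)}=\big\|\,\|u(t,x)\|_{L^q_t(I)}\big\|_{L^p_x(\mathbb R)}$. The space $\dot X^s(I)$ consists of functions in $C_t\dot H^s_x(I\times\mathbb R)$ with finite norm $$\|u\|_{\dot X^s(I)}=\sup_{t\in I}\|u(t)\|_{\dot H^s_x}+\big\|D_x^{s+\frac12}u\big\|_{L_x^{\frac{4\alpha+2}{\alpha-1}}L_t^{\frac{4\alpha+2}{3}}(I\times\mathbb R)}.$$ Let $$p_s=\frac{(2\alpha+1)k}{\alpha+2},\qquad q_s=\frac{(2\alpha+1)(\alpha+1)k}{2(\alpha^2-1)-(s-s_k)(2\alpha+1)k},\qquad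 S^s(I)=L^{p_s}_xL^{q_s}_t(I\times\mathbb R).$$ Write $\dot X^s_T=\dot X^s([0,T])$, $S^s_T=S^s([0,T])$. A solution satisfies the Duhamel formula $u(t)=V_\alpha(t)u_0-\frac{\mu}{k+1}\int_0^tV_\alpha(t-\tau)\partial_x(u^{k+1})(\tau)\,d\tau$. Critical local theory: for $u_0\in\dot H^{s_k}_x$ there is $\varepsilon_0=\varepsilon_0(\|u_0\|_{\dot H^{s_k}_x})>0$ such that, for $T=T(u_0)>0$ chosen with $\|V_\alpha(t)u_0\|_{S^{s_k}_T}\le\varepsilon_0$, there is a unique solution $u\in\dot X^{s_k}_T\cap S^{s_k}_T$ with data $u_0$.
   Formalization: Membership in S^s_T is claimed only when 2(α²−1)−(s−s_k)(2α+1)k ≥ 0 (with q_s=∞ when it is 0); for larger s the exponent q_s is negative and S^s_T is undefined. Membership in X^s_T is proved for all s ≥ 0. *)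

theory Defs
  imports "HOL-Analysis.Analysis" "HOL-Probability.Essential_Supremum"
begin

section \<open>Fourier multipliers\<close>

definition schwartz :: "(real \<Rightarrow> complex) \<Rightarrow> bool" where
  "schwartz \<phi> \<longleftrightarrow>
     (\<forall>n x. ((\<lambda>h y. vector_derivative h (at y)) ^^ n) \<phi> differentiable (at x)) \<and>
     (\<forall>m n. bounded (range (\<lambda>x. x ^ m *\<^sub>R ((\<lambda>h y. vector_derivative h (at y)) ^^ n) \<phi> x)))"

definition fourier :: "(real \<Rightarrow> complex) \<Rightarrow> real \<Rightarrow> complex" where
  "fourier h x = (LINT \<xi>|lborel. exp (- \<i> * of_real (x * \<xi>)) * h \<xi>)"

text \<open>
  The elements of homogeneous Sobolev spaces need not be integrable, so their Fourier transform is
  the one of tempered distributions: \<open>f\<close> and \<open>F\<close> are functions that define tempered distributions,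
  and \<open>F\<close> is the transform of \<open>f\<close>. It determines \<open>F\<close> from \<open>f\<close>, and \<open>f\<close> from \<open>F\<close>, up to null sets.
\<close>

definition fourier_pair :: "(real \<Rightarrow> complex) \<Rightarrow> (real \<Rightarrow> complex) \<Rightarrow> bool" where
  "fourier_pair f F \<longleftrightarrow> (\<forall>\<psi>. schwartz \<psi> \<longrightarrow>
     integrable lborel (\<lambda>x. f x * fourier \<psi> x) \<and>
     integrable lborel (\<lambda>\<xi>. F \<xi> * \<psi> \<xi>) \<and>
     (LINT x|lborel. f x * fourier \<psi> x) = (LINT \<xi>|lborel. F \<xi> * \<psi> \<xi>))"

text \<open>\<open>g\<close> is the image of \<open>f\<close> under the Fourier multiplier with symbol \<open>m\<close>.\<close>

definition fourier_multiplier ::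
  "(real \<Rightarrow> complex) \<Rightarrow> (real \<Rightarrow> complex) \<Rightarrow> (real \<Rightarrow> complex) \<Rightarrow> bool" where
  "fourier_multiplier m f g \<longleftrightarrow>
     (\<exists>F. fourier_pair f F \<and> fourier_pair g (\<lambda>\<xi>. m \<xi> * F \<xi>))"

definition D_symbol :: "real \<Rightarrow> real \<Rightarrow> complex" where
  "D_symbol s \<xi> = of_real (\<bar>\<xi>\<bar> powr s)"

definition V_symbol :: "real \<Rightarrow> real \<Rightarrow> real \<Rightarrow> complex" where
  "V_symbol \<alpha> t \<xi> = exp (- \<i> * of_real (t * \<bar>\<xi>\<bar> powr \<alpha> * \<xi>))"


section \<open>Lebesgue and homogeneous Sobolev norms\<close>

text \<open>Only used for \<open>a > 0\<close>.\<close>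

definition ennreal_powr :: "ennreal \<Rightarrow> real \<Rightarrow> ennreal" where
  "ennreal_powr x a = (if x = \<infinity> then \<infinity> else ennreal (enn2real x powr a))"

definition Lebesgue_norm :: "'a measure \<Rightarrow> ennreal \<Rightarrow> ('a \<Rightarrow> ennreal) \<Rightarrow> ennreal" where
  "Lebesgue_norm M p f =
     (if p = \<infinity> then esssup M f
      else ennreal_powr (\<integral>\<^sup>+ x. ennreal_powr (f x) (enn2real p) \<partial>M) (1 / enn2real p))"

text \<open>\<open>u t x\<close> has time as first argument; the norm in time is the inner one.\<close>

definition mixed_norm ::
  "ennreal \<Rightarrow> ennreal \<Rightarrow> real set \<Rightarrow> (real \<Rightarrow> real \<Rightarrow> 'b::real_normed_vector) \<Rightarrow> ennreal" where
  "mixed_norm p q I u =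
     Lebesgue_norm lborel p
       (\<lambda>x. Lebesgue_norm (restrict_space lborel I) q (\<lambda>t. ennreal (norm (u t x))))"

definition spacetime_measurable ::
  "real set \<Rightarrow> (real \<Rightarrow> real \<Rightarrow> 'b::real_normed_vector) \<Rightarrow> bool" where
  "spacetime_measurable I u \<longleftrightarrow>
     (\<lambda>(t, x). u t x) \<in> borel_measurable (restrict_space lborel I \<Otimes>\<^sub>M lborel)"

text \<open>
  The \<open>L\<^sup>2\<close> norm of \<open>D\<^sup>s f\<close>. The function \<open>g = D\<^sup>s f\<close> is unique up to a null set, so the infimum is
  over a single value; it is \<open>\<infinity>\<close> if there is no such function. For \<open>s \<ge> 0\<close> every tempered
  distribution whose transform \<open>F\<close> is locally integrable with \<open>\<bar>\<xi>\<bar>\<^sup>s F\<close> in \<open>L\<^sup>2\<close> is a function.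
\<close>

definition Hdot_norm :: "real \<Rightarrow> (real \<Rightarrow> real) \<Rightarrow> ennreal" where
  "Hdot_norm s f =
     (INF g \<in> {g. fourier_multiplier (D_symbol s) (\<lambda>x. complex_of_real (f x)) g}.
        Lebesgue_norm lborel 2 (\<lambda>x. ennreal (norm (g x))))"

definition Hdot :: "real \<Rightarrow> (real \<Rightarrow> real) set" where
  "Hdot s = {f. Hdot_norm s f < \<infinity>}"


section \<open>The solution spaces\<close>

text \<open>
  The norm of \<open>D\<^sup>s u\<close> in \<open>L\<^sup>p\<close> in \<open>x\<close> and \<open>L\<^sup>q\<close> in \<open>t\<close>. For a single time \<open>D\<^sup>s u(t)\<close> may only be
  a distribution; the norm is finite only if it is, at almost every time, the function \<open>w t\<close>. Again
  \<open>w\<close> is unique up to null sets.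
\<close>

definition D_mixed_norm ::
  "real \<Rightarrow> ennreal \<Rightarrow> ennreal \<Rightarrow> real set \<Rightarrow> (real \<Rightarrow> real \<Rightarrow> real) \<Rightarrow> ennreal" where
  "D_mixed_norm s p q I u =
     (INF w \<in> {w. spacetime_measurable I w \<and>
                  (AE t in lborel. t \<in> I \<longrightarrow>
                     fourier_multiplier (D_symbol s) (\<lambda>x. complex_of_real (u t x)) (w t))}.
        mixed_norm p q I w)"

definition X_norm :: "real \<Rightarrow> real \<Rightarrow> real set \<Rightarrow> (real \<Rightarrow> real \<Rightarrow> real) \<Rightarrow> ennreal" where
  "X_norm \<alpha> s I u =
     (SUP t \<in> I. Hdot_norm s (u t)) +
     D_mixed_norm (s + 1 / 2)
       (ennreal ((4 * \<alpha> + 2) / (\<alpha> - 1))) (ennreal ((4 * \<alpha> + 2) / 3)) I u"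

definition X_space :: "real \<Rightarrow> real \<Rightarrow> real set \<Rightarrow> (real \<Rightarrow> real \<Rightarrow> real) set" where
  "X_space \<alpha> s I =
     {u. spacetime_measurable I u \<and>
         (\<forall>t\<in>I. u t \<in> Hdot s) \<and>
         (\<forall>t\<in>I. ((\<lambda>r. Hdot_norm s (\<lambda>x. u r x - u t x)) \<longlongrightarrow> 0) (at t within I)) \<and>
         X_norm \<alpha> s I u < \<infinity>}"

definition s_crit :: "real \<Rightarrow> nat \<Rightarrow> real" where
  "s_crit \<alpha> k = 1 / 2 - \<alpha> / real k"

definition p_exp :: "real \<Rightarrow> nat \<Rightarrow> ennreal" where
  "p_exp \<alpha> k = ennreal ((2 * \<alpha> + 1) * real k / (\<alpha> + 2))"

definition q_denom :: "real \<Rightarrow> nat \<Rightarrow> real \<Rightarrow> real" where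
  "q_denom \<alpha> k s = 2 * (\<alpha>\<^sup>2 - 1) - (s - s_crit \<alpha> k) * (2 * \<alpha> + 1) * real k"

text \<open>
  The exponent is \<open>\<infinity>\<close> where the denominator vanishes. For larger \<open>s\<close> the denominator is negative
  and there is no exponent; the value of \<open>q_exp\<close> is then meaningless.
\<close>

definition q_exp :: "real \<Rightarrow> nat \<Rightarrow> real \<Rightarrow> ennreal" where
  "q_exp \<alpha> k s =
     (if q_denom \<alpha> k s = 0 then \<infinity>
      else ennreal ((2 * \<alpha> + 1) * (\<alpha> + 1) * real k / q_denom \<alpha> k s))"

definition S_norm ::
  "real \<Rightarrow> nat \<Rightarrow> real \<Rightarrow> real set \<Rightarrow> (real \<Rightarrow> real \<Rightarrow> 'b::real_normed_vector) \<Rightarrow> ennreal" where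
  "S_norm \<alpha> k s I u = mixed_norm (p_exp \<alpha> k) (q_exp \<alpha> k s) I u"

definition S_space :: "real \<Rightarrow> nat \<Rightarrow> real \<Rightarrow> real set \<Rightarrow> (real \<Rightarrow> real \<Rightarrow> real) set" where
  "S_space \<alpha> k s I = {u. spacetime_measurable I u \<and> S_norm \<alpha> k s I u < \<infinity>}"


section \<open>Solutions and the critical local theory\<close>

text \<open>\<open>v t\<close> is \<open>V\<^sub>\<alpha>(t) u\<^sub>0\<close> for all \<open>t\<close> in \<open>I\<close>.\<close>

definition free_evolution ::
  "real \<Rightarrow> (real \<Rightarrow> real) \<Rightarrow> real set \<Rightarrow> (real \<Rightarrow> real \<Rightarrow> complex) \<Rightarrow> bool" where
  "free_evolution \<alpha> u0 I v \<longleftrightarrow>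
     spacetime_measurable I v \<and>
     (\<forall>t\<in>I. fourier_multiplier (V_symbol \<alpha> t) (\<lambda>x. complex_of_real (u0 x)) (v t))"

text \<open>
  The Duhamel formula, as an identity of tempered distributions at every time \<open>t\<close>, tested against
  \<open>fourier \<psi>\<close>. The distribution \<open>V\<^sub>\<alpha>(\<sigma>) \<partial>\<^sub>x N\<close> has the symbol \<open>m(\<xi>) = exp(- \<i> \<sigma> \<bar>\<xi>\<bar>\<^sup>\<alpha> \<xi>) \<i> \<xi>\<close>, so
  that its value at \<open>fourier \<psi>\<close> is the value of \<open>N\<close> at \<open>fourier (m \<psi>)\<close>; the latter function decays
  like \<open>\<bar>x\<bar>\<close> to the power \<open>-(\<alpha> + 3)\<close>, or faster.
\<close>

definition Duhamel_integrand ::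
  "real \<Rightarrow> nat \<Rightarrow> (real \<Rightarrow> real \<Rightarrow> real) \<Rightarrow> real \<Rightarrow> (real \<Rightarrow> complex) \<Rightarrow> real \<Rightarrow> real \<Rightarrow> complex" where
  "Duhamel_integrand \<alpha> k u t \<psi> \<tau> x =
     of_real (u \<tau> x ^ (k + 1)) *
     fourier (\<lambda>\<xi>. V_symbol \<alpha> (t - \<tau>) \<xi> * (\<i> * of_real \<xi>) * \<psi> \<xi>) x"

definition solves_Duhamel ::
  "real \<Rightarrow> nat \<Rightarrow> real \<Rightarrow> (real \<Rightarrow> real) \<Rightarrow> real \<Rightarrow> (real \<Rightarrow> real \<Rightarrow> real) \<Rightarrow> bool" where
  "solves_Duhamel \<alpha> k \<mu> u0 T u \<longleftrightarrow>
     (\<exists>v. free_evolution \<alpha> u0 {0..T} v \<and>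
       (\<forall>t\<in>{0..T}. \<forall>\<psi>. schwartz \<psi> \<longrightarrow>
          integrable lborel (\<lambda>x. of_real (u t x) * fourier \<psi> x) \<and>
          integrable (restrict_space lborel {0..t} \<Otimes>\<^sub>M lborel)
            (\<lambda>(\<tau>, x). Duhamel_integrand \<alpha> k u t \<psi> \<tau> x) \<and>
          (LINT x|lborel. of_real (u t x) * fourier \<psi> x) =
            (LINT x|lborel. v t x * fourier \<psi> x) -
            of_real (\<mu> / real (k + 1)) *
              (LINT \<tau>|restrict_space lborel {0..t}.
                 LINT x|lborel. Duhamel_integrand \<alpha> k u t \<psi> \<tau> x)))"

definition critical_solution ::
  "real \<Rightarrow> nat \<Rightarrow> real \<Rightarrow> (real \<Rightarrow> real) \<Rightarrow> real \<Rightarrow> (real \<Rightarrow> real \<Rightarrow> real) \<Rightarrow> bool" where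
  "critical_solution \<alpha> k \<mu> u0 T u \<longleftrightarrow>
     u \<in> X_space \<alpha> (s_crit \<alpha> k) {0..T} \<inter> S_space \<alpha> k (s_crit \<alpha> k) {0..T} \<and>
     solves_Duhamel \<alpha> k \<mu> u0 T u"

text \<open>\<open>T\<close> is an admissible time for the data \<open>u0\<close> and the threshold \<open>\<epsilon>\<close>.\<close>

definition admissible_time ::
  "real \<Rightarrow> nat \<Rightarrow> real \<Rightarrow> (real \<Rightarrow> real) \<Rightarrow> real \<Rightarrow> bool" where
  "admissible_time \<alpha> k \<epsilon> u0 T \<longleftrightarrow>
     T > 0 \<and>
     (\<exists>v. free_evolution \<alpha> u0 {0..T} v \<and> S_norm \<alpha> k (s_crit \<alpha> k) {0..T} v \<le> ennreal \<epsilon>)"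

text \<open>
  The critical local theory holds with the threshold function \<open>\<epsilon>0\<close>, which depends only on the size
  of the data. Functions are identified when they agree almost everywhere at every time.
\<close>

definition critical_local_theory :: "real \<Rightarrow> nat \<Rightarrow> real \<Rightarrow> (real \<Rightarrow> real) \<Rightarrow> bool" where
  "critical_local_theory \<alpha> k \<mu> \<epsilon>0 \<longleftrightarrow>
     (\<forall>u0 \<in> Hdot (s_crit \<alpha> k).
        let \<epsilon> = \<epsilon>0 (enn2real (Hdot_norm (s_crit \<alpha> k) u0)) in
          \<epsilon> > 0 \<and>
          (\<forall>T. admissible_time \<alpha> k \<epsilon> u0 T \<longrightarrow>
             (\<exists>u. critical_solution \<alpha> k \<mu> u0 T u) \<and>
             (\<forall>u w. critical_solution \<alpha> k \<mu> u0 T u \<longrightarrow> critical_solution \<alpha> k \<mu> u0 T w \<longrightarrow>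
                (\<forall>t\<in>{0..T}. AE x in lborel. u t x = w t x))))"

end

theory Submission
 imports Defs "HOL-Probability.Probability" "HOL-Real_Asymp.Real_Asymp"
begin

text \<open>Regularity is propagated by an a priori estimate for the pieces \<open>u\<^sub>l\<close> of \<open>u\<close> at frequency \<open>2\<^sup>l\<close>. Let
 \<open>S u\<close> be \<open>u\<close> cut off at frequencies far below \<open>2\<^sup>l / (k + 1)\<close>. As \<open>(S u)\<^bsup>k+1\<^esup>\<close> has no frequencies near \<open>2\<^sup>l\<close>, one
 may replace \<open>u\<^bsup>k+1\<^esup>\<close> by \<open>R\<^sub>l = u\<^bsup>k+1\<^esup> - (S u)\<^bsup>k+1\<^esup>\<close> in the equation for \<open>u\<^sub>l\<close>, and \<open>R\<^sub>l\<close> is controlled by the \<open>u\<^sub>j\<close>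
 with \<open>j \<ge> l - C\<close>; this takes the place of a fractional Leibniz rule. Kato smoothing, the maximal function estimate
 and the Christ--Kiselev argument bound the norm \<open>n\<^sub>l\<close> of \<open>u\<^sub>l\<close> in \<open>L\<^sup>P\<^sub>x L\<^sup>Q\<^sub>t\<close> by \<open>c\<^sub>l + C \<parallel>u\<parallel>\<^sup>k \<Sum>\<^sub>j n\<^sub>j\<close>, the sum over
 \<open>j \<ge> l - C\<close>, the norm of \<open>u\<close> being that of \<open>L\<^sup>p\<^sub>x L\<^sup>q\<^sub>t\<close> for the critical exponents. It is small on short time intervals,
 where iteration from the critical bound on \<open>n\<^sub>l\<close> transfers the \<open>\<ell>\<^sup>2\<close> bound of \<open>2\<^bsup>(s+1/2)l\<^esup> c\<^sub>l\<close> to \<open>n\<^sub>l\<close>. Back in Duhamel's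
 formula this bounds every piece by a function \<open>V\<close> square integrable in \<open>t\<close> and a function \<open>B\<close> of \<open>x\<close> in \<open>L\<^sup>4\<close>, with
 opposite powers of \<open>2\<^sup>l\<close>; summing pointwise as in Hedberg's inequality gives both mixed norms.\<close>

text \<open>Nothing is known of \<open>u\<close> beyond the critical norms, so the norm to be
  propagated could be infinite and cannot simply be moved to the left by smallness. The critical
  norm helps twice. It gives the pieces the decay \<open>2 powr (- (sg0*l))\<close> with
  \<open>sg0 = s_crit + 1/2 > 0\<close>, so that sums over higher scales converge and the iteration
  has a starting point; and it is small on short time intervals because its time exponent is finite.
  The exponents \<open>P\<close>, \<open>Q\<close> interpolate between two endpoints valid at a
  single frequency: square integrability in time, uniform in \<open>x\<close>, with a gain of
  \<open>alpha/2\<close> derivatives, and a maximal function in \<open>L^4\<close> with a loss of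
  \<open>1/4\<close>. The forcing is measured in the conjugate exponents, and Hoelder splits it into
  one factor in the \<open>P\<close>, \<open>Q\<close> norm and \<open>k\<close> critical factors.
  The direct estimate and its dual each return half of the derivative in the nonlinearity, so the
  constants are the same at all scales. The order \<open>s\<close> enters only through the weights
  \<open>2 powr (s*l)\<close> of a sequence norm, which is why integer and fractional
  \<open>s\<close> are treated alike.\<close>

notation ennreal_powr (infixr "^." 80)

abbreviation "LL \<equiv> lborel \<Otimes>\<^sub>M (lborel :: real measure) :: (real \<times> real) measure"
abbreviation nnl :: "(real \<Rightarrow> ennreal) \<Rightarrow> ennreal" (binder "NN " 10) where "nnl f \<equiv> integral\<^sup>N lborel f"
abbreviation lil :: "(real \<Rightarrow> 'a) \<Rightarrow> 'a::{banach, second_countable_topology}" (binder "LI " 60) where "lil f \<equiv> integral\<^sup>L lborel f"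
abbreviation en :: "'a::real_normed_vector \<Rightarrow> ennreal" where "en x \<equiv> ennreal (norm x)"
abbreviation uc :: "(real \<Rightarrow> real \<Rightarrow> 'a) \<Rightarrow> real \<times> real \<Rightarrow> 'a" where "uc R z \<equiv> R (fst z) (snd z)"
abbreviation vd :: "(real \<Rightarrow> 'a::real_normed_vector) \<Rightarrow> 'a \<Rightarrow> real \<Rightarrow> bool" where "vd f a x \<equiv> (f has_vector_derivative a) (at x)"
abbreviation ri :: "int \<Rightarrow> real" where "ri \<equiv> real_of_int"
abbreviation cor :: "real \<Rightarrow> complex" where "cor \<equiv> complex_of_real"
abbreviation pw :: "real \<Rightarrow> int \<Rightarrow> real" where "pw s l \<equiv> 2 powr (s * ri l)"
abbreviation bm :: "('b::topological_space \<Rightarrow> 'a::topological_space) \<Rightarrow> bool" where "bm f \<equiv> f \<in> borel_measurable borel"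
abbreviation mm :: "(real \<Rightarrow> real \<Rightarrow> 'a::topological_space) \<Rightarrow> bool" where
 "mm f \<equiv> (\<lambda>(t, x). f t x) \<in> borel_measurable LL"

abbreviation "ind \<equiv> indicator"
abbreviation ael :: "(real \<Rightarrow> bool) \<Rightarrow> bool" (binder "AEL " 10) where "ael P \<equiv> almost_everywhere lborel P"
abbreviation er :: "real \<Rightarrow> ennreal" where "er \<equiv> ennreal"
abbreviation bml :: "('b::euclidean_space \<Rightarrow> 'a::topological_space) \<Rightarrow> bool" where "bml f \<equiv> f \<in> borel_measurable lborel"
abbreviation bmL :: "(real \<times> real \<Rightarrow> 'a::topological_space) \<Rightarrow> bool" where "bmL f \<equiv> f \<in> borel_measurable LL"
abbreviation lims :: "(nat \<Rightarrow> 'a::topological_space) \<Rightarrow> 'a \<Rightarrow> bool" ("(_)/ ----> (_)" [60, 60] 60) where "X ----> a \<equiv> X \<longlonglongrightarrow> a"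

abbreviation nnL :: "(real \<times> real \<Rightarrow> ennreal) \<Rightarrow> ennreal" (binder "NL " 10) where "nnL f \<equiv> integral\<^sup>N LL f"

lemmas LI_mult = Bochner_Integration.integral_mult_right_zero
lemmas sigma_lborel = lborel.sigma_finite_measure_axioms
lemmas LI_cong = Bochner_Integration.integral_cong
lemmas LI_bound = Bochner_Integration.integrable_bound
lemmas nn_mono = nn_integral_mono
lemmas nn_cong = nn_integral_cong
lemmas nn_cmult = nn_integral_cmult
lemmas nn_multc = nn_integral_multc
lemmas bmi = borel_measurable_integrable

section \<open>Powers of extended nonnegative reals\<close>

lemma epowr_top [simp]: "\<infinity>^.a = \<infinity>" "top^.a = top" by (auto simp: ennreal_powr_def)

lemma epowr_ennreal [simp]: "0 <= r ==> ennreal r^.a = ennreal (r powr a)" by (auto simp: ennreal_powr_def)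

lemma epowr_0 [simp]: "0^.a = 0" "1^.a = 1" by (auto simp: ennreal_powr_def)

lemma epowr_1 [simp]: "x^.1 = x" by (cases x) auto

lemma epowr_mono: "x <= y ==> 0 <= a ==> x^.a <= y^.a" by (cases x; cases y) (auto intro!: ennreal_leI powr_mono2 simp: top_unique)

text \<open>The conventions \<open>0^.a = 0\<close> and \<open>top^.a = top\<close> for every real
  \<open>a\<close>, negative ones included, are stable under products, so this law,
  \<open>epowr_add\<close> and \<open>epowr_mult\<close> hold without side conditions. The price is
  that \<open>x^.0\<close> is not 1 at 0 and at \<open>top\<close>.\<close>

lemma epowr_powr: "(x^.a)^.b = x^.(a*b)" by (cases x) (auto simp: powr_powr)

lemma epowr_add: "x^.a*x^.b = x^.(a + b)" by (cases x) (auto simp: powr_add ennreal_mult[symmetric])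

lemma epowr_eq_0 [simp]: "x^.a = 0 \<longleftrightarrow> x = 0" by (cases x) (auto simp: less_le)

lemma epowr_mult: "(x*y)^.a = x^.a*y^.a"
proof -
 consider "x = 0 | y = 0" | "x ~= 0" "y ~= 0" "x = top | y = top" | "x ~= 0" "y ~= 0" "x ~= top" "y ~= top" by blast
 thus ?thesis
 proof cases
  case 1
  thus ?thesis by (elim disjE) simp_all
 next
  case 2
  hence "x*y = top" "x^.a*y^.a = top" using epowr_eq_0[of x a] epowr_eq_0[of y a] by (auto simp only: ennreal_mult_top ennreal_top_mult epowr_top if_False)
  thus ?thesis by simp
 next
  case 3
  then obtain r q where rq: "x = er r" "y = er q" "r > 0" "q > 0" by (cases x; cases y) (auto simp: less_le)
  have "(x*y)^.a = er ((r*q) powr a)" using rq by (simp add: ennreal_mult[symmetric])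
  also have "... = x^.a*y^.a" using rq by (simp add: powr_mult ennreal_mult)
  finally show ?thesis .
 qed
qed

lemma epowr_eq_top [simp]: "x^.a = top \<longleftrightarrow> x = top" by (cases x) auto

lemma epowr_less_top [simp]: "x^.a < top \<longleftrightarrow> x < top" by (cases x) auto

lemma epowr_numeral: "x^.numeral n = x^numeral n"
proof (cases x)
 case (real r)
 have "x^.numeral n = er (r^numeral n)" using real by (simp only: epowr_ennreal powr_numeral)
 also have "... = x^numeral n" using real by (simp only: ennreal_power)
 finally show ?thesis .
qed (simp add: top_power_ennreal)

lemma epowr_measurable [measurable]:
 assumes [measurable]: "f : borel_measurable M"
 shows "(%x. f x^.a) : borel_measurable M" unfolding ennreal_powr_def by measurable

lemma epowr_le_iff: "0 < a ==> x^.a <= y^.a \<longleftrightarrow> x <= y"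
proof (rule iffI)
 assume a: "0 < a" and "x^.a <= y^.a"
 have "(x^.a)^.(1/a) <= (y^.a)^.(1/a)" using \<open>x^.a <= y^.a\<close> epowr_mono[of "x^.a" "y^.a" "1/a"] a by simp
 thus "x <= y" using a by (simp add: epowr_powr)
next
 assume "0 < a" "x <= y" thus "x^.a <= y^.a" by (simp add: epowr_mono)
qed

lemma tendsto_ennreal_powr:
 assumes "(f \<longlongrightarrow> x) F" "0 < a"
 shows "((%n. f n^.a) \<longlongrightarrow> x^.a) F"
proof (cases x)
 case (real r)
 have ev: "eventually (%n. f n < top) F" using order_tendstoD(2)[OF assms(1), of top] real by auto
 have "((%n. er (enn2real (f n) powr a)) \<longlongrightarrow> er (enn2real x powr a)) F"
 proof (rule tendsto_ennrealI)
  have "((%n. enn2real (f n)) \<longlongrightarrow> enn2real x) F" using real assms(1) by (auto intro!: tendsto_enn2real)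
  thus "((%n. enn2real (f n) powr a) \<longlongrightarrow> enn2real x powr a) F" using assms(2) by (intro tendsto_powr') auto
 qed
 thus ?thesis using ev real by (subst tendsto_cong[where g="%n. er (enn2real (f n) powr a)"]) (auto simp: ennreal_powr_def elim!: eventually_mono)
next
 case top
 show ?thesis unfolding top epowr_top
 proof (rule order_tendstoI)
  fix y :: ennreal assume y: "y < top"
  have "y^.(1/a) < top" using y by simp
  hence "eventually (%n. y^.(1/a) < f n) F" using order_tendstoD(1)[OF assms(1)] top by auto
  thus "eventually (%n. y < f n^.a) F"
  proof (eventually_elim)
   case (elim n)
   have "(y^.(1/a))^.a = y" using assms by (simp only: epowr_powr) simp
   thus ?case using elim epowr_le_iff[OF assms(2), of "f n" "y^.(1/a)"] by (simp add: not_le[symmetric])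
  qed
 qed simp
qed

section \<open>Hoelder and Minkowski inequalities\<close>

lemma epowr_Young:
 assumes "0 < theta" "theta < 1"
 shows "x^.theta*y^.(1 - theta) <= er theta*x + er (1 - theta)*y"
proof (cases "x = 0 | y = 0 | x = top | y = top")
 case True
 thus ?thesis using assms by (auto simp: ennreal_mult_top ennreal_top_mult)
next
 case False
 then obtain r q where rq: "x = er r" "y = er q" "r > 0" "q > 0" by (cases x; cases y) (auto simp: less_le)
 have "r powr theta*q powr (1 - theta) <= theta*r + (1 - theta)*q" using Youngs_inequality_0[of theta "1-theta" r q] rq assms by auto
 thus ?thesis using rq assms by (auto simp: ennreal_mult[symmetric] ennreal_plus[symmetric]
    simp del: ennreal_plus intro!: ennreal_leI)
qed

lemma ennreal_cancel_mult:
 fixes c :: ennreal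
 assumes "c ~= 0" "c ~= top" shows "c*(x/c) = x" "x/c*c = x"
proof -
 show "c*(x/c) = x" unfolding ennreal_times_divide mult.commute[of c x] using assms by (rule ennreal_mult_divide_eq)
 thus "x/c*c = x" by (simp only: mult.commute[of "x/c"])
qed

text \<open>Writing \<open>theta\<close> for \<open>1/p\<close> avoids conjugate exponents. Once
  both integrals are normalised to 1 this is Young's inequality integrated; vanishing and infinite
  integrals are split off because \<open>0 * top = 0\<close>.\<close>

lemma nn_integral_Holder:
 assumes [measurable]: "f : borel_measurable M" "g : borel_measurable M"
  and t: "0 < theta" "theta < 1"
 shows "(\<integral>\<^sup>+x. f x^.theta*g x^.(1 - theta) \<partial>M) <= (\<integral>\<^sup>+x. f x \<partial>M)^.theta*(\<integral>\<^sup>+x. g x \<partial>M)^.(1 - theta)"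
  (is "?L <= ?F^.theta*?G^.(1 - theta)")
proof -
 consider "?F = 0 | ?G = 0" | "?F ~= 0" "?G ~= 0" "?F = top | ?G = top"
  | "?F ~= 0" "?G ~= 0" "?F ~= top" "?G ~= top" by blast
 thus ?thesis
 proof cases
  case 1
  hence "?L = 0"
  proof
   assume "?F = 0"
   hence "AE x in M. f x = 0" by (simp add: nn_integral_0_iff_AE)
   thus ?thesis by (subst nn_integral_0_iff_AE) (auto elim: eventually_mono)
  next
   assume "?G = 0"
   hence "AE x in M. g x = 0" by (simp add: nn_integral_0_iff_AE)
   thus ?thesis by (subst nn_integral_0_iff_AE) (auto elim: eventually_mono)
  qed
  thus ?thesis by simp
 next
  case 2
  hence "?F^.theta*?G^.(1 - theta) = top" by (auto simp: ennreal_mult_top ennreal_top_mult)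
  thus ?thesis by simp
 next
  case 3
  have eq: "f x^.theta*g x^.(1 - theta) = (?F^.theta*?G^.(1 - theta))*((f x/?F)^.theta*(g x/?G)^.(1 - theta))" for x
  proof -
   have "f x^.theta*g x^.(1 - theta) = (?F*(f x/?F))^.theta*(?G*(g x/?G))^.(1 - theta)" using 3 by (simp add: ennreal_cancel_mult)
   thus ?thesis by (simp add: epowr_mult mult_ac)
  qed
  have "?L = (?F^.theta*?G^.(1 - theta))*(\<integral>\<^sup>+x. (f x/?F)^.theta*(g x/?G)^.(1 - theta) \<partial>M)" unfolding eq by (subst nn_cmult) auto
  also have "(\<integral>\<^sup>+x. (f x/?F)^.theta*(g x/?G)^.(1 - theta) \<partial>M)
    <= (\<integral>\<^sup>+x. er theta*(f x/?F) + er (1 - theta)*(g x/?G) \<partial>M)" using t by (intro nn_mono epowr_Young)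
  also have "... = er theta*(?F/?F) + er (1 - theta)*(?G/?G)" by (simp add: nn_integral_add nn_cmult nn_integral_divide)
  also have "... = 1" using 3 t by (simp add: ennreal_divide_self top.not_eq_extremum flip: ennreal_plus)
  finally show ?thesis by (simp add: mult_left_mono)
 qed
qed

text \<open>Hoelder with the inner norm \<open>s z\<close> as weight bounds the \<open>p\<close>-th
  power of the integral over \<open>z\<close> by \<open>S^.(p - 1)\<close> times an integral linear
  in \<open>f^.p\<close>, and integrating in \<open>x\<close> returns \<open>S\<close>. Unlike the
  usual proof this never divides by the left-hand side, which could be infinite.\<close>

lemma nn_integral_Minkowski:
 assumes M: "sigma_finite_measure M" and N: "sigma_finite_measure N"
  and [measurable]: "(%(x, z). f x z) : borel_measurable (M \<Otimes>\<^sub>M N)" and p: "1 < p"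
 shows "(\<integral>\<^sup>+x. (\<integral>\<^sup>+z. f x z \<partial>N)^.p \<partial>M)^.(1/p) <= (\<integral>\<^sup>+z. (\<integral>\<^sup>+x. f x z^.p \<partial>M)^.(1/p) \<partial>N)"
proof -
 interpret M: sigma_finite_measure M by fact
 interpret N: sigma_finite_measure N by fact
 interpret P: pair_sigma_finite M N ..
 have fm [measurable]: "(%(z, x). f x z) : borel_measurable (N \<Otimes>\<^sub>M M)"
  using measurable_compose[OF measurable_pair_swap' assms(3)] by (simp add: split_beta')
 define s where "s z = (\<integral>\<^sup>+x. f x z^.p \<partial>M)^.(1/p)" for z
 have [measurable]: "s : borel_measurable N" unfolding s_def by measurable
 define S where "S = (\<integral>\<^sup>+z. s z \<partial>N)"
 show ?thesis
 proof (cases "S = top")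
  case True thus ?thesis by (simp add: S_def s_def)
 next
  case False
  have ae_top: "AE z in N. s z ~= top" using False unfolding S_def using nn_integral_PInf_AE[of s N] by simp
  \<comment> \<open>Where \<open>s z = 0\<close> the weight \<open>s z^.(1 - p)\<close> is 0 by
    convention and not infinite, so there \<open>f\<close> itself has to be shown to vanish almost
    everywhere.\<close>
  let ?b = "%x z. f x z*ind {z. s z = 0} z"
  have "(\<integral>\<^sup>+x. (\<integral>\<^sup>+z. ?b x z^.p \<partial>N) \<partial>M) = (\<integral>\<^sup>+z. (\<integral>\<^sup>+x. ?b x z^.p \<partial>M) \<partial>N)"
   by (subst P.Fubini') auto
  also have "... = (\<integral>\<^sup>+z. 0 \<partial>N)"
  proof (intro nn_cong)
   fix z assume "z : space N"
   have "(\<integral>\<^sup>+x. ?b x z^.p \<partial>M) = (\<integral>\<^sup>+x. f x z^.p*ind {z. s z = 0} z \<partial>M)"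
    using p by (intro nn_cong) (auto simp: indicator_def)
   also have "... = 0" using \<open>z \<in> space N\<close> by (cases "s z = 0") (auto simp: s_def)
   finally show "(\<integral>\<^sup>+x. ?b x z^.p \<partial>M) = 0" .
  qed
  finally have "(\<integral>\<^sup>+x. (\<integral>\<^sup>+z. ?b x z^.p \<partial>N) \<partial>M) = 0" by simp
  hence "AE x in M. (\<integral>\<^sup>+z. ?b x z^.p \<partial>N) = 0" by (subst (asm) nn_integral_0_iff_AE) auto
  note aeb = this
  have ae0: "AE x in M. AE z in N. s z = 0 --> f x z = 0"
  proof (rule AE_mp[OF aeb], rule AE_I2, rule impI)
   fix x assume x: "x : space M" and "(\<integral>\<^sup>+z. ?b x z^.p \<partial>N) = 0"
   hence "AE z in N. ?b x z^.p = 0" by (subst (asm) nn_integral_0_iff_AE) auto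
   thus "AE z in N. s z = 0 --> f x z = 0" by eventually_elim (auto split: split_indicator_asm)
  qed
  let ?h = "%x z. f x z^.p*(s z^.(1 - p))"
  let ?H = "%x. \<integral>\<^sup>+z. ?h x z \<partial>N" and ?F = "%x. \<integral>\<^sup>+z. f x z \<partial>N"
  have key: "AE x in M. ?F x^.p <= ?H x*S^.(p - 1)"
  proof (rule AE_mp[OF ae0], rule AE_I2, rule impI)
   fix x assume x: "x : space M" and ae: "AE z in N. s z = 0 --> f x z = 0"
   have xm [measurable]: "(%z. f x z) : borel_measurable N" using x by measurable
   have "?F x = (\<integral>\<^sup>+z. ?h x z^.(1/p) * s z^.(1 - 1/p) \<partial>N)" using ae ae_top
   proof (intro nn_integral_cong_AE, eventually_elim)
    case (elim z)
    show ?case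
    proof (cases "s z = 0")
     case True thus ?thesis using elim by simp
    next
     case False
     then obtain r where r: "s z = er r" "r > 0" using elim by (cases "s z") (auto simp: less_le)
     have "?h x z^.(1/p) * s z^.(1 - 1/p) = f x z*(er (r powr ((1-p)/p))*er (r powr (1 - 1/p)))" using r p by (simp add: epowr_mult epowr_powr powr_powr mult_ac)
     also have "... = f x z*er (r powr ((1-p)/p + (1 - 1/p)))" by (simp add: ennreal_mult[symmetric] powr_add)
     also have "(1-p)/p + (1 - 1/p) = 0" using p by (simp add: field_simps)
     finally show ?thesis using r by simp
    qed
   qed
   also have "... <= ?H x^.(1/p)*S^.(1 - 1/p)" unfolding S_def using p by (intro nn_integral_Holder) auto
   finally have "?F x^.p <= (?H x^.(1/p)*S^.(1 - 1/p))^.p"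
    using p by (intro epowr_mono) auto
   also have "... = ?H x*S^.(p - 1)" using p by (simp add: epowr_mult epowr_powr left_diff_distrib)
   finally show "?F x^.p <= ?H x*S^.(p - 1)" .
  qed
  have "(\<integral>\<^sup>+x. ?H x \<partial>M) = (\<integral>\<^sup>+z. (\<integral>\<^sup>+x. ?h x z \<partial>M) \<partial>N)"
   by (subst P.Fubini') auto
  also have "... = (\<integral>\<^sup>+z. s z^.p * s z^.(1 - p) \<partial>N)" by (intro nn_cong, subst nn_multc) (use p in "auto simp: s_def epowr_powr")
  also have "... = S" by (simp add: epowr_add S_def)
  finally have hS: "(\<integral>\<^sup>+x. ?H x \<partial>M) = S" .
  have "S*S^.(p - 1) = S^.1*S^.(p - 1)" unfolding epowr_1 ..
  also have "... = S^.p" unfolding epowr_add by simp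
  finally have SS: "S*S^.(p - 1) = S^.p" .
  define A where "A = (\<integral>\<^sup>+x. ?F x^.p \<partial>M)"
  have "(\<integral>\<^sup>+x. ?H x*S^.(p - 1) \<partial>M) = (\<integral>\<^sup>+x. ?H x \<partial>M)*S^.(p - 1)"
   by (rule nn_multc) measurable
  hence "A <= S^.p" using nn_integral_mono_AE[OF key] SS hS A_def by simp
  hence "A^.(1/p) <= (S^.p)^.(1/p)" using epowr_mono[of A "S^.p" "1/p"] p by simp
  hence "A^.(1/p) <= S" using p by (simp only: epowr_powr) simp
  thus ?thesis by (simp only: A_def S_def s_def)
 qed
qed

section \<open>Mixed norms in space and time\<close>

definition mx :: "real => real => (real => real => ennreal) => ennreal" where "mx p q f = (NN x. (NN t. f t x^.q)^.(p/q))^.(1/p)"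

lemma mm_swap: "mm f ==> (%(x, t). f t x) : borel_measurable LL" using measurable_compose[OF measurable_pair_swap', of "%(t, x). f t x" lborel lborel borel]
 by (simp add: split_beta')

lemma mm_section:
 assumes [measurable]: "mm f"
 shows "bml (%t. f t x)" "bml (f t)" by measurable

lemma mx_mono_AE:
 assumes "AEL x. AEL t. f t x <= g t x" "0 < p" "0 < q"
 shows "mx p q f <= mx p q g" unfolding mx_def
proof (rule epowr_mono, rule nn_integral_mono_AE)
 show "AEL x. (NN t. f t x^.q)^.(p/q) <= (NN t. g t x^.q)^.(p/q)" using assms(1)
 proof eventually_elim
  case (elim x)
  have "(NN t. f t x^.q) <= (NN t. g t x^.q)" using elim assms by (intro nn_integral_mono_AE) (auto elim!: eventually_mono intro!: epowr_mono)
  thus ?case using assms by (intro epowr_mono) auto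
 qed
qed (use assms in auto)

lemma mx_mono: "(!!t x. f t x <= g t x) ==> 0 < p ==> 0 < q ==> mx p q f <= mx p q g" by (rule mx_mono_AE) auto

lemma mx_cmult:
 assumes [measurable]: "mm f" and "0 < p" "0 < q"
 shows "mx p q (%t x. c*f t x) = c*mx p q f"
proof -
 have [measurable]: "bmL (%(x, t). f t x)" by (rule mm_swap) fact
 have "mx p q (%t x. c*f t x) = (NN x. c^.p*(NN t. f t x^.q)^.(p/q))^.(1/p)" unfolding mx_def using assms by (simp add: epowr_mult nn_cmult epowr_powr)
 also have "... = (c^.p)^.(1/p)*mx p q f" by (subst nn_cmult) (auto simp: epowr_mult mx_def)
 also have "(c^.p)^.(1/p) = c" using assms by (simp add: epowr_powr)
 finally show ?thesis .
qed

lemma mx_Holder: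
 assumes fm [measurable]: "mm f" and gm [measurable]: "mm g"
  and pos: "0 < p0" "0 < p1" "0 < p2" "0 < q0" "0 < q1" "0 < q2"
  and p: "1/p0 = 1/p1 + 1/p2" and q: "1/q0 = 1/q1 + 1/q2"
 shows "mx p0 q0 (%t x. f t x*g t x) <= mx p1 q1 f*mx p2 q2 g"
proof -
 have [measurable]: "bmL (%(x, t). f t x)" "bmL (%(x, t). g t x)" by (rule mm_swap, fact)+
 let ?F = "%x. (NN t. f t x^.q1)" and ?G = "%x. (NN t. g t x^.q2)"
 have "1/q1 < 1/q0" "1/p1 < 1/p0" using p q pos by auto
 hence "q0 < q1" "p0 < p1" using pos by (simp_all add: field_simps)
 hence th: "1 - q0/q1 = q0/q2" "q0/q1 < 1" and tp: "1 - p0/p1 = p0/p2" "p0/p1 < 1" using p q pos by (auto simp: field_simps)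
 have "(NN t. (f t x*g t x)^.q0)^.(p0/q0) <= (?F x^.(p1/q1))^.(p0/p1)*(?G x^.(p2/q2))^.(1 - p0/p1)" for x
 proof -
  have "(NN t. (f t x*g t x)^.q0) = (NN t. (f t x^.q1)^.(q0/q1)*(g t x^.q2)^.(1 - q0/q1))" unfolding th using pos by (simp add: epowr_mult epowr_powr)
  also have "... <= ?F x^.(q0/q1)*?G x^.(1 - q0/q1)" using th pos by (intro nn_integral_Holder) auto
  finally have "(NN t. (f t x*g t x)^.q0)^.(p0/q0) <= (?F x^.(q0/q1)*?G x^.(1 - q0/q1))^.(p0/q0)" using pos by (intro epowr_mono) auto
  also have "... = (?F x^.(p1/q1))^.(p0/p1)*(?G x^.(p2/q2))^.(1 - p0/p1)" unfolding th tp using pos by (simp add: epowr_mult epowr_powr)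
  finally show ?thesis .
 qed
 hence "mx p0 q0 (%t x. f t x*g t x) <= (NN x. (?F x^.(p1/q1))^.(p0/p1)*(?G x^.(p2/q2))^.(1 - p0/p1))^.(1/p0)"
  unfolding mx_def using pos by (intro epowr_mono nn_mono) auto
 also have "... <= ((NN x. ?F x^.(p1/q1))^.(p0/p1)*(NN x. ?G x^.(p2/q2))^.(1 - p0/p1))^.(1/p0)" using pos tp by (intro epowr_mono nn_integral_Holder) auto
 also have "... = mx p1 q1 f*mx p2 q2 g" unfolding tp mx_def using pos by (simp add: epowr_mult epowr_powr)
 finally show ?thesis .
qed

lemma mx_power:
 assumes "0 < p" "0 < q" "0 < n"
 shows "mx (p/n) (q/n) (%t x. f t x^.n) = mx p q f^.n" unfolding mx_def using assms by (simp add: epowr_powr)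

lemma mx_1: "mx 1 1 f = (NN x. (NN t. f t x))" by (simp add: mx_def)

lemma mx_Minkowski:
 assumes N: "sigma_finite_measure N"
  and f [measurable]: "(%(z, t, x). f z t x) : borel_measurable (N \<Otimes>\<^sub>M LL)"
  and p: "1 < p" "1 < q"
 shows "mx p q (%t x. \<integral>\<^sup>+z. f z t x \<partial>N) <= (\<integral>\<^sup>+z. mx p q (f z) \<partial>N)"
proof -
 interpret N: sigma_finite_measure N by fact
 let ?g = "%z x. (NN t. f z t x^.q)^.(1/q)"
 have [measurable]: "(%((x, z), t). f z t x) : borel_measurable ((lborel \<Otimes>\<^sub>M N) \<Otimes>\<^sub>M lborel)"
  "(%((x, t), z). f z t x) : borel_measurable (LL \<Otimes>\<^sub>M N)"
 proof -
  have "(%w. case (snd (fst w), snd w, fst (fst w)) of (z, t, x) => f z t x) : borel_measurable ((lborel \<Otimes>\<^sub>M N) \<Otimes>\<^sub>M lborel)"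
   by (rule measurable_compose[OF _ f]) measurable
  thus "(%((x, z), t). f z t x) : borel_measurable ((lborel \<Otimes>\<^sub>M N) \<Otimes>\<^sub>M lborel)" by (simp add: split_beta')
  have "(%w. case (snd w, snd (fst w), fst (fst w)) of (z, t, x) => f z t x) : borel_measurable (LL \<Otimes>\<^sub>M N)"
   by (rule measurable_compose[OF _ f]) measurable
  thus "(%((x, t), z). f z t x) : borel_measurable (LL \<Otimes>\<^sub>M N)" by (simp add: split_beta')
 qed
 note fm = this
 have [measurable]: "bmL (%(x, t). \<integral>\<^sup>+z. f z t x \<partial>N)"
  unfolding split_beta' by (rule N.borel_measurable_nn_integral) (use fm(2) in "simp add: split_beta'")
 have [measurable]: "(%(x, z). ?g z x) : borel_measurable (lborel \<Otimes>\<^sub>M N)" unfolding split_beta'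
 proof (intro epowr_measurable lborel.borel_measurable_nn_integral)
  show "(%(w, t). f (snd w) t (fst w)^.q) : borel_measurable ((lborel \<Otimes>\<^sub>M N) \<Otimes>\<^sub>M lborel)"
   using epowr_measurable[OF fm(1), of q] by (simp add: split_beta')
 qed
 have inner: "(NN t. (\<integral>\<^sup>+z. f z t x \<partial>N)^.q)^.(1/q) <= (\<integral>\<^sup>+z. ?g z x \<partial>N)" for x
 proof (rule nn_integral_Minkowski)
  show "(%(t, z). f z t x) : borel_measurable (lborel \<Otimes>\<^sub>M N)"
   using measurable_compose[of "%(t, z). (z, t, x)" "lborel \<Otimes>\<^sub>M N" "N \<Otimes>\<^sub>M LL", OF _ f] by (simp add: split_beta')
 qed (use p N in "auto intro: sigma_lborel")
 have "(NN x. (NN t. (\<integral>\<^sup>+z. f z t x \<partial>N)^.q)^.(p/q)) = (NN x. ((NN t. (\<integral>\<^sup>+z. f z t x \<partial>N)^.q)^.(1/q))^.p)"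
  by (simp add: epowr_powr)
 also have "... <= (NN x. (\<integral>\<^sup>+z. ?g z x \<partial>N)^.p)" using p inner by (intro nn_mono) (simp add: epowr_mono)
 finally have "mx p q (%t x. \<integral>\<^sup>+z. f z t x \<partial>N) <= (NN x. (\<integral>\<^sup>+z. ?g z x \<partial>N)^.p)^.(1/p)"
  unfolding mx_def using p epowr_mono by simp
 also have "... <= (\<integral>\<^sup>+z. (NN x. ?g z x^.p)^.(1/p) \<partial>N)"
  by (rule nn_integral_Minkowski) (use p N in "auto intro: sigma_lborel")
 also have "... = (\<integral>\<^sup>+z. mx p q (f z) \<partial>N)" unfolding mx_def by (simp add: epowr_powr)
 finally show ?thesis .
qed

text \<open>Minkowski's inequality with exponent \<open>q/p > 1\<close> on a two-point space. It
  lets \<open>q\<close>-th powers of norms of disjoint pieces be added although the time norm is the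
  inner one. The bisection of the forcing (with \<open>P' < Q'\<close>) and the subdivision of the
  time interval (with the critical exponents) both rest on it.\<close>

lemma mx_superadd:
 assumes [measurable]: "mm f" "mm g" and p: "0 < p" "p < q"
  and disj: "!!t x. f t x = 0 | g t x = 0"
 shows "mx p q f^.q + mx p q g^.q <= mx p q (%t x. f t x + g t x)^.q"
proof -
 have [measurable]: "bmL (%(x, t). f t x)" "bmL (%(x, t). g t x)" by (rule mm_swap, fact)+
 let ?r = "q/p"
 define a where "a i x = (if i then (NN t. f t x^.q) else (NN t. g t x^.q))" for i :: bool and x
 have [measurable]: "bml (a i)" for i unfolding a_def by (cases i) auto
 have "(\<integral>\<^sup>+i. (NN x. a i x^.(p/q))^.?r \<partial>count_space UNIV)^.(1/?r)
   <= (NN x. (\<integral>\<^sup>+i. (a i x^.(p/q))^.?r \<partial>count_space UNIV)^.(1/?r))"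
  using p by (intro nn_integral_Minkowski sigma_finite_measure_count_space_countable sigma_lborel
    measurable_pair_measure_countable1) auto
 also have "... = (NN x. (a True x + a False x)^.(p/q))" using p by (simp add: epowr_powr nn_integral_count_space_finite UNIV_bool add.commute)
 also have "... = (NN x. (NN t. (f t x + g t x)^.q)^.(p/q))"
 proof (intro nn_cong)
  fix x
  have "(NN t. (f t x + g t x)^.q) = (NN t. f t x^.q + g t x^.q)"
  proof (intro nn_cong)
   fix t show "(f t x + g t x)^.q = f t x^.q + g t x^.q" using disj[of t x] by (elim disjE) simp_all
  qed
  also have "... = a True x + a False x" unfolding a_def by (simp add: nn_integral_add)
  finally show "(a True x + a False x)^.(p/q) = (NN t. (f t x + g t x)^.q)^.(p/q)" by simp
 qed
 finally have "((\<integral>\<^sup>+i. (NN x. a i x^.(p/q))^.?r \<partial>count_space UNIV)^.(1/?r))^.?r <= (NN x. (NN t. (f t x + g t x)^.q)^.(p/q))^.?r"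
  using p epowr_mono by simp
 thus ?thesis using p by (simp add: epowr_powr mx_def nn_integral_count_space_finite UNIV_bool a_def add.commute)
qed

lemma indicator_powr: "(f*ind A t)^.q = f^.q*ind A t" by (auto simp: indicator_def)

text \<open>Time sets become an indicator factor under the full measure, so that norms over
  different pieces of time can be compared pointwise.\<close>

lemma mixed_norm_mx:
 fixes u :: "real => real => 'b::real_normed_vector"
 assumes "0 < p" "0 < q" "I : sets lborel"
 shows "mixed_norm (er p) (er q) I u = mx p q (%t x. en (u t x)*ind I t)" using assms
 by (simp add: mixed_norm_def Lebesgue_norm_def mx_def epowr_powr nn_integral_restrict_space
   indicator_powr)

text \<open>Dominated convergence in \<open>t\<close> and then in \<open>x\<close>, for finite
  exponents; the only time at which the indicators may fail to converge is \<open>s\<close>, a null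
  set.\<close>

lemma mx_restrict_continuous:
 assumes fm [measurable]: "mm f" and fin: "mx p q f < top" and p: "0 < p" "0 < q"
 shows "continuous_on UNIV (%s. enn2real (mx p q (%t x. f t x*ind {..s} t)))"
proof (rule continuous_on_sequentiallyI)
 fix S :: "nat => real" and s :: real assume S: "S ----> s"
 have fm' [measurable]: "bmL (%(x, t). f t x)" by (rule mm_swap) fact
 let ?F = "%x. (NN t. f t x^.q)"
 have fin': "(NN x. ?F x^.(p/q)) < top" using fin unfolding mx_def by simp
 hence ae: "AEL x. ?F x^.(p/q) ~= top" using nn_integral_PInf_AE[of "%x. ?F x^.(p/q)" lborel] by simp
 have ind: "AEL t. (%n. ind {..S n} t :: ennreal) ----> ind {..s} t"
 proof (rule AE_mp[OF AE_lborel_singleton[of s]], rule AE_I2, rule impI)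
  fix t assume "t ~= s"
  then consider "t < s" | "s < t" by linarith
  hence "eventually (%n. (ind {..S n} t :: ennreal) = ind {..s} t) sequentially"
  proof cases
   case 1
   thus ?thesis using order_tendstoD(1)[OF S 1] by (auto elim!: eventually_mono simp: indicator_def)
  next
   case 2
   thus ?thesis using order_tendstoD(2)[OF S 2] by (auto elim!: eventually_mono simp: indicator_def)
  qed
  thus "(%n. ind {..S n} t :: ennreal) ----> ind {..s} t" by (rule tendsto_eventually)
 qed
 have inner: "(%n. (NN t. (f t x*ind {..S n} t)^.q)) ----> (NN t. (f t x*ind {..s} t)^.q)" if x: "?F x < top" for x unfolding indicator_powr
 proof (rule nn_integral_dominated_convergence[where w="%t. f t x^.q"])
  have "AEL t. f t x^.q ~= top" using x nn_integral_PInf_AE[of "%t. f t x^.q" lborel] by simp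
  thus "AEL t. (%n. f t x^.q*ind {..S n} t) ----> f t x^.q*ind {..s} t" using ind
  proof eventually_elim
   case (elim t)
   thus ?case by (intro tendsto_mult_ennreal tendsto_const) (auto simp: indicator_def)
  qed
 qed (use x in "auto simp: indicator_def")
 have "(%n. (NN x. (NN t. (f t x*ind {..S n} t)^.q)^.(p/q)))
   ----> (NN x. (NN t. (f t x*ind {..s} t)^.q)^.(p/q))"
 proof (rule nn_integral_dominated_convergence[where w="%x. ?F x^.(p/q)"])
  show "AEL x. (NN t. (f t x*ind {..S n} t)^.q)^.(p/q) <= ?F x^.(p/q)" for n using p by (intro AE_I2 epowr_mono nn_mono) (auto simp: indicator_def)
  show "AEL x. (%n. (NN t. (f t x*ind {..S n} t)^.q)^.(p/q))
    ----> (NN t. (f t x*ind {..s} t)^.q)^.(p/q)" using ae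
  proof eventually_elim
   case (elim x)
   thus ?case using p by (intro tendsto_ennreal_powr inner) (auto simp: less_top)
  qed
 qed (use fin' in auto)
 hence lim: "(%n. mx p q (%t x. f t x*ind {..S n} t)) ----> mx p q (%t x. f t x*ind {..s} t)" unfolding mx_def using p by (intro tendsto_ennreal_powr) auto
 have "mx p q (%t x. f t x*ind {..s} t) <= mx p q f" using p by (intro mx_mono) (auto simp: indicator_def)
 thus "(%n. enn2real (mx p q (%t x. f t x*ind {..S n} t))) ----> enn2real (mx p q (%t x. f t x*ind {..s} t))"
  using fin lim by (intro tendsto_enn2real) (auto simp: ennreal_enn2real_if less_top)
qed

lemma ennreal_add_le_imp:
 assumes "er a + X <= er b" "0 <= a"
 shows "X <= er (b - a)"
proof -
 have "X = er a + X - er a" by simp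
 also have "... <= er b - er a" using assms(1) by (rule ennreal_minus_mono) simp
 also have "... = er (b - a)" using assms(2) by (rule ennreal_minus)
 finally show ?thesis .
qed

lemma mx_indicator_mono: "A \<subseteq> B ==> 0 < p ==> 0 < q ==>
  mx p q (%t x. f t x*ind A t) <= mx p q (%t x. f t x*ind B t)" by (intro mx_mono) (auto simp: indicator_def)

lemma mx_null: "0 < p ==> 0 < q ==> mx p q (%t x. f t x*ind {a} t) = 0"
proof -
 assume p: "0 < p" "0 < q"
 have "AEL t. f t x*ind {a} t = 0" for x using AE_lborel_singleton[of a] by eventually_elim auto
 hence "mx p q (%t x. f t x*ind {a} t) <= mx p q (%t x. 0)" using p by (intro mx_mono_AE) (simp_all only: order.refl le_zero_eq AE_I2)
 thus ?thesis by (simp add: mx_def)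
qed

text \<open>By continuity there is a cut where the first part has exactly
  \<open>2 powr (-1/q)\<close> times the full norm. This uses up half of the \<open>q\<close>-th
  power, and superadditivity leaves at most the other half.\<close>

lemma mx_bisect:
 assumes fm [measurable]: "mm f" and p: "0 < p" "p < q" and supp: "!!t x. t ~: {0..T} ==> f t x = 0"
  and nu: "mx p q f <= er nu" "0 <= nu" and T: "0 <= T"
 shows "\<exists>s\<in>{0..T}. mx p q (%t x. f t x*ind {..s} t) <= er (2 powr (-1/q)*nu) &
   mx p q (%t x. f t x*ind {s<..} t) <= er (2 powr (-1/q)*nu)"
proof -
 let ?H = "%s. mx p q (%t x. f t x*ind {..s} t)"
 let ?h = "%s. enn2real (?H s)"
 have q: "0 < q" using p by simp
 have fin: "mx p q f < top" using nu(1) ennreal_less_top by (rule order_le_less_trans)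
 have HT: "?H T = mx p q f" using supp by (intro arg_cong[of _ _ "mx p q"] ext) (auto simp: indicator_def)
 have "(%t x. f t x*ind {..0} t) = (%t x. f t x*ind {0} t)" using supp by (intro ext) (auto simp: indicator_def)
 hence H0: "?H 0 = 0" using mx_null[of p q f 0] p by simp
 have Hle: "?H s <= mx p q f" for s using p by (intro mx_mono) (auto simp: indicator_def)
 obtain m where m: "mx p q f = er m" "0 <= m" using fin by (cases "mx p q f") auto
 have c2: "2 powr (-1/q) <= 1" using q powr_mono[of "-1/q" 0 2] by simp
 have "\<exists>s\<ge>0. s <= T & ?h s = 2 powr (-1/q)*m"
 proof (rule IVT')
  show "?h 0 <= 2 powr (-1/q)*m" using H0 m by simp
  show "2 powr (-1/q)*m <= ?h T" using HT m c2 by (simp add: mult_left_le_one_le)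
  show "continuous_on {0..T} ?h" using mx_restrict_continuous[OF fm fin] p by (auto intro: continuous_on_subset)
 qed fact
 then obtain s where s: "0 <= s" "s <= T" "?h s = 2 powr (-1/q)*m" by blast
 hence Hs: "?H s = er (2 powr (-1/q)*m)" using Hle[of s] fin by (metis ennreal_enn2real order_le_less_trans)
 let ?G = "mx p q (%t x. f t x*ind {s<..} t)"
 have mle: "m <= nu" using m nu by simp
 have sup: "?H s^.q + ?G^.q <= mx p q f^.q"
 proof -
  have "?H s^.q + ?G^.q <= mx p q (%t x. f t x*ind {..s} t + f t x*ind {s<..} t)^.q" using p by (intro mx_superadd) (auto simp: indicator_def)
  also have "(%t x. f t x*ind {..s} t + f t x*ind {s<..} t) = f" by (intro ext) (auto simp: indicator_def)
  finally show ?thesis .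
 qed
 have "(2 powr (-1/q)*m) powr q = 2 powr (-1/q*q)*m powr q" by (simp only: powr_mult powr_powr)
 also have "-1/q*q = - 1" using q by simp
 also have "2 powr (-1)*m powr q = m powr q/2" by (simp add: powr_minus)
 finally have half: "er (2 powr (-1/q)*m)^.q = er (m powr q/2)" using m by simp
 have "er (m powr q/2) + ?G^.q <= er (m powr q)" using sup m unfolding Hs half by simp
 hence "?G^.q <= er (m powr q - m powr q/2)" by (rule ennreal_add_le_imp) simp
 hence "?G^.q <= er (2 powr (-1/q)*m)^.q" unfolding half by simp
 hence "?G <= er (2 powr (-1/q)*m)" using q by (simp only: epowr_le_iff)
 moreover have "er (2 powr (-1/q)*m) <= er (2 powr (-1/q)*nu)" using mle by (intro ennreal_leI mult_left_mono) auto
 ultimately show ?thesis using s Hs by (intro bexI[of _ s]) auto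
qed

text \<open>The \<open>q\<close>-th power of the norm up to time \<open>b\<close> is uniformly
  continuous in \<open>b\<close>, and its increments dominate the norm on \<open>{a<..b}\<close>.
  Hence all steps of a fixed length \<open>delta/2\<close> are \<open>eta\<close>-small and finitely
  many of them reach \<open>T\<close>.\<close>

lemma mx_interval_induct:
 assumes fm [measurable]: "mm f" and p: "0 < p" "p < q" and fin: "mx p q f < top" and eta: "0 < eta"
  and T: "0 <= T" and P0: "P 0"
  and step: "!!a b. 0 <= a ==> a <= b ==> b <= T ==> P a ==>
   mx p q (%t x. f t x*ind {a<..b} t) <= er eta ==> P b"
 shows "P T"
proof -
 let ?H = "%s. mx p q (%t x. f t x*ind {..s} t)"
 let ?h = "%s. enn2real (?H s) powr q"
 have q: "0 < q" using p by simp
 have Hle: "?H s <= mx p q f" for s using p by (intro mx_mono) (auto simp: indicator_def)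
 have Hh: "?H s^.q = er (?h s)" for s using Hle[of s] fin by (cases "?H s") (auto simp: top_unique)
 have "continuous_on {0..T} (%s. enn2real (?H s))" using mx_restrict_continuous[OF fm fin] p by (auto intro: continuous_on_subset)
 hence "continuous_on {0..T} ?h" by (rule continuous_on_powr') (use q in auto)
 hence "uniformly_continuous_on {0..T} ?h" by (rule compact_uniformly_continuous) simp
 then obtain delta where delta: "0 < delta" and uc: "!!a b. a : {0..T} ==> b : {0..T} ==> dist b a < delta ==> dist (?h b) (?h a) < eta powr q"
  unfolding uniformly_continuous_on_def using eta by (fastforce dest: spec[of _ "eta powr q"])
 have small: "mx p q (%t x. f t x*ind {a<..b} t) <= er eta" if ab: "0 <= a" "a <= b" "b <= T" "b - a < delta" for a b
 proof -
  let ?G = "mx p q (%t x. f t x*ind {a<..b} t)"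
  have "?H a^.q + ?G^.q <= mx p q (%t x. f t x*ind {..a} t + f t x*ind {a<..b} t)^.q" using p by (intro mx_superadd) (auto simp: indicator_def)
  also have "(%t x. f t x*ind {..a} t + f t x*ind {a<..b} t) = (%t x. f t x*ind {..b} t)" using ab by (intro ext) (auto simp: indicator_def)
  finally have "er (?h a) + ?G^.q <= er (?h b)" unfolding Hh .
  moreover have "?h b < ?h a + eta powr q" using uc[of a b] ab by (auto simp: dist_real_def)
  moreover have "?G^.q <= er (?h b - ?h a)" using calculation(1) by (rule ennreal_add_le_imp) simp
  moreover have "er (?h b - ?h a) <= er (eta powr q)" using calculation(2) by (intro ennreal_leI) linarith
  ultimately have "?G^.q <= er (eta powr q)" by (meson order_trans)
  hence "?G^.q <= er eta^.q" using eta by simp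
  thus ?thesis using q by (simp only: epowr_le_iff)
 qed
 have "P (min (real n*(delta/2)) T)" for n
 proof (induction n)
  case 0 thus ?case using P0 T by simp
 next
  case (Suc n)
  let ?a = "min (real n*(delta/2)) T" and ?b = "min (real (Suc n)*(delta/2)) T"
  have "real (Suc n)*(delta/2) = real n*(delta/2) + delta/2" "0 <= real n*(delta/2)" using delta by (simp_all add: algebra_simps)
  hence ab: "0 <= ?a" "?a <= ?b" "?b <= T" "?b - ?a < delta" using T delta by linarith+
  show ?case by (rule step[OF ab(1-3) Suc small[OF ab]])
 qed
 moreover obtain n where "T/(delta/2) <= real n" using real_arch_simple by blast
 hence "min (real n*(delta/2)) T = T" using delta by (simp add: field_simps min_absorb2)
 with calculation[of n] show ?thesis by simp
qed

text \<open>Pointwise interpolation between a bound for the square integral in time and a maximal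
  function: \<open>f^.Q <= B^.(Q - 2) * f^.2\<close>. The relation \<open>(Q - 2)*(P/Q) = 4\<close>
  leaves exactly \<open>B^.4\<close> under the outer integral.\<close>

lemma mx_from_endpoints:
 fixes f :: "real => real => ennreal"
 assumes [measurable]: "mm f" "bml B" and PQ: "2 < Q" "0 < P" "(Q - 2)*(P/Q) = 4"
  and K: "!!x. (NN t. f t x^.2) <= kappa" and B: "!!t x. f t x <= B x"
  and B4: "(NN x. B x^.4) <= m"
 shows "mx P Q f <= (m*kappa^.(P/Q))^.(1/P)"
proof -
 have "(NN t. f t x^.Q)^.(P/Q) <= B x^.4*kappa^.(P/Q)" for x
 proof -
  have [measurable]: "bml (%t. f t x)" using mm_section(1)[OF assms(1)] .
  have "(NN t. f t x^.Q) <= (NN t. B x^.(Q - 2)*f t x^.2)"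
  proof (intro nn_mono)
   fix t
   have "f t x^.Q = f t x^.(Q - 2)*f t x^.2" unfolding epowr_add by simp
   also have "... <= B x^.(Q - 2)*f t x^.2" by (rule mult_right_mono, rule epowr_mono) (use PQ B in auto)
   finally show "f t x^.Q <= B x^.(Q - 2)*f t x^.2" .
  qed
  also have "... = B x^.(Q - 2)*(NN t. f t x^.2)" by (rule nn_cmult) measurable
  also have "... <= B x^.(Q - 2)*kappa" by (intro mult_left_mono K) simp
  finally have "(NN t. f t x^.Q)^.(P/Q) <= (B x^.(Q - 2)*kappa)^.(P/Q)" by (rule epowr_mono) (use PQ in simp)
  thus ?thesis using PQ by (simp only: epowr_mult epowr_powr)
 qed
 hence "(NN x. (NN t. f t x^.Q)^.(P/Q)) <= (NN x. B x^.4*kappa^.(P/Q))" by (intro nn_mono) auto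
 also have "... = (NN x. B x^.4)*kappa^.(P/Q)" by (rule nn_multc) measurable
 also have "... <= m*kappa^.(P/Q)" by (intro mult_right_mono B4) simp
 finally show ?thesis unfolding mx_def by (rule epowr_mono) (use PQ in simp)
qed

section \<open>Fourier transform\<close>

lemma integrable_le:
 fixes f :: "'a => 'b::{banach, second_countable_topology}" and g :: "'a => real"
 assumes "integrable M g" "f : borel_measurable M" "!!x. norm (f x) <= g x"
 shows "integrable M f"
 by (rule LI_bound[OF assms(1,2)]) (use assms(3) in "auto intro!: AE_I2 intro: order_trans[OF _ abs_ge_self]")

text \<open>A bounded kernel between two integrable factors: the passages below from an operator to
  its adjoint are instances, with \<open>C = 1\<close> for unimodular kernels.\<close>

lemma kernel_Fubini_gen:
 fixes f :: "'a => complex" and g :: "'b => complex" and k :: "'a => 'b => complex"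
 assumes M: "sigma_finite_measure M" and N: "sigma_finite_measure N"
  and f: "integrable M f" and g: "integrable N g" and [measurable]: "(%(x, y). k x y) : borel_measurable (M \<Otimes>\<^sub>M N)"
  and C: "!!x y. norm (k x y) <= C"
 shows "(LINT x|M. f x*(LINT y|N. g y*k x y)) = (LINT y|N. g y*(LINT x|M. f x*k x y))"
proof -
 interpret M: sigma_finite_measure M by fact
 interpret N: sigma_finite_measure N by fact
 interpret P: pair_sigma_finite M N ..
 have [measurable]: "f : borel_measurable M" "g : borel_measurable N" using f g by (auto dest: bmi)
 have "integrable (M \<Otimes>\<^sub>M N) (%(x, y). f x*g y)" by (rule P.Fubini_integrable)
   (use f g in "auto simp: norm_mult intro!: integrable_mult_left integrable_norm")
 hence "integrable (M \<Otimes>\<^sub>M N) (%z. C*norm (case z of (x, y) => f x*g y))" by (intro integrable_mult_right integrable_norm)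
 hence i: "integrable (M \<Otimes>\<^sub>M N) (%(x, y). f x*(g y*k x y))"
 proof (rule integrable_le)
  fix z show "norm (case z of (x, y) => f x*(g y*k x y)) <= C*norm (case z of (x, y) => f x*g y)"
   using mult_left_mono[OF C[of "fst z" "snd z"], of "norm (f (fst z)*g (snd z))"] by (cases z) (simp add: norm_mult mult_ac)
 qed measurable
 have "(LINT x|M. f x*(LINT y|N. g y*k x y)) = (LINT x|M. LINT y|N. f x*(g y*k x y))" by simp
 also have "... = (LINT y|N. LINT x|M. f x*(g y*k x y))" using P.Fubini_integral[OF i] by simp
 also have "... = (LINT y|N. g y*(LINT x|M. f x*k x y))" by (simp add: mult.left_commute[of "f _"])
 finally show ?thesis .
qed

lemma kernel_Fubini:
 fixes f g :: "real => complex" and k :: "real => real => complex"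
 assumes f: "integrable lborel f" and g: "integrable lborel g" and km: "mm k"
  and C: "!!x y. norm (k x y) <= C"
 shows "(LI x. f x*(LI y. g y*k x y)) = (LI y. g y*(LI x. f x*k x y))"
 by (rule kernel_Fubini_gen[OF sigma_lborel sigma_lborel f g km C])

lemma cis_measurable [measurable]: "bm cis" by (intro borel_measurable_continuous_onI) (simp add: continuous_on_cis)

lemma cnj_measurable [measurable]: "bm cnj" by (intro borel_measurable_continuous_onI continuous_intros)

lemma of_real_measurable [measurable]: "bm cor" by (intro borel_measurable_continuous_onI continuous_intros)

lemma fourier_cis: "fourier h x = (LI xi. h xi*cis (- (x*xi)))" unfolding fourier_def by (intro LI_cong) (auto simp: cis_conv_exp mult.commute)

lemma integrable_mult_cis:
 assumes "integrable lborel h" "bm g"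
 shows "integrable lborel (%xi. h xi*cis (g xi))"
proof (rule LI_bound[OF assms(1)])
 show "bml (%xi. h xi*cis (g xi))" using assms by (auto dest!: bmi)
qed (simp add: norm_mult)

lemma norm_integral_cis_le:
 assumes "integrable lborel h"
 shows "norm (LI xi. h xi*cis (g xi)) <= (LI xi. norm (h xi))"
proof -
 have "norm (LI xi. h xi*cis (g xi)) <= (LI xi. norm (h xi*cis (g xi)))" by (rule integral_norm_bound)
 thus ?thesis by (simp add: norm_mult)
qed

text \<open>Rescaled by \<open>c = sqrt (2*eps)\<close> from the characteristic function of the
  standard normal distribution.\<close>

lemma gaussian_ft:
 assumes e: "0 < eps"
 shows "integrable lborel (%t. exp (- eps*t^2))"
  and "(LI t. cor (exp (- eps*t^2))*cis (a*t)) = cor (sqrt (pi/eps)*exp (- a\<^sup>2/(4*eps)))"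
proof -
 define c where "c = sqrt (2*eps)"
 have c: "c > 0" "c^2 = 2*eps" using e by (auto simp: c_def)
 have dens: "std_normal_density (c*t) = exp (- eps*t^2)/sqrt (2*pi)" for t unfolding std_normal_density_def using c by (simp add: power_mult_distrib)
 have i: "integrable lborel (%t. std_normal_density (0 + c*t))" using c by (intro lborel_integrable_real_affine integrable_normal_density) auto
 hence "integrable lborel (%t. sqrt (2*pi) * std_normal_density (c*t))" by simp
 thus "integrable lborel (%t. exp (- eps*t^2))" by (simp add: dens)
 have "char std_normal_distribution (a/c) = (LI x. std_normal_density x *\<^sub>R cis (a/c*x))" unfolding char_def by (subst integral_density) (auto simp: cis_conv_exp)
 also have "... = (abs c) *\<^sub>R (LI t. std_normal_density (0 + c*t) *\<^sub>R cis (a/c*(0 + c*t)))" by (rule lborel_integral_real_affine) (use c in simp)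
 also have "... = (LI t. (c/sqrt (2*pi)) *\<^sub>R (cor (exp (- eps*t^2))*cis (a*t)))"
  using c by (simp add: dens scaleR_conv_of_real mult.assoc flip: LI_mult)
 also have "... = (c/sqrt (2*pi)) *\<^sub>R (LI t. cor (exp (- eps*t^2))*cis (a*t))" by (rule Bochner_Integration.integral_scaleR_right)
 finally have "(c/sqrt (2*pi)) *\<^sub>R (LI t. cor (exp (- eps*t^2))*cis (a*t)) = cor (exp (- (a/c)\<^sup>2/2))" by (simp add: char_std_normal_distribution)
 hence "(LI t. cor (exp (- eps*t^2))*cis (a*t)) = (sqrt (2*pi)/c) *\<^sub>R cor (exp (- (a/c)\<^sup>2/2))" using c by (simp add: field_simps scaleR_conv_of_real)
 also have "- (a/c)\<^sup>2/2 = - a\<^sup>2/(4*eps)" using c by (simp add: power_divide)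
 also have "sqrt (2*pi)/c = sqrt (pi/eps)" using e by (simp add: c_def real_sqrt_divide[symmetric])
 finally show "(LI t. cor (exp (- eps*t^2))*cis (a*t)) = cor (sqrt (pi/eps)*exp (- a\<^sup>2/(4*eps)))" by (simp add: scaleR_conv_of_real)
qed

lemma gaussian_integral:
 assumes e: "0 < eps"
 shows "(LI t. exp (- eps*t^2)) = sqrt (pi/eps)"
  and "(NN t. er (exp (- eps*t^2))) = er (sqrt (pi/eps))"
proof -
 have "cor (LI t. exp (- eps*t^2)) = cor (sqrt (pi/eps))" using gaussian_ft(2)[OF e, of 0] by (simp flip: integral_complex_of_real)
 thus *: "(LI t. exp (- eps*t^2)) = sqrt (pi/eps)" by (simp only: of_real_eq_iff)
 show "(NN t. er (exp (- eps*t^2))) = er (sqrt (pi/eps))" using nn_integral_eq_integral[OF gaussian_ft(1)[OF e]] * by simp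
qed

lemma nn_integral_norm_eq:
 fixes f :: "_ => 'b::{banach, second_countable_topology}"
 assumes "integrable M f" shows "(\<integral>\<^sup>+x. en (f x) \<partial>M) = er (LINT x|M. norm (f x))"
 using assms by (intro nn_integral_eq_integral integrable_norm) auto

lemma norm_integral_le_nn:
 fixes f :: "_ => 'b::{banach, second_countable_topology}"
 shows "en (LINT x|M. f x) <= (\<integral>\<^sup>+x. en (f x) \<partial>M)"
proof (cases "integrable M f")
 case True
 thus ?thesis using integral_norm_bound_ennreal by blast
qed (simp add: not_integrable_integral_eq)

lemma cis_transform_measurable [measurable]:
 assumes [measurable]: "bm h" "bm omega"
 shows "bm (%t. LI xi. h xi*cis (t * omega xi))"
proof -
 have "bml (%t. LI xi. h xi*cis (t * omega xi))" by (rule lborel.borel_measurable_lebesgue_integral) measurable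
 thus ?thesis by simp
qed

text \<open>Damping the time integral by a Gaussian turns the square of the transform into a double
 integral against a Gaussian in \<open>omega xi - omega xi'\<close>, to which Schur's test applies.\<close>

lemma Bessel_phase:
 fixes h :: "real => complex" and omega :: "real => real"
 assumes h: "integrable lborel h" and omegam [measurable]: "bm omega"
  and l: "0 < lam" and sep: "!!xi eta. h xi ~= 0 ==> h eta ~= 0 ==> lam*\<bar>xi - eta\<bar> <= \<bar>omega xi - omega eta\<bar>"
 shows "(NN t. en (LI xi. h xi*cis (t * omega xi))^2) <= er (2*pi/lam)*(NN xi. en (h xi)^2)"
proof -
 have hm [measurable]: "bm h" using h by (auto dest: bmi)
 define H where "H t = (LI xi. h xi*cis (t * omega xi))" for t
 have Hm [measurable]: "bm H" unfolding H_def by measurable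
 define N where "N = (LI xi. norm (h xi))"
 have HN: "norm (H t) <= N" for t unfolding H_def N_def using h by (rule norm_integral_cis_le)
 have cnjH: "cnj (H t) = (LI xi. cnj (h xi)*cis (- (t * omega xi)))" for t
  unfolding H_def using Bochner_Integration.integral_cnj[of lborel "%xi. h xi*cis (t * omega xi)"] by (simp add: cis_cnj)
 have main: "(NN t. er (exp (- eps*t^2))*en (H t)^2) <= er (2*pi/lam)*(NN xi. en (h xi)^2)" if e: "0 < eps" for eps
 proof -
  let ?e = "%t. cor (exp (- eps*t^2))"
  define gamma where "gamma y = sqrt (pi/eps)*exp (- y\<^sup>2/(4*eps))" for y :: real
  have [measurable]: "bm gamma" unfolding gamma_def by measurable
  have gamma0: "0 <= gamma y" for y using e by (simp add: gamma_def)
  have ei: "integrable lborel ?e" using gaussian_ft(1)[OF e] by (rule integrable_of_real)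
  have ecH: "integrable lborel (%t. ?e t*cnj (H t))"
  proof (rule LI_bound[OF integrable_mult_right[OF gaussian_ft(1)[OF e], of N]])
   show "AEL t. norm (?e t*cnj (H t)) <= norm (N*exp (- eps*t^2))"
    using HN by (intro AE_I2) (auto simp: norm_mult abs_mult mult.commute intro!: mult_right_mono order_trans[OF HN abs_ge_self])
  qed measurable
  have iH: "integrable lborel (%t. exp (- eps*t^2)*(norm (H t))^2)"
  proof (rule LI_bound[OF integrable_mult_right[OF gaussian_ft(1)[OF e], of "N^2"]])
   have "(norm (H t))^2 <= N^2" for t using HN by (intro power_mono) auto
   thus "AEL t. norm (exp (- eps*t^2)*(norm (H t))^2) <= norm (N^2*exp (- eps*t^2))" by (intro AE_I2) (auto simp: abs_mult mult.commute intro!: mult_right_mono)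
  qed measurable
  have inner: "(LI t. (?e t*cnj (H t))*cis (t * omega xi)) = (LI eta. cnj (h eta)*cor (gamma (omega xi - omega eta)))" for xi
  proof -
   have "(LI t. (?e t*cnj (H t))*cis (t * omega xi)) = (LI t. (?e t*cis (t * omega xi))*(LI eta. cnj (h eta)*cis (- (t * omega eta))))"
    unfolding cnjH by (intro LI_cong) (auto simp: mult_ac)
   also have "... = (LI eta. cnj (h eta)*(LI t. (?e t*cis (t * omega xi))*cis (- (t * omega eta))))"
    by (rule kernel_Fubini[where C=1]) (use h ei in "auto intro!: integrable_mult_cis")
   also have "... = (LI eta. cnj (h eta)*cor (gamma (omega xi - omega eta)))"
   proof (intro LI_cong refl arg_cong2[where f="(*)"])
    fix eta
    have "(LI t. (?e t*cis (t * omega xi))*cis (- (t * omega eta))) = (LI t. ?e t*cis ((omega xi - omega eta)*t))"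
     by (intro LI_cong) (auto simp: mult.assoc cis_mult algebra_simps)
    thus "(LI t. (?e t*cis (t * omega xi))*cis (- (t * omega eta))) = cor (gamma (omega xi - omega eta))" unfolding gaussian_ft(2)[OF e] gamma_def .
   qed
   finally show ?thesis .
  qed
  have "cor (LI t. exp (- eps*t^2)*(norm (H t))^2) = (LI t. (?e t*cnj (H t))*H t)" by (subst integral_complex_of_real[symmetric], intro LI_cong)
    (auto simp: complex_norm_square mult_ac simp del: of_real_power)
  also have "... = (LI t. (?e t*cnj (H t))*(LI xi. h xi*cis (t * omega xi)))" by (simp add: H_def)
  also have "... = (LI xi. h xi*(LI t. (?e t*cnj (H t))*cis (t * omega xi)))" by (rule kernel_Fubini[where C=1]) (use h ecH in auto)
  also have "... = (LI xi. h xi*(LI eta. cnj (h eta)*cor (gamma (omega xi - omega eta))))" unfolding inner ..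
  finally have eq: "cor (LI t. exp (- eps*t^2)*(norm (H t))^2) = (LI xi. h xi*(LI eta. cnj (h eta)*cor (gamma (omega xi - omega eta))))" .
  let ?n = "%xi. en (h xi)" and ?g = "%xi eta. er (gamma (lam*(xi - eta)))" and ?l = "%xi. LI eta. cnj (h eta)*cor (gamma (omega xi - omega eta))"
  have half: "er (1/2)*X + er (1/2)*X = X" for X
  proof -
   have "er (1/2)*X + er (1/2)*X = (er (1/2) + er (1/2))*X" by (simp only: distrib_right)
   also have "er (1/2) + er (1/2) = er (1/2 + 1/2)" by (intro ennreal_plus[symmetric]) auto
   finally show ?thesis by simp
  qed
  have "(NN t. er (exp (- eps*t^2))*en (H t)^2) = (NN t. er (exp (- eps*t^2)*(norm (H t))^2))" by (simp add: ennreal_mult ennreal_power)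
  also have "... = er (LI t. exp (- eps*t^2)*(norm (H t))^2)" using iH by (intro nn_integral_eq_integral) auto
  also have "... <= en (cor (LI t. exp (- eps*t^2)*(norm (H t))^2))" by (intro ennreal_leI) simp
  also have "... <= (NN xi. en (h xi*?l xi))" unfolding eq by (rule norm_integral_le_nn)
  \<comment> \<open>Schur's test for a symmetric kernel: \<open>2*a*b <= a^2 + b^2\<close> leaves
    two terms that agree after exchanging \<open>xi\<close> and \<open>eta\<close>. The separation
    of the phases enters through
    \<open>gamma (omega xi - omega eta) <= gamma (lam*(xi - eta))\<close>.\<close>
  also have "... <= (NN xi. (NN eta. er (1/2)*(?n xi^2*?g xi eta) + er (1/2)*(?n eta^2*?g xi eta)))"
  proof (rule nn_mono)
   fix xi
   have "en (h xi*?l xi) <= ?n xi*(NN eta. en (cnj (h eta)*cor (gamma (omega xi - omega eta))))"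
    unfolding norm_mult[of "h xi"] ennreal_mult[OF norm_ge_zero norm_ge_zero] by (intro mult_left_mono norm_integral_le_nn) simp
   also have "... = (NN eta. ?n xi*en (cnj (h eta)*cor (gamma (omega xi - omega eta))))" by (rule nn_cmult[symmetric]) measurable
   also have "... <= (NN eta. er (1/2)*(?n xi^2*?g xi eta) + er (1/2)*(?n eta^2*?g xi eta))"
   proof (rule nn_mono)
    fix eta
    show "?n xi*en (cnj (h eta)*cor (gamma (omega xi - omega eta))) <= er (1/2)*(?n xi^2*?g xi eta) + er (1/2)*(?n eta^2*?g xi eta)"
    proof (cases "h xi = 0 | h eta = 0")
     case False
     have "gamma (omega xi - omega eta) <= gamma (lam*(xi - eta))"
     proof -
      have "(lam*(xi - eta))^2 <= (omega xi - omega eta)^2" using sep[of xi eta] False l by (intro abs_le_square_iff[THEN iffD1]) (simp add: abs_mult)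
      thus ?thesis using e by (auto simp: gamma_def divide_right_mono intro!: mult_left_mono)
     qed
     hence "norm (h xi)*(norm (h eta)*gamma (omega xi - omega eta)) <= (norm (h xi)*norm (h eta))*gamma (lam*(xi - eta))" by (simp add: mult.assoc mult_left_mono)
     also have "... <= (((norm (h xi))^2 + (norm (h eta))^2)/2)*gamma (lam*(xi - eta))"
      using sum_squares_bound[of "norm (h xi)" "norm (h eta)"] gamma0 by (intro mult_right_mono) auto
     finally have "norm (h xi)*(norm (h eta)*gamma (omega xi - omega eta)) <= (1/2)*((norm (h xi))^2*gamma (lam*(xi - eta))) + (1/2)*((norm (h eta))^2*gamma (lam*(xi - eta)))"
      by (simp add: field_simps)
     hence "er (norm (h xi)*(norm (h eta)*gamma (omega xi - omega eta))) <= er ((1/2)*((norm (h xi))^2*gamma (lam*(xi - eta))) + (1/2)*((norm (h eta))^2*gamma (lam*(xi - eta))))"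
      by (rule ennreal_leI)
     also have "... = er (1/2)*(?n xi^2*?g xi eta) + er (1/2)*(?n eta^2*?g xi eta)"
      using gamma0 by (simp only: ennreal_plus ennreal_mult ennreal_power norm_ge_zero zero_le_power2 mult_nonneg_nonneg divide_nonneg_nonneg zero_le_one zero_le_numeral)
     finally show ?thesis using gamma0 by (simp only: norm_mult complex_mod_cnj norm_of_real abs_of_nonneg ennreal_mult norm_ge_zero mult_nonneg_nonneg)
    qed auto
   qed
   finally show "en (h xi*?l xi)
    <= (NN eta. er (1/2)*(?n xi^2*?g xi eta) + er (1/2)*(?n eta^2*?g xi eta))" .
  qed
  also have "... = er (1/2)*(NN xi. (NN eta. ?n xi^2*?g xi eta))
    + er (1/2)*(NN xi. (NN eta. ?n eta^2*?g xi eta))" by (simp add: nn_integral_add nn_cmult)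
  also have "(NN xi. (NN eta. ?n eta^2*?g xi eta)) = (NN eta. (NN xi. ?n eta^2*?g xi eta))" by (rule lborel_pair.Fubini') measurable
  also have "... = (NN xi. (NN eta. ?n xi^2*?g xi eta))" by (intro nn_cong) (simp add: gamma_def power2_eq_square algebra_simps)
  also have "er (1/2)*(NN xi. (NN eta. ?n xi^2*?g xi eta)) + er (1/2)*... = (NN xi. (NN eta. ?n xi^2*?g xi eta))" by (rule half)
  also have "... = (NN xi. ?n xi^2*er (2*pi/lam))"
  proof (intro nn_cong)
   fix xi :: real
   define d where "d = lam^2/(4*eps)"
   have d: "0 < d" using l e by (simp add: d_def)
   have "(NN eta. ?g xi eta) = er \<bar>- 1\<bar>*(NN eta. er (gamma (lam*(xi - (xi + (- 1)*eta)))))" by (rule nn_integral_real_affine) auto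
   also have "... = (NN eta. er (sqrt (pi/eps))*er (exp (- d*eta^2)))" using e by (simp add: gamma_def d_def power_mult_distrib ennreal_mult)
   also have "... = er (sqrt (pi/eps))*er (sqrt (pi/d))" unfolding gaussian_integral(2)[OF d, symmetric] by (rule nn_cmult) measurable
   \<comment> \<open>The height \<open>sqrt (pi/eps)\<close> of the Gaussian and its width,
     proportional to \<open>sqrt eps/lam\<close>, compensate each other, so no trace of
     \<open>eps\<close> remains.\<close>
   also have "... = er (2*pi/lam)"
   proof -
    have "sqrt (pi/eps) * sqrt (pi/d) = sqrt ((2*pi/lam)^2)" using e l by (simp add: d_def power_divide power_mult_distrib power2_eq_square flip: real_sqrt_mult)
    also have "... = 2*pi/lam" using l by (simp del: power_divide)
    finally show ?thesis using e d by (simp flip: ennreal_mult)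
   qed
   finally show "(NN eta. ?n xi^2*?g xi eta) = ?n xi^2*er (2*pi/lam)" by (subst nn_cmult) auto
  qed
  also have "... = er (2*pi/lam)*(NN xi. ?n xi^2)" by (subst nn_multc) (auto simp: mult.commute)
  finally show ?thesis .
 qed
 \<comment> \<open>The bound is uniform in \<open>eps\<close>, so Fatou's lemma along
   \<open>eps = 1/(n + 1)\<close> removes the damping.\<close>
 have "(NN t. en (H t)^2) = (NN t. liminf (%n. er (exp (- (1/real (Suc n))*t^2))*en (H t)^2))"
 proof (intro nn_cong)
  fix t :: real
  have "(%n. exp (- (1/real (Suc n))*t^2)) ----> exp (- 0*t^2)" by (intro tendsto_intros LIMSEQ_Suc lim_1_over_n)
  hence "(%n. er (exp (- (1/real (Suc n))*t^2))*en (H t)^2) ----> er 1*en (H t)^2" by (intro tendsto_mult_ennreal tendsto_ennrealI tendsto_const) auto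
  from lim_imp_Liminf[OF _ this]
  show "en (H t)^2 = liminf (%n. er (exp (- (1/real (Suc n))*t^2))*en (H t)^2)" by simp
 qed
 also have "... <= liminf (%n. (NN t. er (exp (- (1/real (Suc n))*t^2))*en (H t)^2))" by (rule nn_integral_liminf) measurable
 also have "... <= er (2*pi/lam)*(NN xi. en (h xi)^2)" by (intro Liminf_le always_eventually allI main) simp_all
 finally show ?thesis unfolding H_def .
qed

text \<open>The transform of the damping factor \<open>exp (- t^2/(n + 1))\<close>, recentred at
  \<open>a\<close>. It is an approximate identity of total mass \<open>2*pi\<close>, the origin of
  that factor in the inversion formulas.\<close>

abbreviation gk :: "nat => real => real => complex" where
 "gk n a xi \<equiv> cor (sqrt (pi/(1/real (Suc n)))*exp (- (xi - a)\<^sup>2/(4*(1/real (Suc n)))))"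

text \<open>Substituting \<open>xi = a + z/sqrt (n + 1)\<close> frees the kernel from
  \<open>n\<close>; then boundedness and continuity at \<open>a\<close> suffice for dominated
  convergence.\<close>

lemma gaussian_approx:
 fixes f :: "real => complex"
 assumes fm [measurable]: "bm f" and C: "!!x. norm (f x) <= C" and cont: "isCont f a"
 shows "(%n. LI xi. f xi*gk n a xi)
  ----> 2*pi*f a"
proof -
 let ?g = "%n z. f (a + z/sqrt (real (Suc n)))*cor (sqrt pi*exp (- (1/4)*z^2))"
 have eq: "(LI xi. f xi*gk n a xi) = (LI z. ?g n z)" for n
 proof -
  define r where "r = sqrt (real (Suc n))"
  have r: "r > 0" "r^2 = real (Suc n)" by (auto simp: r_def)
  have "(LI xi. f xi*gk n a xi)
   = \<bar>1/r\<bar> *\<^sub>R (LI z. f (a + (1/r)*z)*gk n a (a + (1/r)*z))"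
   by (rule lborel_integral_real_affine) (use r in simp)
  also have "... = (LI z. (1/r) *\<^sub>R (f (a + (1/r)*z)*gk n a (a + (1/r)*z)))"
   using r by (subst integral_scaleR_right) simp
  also have "... = (LI z. ?g n z)"
  proof (intro LI_cong refl)
   fix z
   have "(a + (1/r)*z - a)^2/(4*(1/real (Suc n))) = (1/4)*z^2" using r by (simp add: power_divide flip: r(2))
   moreover have "sqrt (pi/(1/real (Suc n))) = r * sqrt pi" by (simp add: r_def real_sqrt_mult)
   ultimately have "(1/r) *\<^sub>R (f (a + (1/r)*z)*gk n a (a + (1/r)*z))
     = (1/r) *\<^sub>R (f (a + (1/r)*z)*cor (r * sqrt pi*exp (- (1/4)*z^2)))" by (simp only: minus_mult_left minus_divide_left[symmetric])
   also have "... = ?g n z" using r by (simp add: scaleR_conv_of_real r_def[symmetric] del: of_nat_Suc)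
   finally show "(1/r) *\<^sub>R (f (a + (1/r)*z)*gk n a (a + (1/r)*z)) = ?g n z" .
  qed
  finally show ?thesis .
 qed
 have "(%n. LI z. ?g n z) ----> (LI z. f a*cor (sqrt pi*exp (- (1/4)*z^2)))"
 proof (rule integral_dominated_convergence)
  show "integrable lborel (%z. C*(sqrt pi*exp (- (1/4)*z^2)))" using gaussian_ft(1)[of "1/4"] by (intro integrable_mult_right) auto
  show "AEL z. (%n. ?g n z) ----> f a*cor (sqrt pi*exp (- (1/4)*z^2))"
  proof (intro AE_I2 tendsto_mult tendsto_const)
   fix z
   have "(%n. a + z/sqrt (real (Suc n))) ----> a + 0" by (intro tendsto_add tendsto_const real_tendsto_divide_at_top[OF tendsto_const]
      filterlim_compose[OF sqrt_at_top] filterlim_compose[OF filterlim_real_sequentially] filterlim_Suc)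
   thus "(%n. f (a + z/sqrt (real (Suc n)))) ----> f a" using isCont_tendsto_compose[OF cont] by simp
  qed
  show "AEL z. norm (?g n z) <= C*(sqrt pi*exp (- (1/4)*z^2))" for n using C by (intro AE_I2) (auto simp: norm_mult abs_mult intro!: mult_right_mono)
 qed measurable
 also have "(LI z. f a*cor (sqrt pi*exp (- (1/4)*z^2))) = f a*(cor (sqrt pi)*cor (LI z. exp (- (1/4)*z^2)))" by (simp flip: integral_complex_of_real)
 also have "... = 2*pi*f a" using gaussian_integral(1)[of "1/4"] by (simp add: real_sqrt_mult flip: of_real_mult)
 finally show ?thesis unfolding eq .
qed

lemma fourier_inversion_at:
 fixes psi :: "real => complex"
 assumes p: "integrable lborel psi" and C: "!!x. norm (psi x) <= C" and cont: "isCont psi a"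
  and f: "integrable lborel (fourier psi)"
 shows "(LI x. fourier psi x*cis (x*a)) = 2*pi*psi a"
proof (rule LIMSEQ_unique)
 have pm [measurable]: "bm psi" using p by (auto dest: bmi)
 have fm [measurable]: "bm (fourier psi)" using f by (auto dest: bmi)
 let ?e = "%n x. cor (exp (- (1/real (Suc n))*x^2))"
 have eq: "(LI x. (?e n x*cis (x*a))*fourier psi x) = (LI xi. psi xi*gk n a xi)" for n
 proof -
  have e: "(1/real (Suc n)) > 0" by simp
  have "(LI x. (?e n x*cis (x*a))*fourier psi x) = (LI x. (?e n x*cis (x*a))*(LI xi. psi xi*cis (- (x*xi))))" by (simp only: fourier_cis)
  also have "... = (LI xi. psi xi*(LI x. (?e n x*cis (x*a))*cis (- (x*xi))))" by (rule kernel_Fubini[where C=1])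
    (use p gaussian_ft(1)[OF e] in "auto intro!: integrable_mult_cis integrable_of_real simp del: of_nat_Suc")
  also have "... = (LI xi. psi xi*gk n a xi)"
  proof (intro LI_cong refl arg_cong2[where f="(*)"])
   fix xi
   have "(LI x. (?e n x*cis (x*a))*cis (- (x*xi))) = (LI x. ?e n x*cis ((a - xi)*x))"
    by (intro LI_cong) (auto simp: mult.assoc cis_mult algebra_simps simp del: of_nat_Suc)
   also have "... = gk n a xi" unfolding gaussian_ft(2)[OF e] by (simp add: power2_commute)
   finally show "(LI x. (?e n x*cis (x*a))*cis (- (x*xi))) = gk n a xi" .
  qed
  finally show ?thesis .
 qed
 show "(%n. LI x. (?e n x*cis (x*a))*fourier psi x) ----> 2*pi*psi a" unfolding eq using gaussian_approx[OF pm C cont] .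
 show "(%n. LI x. (?e n x*cis (x*a))*fourier psi x) ----> (LI x. fourier psi x*cis (x*a))"
 proof (rule integral_dominated_convergence)
  show "integrable lborel (%x. norm (fourier psi x))" using f by (rule integrable_norm)
  show "AEL x. (%n. (?e n x*cis (x*a))*fourier psi x) ----> fourier psi x*cis (x*a)"
  proof (rule AE_I2)
   fix x :: real
   have "(%n. (?e n x*cis (x*a))*fourier psi x) ----> (cor (exp (- 0*x^2))*cis (x*a))*fourier psi x" by (intro tendsto_intros LIMSEQ_Suc lim_1_over_n)
   thus "(%n. (?e n x*cis (x*a))*fourier psi x) ----> fourier psi x*cis (x*a)" by (simp add: mult.commute)
  qed
  show "AEL x. norm ((?e n x*cis (x*a))*fourier psi x) <= norm (fourier psi x)" for n by (intro AE_I2) (auto simp: norm_mult intro!: mult_left_le_one_le)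
 qed measurable
qed

text \<open>The positive and negative parts of \<open>g\<close> have the same transform, hence the
  same mass \<open>m\<close> (take \<open>c = 0\<close>). If \<open>m = 0\<close> both vanish;
  otherwise they are, after division by \<open>m\<close>, densities of probability measures with
  equal characteristic functions, and Levy's uniqueness theorem applies.\<close>

lemma zero_fourier_imp_zero_real:
 fixes g :: "real => real"
 assumes g: "integrable lborel g" and z: "!!c. (LI x. cor (g x)*cis (c*x)) = 0"
 shows "AEL x. g x = 0"
proof -
 have gm [measurable]: "bm g" using g by (auto dest: bmi)
 define p where "p i x = max (if i then g x else - g x) 0" for i :: bool and x
 have pm [measurable]: "bm (p i)" for i unfolding p_def by (cases i) auto
 have p0: "0 <= p i x" for i x by (simp add: p_def)
 have pi: "integrable lborel (p i)" for i unfolding p_def using g by (cases i) auto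
 have gp: "g x = p True x - p False x" for x by (simp add: p_def)
 have eq: "(LI x. cor (p True x)*cis (c*x)) = (LI x. cor (p False x)*cis (c*x))" for c
 proof -
  have i: "integrable lborel (%x. cor (p i x)*cis (c*x))" for i by (intro integrable_mult_cis integrable_of_real pi) auto
  have "(LI x. cor (p True x)*cis (c*x)) - (LI x. cor (p False x)*cis (c*x)) = 0"
   using z[of c] i by (subst Bochner_Integration.integral_diff[symmetric]) (simp_all add: gp left_diff_distrib)
  thus ?thesis by simp
 qed
 define m where "m = (LI x. p True x)"
 have mi: "(LI x. p i x) = m" for i
 proof (cases i)
  case False
  have "cor (LI x. p True x) = cor (LI x. p False x)" using eq[of 0] by (simp flip: integral_complex_of_real)
  thus ?thesis using False by (simp add: m_def)
 qed (simp add: m_def)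
 show ?thesis
 proof (cases "m = 0")
  case True
  have "AEL x. p i x = 0" for i using integral_nonneg_eq_0_iff_AE[OF pi, of i] p0 mi True by auto
  from this[of True] this[of False] show ?thesis by eventually_elim (simp add: gp)
 next
  case False
  have "0 <= m" unfolding m_def using p0 by simp
  with False have m: "m > 0" by simp
  define M where "M i = density lborel (%x. er (p i x/m))" for i
  have rd: "real_distribution (M i)" for i
  proof -
   have "emeasure (M i) (space (M i)) = (NN x. er (p i x/m))" unfolding M_def by (simp add: emeasure_density)
   also have "... = er (LI x. p i x/m)" using p0 m pi by (intro nn_integral_eq_integral) auto
   also have "... = 1" using m mi by simp
   finally have "prob_space (M i)" by (rule prob_spaceI)
   thus ?thesis by (simp add: real_distribution_def real_distribution_axioms_def M_def)
  qed
  have ch: "char (M i) c = (LI x. cor (p i x)*cis (c*x))/m" for i c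
  proof -
   have "char (M i) c = (LI x. (p i x/m) *\<^sub>R cis (c*x))" unfolding char_def M_def using p0 m by (subst integral_density) (auto simp: cis_conv_exp)
   also have "... = (LI x. cor (p i x)*cis (c*x)/m)" by (intro LI_cong) (auto simp: scaleR_conv_of_real)
   finally show ?thesis by simp
  qed
  have "M True = M False" by (rule Levy_uniqueness[OF rd rd]) (simp add: ch fun_eq_iff eq)
  moreover have "sigma_finite_measure (M True)" using rd[of True] by (simp add: real_distribution_def prob_space_def finite_measure_def)
  ultimately have "AEL x. er (p True x/m) = er (p False x/m)" unfolding M_def by (subst (asm) sigma_finite_density_unique) auto
  thus ?thesis
  proof eventually_elim
   case (elim x)
   thus ?case using m p0[of True x] p0[of False x] by (simp add: gp)
  qed
 qed
qed

text \<open>Conjugation reflects the frequency, so the real and the imaginary part of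
  \<open>G\<close> have vanishing transforms as well.\<close>

lemma zero_fourier_imp_zero:
 fixes G :: "real => complex"
 assumes G: "integrable lborel G" and z: "!!c. (LI x. G x*cis (c*x)) = 0"
 shows "AEL x. G x = 0"
proof -
 have i: "integrable lborel (%x. G x*cis (c*x))" "integrable lborel (%x. cnj (G x)*cis (c*x))" for c using G by (auto intro!: integrable_mult_cis)
 have zc: "(LI x. cnj (G x)*cis (c*x)) = 0" for c
 proof -
  have "(LI x. cnj (G x)*cis (c*x)) = cnj (LI x. G x*cis (- c*x))" by (simp add: cis_cnj flip: Bochner_Integration.integral_cnj)
  thus ?thesis using z[of "- c"] by simp
 qed
 have "AEL x. Re (G x) = 0"
 proof (rule zero_fourier_imp_zero_real)
  fix c
  have "(LI x. cor (Re (G x))*cis (c*x)) = (LI x. (1/2)*(G x*cis (c*x) + cnj (G x)*cis (c*x)))" by (intro LI_cong refl) (simp add: complex_add_cnj flip: distrib_right)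
  also have "... = 0" using i z zc by simp
  finally show "(LI x. cor (Re (G x))*cis (c*x)) = 0" .
 qed (use G in auto)
 moreover have "AEL x. Im (G x) = 0"
 proof (rule zero_fourier_imp_zero_real)
  fix c
  have "(LI x. cor (Im (G x))*cis (c*x)) = (LI x. (1/(2*\<i>))*(G x*cis (c*x) - cnj (G x)*cis (c*x)))"
  proof (intro LI_cong refl)
   fix x
   have "G x*cis (c*x) - cnj (G x)*cis (c*x) = (2*\<i>)*(cor (Im (G x))*cis (c*x))"
    unfolding left_diff_distrib[symmetric] complex_diff_cnj by (simp only: mult_ac of_real_mult of_real_numeral)
   thus "cor (Im (G x))*cis (c*x) = (1/(2*\<i>))*(G x*cis (c*x) - cnj (G x)*cis (c*x))" by simp
  qed
  also have "... = 0" using i z zc by simp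
  finally show "(LI x. cor (Im (G x))*cis (c*x)) = 0" .
 qed (use G in auto)
 ultimately show ?thesis by eventually_elim (simp add: complex_eq_iff)
qed

lemma integral_derivative_zero:
 fixes f :: "real => complex"
 assumes d: "!!x. (f has_vector_derivative f' x) (at x)" and c: "continuous_on UNIV f'"
  and i: "integrable lborel f'" and l: "(f \<longlongrightarrow> 0) at_top" "(f \<longlongrightarrow> 0) at_bot"
 shows "(LI x. f' x) = 0"
proof -
 have "(LBINT x=-\<infinity>..\<infinity>. f' x) = 0 - 0"
 proof (rule interval_integral_FTC_integrable[where F=f])
  show "set_integrable lborel (einterval (-\<infinity>) \<infinity>) f'" using i by (simp add: set_integrable_def)
  show "((f \<circ> real_of_ereal) \<longlongrightarrow> 0) (at_right (-\<infinity>))" "((f \<circ> real_of_ereal) \<longlongrightarrow> 0) (at_left \<infinity>)"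
   using l by (simp_all only: ereal_tendsto_simps)
  show "isCont f' x" for x using c by (simp add: continuous_on_eq_continuous_at)
 qed (use d in auto)
 thus ?thesis by (simp add: interval_lebesgue_integral_def set_lebesgue_integral_def)
qed

lemma fourier_derivative:
 assumes d: "!!x. (psi has_vector_derivative psi' x) (at x)" and c: "continuous_on UNIV psi'"
  and i: "integrable lborel psi" "integrable lborel psi'" and l: "(psi \<longlongrightarrow> 0) at_top" "(psi \<longlongrightarrow> 0) at_bot"
 shows "fourier psi' x = \<i>*x*fourier psi x"
proof -
 have lim: "((%xi. psi xi*cis (- (x*xi))) \<longlongrightarrow> 0) F" if "(psi \<longlongrightarrow> 0) F" for F
  by (rule tendsto_norm_zero_cancel) (simp only: norm_mult norm_cis mult_1_right tendsto_norm_zero[OF that])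
 have cont: "continuous_on UNIV psi" using d by (auto simp: continuous_on_eq_continuous_at intro: has_vector_derivative_continuous)
 have d2: "vd ((%xi. cis (- (x*xi)))) ((- \<i>*x*cis (- (x*xi)))) xi" for xi
 proof -
  have "vd ((%xi. exp ((- \<i>*x)*cor xi))) ((- \<i>*x)*exp ((- \<i>*x)*cor xi)) xi"
   by (rule has_vector_derivative_real_field) (auto intro!: derivative_eq_intros)
  thus ?thesis by (simp add: cis_conv_exp mult.assoc)
 qed
 let ?g = "%xi. (- \<i>*x)*(psi xi*cis (- (x*xi))) + psi' xi*cis (- (x*xi))"
 have ic: "integrable lborel (%xi. psi xi*cis (- (x*xi)))" "integrable lborel (%xi. psi' xi*cis (- (x*xi)))" using i by (auto intro: integrable_mult_cis)
 have "(LI xi. ?g xi) = 0"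
 proof (rule integral_derivative_zero)
  fix xi
  have "vd ((%xi. psi xi*cis (- (x*xi)))) (psi xi*((- \<i>*x)*cis (- (x*xi))) + psi' xi*cis (- (x*xi))) xi"
   by (rule has_vector_derivative_mult[OF d d2])
  thus "vd ((%xi. psi xi*cis (- (x*xi)))) (?g xi) xi" by (simp only: mult.left_commute[of "psi xi"])
 next
  show "continuous_on UNIV ?g" by (intro continuous_intros cont c continuous_on_cis)
  show "integrable lborel ?g" by (intro Bochner_Integration.integrable_add integrable_mult_right ic)
 qed (rule lim, rule l)+
 moreover have "(LI xi. ?g xi) = - \<i>*x*fourier psi x + fourier psi' x" using ic by (subst Bochner_Integration.integral_add) (auto simp: fourier_cis)
 ultimately show ?thesis by (simp add: add_eq_0_iff)
qed

lemma fourier_decay: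
 assumes d: "!!x. (psi has_vector_derivative psi1 x) (at x)" "!!x. (psi1 has_vector_derivative psi2 x) (at x)"
  and c: "continuous_on UNIV psi2"
  and i: "integrable lborel psi" "integrable lborel psi1" "integrable lborel psi2"
  and l: "(psi \<longlongrightarrow> 0) at_top" "(psi \<longlongrightarrow> 0) at_bot" "(psi1 \<longlongrightarrow> 0) at_top" "(psi1 \<longlongrightarrow> 0) at_bot"
 shows "norm (fourier psi x) <= ((LI xi. norm (psi xi)) + (LI xi. norm (psi2 xi)))/(1 + x^2)"
proof -
 have c1: "continuous_on UNIV psi1" using d by (auto simp: continuous_on_eq_continuous_at intro: has_vector_derivative_continuous)
 have "fourier psi2 x = \<i>*x*(\<i>*x*fourier psi x)" using fourier_derivative[OF d(1) c1 i(1,2) l(1,2)] fourier_derivative[OF d(2) c i(2,3) l(3,4)] by simp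
 hence "fourier psi2 x = (\<i>*\<i>)*(x^2*fourier psi x)" by (simp only: power2_eq_square mult_ac of_real_mult)
 hence "x^2*norm (fourier psi x) = norm (fourier psi2 x)" by (simp add: norm_mult norm_power)
 also have "... <= (LI xi. norm (psi2 xi))" unfolding fourier_cis using i by (intro norm_integral_cis_le)
 finally have "x^2*norm (fourier psi x) <= (LI xi. norm (psi2 xi))" .
 moreover have "norm (fourier psi x) <= (LI xi. norm (psi xi))" unfolding fourier_cis using i by (intro norm_integral_cis_le)
 moreover have "0 < 1 + x^2" by (simp add: add_pos_nonneg)
 ultimately show ?thesis by (simp add: pos_le_divide_eq distrib_left mult.commute)
qed

lemma integrable_inverse_1_plus_sq: "integrable lborel (%x::real. C/(1 + x^2))"
proof -
 have "integrable lborel (%x::real. inverse (1 + x^2))" using integrable_inverse_1_plus_square by (simp add: set_integrable_def)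
 hence "integrable lborel (%x::real. C*inverse (1 + x^2))" by (rule integrable_mult_right)
 thus ?thesis by (simp add: divide_inverse)
qed

text \<open>Through Hoelder this turns any mixed norm bound on a bounded time interval into
  integrability against \<open>1/(1 + x^2)\<close>, which is what pairing with a Schwartz function
  requires.\<close>

lemma mx_weight:
 assumes p: "1 < p" "1 < q" and T: "0 <= T"
 shows "mx p q (%t x. er (1/(1 + x^2))*ind {0..T} t) < top"
proof -
 let ?w = "%x::real. er (1/(1 + x^2))"
 let ?h = "%t x. ?w x*ind {0..T} t"
 have "mx p q ?h = (NN x. er T^.(p/q)*?w x^.p)^.(1/p)"
 proof -
  have "(NN t. ?h t x^.q) = ?w x^.q*er T" for x unfolding indicator_powr using T by (simp add: nn_cmult)
  thus ?thesis unfolding mx_def using p by (simp only: epowr_mult epowr_powr) (simp add: mult.commute)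
 qed
 also have "... < top"
 proof -
  have "(NN x. ?w x^.p) <= (NN x. ?w x)"
  proof (rule nn_mono)
   fix x :: real
   have "1/(1 + x^2) <= 1" by (subst divide_le_eq_1_pos) (auto simp: add_pos_nonneg)
   hence "(1/(1 + x^2)) powr p <= (1/(1 + x^2)) powr 1" using p by (intro powr_mono') (auto simp: add_nonneg_nonneg)
   thus "?w x^.p <= ?w x" by (simp add: add_nonneg_nonneg ennreal_leI)
  qed
  also have "... = er (LI x. 1/(1 + x^2))" by (intro nn_integral_eq_integral integrable_inverse_1_plus_sq) (simp add: add_nonneg_nonneg)
  finally have "(NN x. ?w x^.p) < top" by (rule le_less_trans) simp
  thus ?thesis by (simp add: nn_cmult ennreal_mult_less_top)
 qed
 finally show ?thesis .
qed

lemma inverse_1_plus_sq_tendsto: "((%x::real. C/(1 + x^2)) \<longlongrightarrow> 0) at_top" "((%x::real. C/(1 + x^2)) \<longlongrightarrow> 0) at_bot" by real_asymp+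

section \<open>Schwartz functions, Gaussians and uniqueness of transforms\<close>

lemma schwartzD:
 assumes "schwartz psi"
 defines "D \<equiv> %n. ((%h y. vector_derivative h (at y)) ^^ n) psi"
 shows "D 0 = psi" "vd (D n) (D (Suc n) x) x" "\<exists>C\<ge>0. \<forall>x. norm (D n x) <= C/(1 + x^2)"
proof -
 show "D 0 = psi" by (simp add: D_def)
 show "vd (D n) (D (Suc n) x) x" using assms unfolding schwartz_def D_def by (simp add: vector_derivative_works)
 obtain C0 where C0: "norm (D n x) <= C0" for x
 proof -
  have "bounded (range (%x. x^0 *\<^sub>R D n x))" using assms unfolding schwartz_def D_def by blast
  thus ?thesis using that unfolding bounded_iff by auto
 qed
 have "bounded (range (%x. x^2 *\<^sub>R D n x))" using assms unfolding schwartz_def D_def by blast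
 then obtain C2 where C2: "x^2*norm (D n x) <= C2" for x unfolding bounded_iff by auto
 have "norm (D n x) <= (C0 + C2)/(1 + x^2)" for x
 proof -
  have "0 < 1 + x^2" by (simp add: add_pos_nonneg)
  thus ?thesis using C0[of x] C2[of x] by (simp add: pos_le_divide_eq distrib_left mult.commute)
 qed
 moreover have "0 <= C0 + C2" using order_trans[OF norm_ge_zero C0[of 0]] C2[of 0] by simp
 ultimately show "\<exists>C\<ge>0. \<forall>x. norm (D n x) <= C/(1 + x^2)" by blast
qed

lemma decay_le: "0 <= C ==> C/(1 + x^2) <= C" for C x :: real
 by (simp add: divide_le_eq add_pos_nonneg mult_le_cancel_left1)

lemma integrable_decay:
 fixes f :: "real => 'a::{banach, second_countable_topology}"
 assumes "bm f" "!!x. norm (f x) <= C/(1 + x^2)"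
 shows "integrable lborel f"
 by (rule integrable_le[OF integrable_inverse_1_plus_sq[of C] _ assms(2)]) (use assms in simp)

lemma schwartz_props:
 assumes "schwartz psi"
 shows "continuous_on UNIV psi" "integrable lborel psi" "\<exists>C\<ge>0. \<forall>x. norm (psi x) <= C/(1 + x^2)"
  "\<exists>C\<ge>0. \<forall>x. norm (fourier psi x) <= C/(1 + x^2)" "bm (fourier psi)" "integrable lborel (fourier psi)"
proof -
 define D where "D = (%n. ((%h y. vector_derivative h (at y)) ^^ n) psi)"
 have D0: "D 0 = psi" and D: "!!n x. (D n has_vector_derivative D (Suc n) x) (at x)"
  and bd: "!!n. \<exists>C\<ge>0. \<forall>x. norm (D n x) <= C/(1 + x^2)" using schwartzD[OF assms] unfolding D_def by blast+
 have cont: "continuous_on UNIV (D n)" for n using D by (auto simp: continuous_on_eq_continuous_at intro: has_vector_derivative_continuous)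
 have meas: "bm (D n)" for n by (rule borel_measurable_continuous_onI[OF cont])
 have int: "integrable lborel (D n)" for n using bd[of n] meas[of n] by (auto intro: integrable_decay)
 have lim: "(D n \<longlongrightarrow> 0) at_top" "(D n \<longlongrightarrow> 0) at_bot" for n
 proof -
  obtain C where C: "!!x. norm (D n x) <= C/(1 + x^2)" using bd[of n] by blast
  show "(D n \<longlongrightarrow> 0) at_top" "(D n \<longlongrightarrow> 0) at_bot"
   by (rule Lim_null_comparison[OF _ inverse_1_plus_sq_tendsto(1)[of C]], use C in simp)
    (rule Lim_null_comparison[OF _ inverse_1_plus_sq_tendsto(2)[of C]], use C in simp)
 qed
 show "continuous_on UNIV psi" "integrable lborel psi" "\<exists>C\<ge>0. \<forall>x. norm (psi x) <= C/(1 + x^2)"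
  using cont[of 0] int[of 0] bd[of 0] by (simp_all add: D0)
 have "norm (fourier psi x) <= ((LI xi. norm (D 0 xi)) + (LI xi. norm (D (Suc (Suc 0)) xi)))/(1 + x^2)" for x
  using fourier_decay[OF D[of 0] D[of "Suc 0"] cont int int int lim lim, of x] D0 by simp
 thus dec: "\<exists>C\<ge>0. \<forall>x. norm (fourier psi x) <= C/(1 + x^2)"
  by (intro exI[of _ "(LI xi. norm (D 0 xi)) + (LI xi. norm (D (Suc (Suc 0)) xi))"]) (auto intro!: add_nonneg_nonneg)
 have "bm (fourier psi)"
 proof -
  have [measurable]: "bm psi" using meas[of 0] D0 by simp
  have "bml (%x. LI xi. psi xi*cis (- (x*xi)))" by (rule lborel.borel_measurable_lebesgue_integral) measurable
  thus ?thesis unfolding fourier_cis[abs_def] by simp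
 qed
 thus "bm (fourier psi)" "integrable lborel (fourier psi)" using dec by (auto intro: integrable_decay)
qed

text \<open>One complex parameter covers two families of test functions: imaginary \<open>z\<close>
  gives modulations of the Gaussian, which determine \<open>F\<close> in a Fourier pair, and real
  \<open>z\<close> gives its translates up to a factor, which determine \<open>f\<close>.\<close>

definition gsn :: "complex => real => complex" where "gsn z x = exp (cor (- x\<^sup>2/2) + z*cor x)"

lemma gsn_0: "gsn 0 x = cor (exp (- x\<^sup>2/2))" by (simp only: gsn_def mult_zero_left add_0_right exp_of_real)

lemma gsn_of_real: "gsn (cor c) x = cor (exp (- x\<^sup>2/2 + c*x))" by (simp only: gsn_def exp_of_real[symmetric] of_real_mult of_real_add)

lemma power_le_fact_exp:
 fixes y :: real assumes "0 <= y" shows "y^n <= fact n*exp y"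
proof -
 have "y^n/fact n <= (\<Sum>k<Suc n. y^k/fact k)" using assms by (intro member_le_sum) auto
 also have "... <= exp y" unfolding exp_def using assms summable_exp_generic[of y]
  by (intro order_trans[OF _ sum_le_suminf[of "%k. y^k /\<^sub>R fact k" "{..<Suc n}"]]) (auto simp: divide_inverse mult.commute)
 finally show ?thesis by (simp add: divide_le_eq mult.commute)
qed

lemma gsn_deriv: "vd (gsn z) ((z - of_real x)*gsn z x) x"
proof -
 have "vd ((%x. exp (- ((cor x)^2)/2 + z*cor x))) ((z - of_real x)*exp (- ((cor x)^2)/2 + z*cor x)) x"
  by (rule has_vector_derivative_real_field) (auto intro!: derivative_eq_intros simp: algebra_simps)
 thus ?thesis by (simp add: gsn_def[abs_def])
qed

text \<open>Half of the exponent \<open>- x^2/2\<close> is spent on \<open>Re z * x\<close>, by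
  completing the square; the other half dominates every monomial.\<close>

lemma gsn_poly_bound: "\<exists>C. \<forall>x. norm (poly p (cor x)*gsn z x) <= C"
proof (induction p)
 case 0 thus ?case by auto
next
 case (pCons a p)
 have mono: "\<exists>C. \<forall>x. (abs x)^n*norm (gsn z x) <= C" for n
 proof (intro exI allI)
  fix x :: real
  have "(abs x)^n <= 1 + (x^2)^n"
  proof (cases "(abs x) <= 1")
   case True
   hence "(abs x)^n <= 1" by (intro power_le_one) auto
   thus ?thesis by (simp add: add_increasing2)
  next
   case False
   hence "(abs x)^n <= (abs x)^(2*n)" by (intro power_increasing) auto
   thus ?thesis by (simp add: power_mult)
  qed
  also have "(x^2)^n = 4^n*(x^2/4)^n" by (simp add: power_divide)
  also have "... <= 4^n*(fact n*exp (x^2/4))" by (intro mult_left_mono power_le_fact_exp) auto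
  finally have 1: "(abs x)^n <= 1 + 4^n*fact n*exp (x^2/4)" by simp
  also have "... <= exp (x^2/4) + 4^n*fact n*exp (x^2/4)" by simp
  finally have 1: "(abs x)^n <= (1 + 4^n*fact n)*exp (x^2/4)" by (simp add: distrib_right)
  have "0 <= (Re z - x/2)^2" by simp
  hence "Re z*x <= (Re z)^2 + x^2/4" by (simp add: power2_eq_square algebra_simps)
  hence 2: "norm (gsn z x) <= exp ((Re z)^2 - x\<^sup>2/4)" by (simp add: gsn_def)
  have "(abs x)^n*norm (gsn z x) <= ((1 + 4^n*fact n)*exp (x^2/4))*exp ((Re z)^2 - x\<^sup>2/4)" by (intro mult_mono 1 2) auto
  also have "... = (1 + 4^n*fact n)*exp ((Re z)^2)" by (simp add: mult.assoc flip: exp_add)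
  finally show "(abs x)^n*norm (gsn z x) <= (1 + 4^n*fact n)*exp ((Re z)^2)" .
 qed
 have gen: "\<exists>C. \<forall>x. (abs x)^n*norm (poly q (cor x)*gsn z x) <= C" for q n
 proof (induction q arbitrary: n)
  case 0 thus ?case by auto
 next
  case (pCons a q)
  obtain C1 where C1: "(abs x)^n*norm (gsn z x) <= C1" for x using mono by blast
  obtain C2 where C2: "(abs x)^Suc n*norm (poly q (cor x)*gsn z x) <= C2" for x using pCons.IH by blast
  have "(abs x)^n*norm (poly (pCons a q) (cor x)*gsn z x) <= norm a*C1 + C2" for x
  proof -
   have "norm (poly (pCons a q) (cor x)*gsn z x) <= norm (a*gsn z x) + norm (cor x*poly q (cor x)*gsn z x)" by (simp add: distrib_right norm_triangle_ineq)
   hence "(abs x)^n*norm (poly (pCons a q) (cor x)*gsn z x) <= (abs x)^n*(norm (a*gsn z x) + norm (cor x*poly q (cor x)*gsn z x))" by (intro mult_left_mono) auto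
   also have "... = norm a*((abs x)^n*norm (gsn z x)) + (abs x)^Suc n*norm (poly q (cor x)*gsn z x)" by (simp add: norm_mult algebra_simps)
   also have "... <= norm a*C1 + C2" by (intro add_mono mult_left_mono C1 C2) auto
   finally show ?thesis .
  qed
  thus ?case by blast
 qed
 from gen[of 0 "pCons a p"] show ?case by simp
qed

lemma schwartz_gsn: "schwartz (gsn z)"
proof -
 \<comment> \<open>Hermite type recursion: the derivative of \<open>p * gsn z\<close> is
   \<open>p' + (z - x) * p\<close> times \<open>gsn z\<close>.\<close>
 define P where "P = rec_nat [:1:] (%_ p. pderiv p + [:z, -1:]*p)"
 have D: "((%h y. vector_derivative h (at y)) ^^ n) (gsn z) = (%x. poly (P n) (cor x)*gsn z x)"
  and d: "vd ((%x. poly (P n) (cor x)*gsn z x)) (poly (P (Suc n)) (cor x)*gsn z x) x" for n x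
 proof -
  show d: "vd ((%x. poly (P n) (cor x)*gsn z x)) (poly (P (Suc n)) (cor x)*gsn z x) x" for n x
  proof -
   have "vd ((%x. poly (P n) (cor x))) (poly (pderiv (P n)) (cor x)) x" by (rule has_vector_derivative_real_field) (rule poly_DERIV)
   from has_vector_derivative_mult[OF this gsn_deriv[of z x]]
   show ?thesis by (simp add: P_def algebra_simps)
  qed
  show "((%h y. vector_derivative h (at y)) ^^ n) (gsn z) = (%x. poly (P n) (cor x)*gsn z x)"
  proof (induction n)
   case 0 thus ?case by (simp add: P_def)
  next
   case (Suc n)
   show ?case by (rule ext) (simp only: funpow.simps o_apply Suc.IH vector_derivative_at[OF d])
  qed
 qed
 show ?thesis unfolding schwartz_def D
 proof (intro conjI allI)
  show "(%x. poly (P n) (cor x)*gsn z x) differentiable at x" for n x using d[of n x] by (auto simp: differentiable_def has_vector_derivative_def)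
  fix m n
  obtain C where C: "!!x. norm (poly (monom 1 m*P n) (cor x)*gsn z x) <= C" using gsn_poly_bound by blast
  show "bounded (range (%x. x^m *\<^sub>R (poly (P n) (cor x)*gsn z x)))" unfolding bounded_iff
   using C by (intro exI[of _ C]) (auto simp: poly_monom norm_mult norm_power mult.assoc power_abs)
 qed
qed

lemma schwartz_cmult:
 assumes "schwartz psi" shows "schwartz (%x. c*psi x)"
proof -
 define D where "D = (%n. ((%h y. vector_derivative h (at y)) ^^ n) psi)"
 have D0: "D 0 = psi" and D: "!!n x. (D n has_vector_derivative D (Suc n) x) (at x)" using schwartzD[OF assms] unfolding D_def by blast+
 have d: "vd (%x. c*D n x) (c*D (Suc n) x) x" for n x by (rule has_vector_derivative_mult_right[OF D])
 have E: "((%h y. vector_derivative h (at y)) ^^ n) (%x. c*psi x) = (%x. c*D n x)" for n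
 proof (induction n)
  case 0 thus ?case by (simp add: D0)
 next
  case (Suc n)
  show ?case by (rule ext) (simp only: funpow.simps o_apply Suc.IH vector_derivative_at[OF d])
 qed
 show ?thesis unfolding schwartz_def E
 proof (intro conjI allI)
  show "(%x. c*D n x) differentiable at x" for n x using d[of n x] by (auto simp: differentiable_def has_vector_derivative_def)
  fix m n
  have "bounded (range (%x. x^m *\<^sub>R D n x))" using assms unfolding schwartz_def D_def by blast
  then obtain B where B: "!!x. norm (x^m *\<^sub>R D n x) <= B" unfolding bounded_iff by auto
  have "norm (x^m *\<^sub>R (c*D n x)) <= norm c*B" for x using mult_left_mono[OF B[of x], of "norm c"] by (simp add: norm_mult mult_ac)
  thus "bounded (range (%x. x^m *\<^sub>R (c*D n x)))" unfolding bounded_iff by auto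
 qed
qed

text \<open>Testing with all modulations of one Gaussian shows that the integrable function
  \<open>F * gsn 0 - G * gsn 0\<close> has vanishing transform, and \<open>gsn 0\<close> has no
  zeros.\<close>

lemma fourier_pair_unique:
 assumes F: "fourier_pair f F" and G: "fourier_pair f G"
 shows "AEL xi. F xi = G xi"
proof -
 have g: "gsn (\<i>*cor c) xi = gsn 0 xi*cis (c*xi)" for c xi by (simp only: gsn_def mult_zero_left add_0_right exp_add cis_conv_exp of_real_mult mult.assoc)
 have i: "integrable lborel (%xi. F xi*gsn z xi)" "integrable lborel (%xi. G xi*gsn z xi)"
  and e: "(LI xi. F xi*gsn z xi) = (LI xi. G xi*gsn z xi)" for z using F G schwartz_gsn[of z] unfolding fourier_pair_def by auto
 have "AEL xi. (F xi*gsn 0 xi - G xi*gsn 0 xi) = 0"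
 proof (rule zero_fourier_imp_zero)
  fix c
  have "(LI xi. (F xi*gsn 0 xi - G xi*gsn 0 xi)*cis (c*xi)) = (LI xi. F xi*gsn (\<i>*c) xi - G xi*gsn (\<i>*c) xi)" by (simp add: g left_diff_distrib mult.assoc)
  thus "(LI xi. (F xi*gsn 0 xi - G xi*gsn 0 xi)*cis (c*xi)) = 0" using i e by simp
 qed (use i in auto)
 thus ?thesis by eventually_elim (simp add: gsn_def)
qed

text \<open>Now the transforms of the test functions have to be the modulated Gaussians, so the test
  functions are the translates \<open>exp (- (xi - c)^2/2)\<close>, written as a constant times
  \<open>gsn c\<close>.\<close>

lemma fourier_pair_unique_left:
 assumes F: "fourier_pair f F" and G: "fourier_pair g F"
 shows "AEL x. f x = g x"
proof -
 let ?E = "%c x. gsn 0 x*cis (- c*x)" and ?g = "%c xi. cor (exp (- c\<^sup>2/2))*gsn c xi"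
 have ft: "fourier (?g c) x = sqrt (2*pi)*?E c x" for c x :: real
 proof -
  have "fourier (?g c) x = (LI xi. cor (exp (- (xi - c)\<^sup>2/2))*cis (- (x*xi)))" unfolding fourier_cis
  proof (intro LI_cong refl arg_cong2[where f="(*)"])
   fix xi
   have "cor (exp (- c\<^sup>2/2))*gsn c xi = cor (exp (- c\<^sup>2/2 + (- xi\<^sup>2/2 + c*xi)))" by (simp only: gsn_of_real exp_add of_real_mult)
   also have "- c\<^sup>2/2 + (- xi\<^sup>2/2 + c*xi) = - (xi - c)\<^sup>2/2" by (simp add: power2_eq_square field_simps)
   finally show "cor (exp (- c\<^sup>2/2))*gsn c xi = cor (exp (- (xi - c)\<^sup>2/2))" .
  qed
  also have "... = \<bar>1\<bar> *\<^sub>R (LI xi. cor (exp (- (c + 1*xi - c)\<^sup>2/2))*cis (- (x*(c + 1*xi))))" by (rule lborel_integral_real_affine) simp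
  also have "... = (LI xi. cis (- c*x)*(cor (exp (- (1/2)*xi^2))*cis (- x*xi)))"
  proof -
   have "cis (- (x*(c + 1*xi))) = cis (- c*x)*cis (- x*xi)" for xi by (simp add: cis_mult algebra_simps)
   thus ?thesis by (simp add: mult_ac)
  qed
  also have "... = cis (- c*x)*(cor (sqrt (pi/(1/2))*exp (- x\<^sup>2/(4*(1/2)))))" using gaussian_ft(2)[of "1/2" "- x"] by simp
  also have "... = sqrt (2*pi)*?E c x" by (simp add: gsn_0 mult_ac)
  finally show ?thesis .
 qed
 have sch: "schwartz (?g c)" for c :: real by (intro schwartz_cmult schwartz_gsn)
 have i: "integrable lborel (%x. f x*?E c x)" "integrable lborel (%x. g x*?E c x)"
  and e: "(LI x. f x*?E c x) = (LI x. g x*?E c x)" for c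
 proof -
  have s: "cor (sqrt (2*pi)) ~= 0" by simp
  have canc: "h x*(sqrt (2*pi)*?E c x) = cor (sqrt (2*pi))*(h x*?E c x)" for h :: "real => complex" and x
   by (simp only: mult.left_commute[of "h x"])
  have i1: "integrable lborel (%x. cor (sqrt (2*pi))*(f x*?E c x))" "integrable lborel (%x. cor (sqrt (2*pi))*(g x*?E c x))"
   and e1: "(LI x. cor (sqrt (2*pi))*(f x*?E c x)) = (LI x. cor (sqrt (2*pi))*(g x*?E c x))"
   using F G sch[of c] unfolding fourier_pair_def canc[symmetric] ft[symmetric] by auto
  have cm: "integrable lborel h" if "integrable lborel (%x. cor (sqrt (2*pi))*h x)" for h :: "real => complex"
   using integrable_mult_right[OF that, of "1/cor (sqrt (2*pi))"] s by simp
  show "integrable lborel (%x. f x*?E c x)" "integrable lborel (%x. g x*?E c x)" using i1 by (auto intro: cm)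
  show "(LI x. f x*?E c x) = (LI x. g x*?E c x)"
   using e1 s by (simp only: LI_mult mult_cancel_left simp_thms)
 qed
 have "AEL x. (f x*gsn 0 x - g x*gsn 0 x) = 0"
 proof (rule zero_fourier_imp_zero)
  fix c
  have "(LI x. (f x*gsn 0 x - g x*gsn 0 x)*cis (c*x)) = (LI x. f x*?E (- c) x - g x*?E (- c) x)"
   by (simp add: left_diff_distrib mult.assoc)
  also have "... = 0" using i[of "- c"] e[of "- c"] by simp
  finally show "(LI x. (f x*gsn 0 x - g x*gsn 0 x)*cis (c*x)) = 0" .
 qed (use i[of 0] in auto)
 thus ?thesis by eventually_elim (simp add: gsn_def)
qed

section \<open>Plancherel theory for distributional Fourier pairs\<close>

definition sqn :: "(real => complex) => ennreal" where "sqn f = (NN x. en (f x)^2)"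

text \<open>Completeness is proved with the error bounds \<open>e n\<close> carried along, so that
  the limit is one Borel function at a known distance from every \<open>f n\<close>.\<close>

lemma L2_complete:
 fixes f :: "nat => real => complex"
 assumes fm [measurable]: "!!n. bm (f n)"
  and cau: "!!m n. n <= m ==> sqn (%x. f n x - f m x) <= e n" and e: "e ----> 0"
  and c: "!!n. sqn (f n) <= c"
 obtains H where "bm H" "!!n. sqn (%x. f n x - H x) <= e n" "sqn H <= c"
proof -
 have "\<forall>i. \<exists>N. \<forall>n\<ge>N. e n <= er ((1/8)^i)"
 proof
  fix i :: nat
  have "(0::ennreal) < ennreal ((1/8)^i)" by simp
  from order_tendstoD(2)[OF e this] show "\<exists>N. \<forall>n\<ge>N. e n <= er ((1/8)^i)" unfolding eventually_sequentially by (meson less_imp_le)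
 qed
 from choice[OF this] obtain N where N: "!!i n. N i <= n ==> e n <= er ((1/8)^i)" by blast
 define r where "r i = (\<Sum>j\<le>i. N j) + i" for i
 have rN: "N i <= r i" for i unfolding r_def using member_le_sum[of i "{..i}" N] by simp
 have rmono: "r i <= r (Suc i)" for i by (simp add: r_def)
 have rge: "i <= r i" for i by (simp add: r_def)
 define d where "d i x = f (r i) x - f (r (Suc i)) x" for i x
 have dm [measurable]: "bm (d i)" for i unfolding d_def by measurable
 \<comment> \<open>Along the subsequence the squared increments have integral at most
   \<open>(1/8)^i\<close>, so the weights \<open>2^i\<close> leave a convergent series. Where it is
   finite, \<open>norm (d i x)\<close> is at most a multiple of \<open>(1/sqrt 2)^i\<close>, which
   gives pointwise convergence.\<close>
 let ?s = "%x. \<Sum>i. er (2^i)*en (d i x)^2"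
 have "(NN x. (?s x)) = (\<Sum>i. er (2^i) * sqn (d i))" unfolding sqn_def by (subst nn_integral_suminf) (auto simp: nn_cmult)
 also have "... <= (\<Sum>i. er ((1/4)^i))"
 proof (intro suminf_le)
  fix i
  have "sqn (d i) <= er ((1/8)^i)" unfolding d_def using cau[OF rmono[of i]] N[OF rN[of i]] by (rule order_trans)
  hence "er (2^i) * sqn (d i) <= er (2^i)*er ((1/8)^i)" by (intro mult_left_mono) auto
  also have "... = er ((2*(1/8))^i)" by (simp only: ennreal_mult[symmetric] power_mult_distrib zero_le_power zero_le_numeral zero_le_divide_1_iff)
  finally show "er (2^i) * sqn (d i) <= er ((1/4)^i)" by simp
 qed auto
 also have "... = er (\<Sum>i. (1/4)^i)" by (rule suminf_ennreal2) (auto intro: summable_geometric)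
 also have "... < top" by simp
 finally have "AEL x. (?s x) ~= top" using nn_integral_PInf_AE[of "%x. (?s x)" lborel] by simp
 hence conv: "AEL x. convergent (%i. f (r i) x)"
 proof (rule AE_mp, intro AE_I2 impI)
  fix x assume "(?s x) ~= top"
  then obtain K where K: "(?s x) = er K" "0 <= K" by (cases "?s x") auto
  have db: "norm (d i x) <= sqrt K*(1/sqrt 2)^i" for i
  proof -
   have "er (2^i)*en (d i x)^2 <= (?s x)" using sum_le_suminf[of "%i. er (2^i)*en (d i x)^2" "{i}"] by simp
   hence "2^i*(norm (d i x))^2 <= K" using K by (simp add: ennreal_power ennreal_mult[symmetric])
   hence "sqrt (2^i*(norm (d i x))^2) <= sqrt K" by (rule real_sqrt_le_mono)
   hence "sqrt 2^i*norm (d i x) <= sqrt K" by (simp add: real_sqrt_mult real_sqrt_power)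
   hence "norm (d i x) <= sqrt K/sqrt 2^i" by (simp add: pos_le_divide_eq mult.commute)
   thus ?thesis by (simp add: power_one_over divide_inverse power_inverse)
  qed
  have gs: "summable (%i. sqrt K*(1/sqrt 2)^i)" by (intro summable_mult summable_geometric) simp
  have "summable (%i. norm (d i x))" by (rule summable_comparison_test'[OF gs, of 0]) (simp only: real_norm_def abs_norm_cancel db)
  hence "summable (%i. d i x)" by (rule summable_norm_cancel)
  hence "convergent (%n. \<Sum>i<n. d i x)" by (simp add: summable_iff_convergent)
  moreover have "(\<Sum>i<n. d i x) = f (r 0) x - f (r n) x" for n by (induction n) (auto simp: d_def)
  ultimately obtain L where L: "(%n. f (r 0) x - f (r n) x) ----> L" by (auto simp: convergent_def)
  have "(%n. f (r 0) x - (f (r 0) x - f (r n) x)) ----> f (r 0) x - L" by (intro tendsto_diff tendsto_const L)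
  thus "convergent (%i. f (r i) x)" by (simp only: diff_diff_eq2 add_diff_cancel_left' convergentI)
 qed
 define H where "H x = lim (%i. f (r i) x)" for x
 have Hm [measurable]: "bm H" unfolding H_def by measurable
 have lim: "AEL x. (%i. f (r i) x) ----> H x" using conv by eventually_elim (simp add: H_def convergent_LIMSEQ_iff)
 have Fatou: "sqn (%x. g x - H x) <= b" if [measurable]: "bm g" and b: "!!i. n <= i ==> sqn (%x. g x - f (r i) x) <= b" for g b and n :: nat
 proof -
  have "sqn (%x. g x - H x) = (NN x. liminf (%i. en (g x - f (r i) x)^2))" unfolding sqn_def
  proof (intro nn_integral_cong_AE, use lim in eventually_elim)
   case (elim x)
   have "(%i. er ((norm (g x - f (r i) x))^2)) ----> er ((norm (g x - H x))^2)" by (intro tendsto_intros elim)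
   from lim_imp_Liminf[OF _ this] show ?case by (simp add: ennreal_power)
  qed
  also have "... <= liminf (%i. sqn (%x. g x - f (r i) x))" unfolding sqn_def by (rule nn_integral_liminf) measurable
  also have "... <= b" by (rule Liminf_le) (use b in "auto simp: eventually_sequentially")
  finally show ?thesis .
 qed
 have "sqn (%x. 0 - H x) <= c" by (rule Fatou[where n=0]) (use c in "auto simp: sqn_def")
 moreover have "sqn (%x. f n x - H x) <= e n" for n by (rule Fatou[where n=n], measurable, rule cau, erule order_trans, rule rge)
 ultimately show ?thesis by (intro that[of H]) (auto simp: sqn_def)
qed

lemma integrable_mult_L2:
 fixes f g :: "real => complex"
 assumes [measurable]: "bm f" "bm g" and "sqn f < top" "sqn g < top"
 shows "integrable lborel (%x. f x*g x)"
  and "en (LI x. f x*g x)^2 <= sqn f * sqn g"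
proof -
 have cs: "(NN x. en (f x*g x))^2 <= sqn f * sqn g" unfolding sqn_def norm_mult ennreal_mult[OF norm_ge_zero norm_ge_zero]
  by (rule Cauchy_Schwarz_nn_integral) measurable
 also have "... < top" using assms by (simp add: ennreal_mult_less_top)
 finally have "(NN x. en (f x*g x)) < top" by (cases "(NN x. en (f x*g x))") (auto simp: top_power_ennreal)
 thus "integrable lborel (%x. f x*g x)" by (simp add: integrable_iff_bounded)
 show "en (LI x. f x*g x)^2 <= sqn f * sqn g" by (rule order_trans[OF power_mono[OF norm_integral_le_nn] cs]) simp
qed

text \<open>Truncations of \<open>G\<close> have absolutely convergent transforms, which are Cauchy
  in \<open>L^2\<close> by \<open>Bessel_phase\<close> with the identity as phase. The pairing with
  \<open>phi\<close> passes to the limit on both sides; this pairing is what identifies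
  \<open>H\<close> as a distributional transform later.\<close>

lemma L2_transform:
 fixes G :: "real => complex"
 assumes Gm [measurable]: "bm G" and G2: "sqn G < top"
 obtains H where "bm H" "sqn H <= er (2*pi) * sqn G" "!!phi. integrable lborel phi ==> sqn phi < top ==> integrable lborel (%xi. G xi*(LI x. phi x*cis (x*xi))) ==>
   integrable lborel (%x. H x*phi x) & (LI x. H x*phi x) = (LI xi. G xi*(LI x. phi x*cis (x*xi)))"
proof -
 define Gn where "Gn n xi = G xi*ind {- real n..real n} xi" for n xi
 have Gnm [measurable]: "bm (Gn n)" for n unfolding Gn_def by measurable
 have Gn2: "sqn (Gn n) <= sqn G" for n unfolding sqn_def Gn_def by (intro nn_mono power_mono ennreal_leI) (auto simp: indicator_def)
 have Gni: "integrable lborel (Gn n)" for n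
 proof -
  have "sqn (%xi. cor (ind {- real n..real n} xi)) = (NN xi. ind {- real n..real n} xi)" unfolding sqn_def by (intro nn_cong) (auto simp: indicator_def)
  also have "... < top" by (simp add: less_top[symmetric])
  finally have "integrable lborel (%xi. G xi*cor (ind {- real n..real n} xi))" using G2 by (intro integrable_mult_L2) auto
  moreover have "cor (ind A xi) = ind A xi" for A and xi :: real by (simp add: indicator_def)
  ultimately show ?thesis unfolding Gn_def by (simp only:)
 qed
 define Hn where "Hn n x = (LI xi. Gn n xi*cis (x*xi))" for n x
 have Hnm [measurable]: "bm (Hn n)" for n unfolding Hn_def by measurable
 have Bes: "sqn (%x. LI xi. h xi*cis (x*xi)) <= er (2*pi) * sqn h" if "integrable lborel h" for h using Bessel_phase[OF that, of "%x. x" 1] by (simp add: sqn_def)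
 define e where "e n = er (2*pi)*(NN xi. en (G xi)^2*ind (- {- real n..real n}) xi)" for n
 have cau: "sqn (%x. Hn n x - Hn m x) <= e n" if "n <= m" for m n
 proof -
  have "sqn (%x. Hn n x - Hn m x) = sqn (%x. LI xi. (Gn n xi - Gn m xi)*cis (x*xi))" unfolding Hn_def left_diff_distrib
   by (subst Bochner_Integration.integral_diff) (auto intro!: integrable_mult_cis Gni)
  also have "... <= er (2*pi) * sqn (%xi. Gn n xi - Gn m xi)" using Gni by (intro Bes Bochner_Integration.integrable_diff)
  also have "... <= e n" unfolding e_def sqn_def using that by (intro mult_left_mono nn_mono) (auto simp: Gn_def indicator_def)
  finally show ?thesis .
 qed
 have e0: "e ----> 0"
 proof -
  have "(%n. (NN xi. en (G xi)^2*ind (- {- real n..real n}) xi)) ----> (\<integral>\<^sup>+xi. 0 \<partial>(lborel :: real measure))"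
  proof (rule nn_integral_dominated_convergence[where w="%xi. en (G xi)^2"])
   show "AEL xi. (%n. en (G xi)^2*ind (- {- real n..real n}) xi) ----> 0"
   proof (rule AE_I2, rule tendsto_eventually)
    fix xi :: real
    obtain N where "(abs xi) <= real N" using real_arch_simple by blast
    thus "eventually (%n. en (G xi)^2*ind (- {- real n..real n}) xi = 0) sequentially"
     unfolding eventually_sequentially by (intro exI[of _ N]) (auto simp: indicator_def abs_le_iff)
   qed
  qed (use G2 in "auto simp: sqn_def indicator_def")
  hence "e ----> er (2*pi)*(\<integral>\<^sup>+xi. 0 \<partial>(lborel :: real measure))" unfolding e_def by (intro tendsto_mult_ennreal tendsto_const) auto
  thus ?thesis by simp
 qed
 have c: "sqn (Hn n) <= er (2*pi) * sqn G" for n unfolding Hn_def by (rule order_trans[OF Bes[OF Gni[of n]] mult_left_mono[OF Gn2]]) simp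
 obtain H where Hm [measurable]: "bm H" and He: "!!n. sqn (%x. Hn n x - H x) <= e n" and H2: "sqn H <= er (2*pi) * sqn G"
  using L2_complete[of Hn e, OF Hnm cau e0 c] by blast
 have "sqn H < top" using H2 G2 by (auto intro: order_le_less_trans simp: ennreal_mult_less_top)
 show ?thesis
 proof (rule that[OF Hm H2])
  fix phi assume phi: "integrable lborel phi" and phi2: "sqn phi < top"
   and i: "integrable lborel (%xi. G xi*(LI x. phi x*cis (x*xi)))"
  let ?p = "%xi. LI x. phi x*cis (x*xi)"
  have phim [measurable]: "bm phi" using phi by (auto dest: bmi)
  have iH: "integrable lborel (%x. H x*phi x)" using \<open>sqn H < top\<close> phi2 by (intro integrable_mult_L2) auto
  have Hn2: "sqn (Hn n) < top" for n using c[of n] G2 by (auto intro: order_le_less_trans simp: ennreal_mult_less_top)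
  have iHn: "integrable lborel (%x. Hn n x*phi x)" for n using Hn2[of n] phi2 by (intro integrable_mult_L2) auto
  have l1: "(%n. LI x. Hn n x*phi x) ----> (LI x. H x*phi x)"
  proof -
   let ?d = "%n. norm ((LI x. Hn n x*phi x) - (LI x. H x*phi x))"
   have ef: "e n < top" for n
   proof -
    have "e n <= er (2*pi) * sqn G" unfolding e_def sqn_def by (intro mult_left_mono nn_mono) (auto simp: indicator_def)
    thus ?thesis using G2 by (auto intro: order_le_less_trans simp: ennreal_mult_less_top)
   qed
   have b: "er ((?d n)^2) <= e n * sqn phi" for n
   proof -
    have e1: "(LI x. Hn n x*phi x) - (LI x. H x*phi x) = (LI x. (Hn n x - H x)*phi x)" using iH iHn[of n] by (simp add: left_diff_distrib)
    have "en (LI x. (Hn n x - H x)*phi x)^2 <= sqn (%x. Hn n x - H x) * sqn phi"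
     using order_le_less_trans[OF He ef] phi2 by (intro integrable_mult_L2(2)) auto
    also have "... <= e n * sqn phi" by (intro mult_right_mono He) simp
    finally show ?thesis unfolding e1 by (simp add: ennreal_power)
   qed
   have "(%n. e n * sqn phi) ----> 0 * sqn phi" using e0 phi2 by (intro tendsto_mult_ennreal tendsto_const) auto
   hence t: "(%n. e n * sqn phi) ----> 0" by simp
   have "(%n. er ((?d n)^2)) ----> er 0" unfolding ennreal_0 by (rule tendsto_sandwich[OF _ _ tendsto_const t]) (auto intro!: always_eventually b)
   from tendsto_enn2real[OF this] have "(%n. (?d n)^2) ----> 0" by (simp only: enn2real_ennreal zero_le_power2 order.refl ennreal_less_top)
   from tendsto_real_sqrt[OF this] have "?d ----> 0" by (simp only: real_sqrt_abs abs_norm_cancel real_sqrt_zero)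
   thus ?thesis by (subst LIM_zero_iff[symmetric]) (simp only: tendsto_norm_zero_iff)
  qed
  have "(LI x. Hn n x*phi x) = (LI xi. Gn n xi*?p xi)" for n
  proof -
   have "(LI x. Hn n x*phi x) = (LI x. phi x*(LI xi. Gn n xi*cis (x*xi)))" by (simp add: Hn_def mult.commute)
   also have "... = (LI xi. Gn n xi*?p xi)" by (rule kernel_Fubini[where C=1]) (use phi Gni in auto)
   finally show ?thesis .
  qed
  moreover have "(%n. LI xi. Gn n xi*?p xi) ----> (LI xi. G xi*?p xi)"
  proof (rule integral_dominated_convergence[where w="%xi. norm (G xi*?p xi)"])
   have Fm [measurable]: "bm ?p" using cis_transform_measurable[of phi "%x. x"] by (simp add: mult.commute)
   show "bml (%xi. G xi*?p xi)" "!!n. (%xi. Gn n xi*?p xi) : borel_measurable lborel" by measurable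
   show "AEL xi. (%n. Gn n xi*?p xi) ----> G xi*?p xi"
   proof (rule AE_I2, rule tendsto_eventually)
    fix xi :: real
    obtain N where "(abs xi) <= real N" using real_arch_simple by blast
    thus "eventually (%n. Gn n xi*?p xi = G xi*?p xi) sequentially"
     unfolding eventually_sequentially by (intro exI[of _ N]) (auto simp: Gn_def indicator_def abs_le_iff)
   qed
   show "AEL xi. norm (Gn n xi*?p xi) <= norm (G xi*?p xi)" for n by (intro AE_I2) (auto simp: Gn_def indicator_def norm_mult)
  qed (use i in "rule integrable_norm")
  ultimately have "(LI x. H x*phi x) = (LI xi. G xi*?p xi)" using LIMSEQ_unique[OF l1] by simp
  with iH show "integrable lborel (%x. H x*phi x) & (LI x. H x*phi x) = (LI xi. G xi*?p xi)" by blast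
 qed
qed

lemma sqn_decay:
 assumes "!!x. norm (f x) <= C/(1 + x^2)" "0 <= C"
 shows "sqn f < top"
proof -
 have "sqn f <= (NN x. er (C*C/(1 + x^2)))" unfolding sqn_def
 proof (rule nn_mono)
  fix x :: real
  have p: "1 <= 1 + x^2" by simp
  have "norm (f x) <= C/1" by (rule order_trans[OF assms(1) divide_left_mono]) (use assms(2) in "auto intro: add_pos_nonneg")
  hence "(norm (f x))^2 <= C*(C/(1 + x^2))" unfolding power2_eq_square[of "norm (f x)"] using assms by (intro mult_mono) auto
  thus "en (f x)^2 <= er (C*C/(1 + x^2))" by (simp add: ennreal_power ennreal_leI)
 qed
 also have "... = er (LI x. C*C/(1 + x^2))" by (intro nn_integral_eq_integral integrable_inverse_1_plus_sq AE_I2) (simp add: add_nonneg_nonneg)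
 also have "... < top" by simp
 finally show ?thesis .
qed

lemma schwartz_sqn: "schwartz psi ==> sqn psi < top" "schwartz psi ==> sqn (fourier psi) < top" using schwartz_props(3,4)[of psi] sqn_decay by blast+

lemma schwartz_measurable: "schwartz psi ==> psi : borel_measurable borel" by (intro borel_measurable_continuous_onI schwartz_props)

lemma schwartz_inversion:
 fixes psi :: "real => complex"
 assumes "schwartz psi"
 shows "(LI x. fourier psi x*cis (x*a)) = 2*pi*psi a"
proof -
 obtain C where C: "0 <= C" "!!x. norm (psi x) <= C/(1 + x^2)" using schwartz_props(3)[OF assms] by blast
 have "norm (psi x) <= C" for x using order_trans[OF C(2)[of x] divide_left_mono[of 1 "1 + x^2" C]] C(1) by (simp add: add_pos_nonneg)
 thus ?thesis using schwartz_props[OF assms] by (intro fourier_inversion_at) (auto simp: continuous_on_eq_continuous_at)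
qed

lemma fourier_gsn_0: "fourier (gsn 0) x = sqrt (2*pi)*gsn 0 x" using gaussian_ft(2)[of "1/2" "- x"] by (simp add: fourier_cis gsn_0)

text \<open>The definition of a Fourier pair asks for integrability of products only. Multiplied by
  a Gaussian without zeros both functions are measurable, and the Gaussian can be divided
  out.\<close>

lemma fp_measurable:
 assumes "fourier_pair f F"
 shows "bm f" "bm F"
proof -
 have [measurable]: "bm (gsn 0)" by (intro schwartz_measurable schwartz_gsn)
 have i: "integrable lborel (%x. f x*(sqrt (2*pi)*gsn 0 x))" "integrable lborel (%x. F x*gsn 0 x)"
  using assms schwartz_gsn[of 0] unfolding fourier_pair_def fourier_gsn_0[symmetric] by auto
 have [measurable]: "bm (%x. f x*(sqrt (2*pi)*gsn 0 x))" "bm (%x. F x*gsn 0 x)" using i[THEN bmi] by simp_all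
 have "bm (%x. f x*(sqrt (2*pi)*gsn 0 x)/(sqrt (2*pi)*gsn 0 x))" "bm (%x. F x*gsn 0 x/gsn 0 x)" by measurable
 thus "bm f" "bm F" by (simp_all add: gsn_def)
qed

text \<open>\<open>L2_transform\<close> gives the inverse transform up to the factor
  \<open>2*pi\<close>: tested against \<open>fourier psi\<close> it produces \<open>psi\<close> by
  Fourier inversion of Schwartz functions.\<close>

lemma L2_fourier_pair_exists:
 assumes Gm [measurable]: "bm G" and G2: "sqn G < top"
 obtains g where "fourier_pair g G" "sqn g <= sqn G"
proof -
 obtain H where Hm [measurable]: "bm H" and H2: "sqn H <= er (2*pi) * sqn G"
  and H: "!!phi. integrable lborel phi ==> sqn phi < top ==> integrable lborel (%xi. G xi*(LI x. phi x*cis (x*xi))) ==>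
   integrable lborel (%x. H x*phi x) & (LI x. H x*phi x) = (LI xi. G xi*(LI x. phi x*cis (x*xi)))" using L2_transform[OF Gm G2] by blast
 have pi0: "cor (2*pi) ~= 0" by simp
 have "fourier_pair (%x. (1/cor (2*pi))*H x) G" unfolding fourier_pair_def
 proof (intro allI impI)
  fix psi assume s: "schwartz psi"
  have i: "integrable lborel (%xi. G xi*psi xi)" using G2 schwartz_sqn(1)[OF s] schwartz_measurable[OF s] by (intro integrable_mult_L2) auto
  have l: "G xi*(LI x. fourier psi x*cis (x*xi)) = cor (2*pi)*(G xi*psi xi)" for xi unfolding schwartz_inversion[OF s] by (simp only: mult.left_commute[of "G xi"])
  have "integrable lborel (%xi. G xi*(LI x. fourier psi x*cis (x*xi)))" unfolding l using i by (rule integrable_mult_right)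
  from H[OF schwartz_props(6)[OF s] schwartz_sqn(2)[OF s] this]
  have "integrable lborel (%x. H x*fourier psi x)" and e: "(LI x. H x*fourier psi x) = cor (2*pi)*(LI xi. G xi*psi xi)" unfolding l by simp_all
  hence "integrable lborel (%x. (1/cor (2*pi))*(H x*fourier psi x))" by (intro integrable_mult_right)
  moreover have "(LI x. (1/cor (2*pi))*(H x*fourier psi x)) = (LI xi. G xi*psi xi)" unfolding LI_mult e using pi0 by simp
  ultimately show "integrable lborel (%x. (1/cor (2*pi))*H x*fourier psi x) & integrable lborel (%xi. G xi*psi xi) &
    (LI x. (1/cor (2*pi))*H x*fourier psi x) = (LI xi. G xi*psi xi)" using i by (simp only: mult.assoc simp_thms)
 qed
 moreover have "sqn (%x. (1/cor (2*pi))*H x) <= sqn G"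
 proof -
  have "sqn (%x. (1/cor (2*pi))*H x) = er ((1/(2*pi))^2) * sqn H" unfolding sqn_def by (subst nn_cmult[symmetric])
    (auto simp: norm_mult norm_divide power_divide ennreal_power intro!: nn_cong simp flip: ennreal_mult)
  also have "... <= er ((1/(2*pi))^2)*(er (2*pi) * sqn G)" by (intro mult_left_mono H2) simp
  also have "... = er (1/(2*pi)) * sqn G" by (simp add: mult.assoc[symmetric] power2_eq_square flip: ennreal_mult)
  also have "... <= 1 * sqn G" using pi_gt3 by (intro mult_right_mono) (auto simp: field_simps)
  finally show ?thesis by simp
 qed
 ultimately show ?thesis by (rule that)
qed

text \<open>The exponent in \<open>L2_transform\<close> has the opposite sign, so the transform of
  \<open>g\<close> is built from the reflection of \<open>g\<close>. By uniqueness it is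
  \<open>G\<close>, which inherits the \<open>L^2\<close> bound.\<close>

lemma fourier_pair_L2:
 assumes p: "fourier_pair g G" and g2: "sqn g < top"
 shows "sqn G <= er (2*pi) * sqn g"
proof -
 have gm [measurable]: "bm g" using fp_measurable[OF p] by simp
 have r2: "sqn (%x. g (- x)) = sqn g" unfolding sqn_def using nn_integral_real_affine[of "%x. en (g x)^2" "- 1" 0] by simp
 obtain H where Hm [measurable]: "bm H" and H2: "sqn H <= er (2*pi) * sqn (%x. g (- x))"
  and H: "!!phi. integrable lborel phi ==> sqn phi < top ==> integrable lborel (%xi. g (- xi)*(LI x. phi x*cis (x*xi))) ==>
   integrable lborel (%x. H x*phi x) & (LI x. H x*phi x) = (LI xi. g (- xi)*(LI x. phi x*cis (x*xi)))" using L2_transform[of "%x. g (- x)"] g2 r2 by auto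
 have "fourier_pair g H" unfolding fourier_pair_def
 proof (intro allI impI)
  fix psi assume s: "schwartz psi"
  have i: "integrable lborel (%x. g x*fourier psi x)" using p s unfolding fourier_pair_def by blast
  have l: "(LI x. psi x*cis (x*xi)) = fourier psi (- xi)" for xi unfolding fourier_cis by (simp add: mult.commute)
  have "integrable lborel (%xi. g (0 + (- 1)*xi)*fourier psi (0 + (- 1)*xi))" by (rule lborel_integrable_real_affine[OF i]) simp
  hence "integrable lborel (%xi. g (- xi)*(LI x. psi x*cis (x*xi)))" unfolding l by simp
  from H[OF schwartz_props(2)[OF s] schwartz_sqn(1)[OF s] this]
  have "integrable lborel (%x. H x*psi x)" "(LI x. H x*psi x) = (LI xi. g (- xi)*fourier psi (- xi))" unfolding l by simp_all
  moreover have "(LI xi. g (- xi)*fourier psi (- xi)) = (LI xi. g xi*fourier psi xi)" using lborel_integral_real_affine[of "- 1" "%xi. g xi*fourier psi xi" 0] by simp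
  ultimately show "integrable lborel (%x. g x*fourier psi x) & integrable lborel (%xi. H xi*psi xi) & (LI x. g x*fourier psi x) = (LI xi. H xi*psi xi)" using i by simp
 qed
 hence "AEL xi. G xi = H xi" by (rule fourier_pair_unique[OF p])
 hence "sqn G = sqn H" unfolding sqn_def by (intro nn_integral_cong_AE) (auto elim: eventually_mono)
 thus ?thesis using H2 r2 by simp
qed

text \<open>Builds the function with transform \<open>m * F\<close> from pieces whose symbols
  \<open>b i\<close> add up to \<open>m\<close>. Tested against a Schwartz function, the partial
  sums are dominated on the \<open>x\<close> side by the weighted absolute convergence
  \<open>sum\<close> and on the frequency side by \<open>dom\<close>, and the two limits of one
  sequence agree.\<close>

lemma fourier_pair_series:
 fixes b :: "nat => real => complex"
 assumes Fm [measurable]: "bm F" and bm [measurable]: "!!i. bm (b i)"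
  and bF: "!!i. integrable lborel (%xi. F xi*b i xi)"
  and U: "!!i y. U i y = (1/cor (2*pi))*(LI xi. (F xi*b i xi)*cis (y*xi))"
  and sum: "(NN y. (\<Sum>i. en (U i y))*er (1/(1 + y^2))) < top"
  and lim: "AEL xi. (%n. \<Sum>i<n. b i xi) ----> m xi" and mm [measurable]: "bm m"
  and dom: "!!n xi. norm (\<Sum>i<n. b i xi) <= C*norm (m xi)"
  and mF: "!!psi. schwartz psi ==> integrable lborel (%xi. m xi*F xi*psi xi)"
 shows "fourier_pair (%y. \<Sum>i. U i y) (%xi. m xi*F xi)" unfolding fourier_pair_def
proof (intro allI impI conjI)
 fix psi assume s: "schwartz psi"
 show "integrable lborel (%xi. m xi*F xi*psi xi)" using mF[OF s] .
 have [measurable]: "bm psi" "bm (fourier psi)" using schwartz_measurable[OF s] schwartz_props(5)[OF s] by auto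
 have Um [measurable]: "bm (U i)" for i unfolding U[abs_def] by measurable
 obtain K where K: "0 <= K" "!!x. norm (fourier psi x) <= K/(1 + x^2)" using schwartz_props(4)[OF s] by blast
 let ?W = "%y. (\<Sum>i. en (U i y))*er (1/(1 + y^2))"
 have aeW: "AEL y. ?W y ~= top" unfolding infinity_ennreal_def[symmetric]
 proof (rule nn_integral_PInf_AE)
  show "(NN y. ?W y) ~= \<infinity>" using less_imp_neq[OF sum] unfolding infinity_ennreal_def .
 qed measurable
 have summ: "AEL y. summable (%i. norm (U i y))" using aeW
 proof eventually_elim
  case (elim y)
  have "0 < 1 + y^2" by (simp add: add_pos_nonneg)
  hence "er (1/(1 + y^2)) ~= 0" by simp
  with elim have "(\<Sum>i. en (U i y)) ~= top" by (auto simp: ennreal_top_mult)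
  thus ?case by (intro summable_suminf_not_top) auto
 qed
 have nm [measurable]: "bm (%y. \<Sum>i. norm (U i y))" by measurable
 have iS: "integrable lborel (%y. (\<Sum>i. norm (U i y))*(K/(1 + y^2)))"
 proof (rule integrableI_bounded)
  have "(NN y. en ((\<Sum>i. norm (U i y))*(K/(1 + y^2)))) <= (NN y. er K*?W y)"
  proof (intro nn_integral_mono_AE, use summ in eventually_elim)
   case (elim y)
   have "en ((\<Sum>i. norm (U i y))*(K/(1 + y^2))) = er K*(er (\<Sum>i. norm (U i y))*er (1/(1 + y^2)))"
    using K(1) suminf_nonneg[OF elim] by (simp add: abs_mult add_nonneg_nonneg mult_ac flip: ennreal_mult)
   also have "er (\<Sum>i. norm (U i y)) = (\<Sum>i. en (U i y))" by (rule suminf_ennreal2[symmetric]) (use elim in auto)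
   finally show ?case by simp
  qed
  also have "... = er K*(NN y. ?W y)" by (rule nn_cmult) measurable
  also have "... < top" by (simp only: ennreal_mult_less_top sum ennreal_less_top simp_thms)
  finally show "(NN y. en ((\<Sum>i. norm (U i y))*(K/(1 + y^2)))) < \<infinity>" by (simp only: infinity_ennreal_def)
 qed measurable
 define w where "w n y = (\<Sum>i<n. U i y)" for n y
 have [measurable]: "bm (w n)" for n unfolding w_def by measurable
 have Sm [measurable]: "bm (%y. \<Sum>i. U i y)" by measurable
 have wb: "AEL y. norm (w n y*fourier psi y) <= (\<Sum>i. norm (U i y))*(K/(1 + y^2))" for n using summ
 proof eventually_elim
  case (elim y)
  have "norm (w n y) <= (\<Sum>i<n. norm (U i y))" unfolding w_def by (rule norm_sum)
  also have "... <= (\<Sum>i. norm (U i y))" using elim by (intro sum_le_suminf) auto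
  finally show ?case unfolding norm_mult using K(2)[of y] by (intro mult_mono) (auto intro: order_trans[OF norm_ge_zero])
 qed
 have wl: "AEL y. (%n. w n y*fourier psi y) ----> (\<Sum>i. U i y)*fourier psi y" using summ
 proof eventually_elim
  case (elim y)
  thus ?case unfolding w_def by (intro tendsto_mult tendsto_const summable_LIMSEQ[OF summable_norm_cancel[OF elim]])
 qed
 show "integrable lborel (%y. (\<Sum>i. U i y)*fourier psi y)" by (rule integrable_dominated_convergence[OF _ _ iS wl wb]) measurable
 have L: "(%n. LI y. w n y*fourier psi y) ----> (LI y. (\<Sum>i. U i y)*fourier psi y)" by (rule integral_dominated_convergence[OF _ _ iS wl wb]) measurable
 have iU: "integrable lborel (%y. U i y*fourier psi y)"
  and eU: "(LI y. U i y*fourier psi y) = (LI xi. b i xi*F xi*psi xi)"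
  and iE: "integrable lborel (%xi. b i xi*F xi*psi xi)" for i
 proof -
  have Ub: "norm (U i y) <= (1/(2*pi))*(LI xi. norm (F xi*b i xi))" for y
   unfolding U using norm_integral_cis_le[OF bF[of i], of "%xi. y*xi"] by (simp add: norm_mult norm_divide divide_right_mono)
  show "integrable lborel (%y. U i y*fourier psi y)"
   by (rule integrable_le[OF integrable_mult_right[OF integrable_norm[OF schwartz_props(6)[OF s]], of "(1/(2*pi))*(LI xi. norm (F xi*b i xi))"]])
    (measurable, unfold norm_mult[of "U i _"], rule mult_right_mono[OF Ub], simp)
  have "(LI y. U i y*fourier psi y) = (LI y. (1/cor (2*pi))*(fourier psi y*(LI xi. (F xi*b i xi)*cis (y*xi))))" unfolding U by (simp only: mult_ac)
  also have "... = (1/cor (2*pi))*(LI y. fourier psi y*(LI xi. (F xi*b i xi)*cis (y*xi)))" by (rule LI_mult)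
  also have "(LI y. fourier psi y*(LI xi. (F xi*b i xi)*cis (y*xi))) = (LI xi. (F xi*b i xi)*(LI y. fourier psi y*cis (y*xi)))"
   by (rule kernel_Fubini[where C=1]) (use schwartz_props(6)[OF s] bF in auto)
  also have "... = (LI xi. cor (2*pi)*(b i xi*F xi*psi xi))" unfolding schwartz_inversion[OF s] by (simp only: mult_ac of_real_mult)
  also have "(1/cor (2*pi))*... = (LI xi. b i xi*F xi*psi xi)" unfolding LI_mult by simp
  finally show "(LI y. U i y*fourier psi y) = (LI xi. b i xi*F xi*psi xi)" .
  obtain B where B: "0 <= B" "!!x. norm (psi x) <= B/(1 + x^2)" using schwartz_props(3)[OF s] by blast
  show "integrable lborel (%xi. b i xi*F xi*psi xi)"
  proof (rule integrable_le[OF integrable_mult_right[OF integrable_norm[OF bF[of i]], of B]])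
   fix xi
   have "norm (psi xi) <= B" using order_trans[OF B(2)[of xi] divide_left_mono[of 1 "1 + xi^2" B]] B(1) by (simp add: add_pos_nonneg)
   thus "norm (b i xi*F xi*psi xi) <= B*norm (F xi*b i xi)"
    unfolding norm_mult using mult_left_mono[of "norm (psi xi)" B "norm (F xi)*norm (b i xi)"] by (simp add: mult_ac)
  qed measurable
 qed
 have eq: "(LI y. w n y*fourier psi y) = (LI xi. (\<Sum>i<n. b i xi)*(F xi*psi xi))" for n
 proof -
  have "(LI y. w n y*fourier psi y) = (\<Sum>i<n. LI y. U i y*fourier psi y)" unfolding w_def sum_distrib_right by (rule Bochner_Integration.integral_sum) (rule iU)
  also have "... = (LI xi. (\<Sum>i<n. b i xi*F xi*psi xi))" unfolding eU by (rule Bochner_Integration.integral_sum[symmetric]) (rule iE)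
  finally show ?thesis by (simp only: sum_distrib_right mult.assoc)
 qed
 have "(%n. LI xi. (\<Sum>i<n. b i xi)*(F xi*psi xi)) ----> (LI xi. m xi*(F xi*psi xi))"
 proof (rule integral_dominated_convergence[where w="%xi. C*norm (m xi*F xi*psi xi)"])
  show "integrable lborel (%xi. C*norm (m xi*F xi*psi xi))" by (intro integrable_mult_right integrable_norm mF s)
  show "AEL xi. (%n. (\<Sum>i<n. b i xi)*(F xi*psi xi)) ----> m xi*(F xi*psi xi)" using lim by eventually_elim (intro tendsto_mult tendsto_const)
  show "AEL xi. norm ((\<Sum>i<n. b i xi)*(F xi*psi xi)) <= C*norm (m xi*F xi*psi xi)" for n
  proof (rule AE_I2)
   fix xi
   show "norm ((\<Sum>i<n. b i xi)*(F xi*psi xi)) <= C*norm (m xi*F xi*psi xi)"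
    unfolding norm_mult[of "sum _ _"] mult.assoc[of "m xi"] norm_mult[of "m xi"] mult.assoc[of C, symmetric] by (rule mult_right_mono[OF dom]) simp
  qed
 qed measurable
 hence "(%n. LI y. w n y*fourier psi y) ----> (LI xi. m xi*(F xi*psi xi))" unfolding eq .
 from LIMSEQ_unique[OF L this]
 show "(LI y. (\<Sum>i. U i y)*fourier psi y) = (LI xi. m xi*F xi*psi xi)" by (simp only: mult.assoc)
qed

text \<open>The derivative is quantified existentially and not written with
  \<open>vector_derivative\<close>; closure under products, inverses and exponentials is then a
  plain induction on \<open>n\<close>. Derivatives are two-sided, so \<open>S\<close> is meant to be
  open.\<close>

primrec Csm :: "nat => real set => (real => complex) => bool" where "Csm 0 S f \<longleftrightarrow> continuous_on S f"
| "Csm (Suc n) S f \<longleftrightarrow> (\<exists>f'. (\<forall>x\<in>S. (f has_vector_derivative f' x) (at x)) & Csm n S f')"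

section \<open>Bump functions and oscillatory integrals\<close>

definition smooth_on :: "real set => (real => complex) => bool" where "smooth_on S f \<longleftrightarrow> (\<forall>n. Csm n S f)"

lemma Csm_cong: "open S ==> (!!x. x : S ==> f x = g x) ==> Csm n S f ==> Csm n S g"
proof (cases n)
 case 0
 assume "open S" "!!x. x : S ==> f x = g x" "Csm n S f"
 thus ?thesis using 0 continuous_on_cong[of S S f g] by simp
next
 case (Suc m)
 assume S: "open S" and e: "!!x. x : S ==> f x = g x" and "Csm n S f"
 then obtain f' where f': "\<forall>x\<in>S. (f has_vector_derivative f' x) (at x)" "Csm m S f'" using Suc by auto
 have "\<forall>x\<in>S. (g has_vector_derivative f' x) (at x)" using f'(1) S e by (metis has_vector_derivative_transform_within_open)
 thus ?thesis using Suc f'(2) by auto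
qed

lemma Csm_SucI: "(!!x. x : S ==> (f has_vector_derivative f' x) (at x)) ==> Csm n S f' ==> Csm (Suc n) S f" by auto

lemma Csm_Suc_le: "Csm (Suc n) S f ==> Csm n S f"
proof (induction n arbitrary: f)
 case 0
 then obtain f' where "\<forall>x\<in>S. (f has_vector_derivative f' x) (at x)" by auto
 thus ?case by (auto intro!: continuous_at_imp_continuous_on dest: bspec has_vector_derivative_continuous)
next
 case (Suc n)
 thus ?case by (metis Csm.simps(2))
qed

lemma Csm_const: "Csm n S (%x. c)" by (induction n arbitrary: c) (auto intro!: exI[of _ "%x. 0"])

lemma Csm_add: "Csm n S f ==> Csm n S g ==> Csm n S (%x. f x + g x)"
proof (induction n arbitrary: f g)
 case 0 thus ?case by (auto intro: continuous_on_add)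
next
 case (Suc n)
 then obtain f' g' where f: "\<forall>x\<in>S. (f has_vector_derivative f' x) (at x)" "Csm n S f'"
  and g: "\<forall>x\<in>S. (g has_vector_derivative g' x) (at x)" "Csm n S g'" by auto
 thus ?case using Suc.IH[OF f(2) g(2)] by (auto intro!: exI[of _ "%x. f' x + g' x"] has_vector_derivative_add)
qed

lemma Csm_mult: "Csm n S f ==> Csm n S g ==> Csm n S (%x. f x*g x)"
proof (induction n arbitrary: f g)
 case 0 thus ?case by (auto intro: continuous_on_mult)
next
 case (Suc n)
 obtain f' g' where f: "\<forall>x\<in>S. (f has_vector_derivative f' x) (at x)" "Csm n S f'"
  and g: "\<forall>x\<in>S. (g has_vector_derivative g' x) (at x)" "Csm n S g'" using Suc.prems by auto
 have "Csm n S (%x. f x*g' x + f' x*g x)" by (intro Csm_add Suc.IH f g Csm_Suc_le[OF Suc.prems(1)] Csm_Suc_le[OF Suc.prems(2)])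
 thus ?case by (rule Csm_SucI[rotated]) (rule has_vector_derivative_mult[OF bspec[OF f(1)] bspec[OF g(1)]])
qed

lemma Csm_exp: "Csm n S f ==> Csm n S (%x. exp (f x))"
proof (induction n arbitrary: f)
 case 0 thus ?case by (auto intro: continuous_on_exp)
next
 case (Suc n)
 obtain f' where f: "\<forall>x\<in>S. (f has_vector_derivative f' x) (at x)" "Csm n S f'" using Suc.prems by auto
 have "Csm n S (%x. f' x*exp (f x))" by (intro Csm_mult f Suc.IH Csm_Suc_le[OF Suc.prems])
 moreover have "vd ((%x. exp (f x))) (f' x*exp (f x)) x" if "x : S" for x
  using field_vector_diff_chain_at[OF bspec[OF f(1) that] DERIV_exp[of "f x"]] unfolding o_def .
 ultimately show ?case by (intro Csm_SucI)
qed

lemma Csm_inverse: "(!!x. x : S ==> f x ~= 0) ==> Csm n S f ==> Csm n S (%x. inverse (f x))"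
proof (induction n arbitrary: f)
 case 0 thus ?case by (auto intro: continuous_on_inverse)
next
 case (Suc n)
 obtain f' where f: "\<forall>x\<in>S. (f has_vector_derivative f' x) (at x)" "Csm n S f'" using Suc.prems by auto
 have "Csm n S (%x. f' x*((-1)*(inverse (f x)*inverse (f x))))" by (intro Csm_mult f Suc.IH Csm_Suc_le[OF Suc.prems(2)] Csm_const) (use Suc.prems(1) in auto)
 moreover have "vd ((%x. inverse (f x))) (f' x*((-1)*(inverse (f x)*inverse (f x)))) x" if "x : S" for x
 proof -
  have "- (inverse (f x)^Suc (Suc 0)) = (-1)*(inverse (f x)*inverse (f x))" by simp
  thus ?thesis using field_vector_diff_chain_at[OF bspec[OF f(1) that] DERIV_inverse[OF Suc.prems(1)[OF that]]] unfolding o_def by (simp only:)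
 qed
 ultimately show ?case by (intro Csm_SucI)
qed

lemma Csm_subset: "Csm n S f ==> S' \<subseteq> S ==> Csm n S' f" by (induction n arbitrary: f) (auto intro: continuous_on_subset)

lemma Csm_union:
 assumes "open S" "open S'" "Csm n S f" "Csm n S' f"
 shows "Csm n (S \<union> S') f" using assms(3,4)
proof (induction n arbitrary: f)
 case 0 thus ?case using assms(1,2) by (auto intro: continuous_on_open_Un)
next
 case (Suc n)
 let ?d = "%x. vector_derivative f (at x)"
 obtain f' g' where f: "\<forall>x\<in>S. (f has_vector_derivative f' x) (at x)" "Csm n S f'"
  and g: "\<forall>x\<in>S'. (f has_vector_derivative g' x) (at x)" "Csm n S' g'" using Suc.prems by auto
 have "Csm n S ?d" by (rule Csm_cong[OF assms(1) _ f(2)]) (use f(1) in "auto simp: vector_derivative_at")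
 moreover have "Csm n S' ?d" by (rule Csm_cong[OF assms(2) _ g(2)]) (use g(1) in "auto simp: vector_derivative_at")
 ultimately have "Csm n (S \<union> S') ?d" by (rule Suc.IH)
 moreover have "\<forall>x\<in>S \<union> S'. (f has_vector_derivative ?d x) (at x)" using f(1) g(1) by (auto simp: vector_derivative_at)
 ultimately show ?case by auto
qed

lemma Csm_id: "Csm n S cor" by (cases n) (auto intro!: exI[of _ "%x. 1"] continuous_intros Csm_const has_vector_derivative_of_real derivative_eq_intros)

lemma Csm_scale: "Csm n UNIV f ==> Csm n UNIV (%x. f (c*x))"
proof (induction n arbitrary: f)
 case 0 thus ?case by (auto intro: continuous_on_compose2[of UNIV f] continuous_intros)
next
 case (Suc n)
 obtain f' where f: "!!x. (f has_vector_derivative f' x) (at x)" "Csm n UNIV f'" using Suc.prems by auto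
 have "Csm n UNIV (%x. cor c*f' (c*x))" by (intro Csm_mult Csm_const Suc.IH f)
 moreover have "vd ((%x. f (c*x))) (cor c*f' (c*x)) x" for x
 proof -
  have "vd (%x. c*x) c x" by (auto intro!: derivative_eq_intros)
  from vector_diff_chain_at[OF this f(1)] show ?thesis by (simp add: o_def scaleR_conv_of_real)
 qed
 ultimately show ?case by (intro Csm_SucI)
qed

lemma smooth_deriv:
 assumes "open S" "smooth_on S f"
 shows "smooth_on S (%x. vector_derivative f (at x))" "!!x. x : S ==> f differentiable (at x)"
proof -
 show "smooth_on S (%x. vector_derivative f (at x))" unfolding smooth_on_def
 proof
  fix n
  obtain f' where f: "\<forall>x\<in>S. (f has_vector_derivative f' x) (at x)" "Csm n S f'" using assms(2) unfolding smooth_on_def by (meson Csm.simps(2))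
  thus "Csm n S (%x. vector_derivative f (at x))" by (intro Csm_cong[OF assms(1) _ f(2)]) (auto simp: vector_derivative_at)
 qed
 fix x assume "x : S"
 have "Csm (Suc 0) S f" using assms(2) unfolding smooth_on_def by blast
 thus "f differentiable (at x)" using \<open>x \<in> S\<close> by (auto simp: differentiable_def has_vector_derivative_def)
qed

lemma smooth_supp_schwartz:
 assumes "smooth_on UNIV f" "!!x. R < (abs x) ==> f x = 0"
 shows "schwartz f"
proof -
 define D where "D n = ((%h y. vector_derivative h (at y)) ^^ n) f" for n
 have sm: "smooth_on UNIV (D n) & (\<forall>x. R < (abs x) --> D n x = 0)" for n
 proof (induction n)
  case 0 thus ?case using assms by (simp add: D_def)
 next
  case (Suc n)
  have "vector_derivative (D n) (at x) = 0" if x: "R < (abs x)" for x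
  proof -
   have o: "open {x::real. R < (abs x)}" by (intro open_Collect_less continuous_intros)
   have "vd (D n) 0 x" by (rule has_vector_derivative_transform_within_open[OF has_vector_derivative_const[of 0] o]) (use x Suc in auto)
   thus ?thesis by (rule vector_derivative_at)
  qed
  thus ?case using smooth_deriv(1)[of UNIV "D n"] Suc by (simp add: D_def)
 qed
 show ?thesis unfolding schwartz_def D_def[symmetric]
 proof (intro conjI allI)
  show "D n differentiable at x" for n x using smooth_deriv(2)[of UNIV "D n"] sm by auto
  fix m n
  have c: "continuous_on UNIV (D n)" using sm[of n] Csm.simps(1) unfolding smooth_on_def by blast
  have "compact ((%x. x^m *\<^sub>R D n x) ` {-R..R})" by (intro compact_continuous_image continuous_intros continuous_on_subset[OF c]) auto
  hence "bounded ((%x. x^m *\<^sub>R D n x) ` {-R..R})" by (rule compact_imp_bounded)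
  hence "bounded (insert 0 ((%x. x^m *\<^sub>R D n x) ` {-R..R}))" by simp
  moreover have "range (%x. x^m *\<^sub>R D n x) \<subseteq> insert 0 ((%x. x^m *\<^sub>R D n x) ` {-R..R})"
  proof clarify
   fix x assume "x^m *\<^sub>R D n x ~: (%x. x^m *\<^sub>R D n x) ` {- R..R}"
   hence "x ~: {-R..R}" by blast
   hence "R < (abs x)" by auto
   thus "x^m *\<^sub>R D n x = 0" using sm[of n] by simp
  qed
  ultimately show "bounded (range (%x. x^m *\<^sub>R D n x))" by (rule bounded_subset)
 qed
qed

text \<open>With the powers of \<open>1/x\<close> included the family is closed under
  differentiation up to linear combinations, so smoothness at 0 reduces to one difference
  quotient.\<close>

definition bmp :: "nat => real => real" where "bmp m x = (if 0 < x then (1/x)^m*exp (- (1/x)) else 0)"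

lemma bmp_bound: "0 <= bmp m x" "bmp m x <= fact (Suc m)*(abs x)"
proof -
 show "0 <= bmp m x" by (simp add: bmp_def)
 show "bmp m x <= fact (Suc m)*(abs x)"
 proof (cases "0 < x")
  case True
  have "(1/x)^Suc m <= fact (Suc m)*exp (1/x)" using True by (intro power_le_fact_exp) simp
  hence "(1/x)^Suc m*exp (- (1/x)) <= fact (Suc m)*exp (1/x)*exp (- (1/x))" by (rule mult_right_mono) simp
  also have "... = fact (Suc m)" by (simp add: mult.assoc flip: exp_add)
  finally have "(1/x)*bmp m x <= fact (Suc m)" using True by (simp add: bmp_def mult.assoc)
  thus ?thesis using True by (simp add: pos_divide_le_eq)
 qed (simp add: bmp_def mult_le_0_iff del: fact_Suc)
qed

lemma bmp_deriv: "(bmp m has_real_derivative bmp (m + 2) x - real m*bmp (m + 1) x) (at x)"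
proof -
 consider "x > 0" | "x < 0" | "x = 0" by linarith
 thus ?thesis
 proof cases
  case 1
  have "((%x. (1/x)^m*exp (- (1/x))) has_real_derivative (real m*(1/x)^(m - 1)*(- ((1/x)^2)))*exp (- (1/x)) + (1/x)^m*(exp (- (1/x))*(1/x)^2)) (at x)"
   using 1 by (auto intro!: derivative_eq_intros simp: power2_eq_square)
  moreover have "(real m*(1/x)^(m - 1)*(- ((1/x)^2)))*exp (- (1/x)) + (1/x)^m*(exp (- (1/x))*(1/x)^2) = bmp (m + 2) x - real m*bmp (m + 1) x"
   using 1 by (cases m) (simp_all only: bmp_def if_True diff_Suc_1 add_2_eq_Suc' Suc_eq_plus1[symmetric] power_Suc power2_eq_square mult_ac, simp_all)
  ultimately have "((%x. (1/x)^m*exp (- (1/x))) has_real_derivative bmp (m + 2) x - real m*bmp (m + 1) x) (at x)" by simp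
  thus ?thesis by (rule DERIV_cong_ev[THEN iffD1, rotated -1]) (use 1 in \<open>auto simp: bmp_def eventually_nhds intro!: exI[of _ "{0<..}"]\<close>)
 next
  case 2
  have "((%x. 0) has_real_derivative bmp (m + 2) x - real m*bmp (m + 1) x) (at x)" using 2 by (simp add: bmp_def)
  thus ?thesis by (rule DERIV_cong_ev[THEN iffD1, rotated -1]) (use 2 in \<open>auto simp: bmp_def eventually_nhds intro!: exI[of _ "{..<0}"]\<close>)
 next
  case 3
  \<comment> \<open>The difference quotient at 0 is \<open>bmp (m + 1)\<close> itself, which is
    again bounded by a multiple of \<open>abs y\<close>.\<close>
  have q: "\<bar>bmp m y/y\<bar> <= fact (Suc (Suc m))*(abs y)" for y using bmp_bound[of "Suc m" y] by (cases "0 < y") (auto simp: bmp_def mult_ac)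
  have "((%y. bmp m y/y) \<longlongrightarrow> 0) (at 0)"
  proof (rule Lim_null_comparison)
   show "eventually (%y. norm (bmp m y/y) <= fact (Suc (Suc m))*(abs y)) (at 0)" using q by simp
   have "((%y::real. fact (Suc (Suc m))*(abs y)) \<longlongrightarrow> fact (Suc (Suc m))*\<bar>0\<bar>) (at 0)" by (intro tendsto_intros)
   thus "((%y::real. fact (Suc (Suc m))*(abs y)) \<longlongrightarrow> 0) (at 0)" by simp
  qed
  thus ?thesis using 3 by (simp add: has_field_derivative_iff bmp_def)
 qed
qed

lemma Csm_bmp:
 assumes "!!x. (p has_real_derivative p' x) (at x)" "!!n. Csm n UNIV (%x. cor (p' x))"
 shows "Csm n UNIV (%x. cor (bmp m (p x)))"
proof (induction n arbitrary: m)
 case 0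
 have "continuous_on UNIV (bmp m)" using bmp_deriv DERIV_continuous by (blast intro: continuous_at_imp_continuous_on)
 moreover have "continuous_on UNIV p" using assms(1) DERIV_continuous by (blast intro: continuous_at_imp_continuous_on)
 ultimately have "continuous_on UNIV (%x. bmp m (p x))" by (auto intro: continuous_on_compose2)
 thus ?case by (auto intro: continuous_on_of_real)
next
 case (Suc n)
 let ?g = "%x. (cor (bmp (m + 2) (p x)) + (- of_nat m)*cor (bmp (m + 1) (p x)))*cor (p' x)"
 have "Csm n UNIV ?g" by (intro Csm_mult Csm_add Csm_const Suc.IH assms)
 moreover have "vd ((%x. cor (bmp m (p x)))) (?g x) x" for x
 proof -
  have "((%x. bmp m (p x)) has_real_derivative (bmp (m + 2) (p x) - real m*bmp (m + 1) (p x))*p' x) (at x)" by (rule DERIV_chain2[OF bmp_deriv assms(1)])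
  from has_vector_derivative_of_real[OF this]
  show ?thesis by simp
 qed
 ultimately show ?case by (intro Csm_SucI)
qed

text \<open>\<open>4 - x^2\<close> and \<open>x^2 - 1\<close> are never both nonpositive, so the
  denominator has no zeros. The transition takes place between 1 and 2, that is within one dyadic
  scale.\<close>

definition cutoff :: "real => real" where "cutoff x = bmp 0 (4 - x\<^sup>2)/(bmp 0 (4 - x\<^sup>2) + bmp 0 (x^2 - 1))"

lemma cutoff_pos: "0 < bmp 0 (4 - x\<^sup>2) + bmp 0 (x^2 - 1)" by (cases "x^2 < 4") (auto simp: bmp_def add_pos_nonneg)

lemma cutoff_bounds: "0 <= cutoff x" "cutoff x <= 1" using cutoff_pos[of x] bmp_bound(1)[of 0] by (auto simp: cutoff_def divide_le_eq)

lemma cutoff_eq_1: "(abs x) <= 1 ==> cutoff x = 1" using cutoff_pos[of x] abs_square_le_1[of x] by (simp add: cutoff_def bmp_def)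

lemma cutoff_eq_0: "2 <= (abs x) ==> cutoff x = 0" using abs_le_square_iff[of 2 x] by (simp add: cutoff_def bmp_def)

lemma smooth_cutoff: "smooth_on UNIV (%x. cor (cutoff x))" unfolding smooth_on_def
proof
 fix n
 have a: "Csm n UNIV (%x. cor (bmp 0 (4 - x\<^sup>2)))" for n
 proof (rule Csm_bmp)
  show "((%x. 4 - x\<^sup>2) has_real_derivative (- 2)*x) (at x)" for x :: real by (auto intro!: derivative_eq_intros)
  show "Csm n UNIV (%x. cor ((- 2)*x))" for n using Csm_mult[OF Csm_const[of n UNIV "- 2"] Csm_id] by simp
 qed
 have b: "Csm n UNIV (%x. cor (bmp 0 (x^2 - 1)))" for n
 proof (rule Csm_bmp)
  show "((%x. x\<^sup>2 - 1) has_real_derivative 2*x) (at x)" for x :: real by (auto intro!: derivative_eq_intros)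
  show "Csm n UNIV (%x. cor (2*x))" for n using Csm_mult[OF Csm_const[of n UNIV "2"] Csm_id] by simp
 qed
 have nz: "cor (bmp 0 (4 - x\<^sup>2)) + cor (bmp 0 (x^2 - 1)) ~= 0" for x using cutoff_pos[of x] unfolding of_real_add[symmetric] of_real_eq_0_iff by linarith
 show "Csm n UNIV (%x. cor (cutoff x))" using Csm_mult[OF a Csm_inverse[OF nz Csm_add[OF a b]]] by (simp add: cutoff_def divide_inverse)
qed

definition abspow :: "real => real => complex" where "abspow sg xi = of_real ((abs xi) powr sg)"

lemma smooth_abspow: "smooth_on (- {0}) (abspow sg)" unfolding smooth_on_def
proof
 fix n
 have inv: "Csm n (- {0}) (%x. inverse (cor x))" for n by (intro Csm_inverse Csm_id) auto
 have l: "Csm n (- {0}) (%x. cor (ln (abs x)))" for n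
 proof (cases n)
  case 0 thus ?thesis by (auto intro!: continuous_intros)
 next
  case (Suc m)
  have lnd: "((%x. ln (abs x)) has_real_derivative inverse x) (at x)" if "x ~= 0" for x :: real
  proof (cases "x > 0")
   case True
   have "(ln has_real_derivative inverse x) (at x)" using True by (auto intro!: derivative_eq_intros simp: divide_inverse)
   thus ?thesis by (rule DERIV_cong_ev[THEN iffD1, rotated -1]) (use True in \<open>auto simp: eventually_nhds intro!: exI[of _ "{0<..}"]\<close>)
  next
   case False
   have "((%x. ln (- x)) has_real_derivative inverse x) (at x)" using False that by (auto intro!: derivative_eq_intros simp: divide_inverse)
   thus ?thesis by (rule DERIV_cong_ev[THEN iffD1, rotated -1]) (use False that in \<open>auto simp: eventually_nhds intro!: exI[of _ "{..<0}"]\<close>)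
  qed
  have "vd ((%x. cor (ln (abs x)))) (inverse (cor x)) x" if "x ~= 0" for x
  proof -
   have "vd ((%x. cor (ln (abs x)))) (cor (inverse x)) x" by (rule has_vector_derivative_of_real) (rule lnd[OF that])
   thus ?thesis by simp
  qed
  thus ?thesis unfolding Suc by (intro Csm_SucI[OF _ inv]) auto
 qed
 have "Csm n (- {0}) (%x. exp (cor sg*cor (ln (abs x))))" by (intro Csm_exp Csm_mult Csm_const l)
 thus "Csm n (- {0}) (abspow sg)" by (rule Csm_cong[rotated -1]) (auto simp: abspow_def powr_def exp_of_real[symmetric])
qed

lemma smooth_mult: "smooth_on S f ==> smooth_on S g ==> smooth_on S (%x. f x*g x)" by (simp add: smooth_on_def Csm_mult)

lemma smooth_cis: "smooth_on S (%x. cis (c*x))" unfolding smooth_on_def cis_conv_exp of_real_mult by (auto intro!: Csm_exp Csm_mult Csm_const Csm_id)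

text \<open>Near 0, where \<open>f\<close> may be singular like a power of \<open>abs x\<close>, the
  product vanishes identically; the two open sets are glued by \<open>Csm_union\<close>.\<close>

lemma smooth_away_mult:
 assumes "smooth_on (- {0}) f" "smooth_on UNIV g" "0 < delta" "!!x. (abs x) < delta ==> g x = 0"
 shows "smooth_on UNIV (%x. f x*g x)" unfolding smooth_on_def
proof
 fix n
 have "Csm n {- delta<..<delta} (%x. f x*g x)" by (rule Csm_cong[OF _ _ Csm_const[of n _ 0]]) (use assms in auto)
 moreover have "Csm n (- {0}) (%x. f x*g x)" using assms by (auto simp: smooth_on_def intro!: Csm_mult intro: Csm_subset)
 ultimately have "Csm n ({- delta<..<delta} \<union> - {0}) (%x. f x*g x)" by (intro Csm_union) auto
 moreover have "{- delta<..<delta} \<union> - {0} = (UNIV :: real set)" using assms(3) by auto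
 ultimately show "Csm n UNIV (%x. f x*g x)" by simp
qed

section \<open>Van der Corput estimates and the dispersive kernel\<close>

lemma van_der_Corput_1:
 fixes phi phi1 phi2 :: "real => real"
 assumes ab: "a <= b"
  and d1: "!!x. x : {a..b} ==> (phi has_real_derivative phi1 x) (at x within {a..b})"
  and d2: "!!x. x : {a..b} ==> (phi1 has_real_derivative phi2 x) (at x within {a..b})"
  and c2: "continuous_on {a..b} phi2" and pos: "!!x. x : {a..b} ==> 0 <= phi2 x"
  and m: "0 < m" and lb: "!!x. x : {a..b} ==> m <= \<bar>phi1 x\<bar>"
 shows "norm (integral {a..b} (%x. cis (phi x))) <= 4/m"
proof -
 have nz: "phi1 x ~= 0" if "x : {a..b}" for x using lb[OF that] m by auto
 have c0: "continuous_on {a..b} phi" "continuous_on {a..b} phi1" by (rule DERIV_continuous_on, erule d1, rule DERIV_continuous_on, erule d2)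
 \<comment> \<open>\<open>?F\<close> is the boundary term of one integration by parts. The error
   \<open>?G\<close> has modulus \<open>phi2/phi1^2\<close>, the derivative of
   \<open>- inverse phi1\<close>, so its integral is again bounded by boundary values. In total
   \<open>1/m + 1/m + 2/m\<close>.\<close>
 let ?F = "%x. cis (phi x)*(- \<i>*cor (inverse (phi1 x)))"
 let ?G = "%x. cis (phi x)*(\<i>*cor (phi2 x/(phi1 x)^2))"
 have dF: "(?F has_vector_derivative cis (phi x) + ?G x) (at x within {a..b})" if x: "x : {a..b}" for x
 proof -
  have e: "((%x. cis (phi x)) has_vector_derivative phi1 x *\<^sub>R (\<i>*cis (phi x))) (at x within {a..b})"
  proof -
   have "(cis has_vector_derivative \<i>*cis y) (at y within S)" for y S unfolding has_vector_derivative_def using has_derivative_cis[of "%x. x" "%x. x" y S]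
    by (auto intro!: derivative_eq_intros simp: o_def)
   thus ?thesis using vector_diff_chain_within[of phi "phi1 x" x "{a..b}" cis "\<i>*cis (phi x)"] d1[OF x]
    by (simp add: has_real_derivative_iff_has_vector_derivative o_def)
  qed
  have i: "((%x. inverse (phi1 x)) has_real_derivative - (phi2 x/(phi1 x)^2)) (at x within {a..b})"
   using DERIV_inverse_fun[OF d2[OF x] nz[OF x]] by (simp add: power2_eq_square divide_inverse mult_ac)
  have "((%x. - \<i>*cor (inverse (phi1 x))) has_vector_derivative - \<i>*cor (- (phi2 x/(phi1 x)^2))) (at x within {a..b})"
   by (intro has_vector_derivative_mult_right has_vector_derivative_of_real i)
  note D = has_vector_derivative_mult[OF e this]
  have "(c*(\<i>*e))*(- \<i>*d) = (c*d)*e" for c d e :: complex by (simp add: complex_eq_iff algebra_simps)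
  hence "(phi1 x *\<^sub>R (\<i>*cis (phi x)))*(- \<i>*cor (inverse (phi1 x))) = cor (phi1 x*inverse (phi1 x))*cis (phi x)" unfolding scaleR_conv_of_real of_real_mult .
  also have "... = cis (phi x)" using nz[OF x] by simp
  finally have E: "(phi1 x *\<^sub>R (\<i>*cis (phi x)))*(- \<i>*cor (inverse (phi1 x))) = cis (phi x)" .
  show ?thesis by (rule has_vector_derivative_eq_rhs[OF D], subst E) (simp add: add.commute)
 qed
 have FTC: "((%x. cis (phi x) + ?G x) has_integral ?F b - ?F a) {a..b}" by (rule fundamental_theorem_of_calculus[OF ab dF])
 have cG: "continuous_on {a..b} ?G" by (intro continuous_intros c0 c2 continuous_on_cis) (auto simp: nz)
 have iG: "?G integrable_on {a..b}" by (rule integrable_continuous_interval[OF cG])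
 have ic: "(%x. cis (phi x)) integrable_on {a..b}" by (intro integrable_continuous_interval continuous_on_cis c0)
 have "integral {a..b} (%x. cis (phi x)) = (?F b - ?F a) - integral {a..b} ?G" using integral_unique[OF FTC] Henstock_Kurzweil_Integration.integral_add[OF ic iG] by simp
 hence "norm (integral {a..b} (%x. cis (phi x))) <= norm (?F b) + norm (?F a) + norm (integral {a..b} ?G)"
  using norm_triangle_ineq4[of "?F b - ?F a" "integral {a..b} ?G"] norm_triangle_ineq4[of "?F b" "?F a"] by simp
 moreover have nF: "norm (?F x) <= 1/m" if "x : {a..b}" for x
 proof -
  have "norm (?F x) = 1/\<bar>phi1 x\<bar>" by (simp add: norm_mult norm_inverse norm_divide inverse_eq_divide)
  thus ?thesis using lb[OF that] m by (simp add: frac_le)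
 qed
 moreover have "norm (integral {a..b} ?G) <= 2/m"
 proof -
  have g: "((%x. phi2 x/(phi1 x)^2) has_integral - inverse (phi1 b) - - inverse (phi1 a)) {a..b}"
  proof (rule fundamental_theorem_of_calculus[OF ab])
   fix x assume x: "x : {a..b}"
   have "((%x. - inverse (phi1 x)) has_real_derivative (phi2 x/(phi1 x)^2)) (at x within {a..b})"
    using DERIV_minus[OF DERIV_inverse_fun[OF d2[OF x] nz[OF x]]] by (simp add: power2_eq_square divide_inverse mult_ac)
   thus "((%x. - inverse (phi1 x)) has_vector_derivative (phi2 x/(phi1 x)^2)) (at x within {a..b})" by (simp add: has_real_derivative_iff_has_vector_derivative)
  qed
  have "norm (integral {a..b} ?G) <= integral {a..b} (%x. phi2 x/(phi1 x)^2)"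
   using g pos by (intro integral_norm_bound_integral iG) (auto simp: norm_mult norm_divide norm_power)
  also have "... = - inverse (phi1 b) + inverse (phi1 a)" using integral_unique[OF g] by simp
  also have "... <= norm (?F b) + norm (?F a)" by (simp add: norm_mult norm_inverse norm_divide flip: abs_inverse)
  finally show ?thesis using nF[of a] nF[of b] ab by simp
 qed
 moreover have "1/m + 1/m + 2/m = 4/m" by simp
 ultimately show ?thesis using nF[of a] nF[of b] ab by (smt (verit) atLeastAtMost_iff)
qed

text \<open>Since \<open>phi1\<close> grows at rate at least \<open>m\<close>, there is a point
  \<open>c\<close>, its zero or an endpoint, with \<open>m*abs (x - c) <= abs (phi1 x)\<close>.
  Beyond distance \<open>1/sqrt m\<close> from \<open>c\<close> the first derivative estimate
  applies on each side, and the rest has length at most \<open>2/sqrt m\<close>; this is the sum 4 +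
  4 + 2.\<close>

lemma van_der_Corput_2:
 fixes phi phi1 phi2 :: "real => real"
 assumes ab: "a <= b"
  and d1: "!!x. x : {a..b} ==> (phi has_real_derivative phi1 x) (at x within {a..b})"
  and d2: "!!x. x : {a..b} ==> (phi1 has_real_derivative phi2 x) (at x within {a..b})"
  and c2: "continuous_on {a..b} phi2" and m: "0 < m" and lb: "!!x. x : {a..b} ==> m <= phi2 x"
 shows "norm (integral {a..b} (%x. cis (phi x))) <= 10/sqrt m"
proof -
 let ?I = "%a b. integral {a..b} (%x. cis (phi x))"
 have c0: "continuous_on {a..b} phi" "continuous_on {a..b} phi1" by (rule DERIV_continuous_on, erule d1, rule DERIV_continuous_on, erule d2)
 have inc: "m*(y - x) <= phi1 y - phi1 x" if "a <= x" "x <= y" "y <= b" for x y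
 proof (cases "x = y")
  case False
  hence "x < y" using that by simp
  moreover have "(phi1 has_derivative (*) (phi2 z)) (at z within {x..y})" if "x <= z" "z <= y" for z
   by (rule has_derivative_subset[OF d2[unfolded has_field_derivative_def]]) (use \<open>a <= x\<close> \<open>y <= b\<close> that in auto)
  ultimately obtain z where "z : {x<..<y}" "phi1 y - phi1 x = phi2 z*(y - x)" using mvt_simple[of x y phi1 "%z. (*) (phi2 z)"] by auto
  thus ?thesis using lb[of z] that by (simp add: mult_right_mono)
 qed simp
 have "\<exists>c\<in>{a..b}. \<forall>x\<in>{a..b}. m*\<bar>x - c\<bar> <= \<bar>phi1 x\<bar>"
 proof -
  consider "0 <= phi1 a" | "phi1 b <= 0" | "phi1 a <= 0" "0 <= phi1 b" by linarith
  thus ?thesis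
  proof cases
   case 1
   hence "m*\<bar>x - a\<bar> <= \<bar>phi1 x\<bar>" if "x : {a..b}" for x using inc[of a x] that by auto
   thus ?thesis using ab by (intro bexI[of _ a]) auto
  next
   case 2
   have "m*\<bar>x - b\<bar> <= \<bar>phi1 x\<bar>" if "x : {a..b}" for x
   proof -
    have "\<bar>x - b\<bar> = b - x" using that by auto
    thus ?thesis using inc[of x b] that 2 by auto
   qed
   thus ?thesis using ab by (intro bexI[of _ b]) auto
  next
   case 3
   then obtain c where c: "a <= c" "c <= b" "phi1 c = 0" using IVT'[of phi1 a 0 b] ab c0 by auto
   have "m*\<bar>x - c\<bar> <= \<bar>phi1 x\<bar>" if "x : {a..b}" for x
   proof (cases "c <= x")
    case True thus ?thesis using inc[of c x] that c by auto
   next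
    case False
    hence "\<bar>x - c\<bar> = c - x" by simp
    thus ?thesis using inc[of x c] that c False by auto
   qed
   thus ?thesis using c by (intro bexI[of _ c]) auto
  qed
 qed
 then obtain c where c: "c : {a..b}" and lc: "!!x. x : {a..b} ==> m*\<bar>x - c\<bar> <= \<bar>phi1 x\<bar>" by blast
 define d where "d = 1/sqrt m"
 have d: "0 < d" "m*d = sqrt m" using m by (simp_all add: d_def real_div_sqrt)
 define p q where "p = max a (c - d)" and "q = min b (c + d)"
 have pq: "a <= p" "p <= q" "q <= b" using c d by (auto simp: p_def q_def)
 have ic: "(%x. cis (phi x)) integrable_on {a'..b'}" if "{a'..b'} \<subseteq> {a..b}" for a' b'
  by (intro integrable_continuous_interval continuous_on_cis continuous_on_subset[OF c0(1) that])
 have out: "norm (?I a' b') <= 4/sqrt m"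
  if s: "a <= a'" "b' <= b" and far: "!!x. a' < b' ==> x : {a'..b'} ==> d <= \<bar>x - c\<bar>" for a' b'
 proof (cases "a' < b'")
  case True
  have sub: "{a'..b'} \<subseteq> {a..b}" using s by auto
  show ?thesis
  proof (rule van_der_Corput_1)
   show "(phi has_real_derivative phi1 x) (at x within {a'..b'})" if "x : {a'..b'}" for x using d1[of x] that sub by (blast intro: DERIV_subset)
   show "(phi1 has_real_derivative phi2 x) (at x within {a'..b'})" if "x : {a'..b'}" for x using d2[of x] that sub by (blast intro: DERIV_subset)
   show "sqrt m <= \<bar>phi1 x\<bar>" if "x : {a'..b'}" for x
   proof -
    have "m*d <= m*\<bar>x - c\<bar>" using far[OF True that] m by (intro mult_left_mono) auto
    thus ?thesis using lc[of x] that sub d by auto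
   qed
   show "continuous_on {a'..b'} phi2" by (rule continuous_on_subset[OF c2 sub])
   show "0 <= phi2 x" if "x : {a'..b'}" for x using lb[of x] that sub m by (meson less_imp_le order_trans subsetD)
  qed (use True m in auto)
 next
  case False
  hence "?I a' b' = 0" by (cases "a' = b'") auto
  thus ?thesis using m by simp
 qed
 have "?I a b = ?I a p + (?I p q + ?I q b)"
  using pq ic Henstock_Kurzweil_Integration.integral_combine[of a p b "%x. cis (phi x)"]
   Henstock_Kurzweil_Integration.integral_combine[of p q b "%x. cis (phi x)"] by auto
 hence "norm (?I a b) <= norm (?I a p) + (norm (?I p q) + norm (?I q b))"
  by (metis (no_types, lifting) add_left_mono norm_triangle_ineq order_trans)
 also have "norm (?I a p) <= 4/sqrt m" using pq c by (intro out) (auto simp: p_def)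
 also have "norm (?I q b) <= 4/sqrt m" using pq c by (intro out) (auto simp: q_def)
 also have "norm (?I p q) <= 2/sqrt m"
 proof -
  have "norm (?I p q) <= 1*(q - p)" using pq by (intro integral_bound continuous_on_cis continuous_on_subset[OF c0(1)]) auto
  also have "... <= 2*d" by (simp add: p_def q_def)
  finally show ?thesis by (simp add: d_def)
 qed
 finally show ?thesis by simp
qed

text \<open>If the slope of the phase is at least \<open>abs z/2\<close> throughout, the geometric
  mean of the first derivative estimate and of the trivial bound by the length suffices. Otherwise
  the dispersive part of the slope reaches \<open>abs z/2\<close> at one point, and homogeneity
  makes the second derivative at least \<open>abs z/(64*a)\<close> on the whole interval. Neither
  case leaves a dependence on \<open>sg\<close>.\<close>

lemma oscillatory_bound_neg:
 assumes al: "1 <= alpha" "alpha <= 2" and a: "0 < a" and s: "sg <= 0" and z: "z ~= 0"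
 shows "norm (integral {a..4*a} (%xi. cis (z*xi - sg*xi powr (alpha + 1)))) <= 80 * sqrt (a/(abs z))"
proof -
 let ?phi = "%xi. z*xi - sg*xi powr (alpha + 1)"
 let ?phi1 = "%xi. z - sg*((alpha + 1)*xi powr alpha)"
 let ?phi2 = "%xi. - sg*((alpha + 1)*(alpha*xi powr (alpha - 1)))"
 have d1: "(?phi has_real_derivative ?phi1 xi) (at xi within {a..4*a})" if "xi : {a..4*a}" for xi using that a by (auto intro!: derivative_eq_intros)
 have d2: "(?phi1 has_real_derivative ?phi2 xi) (at xi within {a..4*a})" if "xi : {a..4*a}" for xi using that a by (auto intro!: derivative_eq_intros)
 have c2: "continuous_on {a..4*a} ?phi2" using a by (intro continuous_intros) auto
 have pos: "0 <= ?phi2 xi" if "xi : {a..4*a}" for xi using s al by (intro mult_nonneg_nonneg) auto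
 have r: "1/sqrt ((abs z)/a) = sqrt (a/(abs z))" using a z by (simp add: real_sqrt_divide)
 show ?thesis
 proof (cases "\<forall>xi\<in>{a..4*a}. (abs z)/2 <= \<bar>?phi1 xi\<bar>")
  case True
  let ?I = "norm (integral {a..4*a} (%xi. cis (?phi xi)))"
  have 1: "?I <= 4/((abs z)/2)" by (rule van_der_Corput_1[OF _ d1 d2 c2 pos]) (use True a z in auto)
  have 2: "?I <= 1*(4*a - a)" using a by (intro integral_bound continuous_on_cis continuous_intros) auto
  have "?I\<^sup>2 <= (4/((abs z)/2))*(1*(4*a - a))" unfolding power2_eq_square by (intro mult_mono 1 2) (use z in auto)
  also have "... = 24*(a/(abs z))" by simp
  also have "... <= 6400*(a/(abs z))" using a by (intro mult_right_mono) auto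
  also have "... = (80 * sqrt (a/(abs z)))^2" using a by (simp add: power_mult_distrib)
  finally show ?thesis by (rule power2_le_imp_le) (use a in auto)
 next
  case False
  then obtain xi0 where x0: "xi0 : {a..4*a}" and lt: "\<bar>?phi1 xi0\<bar> < (abs z)/2" by (auto simp: not_le)
  have "(abs z)/2 <= - sg*((alpha + 1)*xi0 powr alpha)"
  proof -
   have "0 <= - sg*((alpha + 1)*xi0 powr alpha)" using s al by (intro mult_nonneg_nonneg) auto
   thus ?thesis using lt by linarith
  qed
  also have "... <= - sg*((alpha + 1)*(4*a) powr alpha)" using x0 a s al by (intro mult_left_mono powr_mono2) auto
  finally have z2: "(abs z)/2 <= - sg*((alpha + 1)*(4*a) powr alpha)" .
  have four: "4 powr alpha <= 16" using powr_mono[OF al(2), of 4] by simp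
  have lb: "(abs z)/a/64 <= ?phi2 xi" if "xi : {a..4*a}" for xi
  proof -
   have "(abs z)/a/64 <= ((abs z)/2)/(16*a)" using a by (simp add: field_simps)
   also have "... <= (- sg*((alpha + 1)*(4*a) powr alpha))/(16*a)" using z2 a by (intro divide_right_mono) auto
   also have "... = (- sg*(alpha + 1))*(4 powr alpha/16)*(a powr alpha/a)" using a by (simp add: powr_mult)
   also have "a powr alpha/a = a powr (alpha - 1)" using a by (simp add: powr_diff)
   also have "(- sg*(alpha + 1))*(4 powr alpha/16)*a powr (alpha - 1) <= (- sg*(alpha + 1))*alpha*xi powr (alpha - 1)"
    using four al a s that by (intro mult_mono mult_left_mono powr_mono2 mult_nonneg_nonneg) auto
   finally show ?thesis by (simp add: mult_ac)
  qed
  have "norm (integral {a..4*a} (%xi. cis (?phi xi))) <= 10/sqrt ((abs z)/a/64)" by (rule van_der_Corput_2[OF _ d1 d2 c2 _ lb]) (use a z in auto)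
  also have "sqrt ((abs z)/a/64) = sqrt ((abs z)/a)/8" using real_sqrt_divide[of "(abs z)/a" 64] real_sqrt_unique[of 8 64] by simp
  also have "10/(sqrt ((abs z)/a)/8) = 80*(1/sqrt ((abs z)/a))" by simp
  finally show ?thesis unfolding r .
 qed
qed

text \<open>Complex conjugation reverses the signs of \<open>sg\<close> and \<open>z\<close>, which
  reduces positive \<open>sg\<close> to the previous case.\<close>

lemma oscillatory_bound:
 assumes al: "1 <= alpha" "alpha <= 2" and a: "0 < a" and z: "z ~= 0"
 shows "norm (integral {a..4*a} (%xi. cis (z*xi - sg*xi powr (alpha + 1)))) <= 80 * sqrt (a/(abs z))"
proof (cases "sg <= 0")
 case True thus ?thesis using oscillatory_bound_neg[OF al a _ z] by simp
next
 case False
 let ?J = "%sg z. integral {a..4*a} (%xi. cis (z*xi - sg*xi powr (alpha + 1)))"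
 have c: "continuous_on {a..4*a} (%xi. cis (z*xi - sg*xi powr (alpha + 1)))" using a by (intro continuous_on_cis continuous_intros) auto
 have "cnj (?J sg z) = ?J (- sg) (- z)"
  using integral_cnj[of "{a..4*a}" "%xi. cis (z*xi - sg*xi powr (alpha + 1))"] by (simp add: cis_cnj)
 hence "norm (?J sg z) = norm (?J (- sg) (- z))"
  by (metis complex_mod_cnj)
 thus ?thesis using oscillatory_bound_neg[OF al a, of "- sg" "- z"] False z by simp
qed

definition om :: "real => real => real" where "om alpha xi = (abs xi) powr alpha*xi"

text \<open>The ratio 4 is the width of one Littlewood-Paley symbol: \<open>chi l\<close> below
  vanishes outside \<open>Lam (2 powr l)\<close>.\<close>

definition Lam :: "real => real set" where "Lam a = {xi. a <= (abs xi) & (abs xi) <= 4*a}"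

lemma om_measurable [measurable]: "bm (om alpha)" unfolding om_def by measurable

lemma Lam_measurable [measurable]: "Lam a : sets borel" unfolding Lam_def by measurable

text \<open>\<open>om alpha\<close> is odd and increases with slope at least
  \<open>a powr alpha\<close> away from \<open>{-a<..<a}\<close>; for frequencies of opposite sign
  the two moduli simply add up.\<close>

lemma om_sep:
 assumes a: "0 < a" "a <= (abs xi)" "a <= (abs eta)" and al: "0 <= alpha"
 shows "a powr alpha*\<bar>xi - eta\<bar> <= \<bar>om alpha xi - om alpha eta\<bar>"
proof -
 have pos: "a powr alpha*(x - y) <= x powr alpha*x - y powr alpha*y" if "a <= y" "y <= x" for x y
 proof -
  have "a powr alpha*(x - y) <= x powr alpha*(x - y) + (x powr alpha - y powr alpha)*y"
   using that a al by (intro add_increasing2 mult_nonneg_nonneg mult_right_mono powr_mono2) (auto intro!: powr_mono2)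
  thus ?thesis by (simp add: algebra_simps)
 qed
 have opp: "a powr alpha*(x + y) <= x powr alpha*x + y powr alpha*y" if "a <= y" "a <= x" for x y
  unfolding distrib_left using that a al by (intro add_mono mult_right_mono powr_mono2) auto
 consider "0 < xi" "0 < eta" "eta <= xi" | "0 < xi" "0 < eta" "xi <= eta" | "xi < 0" "eta < 0" "eta <= xi" | "xi < 0" "eta < 0" "xi <= eta"
  | "0 < xi" "eta < 0" | "xi < 0" "0 < eta" using a by linarith
 thus ?thesis
 proof cases
  case 1 thus ?thesis using pos[of eta xi] a by (simp add: om_def)
 next
  case 2 thus ?thesis using pos[of xi eta] a by (simp add: om_def)
 next
  case 3 thus ?thesis using pos[of "- xi" "- eta"] a by (simp add: om_def)
 next
  case 4 thus ?thesis using pos[of "- eta" "- xi"] a by (simp add: om_def)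
 next
  case 5 thus ?thesis using opp[of "- eta" "xi"] a by (simp add: om_def)
 next
  case 6 thus ?thesis using opp[of "eta" "- xi"] a by (simp add: om_def)
 qed
qed

text \<open>Uniformity in the time \<open>sg\<close> is the point: once the time has become an
  arbitrary function of \<open>x\<close>, only the decay in \<open>z\<close> is left to be
  used.\<close>

lemma kernel_bound:
 assumes al: "1 <= alpha" "alpha <= 2" and a: "0 < a" and z: "z ~= 0"
 shows "norm (LI xi. ind (Lam a) xi*cis (z*xi - sg * om alpha xi)) <= 160 * sqrt (a/(abs z))"
proof -
 let ?f = "%xi. cis (z*xi - sg * om alpha xi)"
 have ii: "integrable lborel (%xi. ind {c..d} xi*?f xi)" for c d :: real
 proof (rule integrable_mult_cis)
  have "integrable lborel (%x. cor (ind {c..d} x))" by (intro integrable_of_real integrable_real_indicator) (auto simp: emeasure_lborel_Icc_eq)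
  moreover have "cor (ind {c..d} x) = ind {c..d} x" for x by (simp add: indicator_def)
  ultimately show "integrable lborel (ind {c..d} :: real => complex)" by (simp only:)
 qed measurable
 have pos: "norm (LI xi. ind {a..4*a} xi*cis (w*xi - tau * om alpha xi)) <= 80 * sqrt (a/(abs w))" if "w ~= 0" for w tau
 proof -
  have "(LI xi. ind {a..4*a} xi*cis (w*xi - tau * om alpha xi)) = (LINT xi:{a..4*a}|lborel. cis (w*xi - tau*xi powr (alpha + 1)))" unfolding set_lebesgue_integral_def
   by (intro LI_cong) (use a in "auto simp: indicator_def om_def powr_add")
  also have "... = integral {a..4*a} (%xi. cis (w*xi - tau*xi powr (alpha + 1)))"
   using a by (intro set_borel_integral_eq_integral borel_integrable_atLeastAtMost' continuous_on_cis continuous_intros) auto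
  finally show ?thesis using oscillatory_bound[OF al a that] by simp
 qed
 have "(LI xi. ind {- (4*a)..- a} xi*?f xi) = \<bar>- 1\<bar> *\<^sub>R (LI xi. ind {- (4*a)..- a} (0 + (- 1)*xi)*?f (0 + (- 1)*xi))"
  by (rule lborel_integral_real_affine) simp
 also have "... = (LI xi. ind {a..4*a} xi*cis ((- z)*xi - (- sg) * om alpha xi))" by (simp add: om_def) (intro LI_cong, auto simp: indicator_def)
 finally have "norm (LI xi. ind {- (4*a)..- a} xi*?f xi) <= 80 * sqrt (a/\<bar>- z\<bar>)" using pos[of "- z" "- sg"] z by simp
 moreover have "(LI xi. ind (Lam a) xi*?f xi) = (LI xi. ind {a..4*a} xi*?f xi) + (LI xi. ind {- (4*a)..- a} xi*?f xi)"
  using a by (subst Bochner_Integration.integral_add[symmetric, OF ii ii], intro LI_cong refl) (auto simp: indicator_def Lam_def)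
 ultimately show ?thesis using pos[OF z, of sg] norm_triangle_ineq[of "LI xi. ind {a..4*a} xi*?f xi" "LI xi. ind {- (4*a)..- a} xi*?f xi"] by simp
qed

section \<open>The Hardy-Littlewood-Sobolev inequality\<close>

lemma nn_integral_powr:
 assumes "- 1 < c" "0 <= a"
 shows "(NN b. ind {0..a} b*er (b powr c)) = er (a powr (c + 1)/(c + 1))" using nn_integral_has_integral_lebesgue[OF _ has_integral_powr_from_0[OF assms]]
 by (simp add: ennreal_mult ennreal_indicator)

lemma nn_integral_Riesz_ball:
 assumes "0 <= R"
 shows "(NN z. ind {-R..R} z*er ((abs z) powr (-1/2))) <= er (4 * sqrt R)"
proof -
 let ?J = "%z. ind {0..R} z*er (z powr (-1/2))"
 have J: "(NN z. ?J z) = er (2 * sqrt R)" using nn_integral_powr[of "-1/2" R] assms by (simp add: powr_half_sqrt)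
 have "(NN z. ind {-R..R} z*er ((abs z) powr (-1/2))) <= (NN z. ?J z + ?J (0 + (-1)*z))" by (intro nn_mono) (auto simp: indicator_def)
 also have "... = (NN z. ?J z) + (NN z. ?J (0 + (-1)*z))" by (rule nn_integral_add) measurable
 also have "(NN z. ?J (0 + (-1)*z)) = (NN z. ?J z)" using nn_integral_real_affine[of ?J "-1" 0] by simp
 finally show ?thesis unfolding J using assms by (simp flip: ennreal_plus)
qed

text \<open>Splitting at a distance \<open>R\<close> equal to the measure of \<open>F\<close>
  balances the two contributions: near points give at most \<open>4 * sqrt R\<close>, far points at
  most \<open>R powr (-1/2) * R\<close>.\<close>

lemma Riesz_set_bound:
 assumes Fm [measurable]: "F : sets borel"
 shows "(NN y. ind F y*er (\<bar>x - y\<bar> powr (-1/2))) <= 5*emeasure lborel F^.(1/2)"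
proof -
 consider "emeasure lborel F = 0" | "emeasure lborel F = top" | R where "emeasure lborel F = er R" "0 < R" by (cases "emeasure lborel F") (auto simp: less_le)
 thus ?thesis
 proof cases
  case 1
  hence "AEL y. y ~: F" using AE_iff_measurable[of F lborel "%y. y ~: F"] by auto
  hence "(NN y. ind F y*er (\<bar>x - y\<bar> powr (-1/2))) = 0" by (subst nn_integral_0_iff_AE) (auto elim!: eventually_mono simp: indicator_def)
  thus ?thesis by simp
 next
  case 2 thus ?thesis by (simp add: ennreal_mult_top)
 next
  case 3
  have "(NN y. ind F y*er (\<bar>x - y\<bar> powr (-1/2))) <= (NN y. ind {-R..R} (x + (-1)*y)*er (\<bar>x + (-1)*y\<bar> powr (-1/2)) + er (R powr (-1/2))*ind F y)"
  proof (intro nn_mono)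
   fix y
   show "ind F y*er (\<bar>x - y\<bar> powr (-1/2)) <= ind {-R..R} (x + (-1)*y)*er (\<bar>x + (-1)*y\<bar> powr (-1/2)) + er (R powr (-1/2))*ind F y"
   proof (cases "\<bar>x - y\<bar> <= R")
    case True thus ?thesis by (auto simp: indicator_def)
   next
    case False
    hence "er (\<bar>x - y\<bar> powr (-1/2)) <= er (R powr (-1/2))" using 3 by (intro ennreal_leI powr_mono2') auto
    thus ?thesis by (auto simp: indicator_def intro: add_increasing)
   qed
  qed
  also have "... = (NN y. ind {-R..R} (x + (-1)*y)*er (\<bar>x + (-1)*y\<bar> powr (-1/2))) + er (R powr (-1/2))*emeasure lborel F"
   by (subst nn_integral_add) (auto simp: nn_cmult)
  also have "(NN y. ind {-R..R} (x + (-1)*y)*er (\<bar>x + (-1)*y\<bar> powr (-1/2))) = (NN z. ind {-R..R} z*er ((abs z) powr (-1/2)))"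
   using nn_integral_real_affine[of "%z. ind {-R..R} z*er ((abs z) powr (-1/2))" "-1" x] by simp
  also have "... <= er (4 * sqrt R)" using 3 by (intro nn_integral_Riesz_ball) simp
  also have "er (R powr (-1/2))*emeasure lborel F = er (sqrt R)"
  proof -
   have "R powr (-1/2)*R powr 1 = R powr (-1/2 + 1)" by (rule powr_add[symmetric])
   thus ?thesis using 3 by (simp add: powr_half_sqrt flip: ennreal_mult)
  qed
  also have "er (4 * sqrt R) + er (sqrt R) = er (5 * sqrt R)" using 3 by (simp flip: ennreal_plus)
  also have "... = 5*emeasure lborel F^.(1/2)" using 3 by (simp add: powr_half_sqrt ennreal_mult)
  finally show ?thesis by (simp add: add_right_mono)
 qed
qed

text \<open>Hardy--Littlewood--Sobolev with kernel \<open>(abs x)\<^bsup>-1/2\<^esup>\<close>: by the layer-cake formula it reduces to level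
 sets, where the larger of the two contributes only the square root of its measure.\<close>

lemma HLS:
 fixes G :: "real => real"
 assumes Gm [measurable]: "bm G" and G0: "!!x. 0 <= G x"
 shows "(NN x. (NN y. er (G x)*(er (G y)*er (\<bar>x - y\<bar> powr (-1/2))))) <= 20*(NN x. er (G x powr (4/3)))^.(3/2)"
proof -
 let ?k = "%x. NN y. er (G x)*(er (G y)*er (\<bar>x - y\<bar> powr (-1/2)))"
 define N where "N = (NN x. er (G x powr (4/3)))"
 define I where "I a x = (if 0 < a & a < G x then 1 else 0 :: ennreal)" for a x :: real
 define k where "k x y = er (\<bar>x - y\<bar> powr (-1/2))" for x y :: real
 define e where "e a = (NN x. I a x)" for a
 have [measurable]: "bmL (%(a, x). I a x)" "bmL (%(x, y). k x y)" unfolding I_def k_def by measurable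
 have [measurable]: "bmL (%(x, a). I a x)" unfolding I_def by measurable
 have [measurable]: "bm e"
 proof -
  have "bml e" unfolding e_def by measurable
  thus ?thesis by simp
 qed
 have Ie: "I a x = ind {x. 0 < a & a < G x} x" for a x by (simp add: I_def indicator_def)
 have eF: "emeasure lborel {x. 0 < a & a < G x} = e a" for a unfolding e_def Ie by (subst nn_integral_indicator) auto
 have GI: "er (G x) = (NN a. I a x)" for x
 proof -
  have "(NN a. I a x) = (NN a. ind {0<..<G x} a)" by (intro nn_cong) (auto simp: I_def indicator_def)
  thus ?thesis using G0[of x] by simp
 qed
 define K where "K b x = (NN y. I b y*k x y)" for b x
 have Km [measurable]: "bmL (%(b, x). K b x)" unfolding K_def by measurable
 have Km' [measurable]: "bmL (%(x, b). K b x)" unfolding K_def by measurable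
 have Kb: "K b x <= 5*e b^.(1/2)" for b x unfolding K_def Ie k_def eF[symmetric] by (rule Riesz_set_bound) measurable
 define J where "J a b = (NN x. I a x*K b x)" for a b
 have Jm [measurable]: "bmL (%(a, b). J a b)" unfolding J_def by measurable
 have J1: "J a b <= 5*(e a*e b^.(1/2))" for a b
 proof -
  have "J a b <= (NN x. I a x*(5*e b^.(1/2)))" unfolding J_def by (intro nn_mono mult_left_mono Kb) simp
  also have "... = e a*(5*e b^.(1/2))" unfolding e_def[of a] by (rule nn_multc) measurable
  finally show ?thesis by (simp add: mult_ac)
 qed
 have Jsym: "J a b = J b a" for a b
 proof -
  have "J a b = (NN x. (NN y. I a x*(I b y*k x y)))" unfolding J_def K_def by (intro nn_cong nn_cmult[symmetric]) measurable
  also have "... = (NN y. (NN x. I a x*(I b y*k x y)))" by (rule lborel_pair.Fubini') measurable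
  also have "... = (NN y. (NN x. I b y*(I a x*k y x)))" by (simp add: k_def abs_minus_commute mult.left_commute)
  also have "... = J b a" unfolding J_def K_def by (intro nn_cong nn_cmult) measurable
  finally show ?thesis .
 qed
 define q where "q b a = (if 0 <= b & b <= a then e b^.(1/2) else 0)" for a b
 have qm [measurable]: "bmL (%(b, a). q b a)" "bmL (%(a, b). q b a)" unfolding q_def by measurable
 have "(NN x. ?k x) = (NN x. (NN a. I a x)*(NN b. K b x))"
 proof (intro nn_cong)
  fix x
  have "(NN y. er (G y)*k x y) = (NN y. (NN b. I b y*k x y))" unfolding GI by (intro nn_cong nn_multc[symmetric]) measurable
  also have "... = (NN b. K b x)" unfolding K_def by (rule lborel_pair.Fubini') measurable
  finally have "(NN b. K b x) = (NN y. er (G y)*k x y)" by simp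
  thus "?k x = (NN a. I a x)*(NN b. K b x)" unfolding GI[of x, symmetric] by (simp add: k_def nn_cmult)
 qed
 also have "... = (NN x. (NN a. (NN b. I a x*K b x)))" by (intro nn_cong, subst nn_multc[symmetric], measurable, intro nn_cong nn_cmult[symmetric], measurable)
 also have "... = (NN a. (NN x. (NN b. I a x*K b x)))" by (rule lborel_pair.Fubini') measurable
 also have "... = (NN a. (NN b. J a b))" unfolding J_def by (intro nn_cong lborel_pair.Fubini') measurable
 also have "... <= (NN a. (NN b. 5*(e a*q b a)) + (NN b. 5*(e b*q a b)))"
 proof (intro nn_mono)
  fix a :: real
  have "(NN b. J a b) <= (NN b. 5*(e a*q b a) + 5*(e b*q a b))"
  proof (intro nn_mono)
   fix b
   show "J a b <= 5*(e a*q b a) + 5*(e b*q a b)"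
   proof (cases "0 <= a & 0 <= b")
    case True
    thus ?thesis using J1[of a b] J1[of b a] Jsym[of a b] by (cases "b <= a") (auto simp: q_def intro: add_increasing add_increasing2)
   next
    case False
    hence "e a = 0 | e b = 0" by (auto simp: e_def I_def)
    hence "J a b = 0" using J1[of a b] by auto
    thus ?thesis by simp
   qed
  qed
  also have "... = (NN b. 5*(e a*q b a)) + (NN b. 5*(e b*q a b))" by (rule nn_integral_add) measurable
  finally show "(NN b. J a b) <= (NN b. 5*(e a*q b a)) + (NN b. 5*(e b*q a b))" .
 qed
 also have "... = (NN a. (NN b. 5*(e a*q b a))) + (NN a. (NN b. 5*(e b*q a b)))" by (rule nn_integral_add) measurable
 also have "(NN a. (NN b. 5*(e b*q a b))) = (NN b. (NN a. 5*(e b*q a b)))" by (rule lborel_pair.Fubini') measurable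
 also have "X + X = 2*X" for X :: ennreal by (simp add: mult_2)
 also have "(NN a. (NN b. 5*(e a*q b a))) = 5*(NN a. e a*(NN b. q b a))"
  by (subst nn_cmult[symmetric], measurable, intro nn_cong, subst nn_cmult, measurable, subst nn_cmult, measurable)
 finally have main: "(NN x. ?k x) <= 2*(5*(NN a. e a*(NN b. q b a)))" .
 define N' where "N' = (NN b. e b*er (b powr (1/3)))"
 have N': "N' = er (3/4)*N"
 proof -
  have "N' = (NN b. (NN x. I b x*er (b powr (1/3))))" unfolding N'_def e_def by (intro nn_cong nn_multc[symmetric]) measurable
  also have "... = (NN x. (NN b. I b x*er (b powr (1/3))))" by (rule lborel_pair.Fubini') measurable
  also have "... = (NN x. er (3/4)*er (G x powr (4/3)))"
  proof (intro nn_cong)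
   fix x
   have "(NN b. I b x*er (b powr (1/3))) = (NN b. ind {0..G x} b*er (b powr (1/3)))" using AE_lborel_singleton[of "G x"]
    by (intro nn_integral_cong_AE) (auto elim!: eventually_mono simp: I_def indicator_def)
   also have "... = er (G x powr (1/3 + 1)/(1/3 + 1))" by (rule nn_integral_powr) (use G0 in auto)
   also have "... = er (3/4)*er (G x powr (4/3))" by (simp flip: ennreal_mult)
   finally show "(NN b. I b x*er (b powr (1/3))) = er (3/4)*er (G x powr (4/3))" .
  qed
  also have "... = er (3/4)*N" unfolding N_def by (rule nn_cmult) measurable
  finally show ?thesis .
 qed
 \<comment> \<open>Cauchy-Schwarz with the weight \<open>b powr (1/3)\<close> and its inverse. The
   first is the one for which the integral of \<open>e\<close> is 3/4 of \<open>N\<close>, and the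
   second integrates to a multiple of \<open>a powr (2/3)\<close>.\<close>
 have inner: "(NN b. q b a) <= N'^.(1/2)*er (2*a powr (1/3))" if "0 < a" for a
 proof -
  have "(NN b. q b a) <= (NN b. (e b*er (b powr (1/3)))^.(1/2)*(ind {0..a} b*er (b powr (- 1/3)))^.(1 - 1/2))"
  proof (rule nn_integral_mono_AE, use AE_lborel_singleton[of 0] in eventually_elim)
   case (elim b)
   show ?case
   proof (cases "b : {0..a}")
    case True
    have "(e b*er (b powr (1/3)))^.(1/2)*(ind {0..a} b*er (b powr (- 1/3)))^.(1 - 1/2) = e b^.(1/2)*(er ((b powr (1/3)) powr (1/2))*er ((b powr (- 1/3)) powr (1/2)))"
     using True by (simp add: epowr_mult mult.assoc)
    also have "er ((b powr (1/3)) powr (1/2))*er ((b powr (- 1/3)) powr (1/2)) = er (b powr (1/3*(1/2) + - 1/3*(1/2)))"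
     by (simp only: powr_powr powr_add ennreal_mult powr_ge_zero)
    also have "... = 1" using True elim by simp
    finally show ?thesis using True by (simp add: q_def)
   qed (auto simp: q_def)
  qed
  also have "... <= N'^.(1/2)*(NN b. ind {0..a} b*er (b powr (- 1/3)))^.(1 - 1/2)" unfolding N'_def by (intro nn_integral_Holder) auto
  also have "(NN b. ind {0..a} b*er (b powr (- 1/3))) = er (a powr (- 1/3 + 1)/(- 1/3 + 1))" by (rule nn_integral_powr) (use that in auto)
  also have "er (a powr (- 1/3 + 1)/(- 1/3 + 1))^.(1 - 1/2) <= er (2*a powr (1/3))"
  proof -
   have "a powr (- 1/3 + 1)/(- 1/3 + 1) <= (2*a powr (1/3)) powr 2" using that by (simp add: powr_mult powr_powr power_mult_distrib)
   hence "(a powr (- 1/3 + 1)/(- 1/3 + 1)) powr (1/2) <= ((2*a powr (1/3)) powr 2) powr (1/2)" by (intro powr_mono2) auto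
   also have "... = 2*a powr (1/3)" using that by (simp only: powr_powr) simp
   finally show ?thesis by (simp add: ennreal_leI)
  qed
  finally show ?thesis by (simp add: mult_left_mono)
 qed
 have "(NN a. e a*(NN b. q b a)) <= (NN a. (2*N'^.(1/2))*(e a*er (a powr (1/3))))"
 proof (intro nn_mono)
  fix a :: real
  show "e a*(NN b. q b a) <= (2*N'^.(1/2))*(e a*er (a powr (1/3)))"
  proof (cases "0 < a")
   case True
   have "e a*(NN b. q b a) <= e a*(N'^.(1/2)*er (2*a powr (1/3)))" by (rule mult_left_mono[OF inner[OF True]]) simp
   thus ?thesis by (simp add: ennreal_mult' mult_ac)
  next
   case False
   hence "e a = 0" by (simp add: e_def I_def)
   thus ?thesis by simp
  qed
 qed
 also have "... = 2*(N'^.(1/2)*N'^.1)" unfolding epowr_1 N'_def by (subst nn_cmult) (auto simp: mult.assoc)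
 also have "... = 2*N'^.(3/2)" unfolding epowr_add by simp
 also have "... <= 2*N^.(3/2)"
 proof -
  have "N' <= 1*N" unfolding N' by (intro mult_right_mono) auto
  thus ?thesis by (intro mult_left_mono epowr_mono) auto
 qed
 finally have "2*(5*(NN a. e a*(NN b. q b a))) <= 2*(5*(2*N^.(3/2)))" by (intro mult_left_mono) auto
 with main show ?thesis unfolding N_def[symmetric] by (simp add: mult.assoc[symmetric])
qed

section \<open>Kato smoothing and the maximal function estimate\<close>

definition Aop :: "real => (real => complex) => real => real => complex" where "Aop alpha h t x = (LI xi. h xi*cis (x*xi - t * om alpha xi))"

lemma Aop_measurable [measurable]:
 assumes [measurable]: "bm h"
 shows "mm (Aop alpha h)"
proof -
 have "bmL (%z. LI xi. h xi*cis (snd z*xi - fst z * om alpha xi))" by (rule lborel.borel_measurable_lebesgue_integral) measurable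
 thus ?thesis by (simp add: Aop_def split_beta')
qed

lemma Aop_bound: "integrable lborel h ==> norm (Aop alpha h t x) <= (LI xi. norm (h xi))" unfolding Aop_def by (rule norm_integral_cis_le)

definition KB :: "real set => real => (real => real => complex) => bool" where
 "KB I kappa f \<longleftrightarrow> (\<forall>x. (NN t. en (f t x)^2*ind I t) <= er (kappa^2))"

text \<open>A measurable majorant \<open>B\<close> replaces the supremum over uncountably many
  times, which need not be measurable for a general \<open>f\<close>.\<close>

definition MB :: "real set => real => (real => real => complex) => bool" where
 "MB I m f \<longleftrightarrow> (\<exists>B\<in>borel_measurable borel. (\<forall>t\<in>I. \<forall>x. en (f t x) <= B x) & (NN x. B x^4) <= er (m^4))"

text \<open>For fixed \<open>x\<close> the dependence on time is a superposition of the frequencies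
  \<open>- om alpha xi\<close>, which \<open>om_sep\<close> separates by \<open>a powr alpha\<close>
  times the distance of the \<open>xi\<close>. This is the gain of \<open>alpha/2\<close>
  derivatives; 3 rounds up \<open>sqrt (2*pi)\<close>.\<close>

lemma Kato:
 assumes h: "integrable lborel h" and s: "!!xi. xi ~: Lam a ==> h xi = 0" and a: "0 < a" and al: "0 <= alpha"
  and H: "sqn h <= er (H^2)"
 shows "KB UNIV (3*a powr (- alpha/2)*H) (Aop alpha h)" unfolding KB_def
proof
 fix x
 have "(NN t. en (Aop alpha h t x)^2*ind UNIV t) = (NN t. en (LI xi. (h xi*cis (x*xi))*cis (t*(- om alpha xi)))^2)" by (simp add: Aop_def mult.assoc cis_mult)
 also have "... <= er (2*pi/a powr alpha)*(NN xi. en (h xi*cis (x*xi))^2)"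
 proof (rule Bessel_phase)
  fix xi eta assume "h xi*cis (x*xi) ~= 0" "h eta*cis (x*eta) ~= 0"
  hence "xi : Lam a" "eta : Lam a" using s by auto
  thus "a powr alpha*\<bar>xi - eta\<bar> <= \<bar>- om alpha xi - - om alpha eta\<bar>" using om_sep[OF a, of xi eta alpha] al by (simp add: Lam_def)
 qed (use h a in "auto intro: integrable_mult_cis")
 also have "... = er (2*pi/a powr alpha) * sqn h" by (simp add: sqn_def norm_mult)
 also have "... <= er (9*a powr (- alpha))*er (H^2)" using pi_less_4 a by (intro mult_mono H ennreal_leI) (auto simp: powr_minus divide_inverse)
 also have "... = er ((3*a powr (- alpha/2)*H)^2)" by (simp add: power_mult_distrib power2_eq_square[of "a powr _"] flip: ennreal_mult powr_add)
 finally show "(NN t. en (Aop alpha h t x)^2*ind UNIV t) <= er ((3*a powr (- alpha/2)*H)^2)" .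
qed

lemma indicator_complex_eq: "cor (ind A x) = ind A x" by (simp add: indicator_def)

lemma integrable_indicator_Lam: "integrable lborel (ind (Lam a) :: real => complex)"
proof -
 have "emeasure lborel (Lam a) <= emeasure lborel {- (4*a)..4*a}" by (intro emeasure_mono) (auto simp: Lam_def)
 also have "... < top" by (simp add: emeasure_lborel_Icc_eq)
 finally have "integrable lborel (%x. cor (ind (Lam a) x))" by (intro integrable_of_real integrable_real_indicator) auto
 thus ?thesis unfolding indicator_complex_eq .
qed

text \<open>The maximal function is linearised by a measurable choice \<open>tau x\<close> of the time; then \<open>T T\<^sup>*\<close> with
 the kernel bound and the Hardy--Littlewood--Sobolev inequality apply.\<close>

lemma maximal_linearised:
 assumes h: "integrable lborel h" and s: "!!xi. xi ~: Lam a ==> h xi = 0" and a: "0 < a" and al: "1 <= alpha" "alpha <= 2"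
  and H: "sqn h <= er (H^2)" "0 <= H" and taum [measurable]: "bm tau"
 shows "(NN x. en (Aop alpha h (tau x) x)^4*ind {-R..R} x) <= er ((60*a powr (1/4)*H)^4)"
proof -
 have [measurable]: "bm h" using h by (auto dest: bmi)
 \<comment> \<open>The restriction to \<open>{-R..R}\<close> makes the integral of the fourth power
   finite, so that it can be cancelled at the end.\<close>
 define f where "f x = Aop alpha h (tau x) x*ind {-R..R} x" for x
 have [measurable]: "bm f"
 proof -
  have "bm (%x. case (tau x, x) of (t, x) => Aop alpha h t x)" by (rule measurable_compose[of _ _ "LL"]) measurable
  thus ?thesis unfolding f_def by measurable
 qed
 define N where "N = (LI xi. norm (h xi))"
 have N0: "0 <= N" by (simp add: N_def)
 have fN: "norm (f x) <= N*ind {-R..R} x" for x using Aop_bound[OF h, of alpha "tau x" x] by (auto simp: f_def N_def indicator_def)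
 \<comment> \<open>The dual function of \<open>f\<close> in \<open>L^4\<close>: the pairing of
   \<open>cnj G\<close> with \<open>f\<close> is the integral of \<open>norm f^4\<close>, and so is
   the integral of \<open>norm G powr (4/3)\<close>, the quantity in \<open>HLS\<close>.\<close>
 define G where "G x = f x*cor ((norm (f x))^2)" for x
 have Gm [measurable]: "bm G" unfolding G_def by measurable
 have nG: "norm (G x) = norm (f x)^3" for x by (simp add: G_def norm_mult norm_power power3_eq_cube power2_eq_square)
 have bd: "integrable lborel g" if [measurable]: "bm g" and "!!x. norm (g x) <= c*ind {-R..R} x" for g :: "real => 'b::{banach,second_countable_topology}" and c
 by (rule integrable_le[of lborel "%x. c*ind {-R..R} x"]) (use that in "auto simp: emeasure_lborel_Icc_eq")
 have pw: "norm (f x)^n <= N^n*ind {-R..R} x" if "0 < n" for x n using power_mono[OF fN[of x], of n] that N0 by (auto simp: indicator_def zero_power split: if_splits)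
 have Gi: "integrable lborel G" by (rule bd[of _ "N^3"]) (auto simp: nG pw)
 have X4: "integrable lborel (%x. norm (f x)^4)" by (rule bd[of _ "N^4"]) (auto simp: pw)
 define X where "X = (LI x. norm (f x)^4)"
 have X0: "0 <= X" by (simp add: X_def)
 let ?k = "%x xi. cis (x*xi - tau x * om alpha xi)"
 define W where "W xi = (LI x. cnj (G x)*?k x xi)" for xi
 have Wm [measurable]: "bm W"
 proof -
  have "bml W" unfolding W_def by (rule lborel.borel_measurable_lebesgue_integral) measurable
  thus ?thesis by simp
 qed
 have Wb: "norm (W xi) <= (LI x. norm (G x))" for xi unfolding W_def using norm_integral_cis_le[of "%x. cnj (G x)"] Gi by simp
 define D where "D = (LI x. norm (G x))"
 let ?W = "%xi. ind (Lam a) xi*W xi"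
 have LW: "integrable lborel ?W"
  by (rule integrable_le[OF integrable_mult_right[OF integrable_norm[OF integrable_indicator_Lam[of a]], of D]])
   (measurable, use Wb in "auto simp: indicator_def D_def")
 have "cor X = (LI x. cnj (G x)*f x)" unfolding X_def integral_complex_of_real[symmetric]
 proof (intro LI_cong refl)
  fix x
  have "cnj (G x)*f x = (f x*cnj (f x))*cor ((norm (f x))^2)" by (simp add: G_def)
  also have "... = cor ((norm (f x))^2*(norm (f x))^2)" unfolding complex_norm_square[symmetric] by simp
  finally show "cor (norm (f x)^4) = cnj (G x)*f x" by (simp add: power2_eq_square numeral_eq_Suc mult.assoc)
 qed
 also have "... = (LI x. cnj (G x)*(LI xi. h xi*?k x xi))" by (intro LI_cong refl) (auto simp: G_def f_def Aop_def indicator_def)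
 also have "... = (LI xi. h xi*W xi)" unfolding W_def by (rule kernel_Fubini[where C=1]) (use h Gi in auto)
 also have "... = (LI xi. h xi*(?W xi))" using s by (intro LI_cong) (auto simp: indicator_def)
 finally have XW: "cor X = (LI xi. h xi*(?W xi))" .
 let ?Kn = "%x y. LI xi. ind (Lam a) xi*cis ((x - y)*xi - (tau x - tau y) * om alpha xi)"
 have S1: "sqn ?W = er (LI xi. (norm (?W xi))^2)" unfolding sqn_def ennreal_power[OF norm_ge_zero]
 proof (intro nn_integral_eq_integral)
  show "integrable lborel (%xi. (norm (?W xi))^2)"
   by (rule integrable_le[OF integrable_mult_right[OF integrable_norm[OF integrable_indicator_Lam[of a]], of "D^2"]])
    (measurable, use Wb in "auto simp: indicator_def D_def intro!: power_mono")
 qed simp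
 have S2: "... <= en (cor (LI xi. (norm (?W xi))^2))" by (intro ennreal_leI) simp
 have "cor (LI xi. (norm (?W xi))^2) = (LI xi. (?W xi)*(LI y. G y*cnj (?k y xi)))" unfolding integral_complex_of_real[symmetric]
 proof (intro LI_cong refl)
  fix xi
  have "cnj (W xi) = (LI y. G y*cnj (?k y xi))" unfolding W_def by (subst Bochner_Integration.integral_cnj[symmetric]) simp
  thus "cor ((norm (?W xi))^2) = (?W xi)*(LI y. G y*cnj (?k y xi))"
   using complex_norm_square[of "W xi"] by (auto simp: indicator_def simp del: of_real_power)
 qed
 also have "... = (LI y. G y*(LI xi. (?W xi)*cnj (?k y xi)))" by (rule kernel_Fubini[where C=1]) (use LW Gi in auto)
 also have "... = (LI y. G y*(LI x. cnj (G x)*?Kn x y))"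
 proof (rule LI_cong[OF refl], rule arg_cong[where f="(*) (G _)"])
  fix y
  have "(LI xi. (?W xi)*cnj (?k y xi)) = (LI xi. (ind (Lam a) xi*cis (- (y*xi - tau y * om alpha xi)))*(LI x. cnj (G x)*?k x xi))"
   unfolding W_def by (simp only: cis_cnj mult_ac)
  also have "... = (LI x. cnj (G x)*(LI xi. (ind (Lam a) xi*cis (- (y*xi - tau y * om alpha xi)))*?k x xi))"
   by (rule kernel_Fubini[where C=1]) (use Gi integrable_indicator_Lam in "auto intro!: integrable_mult_cis")
  also have "... = (LI x. cnj (G x)*?Kn x y)" by (simp add: mult.assoc cis_mult algebra_simps)
  finally show "(LI xi. (?W xi)*cnj (?k y xi)) = (LI x. cnj (G x)*?Kn x y)" .
 qed
 finally have S3: "cor (LI xi. (norm (?W xi))^2) = (LI y. G y*(LI x. cnj (G x)*?Kn x y))" .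
 let ?N = "%y. NN x. en (G x)*er (160 * sqrt a*\<bar>y - x\<bar> powr (-1/2))"
 have "en (LI y. G y*(LI x. cnj (G x)*?Kn x y)) <= (NN y. en (G y)*?N y)"
 proof (rule order_trans[OF norm_integral_le_nn nn_mono])
  fix y
  have "en (LI x. cnj (G x)*?Kn x y) <= (NN x. en (cnj (G x)*?Kn x y))" by (rule norm_integral_le_nn)
  also have "... <= ?N y"
  proof (rule nn_integral_mono_AE, use AE_lborel_singleton[of y] in eventually_elim)
   case (elim x)
   have "norm (?Kn x y) <= 160 * sqrt (a/\<bar>x - y\<bar>)" using elim by (intro kernel_bound al a) auto
   also have "... = 160 * sqrt a*\<bar>y - x\<bar> powr (-1/2)"
   proof -
    have "\<bar>y - x\<bar> powr (-1/2) = 1/sqrt \<bar>x - y\<bar>" using powr_minus[of "\<bar>y - x\<bar>" "1/2"] abs_minus_commute[of x y]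
     by (simp only: minus_divide_left powr_half_sqrt abs_ge_zero inverse_eq_divide)
    thus ?thesis by (simp only: real_sqrt_divide times_divide_eq_right mult_1_right)
   qed
   finally show ?case unfolding norm_mult complex_mod_cnj by (subst ennreal_mult[symmetric]) (use a in "auto intro!: ennreal_leI mult_left_mono")
  qed
  finally show "en (G y*(LI x. cnj (G x)*?Kn x y)) <= en (G y)*?N y"
   by (simp only: norm_mult ennreal_mult[OF norm_ge_zero norm_ge_zero] mult_left_mono zero_le)
 qed
 also have "... = er (160 * sqrt a)*(NN y. (NN x. en (G y)*(en (G x)*er (\<bar>y - x\<bar> powr (-1/2)))))"
 proof -
  have "en (G y)*?N y
   = er (160 * sqrt a)*(NN x. en (G y)*(en (G x)*er (\<bar>y - x\<bar> powr (-1/2))))" for y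
   by (subst (1 2) nn_cmult[symmetric]) (use a in "auto simp: ennreal_mult mult_ac")
  thus ?thesis by (simp add: nn_cmult)
 qed
 also have "... <= er (160 * sqrt a)*(20*(NN x. er (norm (G x) powr (4/3)))^.(3/2))" by (intro mult_left_mono HLS) auto
 also have "(NN x. er (norm (G x) powr (4/3))) = er X"
 proof -
  have "norm (G x) powr (4/3) = norm (f x)^4" for x
  proof (cases "f x = 0")
   case False
   hence "norm (G x) powr (4/3) = (norm (f x) powr 3) powr (4/3)" unfolding nG by simp
   also have "... = norm (f x)^4" using False unfolding powr_powr by simp
   finally show ?thesis .
  qed (simp add: nG)
  thus ?thesis unfolding X_def using X4 by (simp add: nn_integral_eq_integral)
 qed
 also have "er (160 * sqrt a)*(20*er X^.(3/2)) = er (3200 * sqrt a*X powr (3/2))"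
 proof -
  have "(20 :: ennreal) = ennreal 20" by simp
  show ?thesis using X0 a unfolding \<open>20 = ennreal 20\<close> epowr_ennreal[OF X0] by (simp add: mult_ac del: ennreal_numeral flip: ennreal_mult)
 qed
 finally have S: "sqn ?W <= er (3200 * sqrt a*X powr (3/2))" using S2 unfolding S1 S3 by (rule order_trans[rotated])
 have "sqn h < top" using H(1) ennreal_less_top by (rule order_le_less_trans)
 moreover have "sqn ?W < top" using S ennreal_less_top by (rule order_le_less_trans)
 ultimately have "en (cor X)^2 <= sqn h * sqn ?W" unfolding XW by (intro integrable_mult_L2(2)) auto
 also have "... <= er (H^2)*er (3200 * sqrt a*X powr (3/2))" by (intro mult_mono H S) auto
 finally have XX: "X^2 <= H^2*(3200 * sqrt a*X powr (3/2))" using X0 a H by (simp add: ennreal_power flip: ennreal_mult)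
 \<comment> \<open>Cancelling \<open>X powr (3/2)\<close> leaves
   \<open>X powr (1/2) <= H^2*(3200 * sqrt a)\<close>; the constant 60 is chosen with
   \<open>60^4 >= 3200^2\<close>.\<close>
 have "X <= (60*a powr (1/4)*H)^4"
 proof (cases "X = 0")
  case False
  hence Xp: "0 < X" using X0 by simp
  have "X powr (3/2)*X powr (1/2) <= X powr (3/2)*(H^2*(3200 * sqrt a))" using XX Xp by (simp add: mult_ac flip: powr_add powr_numeral)
  hence "X powr (1/2) <= H^2*(3200 * sqrt a)" using Xp by simp
  hence "(X powr (1/2))^2 <= (H^2*(3200 * sqrt a))^2" by (rule power_mono) simp
  hence "X <= (H^2*(3200 * sqrt a))^2" using Xp by (simp add: powr_half_sqrt)
  also have "... = 10240000*(a*H^4)" using a by (simp add: power_mult_distrib flip: power_mult)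
  also have "... <= 12960000*(a*H^4)" using a by (intro mult_right_mono) auto
  also have "... = (60*a powr (1/4)*H)^4" using a by (simp add: power_mult_distrib powr_powr flip: powr_realpow)
  finally show ?thesis .
 qed simp
 moreover have "(NN x. en (Aop alpha h (tau x) x)^4*ind {-R..R} x) = er X"
 proof -
  have "en (Aop alpha h (tau x) x)^4*ind {-R..R} x = er (norm (f x)^4)" for x by (auto simp: f_def indicator_def ennreal_power)
  thus ?thesis unfolding X_def using X4 by (simp add: nn_integral_eq_integral)
 qed
 ultimately show ?thesis by (simp only: ennreal_leI)
qed

section \<open>Linear estimates\<close>

lemma Aop_continuous:
 assumes h: "integrable lborel h" and t: "t ----> t0"
 shows "(%n. Aop alpha h (t n) x) ----> Aop alpha h t0 x" unfolding Aop_def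
proof (rule integral_dominated_convergence[where w="%xi. norm (h xi)"])
 have hm [measurable]: "bm h" using h by (auto dest: bmi)
 show "integrable lborel (%xi. norm (h xi))" using h by (rule integrable_norm)
 show "AEL xi. (%n. h xi*cis (x*xi - t n * om alpha xi)) ----> h xi*cis (x*xi - t0 * om alpha xi)"
 proof (rule AE_I2)
  fix xi
  have "isCont (%s. h xi*cis (x*xi - s * om alpha xi)) t0" by (simp add: cis_conv_exp)
  thus "(%n. h xi*cis (x*xi - t n * om alpha xi)) ----> h xi*cis (x*xi - t0 * om alpha xi)" using t by (rule isCont_tendsto_compose)
 qed
 show "bml (%xi. h xi*cis (x*xi - t0 * om alpha xi))" by measurable
 show "!!i. (%xi. h xi*cis (x*xi - t i * om alpha xi)) : borel_measurable lborel" by measurable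
 show "!!i. AEL xi. norm (h xi*cis (x*xi - t i * om alpha xi)) <= norm (h xi)" by (simp add: norm_mult)
qed

lemma rational_sequence: "\<exists>e::nat => real. \<forall>t. \<exists>r::nat => nat. (%n. e (r n)) ----> t"
proof -
 define e :: "nat => real" where "e n = from_nat_into \<rat> n" for n
 have ne: "(\<rat> :: real set) ~= {}" by auto
 have "\<exists>r. (%n. e (r n)) ----> t" for t
 proof -
  have "t : closure \<rat>" using Rats_closure_real by simp
  then obtain q where q: "!!n. q n : \<rat>" "q ----> t" unfolding closure_sequential by blast
  have "\<exists>m. e m = q n" for n using q(1)[of n] range_from_nat_into[OF ne countable_rat] unfolding e_def by (metis rangeE)
  then obtain r where "!!n. e (r n) = q n" by metis
  hence "(%n. e (r n)) = q" by (intro ext)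
  thus ?thesis using q(2) by (intro exI[of _ r]) simp
 qed
 thus ?thesis by blast
qed

text \<open>\<open>tau n x\<close> is a measurable choice of the best among the first
  \<open>n + 1\<close> members of a dense sequence of times, so the linearised bound holds uniformly
  in \<open>n\<close>. Monotone convergence gives the supremum over the sequence, continuity in time
  all other times.\<close>

lemma maximal:
 assumes h: "integrable lborel h" and s: "!!xi. xi ~: Lam a ==> h xi = 0" and a: "0 < a" and al: "1 <= alpha" "alpha <= 2"
  and H: "sqn h <= er (H^2)" "0 <= H"
 shows "MB UNIV (60*a powr (1/4)*H) (Aop alpha h)"
proof -
 have [measurable]: "bm h" using h by (auto dest: bmi)
 obtain e :: "nat => real" where e: "!!t. \<exists>r. (%n. e (r n)) ----> t" using rational_sequence by blast
 define A where "A t x = norm (Aop alpha h t x)" for t x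
 define tau where "tau = rec_nat (%x. e 0) (%n T x. if A (T x) x <= A (e (Suc n)) x then e (Suc n) else T x)"
 have tau0: "tau 0 x = e 0" and tauS: "tau (Suc n) x = (if A (tau n x) x <= A (e (Suc n)) x then e (Suc n) else tau n x)" for n x by (simp_all add: tau_def)
 have Am: "bm (%x. A (g x) x)" if [measurable]: "bm g" for g
 proof -
  have "bm (%x. case (g x, x) of (t, x) => Aop alpha h t x)" by (rule measurable_compose[of _ _ "LL"]) measurable
  thus ?thesis unfolding A_def by simp
 qed
 have taum: "bm (tau n)" for n
 proof (induction n)
  case 0 show ?case unfolding tau0[abs_def] by simp
 next
  case (Suc n)
  have [measurable]: "bm (tau n)" by fact
  have [measurable]: "bm (%x. A (tau n x) x)" "bm (%x. A (e (Suc n)) x)" by (rule Am, measurable)+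
  show ?case unfolding tauS[abs_def] by measurable
 qed
 have inc: "A (tau n x) x <= A (tau (Suc n) x) x" for n x by (simp add: tauS)
 have inc': "A (tau m x) x <= A (tau n x) x" if "m <= n" for m n x using that by (rule lift_Suc_mono_le[of "%n. A (tau n x) x", OF inc])
 have sel: "A (e n) x <= A (tau n x) x" for n x by (cases n) (simp_all add: tau0 tauS)
 define F where "F n x = er (A (tau n x) x)^4*ind {- real n..real n} x" for n x
 have Fm [measurable]: "bm (F n)" for n unfolding F_def using Am[OF taum[of n]] by measurable
 have Finc: "incseq F" unfolding incseq_def le_fun_def F_def by (intro allI impI mult_mono power_mono ennreal_leI inc') (auto simp: indicator_def)
 define B where "B x = (SUP n. F n x)^.(1/4)" for x
 have Bm: "bm B" unfolding B_def by measurable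
 have B4: "B x^4 = (SUP n. F n x)" for x unfolding B_def epowr_numeral[symmetric] epowr_powr by simp
 have "(NN x. B x^4) = (SUP n. (NN x. F n x))" unfolding B4 by (rule nn_integral_monotone_convergence_SUP[OF Finc]) simp
 also have "... <= er ((60*a powr (1/4)*H)^4)" unfolding F_def A_def using maximal_linearised[OF h s a al H taum] by (intro SUP_least)
 finally have int: "(NN x. B x^4) <= er ((60*a powr (1/4)*H)^4)" .
 have eB: "er (A (e i) x) <= B x" for i x
 proof -
  define n where "n = max i (nat \<lceil>(abs x)\<rceil>)"
  have n: "i <= n" "x : {- real n..real n}" unfolding n_def by (auto simp: abs_le_iff) linarith+
  have "er (A (e i) x)^4 <= F n x" unfolding F_def using n(2) order_trans[OF sel[of i x] inc'[OF n(1), of x]] by (simp add: power_mono ennreal_leI)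
  also have "... <= (SUP n. F n x)" by (rule SUP_upper) simp
  finally have "(er (A (e i) x)^4)^.(1/4) <= B x" unfolding B_def by (rule epowr_mono) simp
  thus ?thesis unfolding epowr_numeral[symmetric] epowr_powr by simp
 qed
 have "er (A t x) <= B x" for t x
 proof -
  obtain r where r: "(%n. e (r n)) ----> t" using e by blast
  have "(%n. er (A (e (r n)) x)) ----> er (A t x)" unfolding A_def by (intro tendsto_ennrealI tendsto_norm Aop_continuous h r)
  thus ?thesis by (rule LIMSEQ_le_const2) (use eB in blast)
 qed
 thus ?thesis unfolding MB_def using Bm int unfolding A_def by blast
qed

section \<open>Exponents, duality and the retarded operator\<close>

locale disp =
 fixes alpha :: real
 assumes alpha: "1 < alpha" "alpha <= 2"
begin

text \<open>\<open>P\<close> and \<open>Q\<close> are the exponents in the second part of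
  \<open>X_norm\<close>, and \<open>P'\<close>, \<open>Q'\<close> are their Hoelder
  conjugates.\<close>

definition P where "P = (4*alpha + 2)/(alpha - 1)"
definition Q where "Q = (4*alpha + 2)/3"
definition P' where "P' = (4*alpha + 2)/(3*alpha + 3)"
definition Q' where "Q' = (4*alpha + 2)/(4*alpha - 1)"

text \<open>\<open>(Q - 2)*(P/Q) = 4\<close> puts \<open>P\<close>, \<open>Q\<close> on the line
  between the two endpoints and \<open>1/P - alpha/Q = -1/2\<close> is the resulting power of the
  frequency. \<open>P' < Q'\<close> permits bisection in time, and \<open>Q' < 2\<close> makes it
  profitable.\<close>

lemma PQ: "10 <= P" "2 < Q" "1 < P'" "1 < Q'" "P' < Q'" "Q' < 2" "1/P' = 1 - 1/P" "1/Q' = 1 - 1/Q" "(Q - 2)*(P/Q) = 4" "1/P - alpha/Q = -1/2" "0 < P" "0 < Q" "P' < 2"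
proof -
 define d where "d = 4*alpha + 2"
 have d: "0 < d" "Q = d/3" "P = d/(alpha - 1)" "alpha = (d - 2)/4" using alpha by (auto simp: P_def Q_def d_def)
 have r: "P/Q = 3/(alpha - 1)" "Q - 2 = 4*(alpha - 1)/3" unfolding d(2,3) using d(1) by simp (simp add: d_def field_simps)
 show "(Q - 2)*(P/Q) = 4" unfolding r using alpha by (auto simp: divide_simps)
 show "P' < Q'" unfolding P'_def Q'_def using alpha by (intro divide_strict_left_mono) auto
 have "1/P = (alpha - 1)/d" "alpha/Q = 3*alpha/d" unfolding d(2,3) by simp_all
 hence "1/P - alpha/Q = (alpha - 1 - 3*alpha)/d" by (simp only: diff_divide_distrib)
 also have "alpha - 1 - 3*alpha = - d/2" by (simp add: d_def)
 finally show "1/P - alpha/Q = -1/2" using d(1) by simp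
qed (use alpha in "auto simp: P_def Q_def P'_def Q'_def field_simps")

abbreviation A where "A \<equiv> Aop alpha"

lemma PQ_bound:
 assumes fm: "mm f" and K: "KB I kappa f" and M: "MB I m f" and p: "0 <= kappa" "0 <= m" and I: "I : sets borel"
 shows "mx P Q (%t x. en (f t x)*ind I t) <= er (m powr (4/P)*kappa powr (2/Q))"
proof -
 obtain B where [measurable]: "bm B" and B: "!!t x. t : I ==> en (f t x) <= B x"
  and B4: "(NN x. B x^4) <= er (m^4)" using M unfolding MB_def by blast
 note [measurable] = fm I
 have "mx P Q (%t x. en (f t x)*ind I t) <= (er (m^4)*er (kappa^2)^.(P/Q))^.(1/P)"
 proof (rule mx_from_endpoints)
  show "mm (%t x. en (f t x)*ind I t)" by measurable
  show "(NN t. (en (f t x)*ind I t)^.2) <= er (kappa^2)" for x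
  proof -
   have "(NN t. (en (f t x)*ind I t)^.2) = (NN t. en (f t x)^2*ind I t)" unfolding epowr_numeral by (intro nn_cong) (simp add: indicator_def)
   thus ?thesis using K unfolding KB_def by simp
  qed
  show "en (f t x)*ind I t <= B x" for t x using B by (auto simp: indicator_def)
  show "(NN x. B x^.4) <= er (m^4)" using B4 unfolding epowr_numeral .
 qed (use PQ in auto)
 also have "... = er (m powr (4/P)*kappa powr (2/Q))"
 proof -
  have "er (m^4) = er m^.4" "er (kappa^2) = er kappa^.2" using p by (simp_all only: epowr_numeral ennreal_power)
  hence "(er (m^4)*er (kappa^2)^.(P/Q))^.(1/P) = er m^.(4/P)*er kappa^.(2/Q)" using PQ by (simp add: epowr_mult epowr_powr)
  thus ?thesis using p by (simp add: ennreal_mult)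
 qed
 finally show ?thesis .
qed

text \<open>By \<open>4/P + 2/Q = 1\<close> the product is linear in \<open>H\<close>; the powers of
  \<open>a\<close> combine to \<open>1/P - alpha/Q\<close>, and \<open>60*3 = 180\<close> bounds the
  constants.\<close>

lemma PQ_const:
 assumes "0 <= H" "0 < a"
 shows "(60*a powr (1/4)*H) powr (4/P)*(3*a powr (- alpha/2)*H) powr (2/Q) <= 180*a powr (-1/2)*H"
proof (cases "H = 0")
 case False
 have e: "4/P + 2/Q = 1"
 proof -
  have "(Q - 2)*(P/Q)/P = 4/P" using PQ(9) by simp
  thus ?thesis using PQ by (simp add: field_simps)
 qed
 have "60 powr (4/P) <= 60 powr 1" "3 powr (2/Q) <= (3::real) powr 1" using PQ by (intro powr_mono; simp)+
 hence c: "60 powr (4/P)*3 powr (2/Q) <= (180::real)" using mult_mono[of "60 powr (4/P)" 60 "3 powr (2/Q)" "3::real"] by simp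
 have "a powr (1/P)*a powr (- alpha/Q) = a powr (-1/2)" using PQ(10) by (simp flip: powr_add)
 moreover have "H powr (4/P)*H powr (2/Q) = H" using e False assms by (simp flip: powr_add)
 ultimately have "(60*a powr (1/4)*H) powr (4/P)*(3*a powr (- alpha/2)*H) powr (2/Q) = (60 powr (4/P)*3 powr (2/Q))*(a powr (-1/2)*H)"
  using assms by (simp add: powr_mult powr_powr) (metis mult.assoc mult.left_commute)
 also have "... <= 180*(a powr (-1/2)*H)" using c assms by (intro mult_right_mono) auto
 finally show ?thesis by (simp add: mult.assoc)
qed simp

lemma A_PQ:
 assumes h: "integrable lborel h" and s: "!!xi. xi ~: Lam a ==> h xi = 0" and a: "0 < a"
  and H: "sqn h <= er (H^2)" "0 <= H"
 shows "mx P Q (%t x. en (A h t x)) <= er (180*a powr (-1/2)*H)"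
proof -
 have [measurable]: "bm h" using h by (auto dest: bmi)
 have "mx P Q (%t x. en (A h t x)*ind UNIV t) <= er ((60*a powr (1/4)*H) powr (4/P)*(3*a powr (- alpha/2)*H) powr (2/Q))"
  by (intro PQ_bound Kato maximal h s a H Aop_measurable) (use alpha H in auto)
 also have "... <= er (180*a powr (-1/2)*H)" by (intro ennreal_leI PQ_const H a)
 finally show ?thesis by simp
qed

text \<open>The formal adjoint of \<open>A\<close>, that is, the space-time Fourier transform of
  \<open>R\<close> on the curve given by the dispersion relation.\<close>

definition Ast :: "(real => real => complex) => real => complex" where "Ast R xi = (LINT z|LL. uc R z*cis (- (snd z*xi - fst z * om alpha xi)))"

lemma Ast_measurable [measurable]: "mm R ==> Ast R : borel_measurable borel"
proof -
 assume [measurable]: "mm R"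
 have [measurable]: "bmL (%z. uc R z)" using \<open>mm R\<close> by (simp add: split_beta')
 have "bml (%xi. LINT z|LL. uc R z*cis (- (snd z*xi - fst z * om alpha xi)))" by (rule lborel_pair.borel_measurable_lebesgue_integral) measurable
 thus ?thesis unfolding Ast_def[abs_def] by simp
qed

lemma nn_integral_LL:
 fixes f :: "real => real => ennreal"
 assumes "mm f"
 shows "(NL z. f (fst z) (snd z)) = mx 1 1 f" using lborel_pair.nn_integral_snd[OF assms] by (simp add: mx_1 split_beta')

text \<open>Duality with \<open>A_PQ\<close>: for \<open>h = 1 \<cdot> cnj (Ast R)\<close> on \<open>Lam a\<close> one has \<open>\<integral> (abs h)\<^sup>2 = \<integral>\<integral> R \<cdot> cnj (A (cnj h))\<close>.\<close>

lemma dual: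
 assumes Rm [measurable]: "mm R" and Ri: "integrable LL (%z. uc R z)"
  and rho: "mx P' Q' (%t x. en (R t x)) <= er rho" "0 <= rho" and a: "0 < a"
 shows "sqn (%xi. ind (Lam a) xi*Ast R xi) <= er ((180*a powr (-1/2)*rho)^2)"
proof -
 define D where "D = (LINT z|LL. norm (uc R z))"
 have Rm' [measurable]: "bmL (%z. uc R z)" using Rm by (simp add: split_beta')
 have WD: "norm (Ast R xi) <= D" for xi
 proof -
  have "norm (Ast R xi) <= (LINT z|LL. norm (uc R z*cis (- (snd z*xi - fst z * om alpha xi))))" unfolding Ast_def by (rule integral_norm_bound)
  thus ?thesis by (simp add: D_def norm_mult)
 qed
 define h where "h xi = ind (Lam a) xi*Ast R xi" for xi
 have [measurable]: "bm h" unfolding h_def by measurable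
 have hi: "integrable lborel h"
 by (rule integrable_le[OF integrable_mult_right[OF integrable_norm[OF integrable_indicator_Lam[of a]], of D]])
   (measurable, use WD in "auto simp: indicator_def h_def")
 have h2: "integrable lborel (%xi. (norm (h xi))^2)"
 by (rule integrable_le[OF integrable_mult_right[OF integrable_norm[OF integrable_indicator_Lam[of a]], of "D^2"]])
   (measurable, use WD in "auto simp: indicator_def h_def intro!: power_mono")
 define X where "X = (LI xi. (norm (h xi))^2)"
 have X0: "0 <= X" by (simp add: X_def)
 have hX: "sqn h = er X" unfolding sqn_def X_def ennreal_power[OF norm_ge_zero] using h2 by (rule nn_integral_eq_integral) simp
 have chi: "integrable lborel (%xi. cnj (h xi))" using hi by simp
 have "cor X = (LI xi. cnj (h xi)*Ast R xi)" unfolding X_def integral_complex_of_real[symmetric]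
 proof (rule LI_cong[OF refl])
  fix xi
  have "cor ((norm (h xi))^2) = h xi*cnj (h xi)" using complex_norm_square by simp
  thus "cor ((norm (h xi))^2) = cnj (h xi)*Ast R xi" by (simp add: h_def indicator_def)
 qed
 also have "... = (LINT z|LL. uc R z*(LI xi. cnj (h xi)*cis (- (snd z*xi - fst z * om alpha xi))))"
  unfolding Ast_def by (rule kernel_Fubini_gen[where C=1, OF sigma_lborel lborel_pair.sigma_finite_measure_axioms chi Ri]) auto
 also have "(%z. LI xi. cnj (h xi)*cis (- (snd z*xi - fst z * om alpha xi))) = (%z. cnj (A h (fst z) (snd z)))"
  unfolding Aop_def by (subst Bochner_Integration.integral_cnj[symmetric]) (simp add: cis_cnj)
 finally have "er X = en (LINT z|LL. uc R z*cnj (A h (fst z) (snd z)))" using X0 by (metis norm_of_real abs_of_nonneg)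
 also have "... <= (NL z. en (uc R z)*en (A h (fst z) (snd z)))"
  by (rule order_trans[OF norm_integral_le_nn]) (simp add: norm_mult ennreal_mult)
 also have "... = mx 1 1 (%t x. en (R t x)*en (A h t x))" by (rule nn_integral_LL) measurable
 also have "... <= mx P' Q' (%t x. en (R t x))*mx P Q (%t x. en (A h t x))" using PQ by (intro mx_Holder) auto
 also have "... <= er rho*er (180*a powr (-1/2) * sqrt X)" using X0 hX by (intro mult_mono rho A_PQ hi a) (auto simp: h_def)
 finally have "X <= rho*(180*a powr (-1/2) * sqrt X)" using rho X0 by (simp flip: ennreal_mult)
 hence "sqrt X * sqrt X <= (180*a powr (-1/2)*rho) * sqrt X" using X0 by (simp add: mult_ac)
 hence "sqrt X <= 180*a powr (-1/2)*rho" using X0 rho by (cases "X = 0") (auto simp del: real_sqrt_mult_self)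
 hence "X <= (180*a powr (-1/2)*rho)^2" using X0 by (metis power_mono real_sqrt_ge_zero real_sqrt_pow2)
 thus ?thesis unfolding h_def[symmetric] hX by (rule ennreal_leI)
qed

lemma A_mult_Ast:
 assumes b: "integrable lborel b" and Ri: "integrable LL (%z. uc R z)"
 shows "A (%xi. b xi*Ast R xi) t x = (LINT z|LL. uc R z*A b (t - fst z) (x - snd z))"
proof -
 have "A (%xi. b xi*Ast R xi) t x = (LI xi. (b xi*cis (x*xi - t * om alpha xi))*Ast R xi)" by (simp add: Aop_def mult_ac)
 also have "... = (LINT z|LL. uc R z*(LI xi. (b xi*cis (x*xi - t * om alpha xi))*cis (- (snd z*xi - fst z * om alpha xi))))"
  unfolding Ast_def by (rule kernel_Fubini_gen[where C=1, OF sigma_lborel lborel_pair.sigma_finite_measure_axioms integrable_mult_cis[OF b] Ri]) auto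
 also have "(%z. LI xi. (b xi*cis (x*xi - t * om alpha xi))*cis (- (snd z*xi - fst z * om alpha xi))) = (%z. A b (t - fst z) (x - snd z))"
  unfolding Aop_def mult.assoc cis_mult by (simp add: algebra_simps)
 finally show ?thesis .
qed

text \<open>The Duhamel integral with multiplier \<open>b\<close>, up to constants. A lower limit of
  integration is absent because the forcing terms inserted here vanish before time 0.\<close>

definition ret :: "(real => complex) => (real => real => complex) => real => real => complex" where
 "ret b R t x = (LINT z|LL. uc R z*ind {..t} (fst z)*A b (t - fst z) (x - snd z))"

lemma ret_measurable [measurable]:
 assumes [measurable]: "bm b" and Rm: "mm R"
 shows "mm (ret b R)"
proof -
 have [measurable]: "bmL (%z. uc R z)" using Rm by (simp add: split_beta')
 have "(%w. case (fst (fst w) - fst (snd w), snd (fst w) - snd (snd w)) of (t, x) => A b t x) : borel_measurable (LL \<Otimes>\<^sub>M LL)"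
  by (rule measurable_compose[of _ _ "LL"]) measurable
 hence [measurable]: "(%w. A b (fst (fst w) - fst (snd w)) (snd (fst w) - snd (snd w))) : borel_measurable (LL \<Otimes>\<^sub>M LL)" by simp
 have "bmL (%w. LINT z|LL. uc R z*(if fst z <= fst w then 1 else 0)*A b (fst w - fst z) (snd w - snd z))"
  by (rule lborel_pair.borel_measurable_lebesgue_integral) measurable
 thus ?thesis by (simp add: ret_def split_beta' indicator_def)
qed

lemma integrable_indicator_time:
 fixes R :: "real => real => complex"
 assumes "integrable LL (%z. uc R z)" and [measurable]: "S : sets borel"
 shows "integrable LL (%z. uc R z*ind S (fst z))"
proof (rule LI_bound[OF assms(1)])
 have [measurable]: "bmL (%z. uc R z)" using assms(1) by (auto dest: bmi)
 show "bmL (%z. uc R z*ind S (fst z))" by measurable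
qed (auto simp: indicator_def)

lemma ret_eq_A:
 assumes b: "integrable lborel b" and Ri: "integrable LL (%z. uc R z)"
 shows "ret b R t x = A (%xi. b xi*Ast (%tau y. R tau y*ind {..t} tau) xi) t x"
 unfolding ret_def by (rule A_mult_Ast[symmetric, OF b]) (use integrable_indicator_time[OF Ri, of "{..t}"] in simp)

lemma ret_split:
 fixes s :: real
 assumes b: "integrable lborel b" and Ri: "integrable LL (%z. uc R z)"
 defines "R1 \<equiv> %tau y. R tau y*ind {..s} tau" and "R2 \<equiv> %tau y. R tau y*ind {s<..} tau"
 shows "t <= s ==> ret b R t x = ret b R1 t x"
  and "s < t ==> ret b R t x = A (%xi. b xi*Ast R1 xi) t x + ret b R2 t x"
proof -
 show "ret b R t x = ret b R1 t x" if "t <= s" unfolding ret_def R1_def by (rule LI_cong) (use that in "auto simp: indicator_def")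
 have i1: "integrable LL (%z. uc R1 z)" unfolding R1_def by (rule integrable_indicator_time[OF Ri]) simp
 have i2: "integrable LL (%z. uc R2 z)" unfolding R2_def by (rule integrable_indicator_time[OF Ri]) simp
 have [measurable]: "bm b" using b by (auto dest: bmi)
 have Am [measurable]: "bmL (%z. A b (t - fst z) (x - snd z))"
 proof -
  have "bmL (%z. case (t - fst z, x - snd z) of (t, x) => A b t x)" by (rule measurable_compose[of _ _ "LL"]) measurable
  thus ?thesis by simp
 qed
 have mi: "integrable LL (%z. g z*A b (t - fst z) (x - snd z))" if "integrable LL g" for g :: "real \<times> real => complex"
 proof (rule integrable_le[OF integrable_mult_right[OF integrable_norm[OF that], of "LI xi. norm (b xi)"]])
  have [measurable]: "bmL g" using that by (auto dest: bmi)
  show "bmL (%z. g z*A b (t - fst z) (x - snd z))" by measurable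
  fix z show "norm (g z*A b (t - fst z) (x - snd z)) <= (LI xi. norm (b xi))*norm (g z)"
   unfolding norm_mult mult.commute[of "norm (g z)"] by (intro mult_right_mono Aop_bound b) simp
 qed
 show "ret b R t x = A (%xi. b xi*Ast R1 xi) t x + ret b R2 t x" if "s < t"
 proof -
  have "ret b R t x = (LINT z|LL. uc R1 z*A b (t - fst z) (x - snd z) + uc R2 z*ind {..t} (fst z)*A b (t - fst z) (x - snd z))"
   unfolding ret_def R1_def R2_def by (rule LI_cong) (use that in "auto simp: indicator_def")
  also have "... = A (%xi. b xi*Ast R1 xi) t x + ret b R2 t x" unfolding ret_def A_mult_Ast[OF b i1]
   by (intro Bochner_Integration.integral_add mi i1 integrable_indicator_time i2) simp
  finally show ?thesis .
 qed
qed

end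

section \<open>Sums, gluing and limits of the endpoint bounds\<close>

lemma nn_integral_triangle:
 assumes M: "sigma_finite_measure M" and [measurable]: "f : borel_measurable M" "g : borel_measurable M" and p: "1 < p"
  and f: "(\<integral>\<^sup>+x. f x^.p \<partial>M) <= a^.p" and g: "(\<integral>\<^sup>+x. g x^.p \<partial>M) <= b^.p"
 shows "(\<integral>\<^sup>+x. (f x + g x)^.p \<partial>M) <= (a + b)^.p"
proof -
 let ?N = "count_space (UNIV :: bool set)"
 have [simp]: "(\<integral>\<^sup>+z. h z \<partial>?N) = h True + h False" for h :: "bool => ennreal"
  by (simp add: nn_integral_count_space_finite UNIV_bool add.commute)
 have "(%(x, z). if z then f x else g x) : borel_measurable (M \<Otimes>\<^sub>M ?N)" by measurable
 from nn_integral_Minkowski[OF M sigma_finite_measure_count_space_countable this p]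
 have "(\<integral>\<^sup>+x. (f x + g x)^.p \<partial>M)^.(1/p) <= (\<integral>\<^sup>+x. f x^.p \<partial>M)^.(1/p) + (\<integral>\<^sup>+x. g x^.p \<partial>M)^.(1/p)"
  by simp
 also have "... <= (a^.p)^.(1/p) + (b^.p)^.(1/p)" using p by (intro add_mono epowr_mono f g) auto
 also have "... = ((a + b)^.p)^.(1/p)" using p by (simp add: epowr_powr)
 finally show ?thesis using p by (simp only: epowr_le_iff zero_less_divide_1_iff zero_less_one less_trans[OF zero_less_one p])
qed

lemma KB_mono: "KB I kappa f ==> 0 <= kappa ==> kappa <= kappa' ==> KB I kappa' f" unfolding KB_def by (meson ennreal_leI order_trans power_mono)

lemma MB_I:
 assumes "bm B" "!!t x. t : I ==> en (f t x) <= B x" "(NN x. B x^4) <= er (m^4)"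
 shows "MB I m f" using assms unfolding MB_def by blast

lemma MB_mono: "MB I kappa f ==> 0 <= kappa ==> kappa <= kappa' ==> MB I kappa' f" unfolding MB_def by (meson ennreal_leI order_trans power_mono)

lemma KB_subset: "KB J kappa f ==> I \<subseteq> J ==> KB I kappa f" unfolding KB_def
proof
 fix x assume K: "\<forall>x. (NN t. en (f t x)^2*ind J t) <= er (kappa^2)" and s: "I \<subseteq> J"
 have "(NN t. en (f t x)^2*ind I t) <= (NN t. en (f t x)^2*ind J t)" using s by (intro nn_mono mult_left_mono) (auto simp: indicator_def)
 thus "(NN t. en (f t x)^2*ind I t) <= er (kappa^2)" using K by (meson order_trans)
qed

lemma MB_subset: "MB J kappa f ==> I \<subseteq> J ==> MB I kappa f" unfolding MB_def by (meson subsetD)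

lemma ennreal_sqr: "er (r^2) = er (abs r)^.2" by (simp add: epowr_numeral ennreal_power)

lemma ennreal_pow4: "er (r^4) = er (abs r)^.4" by (simp add: epowr_numeral ennreal_power)

lemma KB_add:
 assumes I: "I : sets borel" and fm: "mm f" "mm g" and f: "KB I kappa f" and g: "KB I gamma g" and p: "0 <= kappa" "0 <= gamma"
 shows "KB I (kappa + gamma) (%t x. f t x + g t x)" unfolding KB_def
proof
 fix x
 note [measurable] = I mm_section(1)[OF fm(1), of x] mm_section(1)[OF fm(2), of x]
 have i: "(en (f t x)*ind I t)^.2 = en (f t x)^2*ind I t" for f :: "real => real => complex" and t unfolding epowr_numeral by (simp add: indicator_def)
 have "(NN t. en (f t x + g t x)^2*ind I t) <= (NN t. (en (f t x)*ind I t + en (g t x)*ind I t)^.2)" unfolding distrib_right[symmetric]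
  unfolding i[of "%t x. f t x + g t x", symmetric] ennreal_plus[OF norm_ge_zero norm_ge_zero, symmetric]
  by (intro nn_mono epowr_mono mult_right_mono ennreal_leI norm_triangle_ineq) auto
 also have "... <= (er kappa + er gamma)^.2"
  using f g p by (intro nn_integral_triangle) (auto simp: sigma_lborel i KB_def ennreal_sqr simp del: epowr_ennreal)
 also have "... = er ((kappa + gamma)^2)" using p by (simp add: ennreal_sqr)
 finally show "(NN t. en (f t x + g t x)^2*ind I t) <= er ((kappa + gamma)^2)" .
qed

lemma MB_add:
 assumes f: "MB I kappa f" and g: "MB I gamma g" and p: "0 <= kappa" "0 <= gamma"
 shows "MB I (kappa + gamma) (%t x. f t x + g t x)"
proof -
 obtain B where [measurable]: "bm B" and B: "!!t x. t : I ==> en (f t x) <= B x"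
  and B4: "(NN x. B x^4) <= er (kappa^4)" using f unfolding MB_def by blast
 obtain E where [measurable]: "bm E" and E: "!!t x. t : I ==> en (g t x) <= E x"
  and E4: "(NN x. E x^4) <= er (gamma^4)" using g unfolding MB_def by blast
 have "(NN x. (B x + E x)^.4) <= (er kappa + er gamma)^.4"
  using B4 E4 p by (intro nn_integral_triangle) (auto simp: sigma_lborel epowr_numeral ennreal_power)
 also have "... = er ((kappa + gamma)^4)" using p by (simp add: ennreal_pow4)
 finally have int: "(NN x. (B x + E x)^4) <= er ((kappa + gamma)^4)" unfolding epowr_numeral .
 have le: "en (f t x + g t x) <= B x + E x" if "t : I" for t x
 proof -
  have "en (f t x + g t x) <= er (norm (f t x) + norm (g t x))" by (intro ennreal_leI norm_triangle_ineq)
  also have "... <= B x + E x" using B[OF that, of x] E[OF that, of x] by (simp add: add_mono)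
  finally show ?thesis .
 qed
 show ?thesis by (rule MB_I[OF _ le int]) measurable
qed

text \<open>The two halves live on disjoint times, so squares add up:
  \<open>kappa^2 + (kappa + gamma)^2 <= (sqrt 2*kappa + gamma)^2\<close>. A factor 2 in place of
  \<open>sqrt 2\<close> would destroy the gain from bisecting the forcing.\<close>

lemma KB_orth:
 assumes I: "I : sets borel" and fm: "mm f1" "mm f2" "mm g" and k: "KB I kappa f1" "KB I kappa f2" "KB I gamma g" and p: "0 <= kappa" "0 <= gamma"
  and F: "!!t x. t <= s ==> F t x = f1 t x" "!!t x. s < t ==> F t x = g t x + f2 t x"
 shows "KB I (sqrt 2*kappa + gamma) F" unfolding KB_def
proof
 fix x
 note [measurable] = I mm_section(1)[OF fm(1), of x] mm_section(1)[OF fm(2), of x] mm_section(1)[OF fm(3), of x]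
 have "(NN t. en (F t x)^2*ind I t) <= (NN t. en (f1 t x)^2*ind I t + en (g t x + f2 t x)^2*ind I t)"
 proof (rule nn_mono)
  fix t show "en (F t x)^2*ind I t <= en (f1 t x)^2*ind I t + en (g t x + f2 t x)^2*ind I t" by (cases "t <= s") (simp_all add: F)
 qed
 also have "... = (NN t. en (f1 t x)^2*ind I t) + (NN t. en (g t x + f2 t x)^2*ind I t)" by (rule nn_integral_add) measurable
 also have "... <= er (kappa^2) + er ((gamma + kappa)^2)" using k(1) KB_add[OF I fm(3,2) k(3,2) p(2,1)] unfolding KB_def by (intro add_mono) auto
 also have "... = er (kappa^2 + (gamma + kappa)^2)" by simp
 also have "... <= er ((sqrt 2*kappa + gamma)^2)"
 proof (rule ennreal_leI)
  have "kappa*gamma <= sqrt 2*(kappa*gamma)" using p mult_right_mono[of 1 "sqrt 2" "kappa*gamma"] by simp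
  thus "kappa^2 + (gamma + kappa)^2 <= (sqrt 2*kappa + gamma)^2" by (simp add: power2_sum power_mult_distrib mult_ac)
 qed
 finally show "(NN t. en (F t x)^2*ind I t) <= er ((sqrt 2*kappa + gamma)^2)" .
qed

text \<open>The larger of the majorants of the two halves works, as the fourth power of a maximum is
  at most the sum of the fourth powers. The factor \<open>sqrt 2\<close> is more than fourth powers
  require; it is kept so that one scheme serves both endpoints.\<close>

lemma MB_orth:
 assumes k: "MB I kappa f1" "MB I kappa f2" "MB I gamma g" and p: "0 <= kappa" "0 <= gamma"
  and F: "!!t x. t <= s ==> F t x = f1 t x" "!!t x. s < t ==> F t x = g t x + f2 t x"
 shows "MB I (sqrt 2*kappa + gamma) F"
proof -
 obtain B where [measurable]: "bm B" and B: "!!t x. t : I ==> en (f1 t x) <= B x"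
  and B4: "(NN x. B x^4) <= er (kappa^4)" using k(1) unfolding MB_def by blast
 obtain E where [measurable]: "bm E" and E: "!!t x. t : I ==> en (g t x + f2 t x) <= E x"
  and E4: "(NN x. E x^4) <= er ((gamma + kappa)^4)" using MB_add[OF k(3,2) p(2,1)] unfolding MB_def by blast
 have "(NN x. max (B x) (E x)^4) <= (NN x. B x^4 + E x^4)" by (intro nn_mono) (simp add: max_def)
 also have "... = (NN x. B x^4) + (NN x. E x^4)" by (rule nn_integral_add) measurable
 also have "... <= er (kappa^4) + er ((gamma + kappa)^4)" by (intro add_mono B4 E4)
 also have "... = er (kappa^4 + (gamma + kappa)^4)" using p by (simp add: zero_le_power)
 also have "... <= er ((sqrt 2*kappa + gamma)^4)"
 proof (rule ennreal_leI)
  have "kappa*gamma <= sqrt 2*(kappa*gamma)" using p mult_right_mono[of 1 "sqrt 2" "kappa*gamma"] by simp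
  hence "kappa^2 + (gamma + kappa)^2 <= (sqrt 2*kappa + gamma)^2" by (simp add: power2_sum power_mult_distrib mult_ac)
  hence "(kappa^2 + (gamma + kappa)^2)^2 <= ((sqrt 2*kappa + gamma)^2)^2" by (rule power_mono) simp
  moreover have "(kappa^2)^2 + ((gamma + kappa)^2)^2 <= (kappa^2 + (gamma + kappa)^2)^2" unfolding power2_sum[of "kappa^2"] by simp
  ultimately show "kappa^4 + (gamma + kappa)^4 <= (sqrt 2*kappa + gamma)^4" unfolding power_mult[symmetric] by simp
 qed
 finally have int: "(NN x. max (B x) (E x)^4) <= er ((sqrt 2*kappa + gamma)^4)" .
 have le: "en (F t x) <= max (B x) (E x)" if "t : I" for t x using B[OF that, of x] E[OF that, of x] by (cases "t <= s") (simp_all add: F le_max_iff_disj)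
 show ?thesis by (rule MB_I[OF _ le int]) measurable
qed

lemma nn_integral_le_liminf:
 fixes g :: "nat => 'a => ennreal"
 assumes "!!n. g n : borel_measurable M" "!!n. (\<integral>\<^sup>+x. g n x \<partial>M) <= c"
 shows "(\<integral>\<^sup>+x. liminf (%n. g n x) \<partial>M) <= c"
proof -
 have "(\<integral>\<^sup>+x. liminf (%n. g n x) \<partial>M) <= liminf (%n. \<integral>\<^sup>+x. g n x \<partial>M)" by (rule nn_integral_liminf) fact
 also have "... <= liminf (%n. c)" by (intro Liminf_mono always_eventually allI assms)
 also have "... = c" by (simp add: Liminf_const)
 finally show ?thesis .
qed

lemma KB_limit:
 assumes I: "I : sets borel" and fm: "!!n. mm (f n)" and k: "!!n. KB I kappa (f n)"
  and l: "!!t x. t : I ==> (%n. f n t x) ----> F t x"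
 shows "KB I kappa F" unfolding KB_def
proof
 fix x
 have "en (F t x)^2*ind I t = liminf (%n. en (f n t x)^2*ind I t)" for t
 proof (cases "t : I")
  case True
  have lim: "(%n. er ((norm (f n t x))^2)) ----> er ((norm (F t x))^2)" by (intro tendsto_ennrealI tendsto_power tendsto_norm l True)
  show ?thesis using True lim_imp_Liminf[OF sequentially_bot lim] by (simp only: ennreal_power[OF norm_ge_zero] indicator_simps mult_1_right)
 qed (simp add: Liminf_const)
 moreover have "(NN t. liminf (%n. en (f n t x)^2*ind I t)) <= er (kappa^2)"
 proof (rule nn_integral_le_liminf)
  fix n
  note [measurable] = I mm_section(1)[OF fm, of n x]
  show "bml (%t. en (f n t x)^2*ind I t)" by measurable
 qed (use k in "simp add: KB_def")
 ultimately show "(NN t. en (F t x)^2*ind I t) <= er (kappa^2)" by simp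
qed

lemma MB_limit:
 assumes k: "!!n. MB I kappa (f n)" and l: "!!t x. t : I ==> (%n. f n t x) ----> F t x"
 shows "MB I kappa F"
proof -
 have "\<exists>B. \<forall>n. B n : borel_measurable borel & (\<forall>t\<in>I. \<forall>x. en (f n t x) <= B n x) & (NN x. B n x^4) <= er (kappa^4)"
  using k unfolding MB_def by metis
 then obtain B where [measurable]: "!!n. bm (B n)" and B: "!!n t x. t : I ==> en (f n t x) <= B n x"
  and B4: "!!n. (NN x. B n x^4) <= er (kappa^4)" by blast
 define E where "E x = liminf (%n. B n x^4)^.(1/4)" for x
 have "bm E" unfolding E_def by measurable
 moreover have "E x^4 = liminf (%n. B n x^4)" for x unfolding E_def epowr_numeral[symmetric] epowr_powr by simp
 hence "(NN x. E x^4) <= er (kappa^4)" using nn_integral_le_liminf[of "%n x. B n x^4" lborel] B4 by simp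
 moreover have "en (F t x) <= E x" if t: "t : I" for t x
 proof -
  have "(%n. er ((norm (f n t x))^4)) ----> er ((norm (F t x))^4)" by (intro tendsto_ennrealI tendsto_power tendsto_norm l t)
  hence "er (norm (F t x)^4) = liminf (%n. er (norm (f n t x)^4))" by (rule lim_imp_Liminf[OF sequentially_bot, symmetric])
  also have "... <= liminf (%n. B n x^4)" unfolding ennreal_power[OF norm_ge_zero, symmetric] by (intro Liminf_mono always_eventually allI power_mono B t) simp
  finally have "(er (norm (F t x)^4))^.(1/4) <= E x" unfolding E_def by (rule epowr_mono) simp
  thus ?thesis by (simp add: ennreal_pow4 epowr_powr del: epowr_ennreal)
 qed
 ultimately show ?thesis unfolding MB_def by blast
qed

lemma two_pi_le: "er (2*pi)*er (x^2) <= er ((3*x)^2)"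
proof -
 have "er (2*pi)*er (x^2) <= er 9*er (x^2)" using pi_less_4 by (intro mult_right_mono ennreal_leI) auto
 also have "... = er ((3*x)^2)" unfolding ennreal_mult[OF zero_le_numeral zero_le_power2, symmetric] by (simp add: power_mult_distrib)
 finally show ?thesis .
qed

lemma cis_L2:
 assumes "integrable lborel h" "bm g" "sqn h <= er (c^2)"
 shows "sqn (%x. LI xi. (h xi*cis (g xi))*cis (x*xi)) <= er ((3*c)^2)"
proof -
 have "sqn (%x. LI xi. (h xi*cis (g xi))*cis (x*xi)) <= er (2*pi/1)*(NN xi. en (h xi*cis (g xi))^2)"
  unfolding sqn_def by (rule Bessel_phase) (use assms in "auto intro: integrable_mult_cis")
 also have "... = er (2*pi) * sqn h" by (simp add: sqn_def norm_mult)
 also have "... <= er (2*pi)*er (c^2)" by (intro mult_left_mono assms) simp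
 also have "... <= er ((3*c)^2)" by (rule two_pi_le)
 finally show ?thesis .
qed

section \<open>The Christ-Kiselev argument\<close>

context disp
begin

definition KW where "KW T = enn2real (mx P Q (%t x. er (1/(1 + x^2))*ind {0..T} t))"

text \<open>\<open>P' > 1\<close>, so the forcing need not be integrable over the unbounded space
  variable. Against the weight it is, and this controls its pairing with kernels that decay like
  \<open>1/(1 + x^2)\<close>.\<close>

lemma weight_L1:
 assumes T: "0 <= T" and Rm [measurable]: "mm R" and s: "!!t x. t ~: {0..T} ==> R t x = (0::complex)"
  and rho: "0 <= rho" "mx P' Q' (%t x. en (R t x)) <= er rho"
 shows "(NL z. en (uc R z)*er (1/(1 + (snd z)^2))) <= er (KW T*rho)"
proof -
 let ?w = "%x::real. er (1/(1 + x^2))"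
 let ?g = "%t x. ?w x*ind {0..T} t"
 have "mx P Q ?g < top" by (rule mx_weight) (use PQ T in auto)
 hence K: "mx P Q ?g = er (KW T)" "0 <= KW T" by (simp_all add: KW_def less_top)
 have "(NL z. en (uc R z)*?w (snd z)) = mx 1 1 (%t x. en (R t x)*?w x)" by (rule nn_integral_LL) measurable
 also have "... = mx 1 1 (%t x. en (R t x)*?g t x)" using s by (intro arg_cong[where f="mx 1 1"] ext) (auto simp: indicator_def)
 also have "... <= mx P' Q' (%t x. en (R t x))*mx P Q ?g" using PQ by (intro mx_Holder) auto
 also have "... <= er rho*er (KW T)" unfolding K(1) by (intro mult_right_mono rho) simp
 finally show ?thesis using K rho by (simp add: ennreal_mult mult.commute)
qed

lemma box_L1:
 assumes T: "0 <= T" and Rm: "mm R" and s: "!!t x. t ~: {0..T} | x ~: {-n..n} ==> R t x = (0::complex)"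
  and rho: "0 <= rho" "mx P' Q' (%t x. en (R t x)) <= er rho"
 shows "(NL z. en (uc R z)) <= er ((1 + n^2)*KW T*rho)"
proof -
 have [measurable]: "bmL (%z. uc R z)" using Rm by (simp add: split_beta')
 have "(NL z. en (uc R z)) <= (NL z. er (1 + n^2)*(en (uc R z)*er (1/(1 + (snd z)^2))))"
 proof (rule nn_mono)
  fix z :: "real \<times> real"
  show "en (uc R z) <= er (1 + n^2)*(en (uc R z)*er (1/(1 + (snd z)^2)))"
  proof (cases "snd z : {-n..n}")
   case True
   hence "(snd z)^2 <= n^2" by (intro abs_le_square_iff[THEN iffD1]) auto
   hence "1 <= (1 + n^2)/(1 + (snd z)^2)" by (simp add: add_pos_nonneg)
   from mult_left_mono[OF this, of "norm (uc R z)"]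
   have "norm (uc R z) <= (1 + n^2)*(norm (uc R z)*(1/(1 + (snd z)^2)))" by (simp add: mult_ac)
   thus ?thesis by (simp only: ennreal_leI add_nonneg_nonneg zero_le_one zero_le_power2 norm_ge_zero zero_le_divide_1_iff mult_nonneg_nonneg flip: ennreal_mult)
  qed (use s in simp)
 qed
 also have "... = er (1 + n^2)*(NL z. en (uc R z)*er (1/(1 + (snd z)^2)))" by (rule nn_cmult) measurable
 also have "... <= er (1 + n^2)*er (KW T*rho)" by (intro mult_left_mono weight_L1 T Rm rho) (use s in auto)
 finally show ?thesis using rho by (simp add: KW_def mult.assoc del: ennreal_plus flip: ennreal_mult)
qed

lemma Peetre: "1 + x^2 <= 2*(1 + y^2)*(1 + (x - y)^2)" for x y :: real
proof -
 have "x^2 <= 2*y^2 + 2*(x - y)^2" using zero_le_power2[of "2*y - x"] by (simp add: power2_eq_square algebra_simps)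
 moreover have "0 <= y^2*(x - y)^2" "0 <= y^2" "0 <= (x - y)^2" by simp_all
 moreover have "2*(1 + y^2)*(1 + (x - y)^2) = 2 + 2*y^2 + 2*(x - y)^2 + 2*(y^2*(x - y)^2)"
  by (simp only: distrib_left distrib_right mult_1_left mult_1_right mult_ac add_ac)
 ultimately show ?thesis by linarith
qed

text \<open>With \<open>r = sqrt 2*2 powr (-1/Q')\<close> the improvement of \<open>beta\<close> to
  \<open>r*beta + C\<close> has the fixed point \<open>C/(1 - r)\<close>. Twice this value leaves
  room for what remains of the initial constant after finitely many steps.\<close>

definition ck :: real where "ck = 2/(1 - sqrt 2*2 powr (-1/Q'))"

text \<open>The ratio is below 1 because \<open>Q' < 2\<close>, that is
  \<open>1/Q' > 1/2\<close>.\<close>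

lemma ck_ratio: "0 <= sqrt 2*2 powr (-1/Q')" "sqrt 2*2 powr (-1/Q') < 1" "0 < ck"
proof -
 have "sqrt 2*2 powr (-1/Q') = 2 powr (1/2 + (-1/Q'))" unfolding powr_add by (simp only: powr_half_sqrt zero_le_numeral)
 also have "... < 2 powr 0"
 proof (rule powr_less_mono)
  have "1/2 < 1/Q'" using PQ by (intro divide_strict_left_mono) auto
  thus "1/2 + - 1/Q' < 0" by (simp only: minus_divide_left[symmetric])
 qed simp
 finally show "sqrt 2*2 powr (-1/Q') < 1" by simp
 thus "0 < ck" by (simp add: ck_def)
qed simp

text \<open>The Christ--Kiselev argument: cut the time interval so that both halves of \<open>R\<close> have norm at most
 \<open>2 powr (-1/Q')\<close> times the norm of \<open>R\<close>. On the second half the contribution of the first one is not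
 retarded. A constant \<open>beta\<close> for \<open>ret\<close> improves to \<open>\<surd>2 \<cdot> 2 powr (-1/Q') \<cdot> beta + C\<close>.\<close>

lemma Christ_Kiselev:
 fixes Y :: "real => (real => real => complex) => bool"
 assumes mono: "!!kappa kappa' f. Y kappa f ==> 0 <= kappa ==> kappa <= kappa' ==> Y kappa' f"
  and orth: "!!kappa gamma F f1 f2 g s. mm f1 ==> mm f2 ==> mm g ==> Y kappa f1 ==> Y kappa f2 ==> Y gamma g ==> 0 <= kappa ==> 0 <= gamma ==>
   (!!t x. t <= s ==> F t x = f1 t x) ==> (!!t x. s < t ==> F t x = g t x + f2 t x) ==> Y (sqrt 2*kappa + gamma) F"
  and crude: "0 <= c" "!!E F. 0 <= E ==> mm F ==> (!!t x. t : {0..T} ==> norm (F t x) <= E/(1 + x^2)) ==> Y (c*E) F"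
  and full: "0 < C" "!!R rho. mm R ==> integrable LL (%z. uc R z) ==> 0 <= rho ==>
   mx P' Q' (%t x. en (R t x)) <= er rho ==> Y (C*rho) (A (%xi. b xi*Ast R xi))"
  and b: "integrable lborel b" and T: "0 <= T"
  and dec: "0 <= D" "!!sg z. (abs sg) <= T ==> norm (A b sg z) <= D/(1 + z^2)"
  and R: "mm R" "!!t x. t ~: {0..T} | x ~: {-n..n} ==> R t x = 0" "0 <= rho" "mx P' Q' (%t x. en (R t x)) <= er rho" and n: "0 <= n"
 shows "Y (ck*C*rho) (ret b R)"
proof -
 have [measurable]: "bm b" using b by (auto dest: bmi)
 define K where "K = (1 + n^2)*KW T"
 have K: "0 <= K" by (simp add: K_def KW_def)
 note KR = box_L1[OF T, where n=n, folded K_def]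
 let ?h = "2 powr (-1/Q')"
 define cls where "cls R rho \<longleftrightarrow> mm R & (\<forall>t x. t ~: {0..T} | x ~: {-n..n} --> R t x = (0::complex)) & 0 <= rho &
   mx P' Q' (%t x. en (R t x)) <= er rho" for R rho
 have clsi: "integrable LL (%z. uc R z)" if "cls R rho" for R rho
 proof (rule integrableI_bounded)
  have [measurable]: "mm R" using that by (simp add: cls_def)
  show "bmL (%z. uc R z)" using \<open>mm R\<close> by (simp add: split_beta')
  have "(NL z. en (uc R z)) <= er (K*rho)" using that by (intro KR) (auto simp: cls_def)
  thus "(NL z. en (uc R z)) < \<infinity>" by (simp add: le_less_trans[OF _ ennreal_less_top])
 qed
 define r where "r = sqrt 2*2 powr (-1/Q')"
 have r: "0 <= r" "r < 1" using ck_ratio by (auto simp: r_def)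
 \<comment> \<open>A crude constant that depends on the box and on \<open>T\<close>. It only has to
   be finite, since the iteration multiplies it by \<open>r^N\<close>.\<close>
 define beta0 where "beta0 = c*(2*(1 + n^2)*D*K)"
 have beta0: "0 <= beta0" using crude(1) dec(1) K by (simp add: beta0_def)
 define beta where "beta N = r^N*beta0 + C*(\<Sum>i<N. r^i)" for N
 have betap: "0 <= beta N" for N using r beta0 full(1) by (simp add: beta_def sum_nonneg)
 let ?D = "%x. 2*(1 + n^2)*D/(1 + x^2)"
 have base: "Y (beta0*rho) (ret b R)" if "cls R rho" for R rho
 proof -
  have Rs: "R t x = 0" if "t ~: {0..T} | x ~: {-n..n}" for t x using \<open>cls R rho\<close> that by (simp add: cls_def)
  have [measurable]: "mm R" and rho: "0 <= rho" using that by (auto simp: cls_def)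
  have "norm (ret b R t x) <= (2*(1 + n^2)*D*K*rho)/(1 + x^2)" if t: "t : {0..T}" for t x
  proof -
   have "en (ret b R t x) <= (NL z. en (uc R z*ind {..t} (fst z)*A b (t - fst z) (x - snd z)))"
    unfolding ret_def by (rule norm_integral_le_nn)
   also have "... <= (NL z. er (?D x)*en (uc R z))"
   proof (rule nn_mono)
    fix z :: "real \<times> real"
    let ?tau = "fst z" and ?y = "snd z"
    have "norm (R ?tau ?y*ind {..t} ?tau*A b (t - ?tau) (x - ?y)) <= ?D x*norm (R ?tau ?y)"
    proof (cases "?tau : {0..T} & ?y : {-n..n}")
     case True
     hence "norm (A b (t - ?tau) (x - ?y)) <= D/(1 + (x - ?y)^2)" using t by (intro dec) auto
     also have "... <= ?D x"
     proof -
      have "?y\<^sup>2 <= n^2" using True by (intro abs_le_square_iff[THEN iffD1]) auto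
      hence "1 + x^2 <= 2*(1 + n^2)*(1 + (x - ?y)^2)"
       using Peetre[of x ?y] by (meson add_left_mono mult_left_mono mult_right_mono order_trans zero_le_numeral add_nonneg_nonneg zero_le_one zero_le_power2)
      hence "D*(1 + x^2) <= D*(2*(1 + n^2)*(1 + (x - ?y)^2))" using dec(1) by (rule mult_left_mono)
      hence "D <= (2*(1 + n^2)*D*(1 + (x - ?y)^2))/(1 + x^2)" by (subst pos_le_divide_eq) (simp_all only: mult_ac add_pos_nonneg zero_less_one zero_le_power2)
      thus ?thesis by (intro mult_imp_div_pos_le) (simp_all only: times_divide_eq_left add_pos_nonneg zero_less_one zero_le_power2)
     qed
     finally show ?thesis unfolding norm_mult by (subst mult.commute) (intro mult_mono, auto simp: indicator_def dec(1) norm_mult)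
    qed (simp add: Rs norm_mult)
    thus "en (R ?tau ?y*ind {..t} ?tau*A b (t - ?tau) (x - ?y)) <= er (?D x)*en (R ?tau ?y)"
     using dec(1) by (simp add: ennreal_leI flip: ennreal_mult)
   qed
   also have "... = er (?D x)*(NL z. en (uc R z))" by (rule nn_cmult) measurable
   also have "... <= er (?D x)*er (K*rho)" using \<open>cls R rho\<close> by (intro mult_left_mono KR) (auto simp: cls_def)
   also have "... = er ((2*(1 + n^2)*D*K*rho)/(1 + x^2))" using dec(1) K rho by (simp add: mult_ac flip: ennreal_mult)
   finally show ?thesis using dec(1) K rho by (subst (asm) ennreal_le_iff) auto
  qed
  hence "Y (c*(2*(1 + n^2)*D*K*rho)) (ret b R)" using dec(1) K rho by (intro crude) auto
  thus ?thesis by (simp add: beta0_def mult_ac)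
 qed
 have step: "Y (beta N*rho) (ret b R)" if "cls R rho" for N R rho using that
 proof (induction N arbitrary: R rho)
  case 0 thus ?case using base by (simp add: beta_def)
 next
  case (Suc N)
  have Rm [measurable]: "mm R" and rho: "0 <= rho" using Suc.prems by (auto simp: cls_def)
  obtain s where s: "mx P' Q' (%t x. en (R t x)*ind {..s} t) <= er (?h*rho)" "mx P' Q' (%t x. en (R t x)*ind {s<..} t) <= er (?h*rho)"
   using mx_bisect[of "%t x. en (R t x)" P' Q' T rho] Suc.prems T PQ by (auto simp: cls_def)
  define R1 where "R1 = (%tau y. R tau y*ind {..s} tau)"
  define R2 where "R2 = (%tau y. R tau y*ind {s<..} tau)"
  have e1: "(%t x. en (R1 t x)) = (%t x. en (R t x)*ind {..s} t)" by (intro ext) (simp add: R1_def indicator_def)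
  have e2: "(%t x. en (R2 t x)) = (%t x. en (R t x)*ind {s<..} t)" by (intro ext) (simp add: R2_def indicator_def)
  have [measurable]: "mm R1" "mm R2" unfolding R1_def R2_def by measurable
  have c1: "cls R1 (?h*rho)" and c2: "cls R2 (?h*rho)"
   using Suc.prems s \<open>mm R1\<close> \<open>mm R2\<close> unfolding cls_def e1 e2 by (auto simp: R1_def R2_def)
  have i1: "integrable LL (%z. uc R1 z)" by (rule clsi[OF c1])
  have sp: "t <= s ==> ret b R t x = ret b R1 t x" "s < t ==> ret b R t x = A (%xi. b xi*Ast R1 xi) t x + ret b R2 t x" for t x
   unfolding R1_def R2_def using ret_split[OF b clsi[OF Suc.prems], where s=s and t=t and x=x] by blast+
  have "Y (sqrt 2*(beta N*(?h*rho)) + C*rho) (ret b R)"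
  proof (rule orth[where ?f1.0="ret b R1" and ?f2.0="ret b R2" and g="A (%xi. b xi*Ast R1 xi)" and s=s])
   have "mx P' Q' (%t x. en (R1 t x)) <= er rho" unfolding e1 using mx_indicator_mono[of "{..s}" UNIV P' Q' "%t x. en (R t x)"] Suc.prems PQ
    by (auto simp: cls_def intro: order_trans)
   thus "Y (C*rho) (A (%xi. b xi*Ast R1 xi))" by (intro full(2) rho i1) measurable
   show "mm (A (%xi. b xi*Ast R1 xi))" by measurable
  qed (use Suc.IH[OF c1] Suc.IH[OF c2] rho betap full(1) sp in "auto intro!: ret_measurable")
  moreover have "sqrt 2*(beta N*(?h*rho)) + C*rho = beta (Suc N)*rho"
  proof -
   have "beta (Suc N) = r*beta N + C" unfolding beta_def sum.lessThan_Suc_shift by (simp add: algebra_simps sum_distrib_left)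
   thus ?thesis by (simp add: r_def algebra_simps)
  qed
  ultimately show ?case by simp
 qed
 have "(%N. r^N*beta0) ----> 0" using r by (intro tendsto_mult_left_zero LIMSEQ_realpow_zero) auto
 moreover have "0 < C/(1 - r)" using full(1) r by simp
 ultimately have "eventually (%N. r^N*beta0 < C/(1 - r)) sequentially" by (rule order_tendstoD(2))
 then obtain N where N: "r^N*beta0 < C/(1 - r)" by (auto simp: eventually_sequentially)
 have "C*(\<Sum>i<N. r^i) <= C*(1/(1 - r))" using full(1) r by (intro mult_left_mono) (auto simp: sum_gp_strict divide_simps)
 hence "beta N <= ck*C"
 proof -
  have "ck*C = C/(1 - r) + C*(1/(1 - r))" unfolding ck_def r_def[symmetric] by simp
  thus ?thesis using N \<open>C * (\<Sum>i<N. r ^ i) <= C * (1 / (1 - r))\<close> unfolding beta_def by linarith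
 qed
 hence le: "beta N*rho <= ck*C*rho" using R(3) by (rule mult_right_mono)
 have "cls R rho" using R by (simp add: cls_def)
 hence "Y (beta N*rho) (ret b R)" by (rule step)
 thus ?thesis using mult_nonneg_nonneg[OF betap R(3)] le by (rule mono)
qed

text \<open>\<open>H\<close> is the dual estimate \<open>180*a powr (-1/2)\<close> times the size
  \<open>beta\<close> of the multiplier. Forcing supported in a box is integrable, as both the crude
  initial bound and the unretarded estimate require; the resulting constants do not depend on the
  box.\<close>

lemma retarded_class:
 assumes b: "integrable lborel b" "!!xi. xi ~: Lam a ==> b xi = 0" "!!xi. norm (b xi) <= beta" and a: "0 < a" and beta: "0 < beta"
  and T: "0 <= T" and dec: "0 <= D" "!!sg z. (abs sg) <= T ==> norm (A b sg z) <= D/(1 + z^2)"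
  and R: "mm R" "!!t x. t ~: {0..T} | x ~: {-n..n} ==> R t x = 0" "0 <= rho" "mx P' Q' (%t x. en (R t x)) <= er rho" and n: "0 <= n"
 defines "H \<equiv> beta*(180*a powr (-1/2))"
 shows "KB {0..T} (ck*(3*a powr (- alpha/2)*H)*rho) (ret b R)"
  and "MB {0..T} (ck*(60*a powr (1/4)*H)*rho) (ret b R)"
  and "sqn (ret b R t) <= er ((3*H*rho)^2)"
proof -
 have [measurable]: "bm b" using b by (auto dest: bmi)
 have H0: "0 < H" using beta a by (simp add: H_def)
 have hs: "sqn (%xi. b xi*Ast R xi) <= er ((H*rho)^2)" and hi: "integrable lborel (%xi. b xi*Ast R xi)"
  if [measurable]: "mm R" and i: "integrable LL (%z. uc R z)"
   and rho: "0 <= rho" "mx P' Q' (%t x. en (R t x)) <= er rho" for R rho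
 proof -
  have "sqn (%xi. b xi*Ast R xi) <= (NN xi. er (beta^2)*en (ind (Lam a) xi*Ast R xi)^2)" unfolding sqn_def
  proof (rule nn_mono)
   fix xi
   have "norm (b xi*Ast R xi) <= beta*norm (ind (Lam a) xi*Ast R xi)" using b(2,3)[of xi] by (cases "xi : Lam a") (simp_all add: norm_mult mult_right_mono)
   hence "en (b xi*Ast R xi)^2 <= er (beta*norm (ind (Lam a) xi*Ast R xi))^2" by (intro power_mono ennreal_leI) auto
   thus "en (b xi*Ast R xi)^2 <= er (beta^2)*en (ind (Lam a) xi*Ast R xi)^2"
    using beta by (simp only: ennreal_mult less_imp_le norm_ge_zero power_mult_distrib ennreal_power)
  qed
  also have "... = er (beta^2) * sqn (%xi. ind (Lam a) xi*Ast R xi)" unfolding sqn_def by (rule nn_cmult) measurable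
  also have "... <= er (beta^2)*er ((180*a powr (-1/2)*rho)^2)" by (intro mult_left_mono dual i rho a) auto
  finally show "sqn (%xi. b xi*Ast R xi) <= er ((H*rho)^2)" by (simp add: H_def power_mult_distrib mult_ac flip: ennreal_mult)
  define E where "E = (LINT z|LL. norm (uc R z))"
  show "integrable lborel (%xi. b xi*Ast R xi)"
  proof (rule integrable_le[OF integrable_mult_right[OF integrable_norm[OF b(1)], of E]])
   fix xi
   have "norm (Ast R xi) <= (LINT z|LL. norm (uc R z*cis (- (snd z*xi - fst z * om alpha xi))))" unfolding Ast_def by (rule integral_norm_bound)
   hence "norm (Ast R xi) <= E" by (simp add: E_def norm_mult)
   thus "norm (b xi*Ast R xi) <= E*norm (b xi)" unfolding norm_mult by (subst mult.commute) (rule mult_right_mono, simp_all)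
  qed measurable
 qed
 have full: "KB {0..T} (3*a powr (- alpha/2)*H*rho) (A (%xi. b xi*Ast R xi))" "MB {0..T} (60*a powr (1/4)*H*rho) (A (%xi. b xi*Ast R xi))"
  if "mm R" and i: "integrable LL (%z. uc R z)"
   and rho: "0 <= rho" "mx P' Q' (%t x. en (R t x)) <= er rho" for R rho
 proof -
  have "KB UNIV (3*a powr (- alpha/2)*(H*rho)) (A (%xi. b xi*Ast R xi))" by (rule Kato[OF hi[OF that] _ a]) (use b(2) hs[OF that] alpha in auto)
  thus "KB {0..T} (3*a powr (- alpha/2)*H*rho) (A (%xi. b xi*Ast R xi))" unfolding mult.assoc by (rule KB_subset) simp
  have "MB UNIV (60*a powr (1/4)*(H*rho)) (A (%xi. b xi*Ast R xi))" by (rule maximal[OF hi[OF that] _ a]) (use b(2) hs[OF that] alpha H0 rho in auto)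
  thus "MB {0..T} (60*a powr (1/4)*H*rho) (A (%xi. b xi*Ast R xi))" unfolding mult.assoc by (rule MB_subset) simp
 qed
 show "KB {0..T} (ck*(3*a powr (- alpha/2)*H)*rho) (ret b R)"
 proof (rule Christ_Kiselev[where Y="KB {0..T}" and c="sqrt T", OF _ _ _ _ _ _ b(1) T dec R n])
  show "KB {0..T} (sqrt T*E) F" if E: "0 <= E" and F: "!!t x. t : {0..T} ==> norm (F t x) <= E/(1 + x^2)" for E F unfolding KB_def
  proof
   fix x
   have "(NN t. en (F t x)^2*ind {0..T} t) <= (NN t. er (E^2)*ind {0..T} t)"
   proof (rule nn_mono)
    fix t
    have "norm (F t x) <= E" if "t : {0..T}"
    using decay_le[OF E, of x] F[OF that, of x] by linarith
    thus "en (F t x)^2*ind {0..T} t <= er (E^2)*ind {0..T} t" unfolding ennreal_power[OF norm_ge_zero] by (auto simp: indicator_def intro!: ennreal_leI power_mono)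
   qed
   also have "... = er ((sqrt T*E)^2)" using T by (subst nn_cmult) (auto simp: power_mult_distrib mult.commute simp flip: ennreal_mult)
   finally show "(NN t. en (F t x)^2*ind {0..T} t) <= er ((sqrt T*E)^2)" .
  qed
  show "0 < 3*a powr (- alpha/2)*H" using a H0 by simp
  show "KB {0..T} kappa' f" if "KB {0..T} kappa f" "0 <= kappa" "kappa <= kappa'" for kappa kappa' f by (rule KB_mono[OF that])
  show "KB {0..T} (sqrt 2*kappa + gamma) F" if "mm f1" "mm f2" "mm g" and k: "KB {0..T} kappa f1" "KB {0..T} kappa f2" "KB {0..T} gamma g" "0 <= kappa" "0 <= gamma"
    "!!t x. t <= s ==> F t x = f1 t x" "!!t x. s < t ==> F t x = g t x + f2 t x" for kappa gamma F f1 f2 g s by (rule KB_orth[OF _ that]) simp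
 qed (use full(1) T in auto)
 define L where "L = (LI x. 1/(1 + x^2 :: real))"
 have L: "0 <= L" unfolding L_def by (intro Bochner_Integration.integral_nonneg) (auto simp: add_nonneg_nonneg)
 \<comment> \<open>Adding 1 ensures \<open>c >= 1\<close> and hence \<open>L <= c^4\<close>, since
   the constant enters the bound through its fourth power.\<close>
 define c where "c = L + 1"
 have c0: "0 <= c" using L by (simp add: c_def)
 show "MB {0..T} (ck*(60*a powr (1/4)*H)*rho) (ret b R)"
 proof (rule Christ_Kiselev[where Y="MB {0..T}" and c=c, OF _ _ _ _ _ _ b(1) T dec R n])
  show "MB {0..T} (c*E) F" if E: "0 <= E" and F: "!!t x. t : {0..T} ==> norm (F t x) <= E/(1 + x^2)" for E F
  proof (rule MB_I[of "%x. er (E/(1 + x^2))"])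
   have "(NN x. er (E/(1 + x^2))^4) <= (NN x. er (E^4*(1/(1 + x^2))))"
   proof (rule nn_mono)
    fix x :: real
    have p: "0 < 1 + x^2" by (simp add: add_pos_nonneg)
    have "(1 + x^2)^1 <= (1 + x^2)^4" by (rule power_increasing) auto
    hence "(E/(1 + x^2))^4 <= E^4*(1/(1 + x^2))" unfolding power_divide using E p by (simp add: divide_left_mono mult_pos_pos zero_less_power)
    thus "er (E/(1 + x^2))^4 <= er (E^4*(1/(1 + x^2)))" using E by (subst ennreal_power) (auto intro: ennreal_leI)
   qed
   also have "... = er (LI x. E^4*(1/(1 + x^2)))"
    using E by (intro nn_integral_eq_integral integrable_mult_right integrable_inverse_1_plus_sq) (auto simp: add_nonneg_nonneg)
   also have "... <= er ((c*E)^4)"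
   proof (rule ennreal_leI)
    have "L <= c^1" by (simp add: c_def)
    also have "... <= c^4" using L by (intro power_increasing) (auto simp: c_def)
    finally show "(LI x. E^4*(1/(1 + x^2))) <= (c*E)^4" unfolding power_mult_distrib LI_mult L_def[symmetric]
     by (subst mult.commute) (rule mult_right_mono, simp_all)
   qed
   finally show "(NN x. er (E/(1 + x^2))^4) <= er ((c*E)^4)" .
  qed (use F in "auto intro: ennreal_leI")
  show "0 < 60*a powr (1/4)*H" using a H0 by simp
  show "MB {0..T} kappa' f" if "MB {0..T} kappa f" "0 <= kappa" "kappa <= kappa'" for kappa kappa' f by (rule MB_mono[OF that])
  show "MB {0..T} (sqrt 2*kappa + gamma) F" if "mm f1" "mm f2" "mm g" and k: "MB {0..T} kappa f1" "MB {0..T} kappa f2" "MB {0..T} gamma g" "0 <= kappa" "0 <= gamma"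
    "!!t x. t <= s ==> F t x = f1 t x" "!!t x. s < t ==> F t x = g t x + f2 t x" for kappa gamma F f1 f2 g s by (rule MB_orth[OF k])
 qed (use full(2) L c0 in auto)
 show "sqn (ret b R t) <= er ((3*H*rho)^2)"
 proof -
  note [measurable] = R(1)
  have "(NL z. en (uc R z)) < top" by (rule le_less_trans[OF box_L1[OF T R] ennreal_less_top])
  hence i: "integrable LL (%z. uc R z)" using R(1) by (intro integrableI_bounded) (auto simp: split_beta')
  define R1 where "R1 = (%tau y. R tau y*ind {..t} tau)"
  have m1: "mm R1" unfolding R1_def by measurable
  have i1: "integrable LL (%z. uc R1 z)" unfolding R1_def by (rule integrable_indicator_time[OF i]) simp
  have "mx P' Q' (%tau y. en (R1 tau y)) <= mx P' Q' (%t x. en (R t x))" using PQ by (intro mx_mono ennreal_leI) (auto simp: R1_def indicator_def)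
  hence rho1: "mx P' Q' (%tau y. en (R1 tau y)) <= er rho" using R(4) by (rule order_trans)
  let ?h = "%xi. b xi*Ast R1 xi"
  note hh = hs[OF m1 i1 R(3) rho1] hi[OF m1 i1 R(3) rho1]
  have "ret b R t x = (LI xi. (?h xi*cis (- (t * om alpha xi)))*cis (x*xi))" for x unfolding ret_eq_A[OF b(1) i] R1_def[symmetric] Aop_def
   by (simp add: mult.assoc cis_mult)
  hence "sqn (ret b R t) = sqn (%x. LI xi. (?h xi*cis (- (t * om alpha xi)))*cis (x*xi))" by (simp add: sqn_def)
  also have "... <= er ((3*(H*rho))^2)" by (rule cis_L2[OF hh(2) _ hh(1)]) measurable
  finally show ?thesis by (simp only: mult.assoc)
 qed
qed

text \<open>The forcing is cut off to \<open>{-n..n}\<close> in space. With \<open>Peetre\<close>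
  the decay of the kernel gives a majorant independent of \<open>n\<close>, so the retarded
  integrals converge pointwise, and the bounds, also independent of \<open>n\<close>, survive by
  Fatou.\<close>

lemma retarded:
 assumes b: "integrable lborel b" "!!xi. xi ~: Lam a ==> b xi = 0" "!!xi. norm (b xi) <= beta" and a: "0 < a" and beta: "0 < beta"
  and T: "0 <= T" and dec: "0 <= D" "!!sg z. (abs sg) <= T ==> norm (A b sg z) <= D/(1 + z^2)"
  and R: "mm R" "!!t x. t ~: {0..T} ==> R t x = 0" "0 <= rho" "mx P' Q' (%t x. en (R t x)) <= er rho"
 defines "H \<equiv> beta*(180*a powr (-1/2))"
 shows "KB {0..T} (ck*(3*a powr (- alpha/2)*H)*rho) (ret b R)"
  and "MB {0..T} (ck*(60*a powr (1/4)*H)*rho) (ret b R)"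
  and "!!t. t : {0..T} ==> sqn (ret b R t) <= er ((3*H*rho)^2)"
  and "!!t x. t : {0..T} ==> integrable LL (%z. uc R z*ind {..t} (fst z)*A b (t - fst z) (x - snd z))"
proof -
 let ?k = "%t x z. uc R z*ind {..t} (fst z)*A b (t - fst z) (x - snd z)" and ?w = "%z. norm (uc R z)*(1/(1 + (snd z)^2))"
 note [measurable] = R(1)
 have Rm [measurable]: "bmL (%z. uc R z)" using R(1) by (simp add: split_beta')
 have bm [measurable]: "bm b" using b by (auto dest: bmi)
 have Am [measurable]: "bmL (%z. A b (t - fst z) (x - snd z))" for t x
 proof -
  have "bmL (%z. case (t - fst z, x - snd z) of (t, x) => A b t x)" by (rule measurable_compose[of _ _ "LL"]) measurable
  thus ?thesis by simp
 qed
 define Rn where "Rn n = (%t x. R t x*ind {- real n..real n} x)" for n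
 have Rnm: "mm (Rn n)" for n unfolding Rn_def by measurable
 have Rnrho: "mx P' Q' (%t x. en (Rn n t x)) <= er rho" for n
 proof -
  have "mx P' Q' (%t x. en (Rn n t x)) <= mx P' Q' (%t x. en (R t x))" using PQ by (intro mx_mono ennreal_leI) (auto simp: Rn_def indicator_def)
  thus ?thesis using R(4) by (rule order_trans)
 qed
 have Rn0: "t ~: {0..T} | x ~: {- real n..real n} ==> Rn n t x = 0" for n t x using R(2) by (auto simp: Rn_def)
 note cl = retarded_class[OF b a beta T dec Rnm Rn0 R(3) Rnrho of_nat_0_le_iff, folded H_def]
 have w0: "0 <= 1/(1 + x^2)" for x :: real by (simp add: add_nonneg_nonneg)
 have "(NL z. en (uc R z)*er (1/(1 + (snd z)^2))) < top" by (rule le_less_trans[OF weight_L1[OF T R] ennreal_less_top])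
 hence wi: "integrable LL ?w"
 proof (intro integrableI_bounded)
  have "en (?w z) = en (uc R z)*er (1/(1 + (snd z)^2))" for z :: "real \<times> real"
   by (subst ennreal_mult[OF norm_ge_zero w0, symmetric]) (simp only: norm_mult real_norm_def abs_mult abs_norm_cancel abs_of_nonneg[OF w0])
  thus "(NL z. en (uc R z)*er (1/(1 + (snd z)^2))) < top ==>
   (NL z. en (?w z)) < \<infinity>" by (simp only: infinity_ennreal_def)
 qed measurable
 have dom: "norm (?k t x z) <= 2*(1 + x^2)*D*(?w z)"
  if "t : {0..T}" for t x z
 proof (cases "fst z : {0..T}")
  case True
  have "norm (A b (t - fst z) (x - snd z)) <= D/(1 + (x - snd z)^2)" using that True by (intro dec) auto
  also have "... <= 2*(1 + x^2)*D/(1 + (snd z)^2)"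
  proof -
   have "1 + (snd z)^2 <= 2*(1 + x^2)*(1 + (x - snd z)^2)" using Peetre[of "snd z" x] by (simp add: power2_commute)
   hence "D*(1 + (snd z)^2) <= D*(2*(1 + x^2)*(1 + (x - snd z)^2))" using dec(1) by (rule mult_left_mono)
   hence "D <= (2*(1 + x^2)*D*(1 + (x - snd z)^2))/(1 + (snd z)^2)" by (subst pos_le_divide_eq) (simp_all only: mult_ac add_pos_nonneg zero_less_one zero_le_power2)
   thus ?thesis by (intro mult_imp_div_pos_le) (simp_all only: times_divide_eq_left add_pos_nonneg zero_less_one zero_le_power2)
  qed
  finally have "norm (uc R z*ind {..t} (fst z))*norm (A b (t - fst z) (x - snd z)) <= norm (uc R z)*(2*(1 + x^2)*D/(1 + (snd z)^2))"
   by (intro mult_mono) (auto simp: indicator_def norm_mult)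
  thus ?thesis by (simp add: norm_mult mult_ac)
 qed (simp add: R(2))
 show int: "integrable LL (?k t x)" if "t : {0..T}" for t x
  by (rule integrable_le[OF integrable_mult_right[OF wi, of "2*(1 + x^2)*D"] _ dom[OF that]]) measurable
 have lim: "(%n. ret b (Rn n) t x) ----> ret b R t x" if t: "t : {0..T}" for t x unfolding ret_def
 proof (rule integral_dominated_convergence[where w="%z. 2*(1 + x^2)*D*(?w z)"])
  show "integrable LL (%z. 2*(1 + x^2)*D*(?w z))" by (rule integrable_mult_right[OF wi])
  show "AE z in LL. (%n. Rn n (fst z) (snd z)*ind {..t} (fst z)*A b (t - fst z) (x - snd z)) ----> ?k t x z"
  proof (rule AE_I2, rule tendsto_eventually)
   fix z :: "real \<times> real"
   obtain N :: nat where "\<bar>snd z\<bar> <= real N" using real_arch_simple by blast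
   thus "\<forall>\<^sub>F n in sequentially. Rn n (fst z) (snd z)*ind {..t} (fst z)*A b (t - fst z) (x - snd z) = ?k t x z"
    by (intro eventually_sequentiallyI[of N]) (auto simp: Rn_def indicator_def)
  qed
  show "AE z in LL. norm (Rn n (fst z) (snd z)*ind {..t} (fst z)*A b (t - fst z) (x - snd z)) <= 2*(1 + x^2)*D*(?w z)" for n
  proof (rule AE_I2, rule order_trans[OF _ dom[OF t]])
   fix z :: "real \<times> real"
   show "norm (Rn n (fst z) (snd z)*ind {..t} (fst z)*A b (t - fst z) (x - snd z)) <= norm (?k t x z)"
    by (auto simp: Rn_def indicator_def)
  qed
  show "bmL (%z. Rn n (fst z) (snd z)*ind {..t} (fst z)*A b (t - fst z) (x - snd z))" for n unfolding Rn_def by measurable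
 qed measurable
 show "KB {0..T} (ck*(3*a powr (- alpha/2)*H)*rho) (ret b R)" by (rule KB_limit[OF _ ret_measurable[OF bm Rnm] cl(1) lim]) simp_all
 show "MB {0..T} (ck*(60*a powr (1/4)*H)*rho) (ret b R)" by (rule MB_limit[OF cl(2) lim])
 show "sqn (ret b R t) <= er ((3*H*rho)^2)" if t: "t : {0..T}" for t
 proof -
  have eq: "en (ret b R t x)^2 = liminf (%n. en (ret b (Rn n) t x)^2)" for x
  proof -
   have "(%n. er ((norm (ret b (Rn n) t x))^2)) ----> er ((norm (ret b R t x))^2)" by (intro tendsto_ennrealI tendsto_power tendsto_norm lim t)
   from lim_imp_Liminf[OF sequentially_bot this] show ?thesis by (simp only: ennreal_power[OF norm_ge_zero])
  qed
  have "bml (%x. en (ret b (Rn n) t x)^2)" for n using mm_section(2)[OF ret_measurable[OF bm Rnm[of n]], of t] by measurable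
  thus ?thesis unfolding sqn_def eq by (rule nn_integral_le_liminf) (use cl(3) in "simp add: sqn_def")
 qed
qed

end

section \<open>Dyadic sums and frequency pieces\<close>

abbreviation zsum :: "(int => ennreal) => ennreal" where "zsum f \<equiv> \<integral>\<^sup>+l. f l \<partial>count_space UNIV"

lemma zsum_shift: "zsum (%l. f (l + m)) = zsum f"
proof -
 have "bij (%l. l + m)" by (rule bij_betwI[of _ _ _ "%l. l - m"]) auto
 thus ?thesis by (rule nn_integral_bij_count_space)
qed

lemma zsum_uminus: "zsum (%l. f (- l)) = zsum f" by (rule nn_integral_bij_count_space) (rule bij_betwI[of _ _ _ uminus], auto)

lemma zsum_mono: "(!!l. f l <= g l) ==> zsum f <= zsum g" by (rule nn_mono)

lemma zsum_ge: "f l <= zsum f" by (rule nn_integral_ge_point) simp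

lemma zsum_nat: "zsum f = (\<Sum>n. f (int_decode n))"
proof -
 have "zsum f = (\<integral>\<^sup>+n. f (int_decode n) \<partial>count_space UNIV)" by (rule nn_integral_bij_count_space[symmetric]) (rule bij_int_decode)
 thus ?thesis by (simp add: nn_integral_count_space_nat)
qed

lemma zsum_geo:
 assumes "0 < c"
 shows "zsum (%l. er (2 powr (- (c*\<bar>ri l\<bar>)))) < top"
proof -
 let ?f = "%l::int. er (2 powr (- (c*\<bar>ri l\<bar>)))"
 have r: "0 < 2 powr (- c)" "2 powr (- c) < (1::real)" using assms powr_less_mono[of "- c" 0 "2::real"] by auto
 have "zsum (%l. ?f l*ind {0..} l) = (\<integral>\<^sup>+l. ?f l \<partial>count_space {0..})" by (rule nn_integral_count_space_indicator[symmetric]) simp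
 also have "... = (\<integral>\<^sup>+n. ?f (int n) \<partial>count_space UNIV)" by (rule nn_integral_bij_count_space[symmetric]) (rule bij_betwI[of _ _ _ nat], auto)
 also have "... = (\<Sum>n. er ((2 powr (- c))^n))" by (simp add: nn_integral_count_space_nat powr_powr flip: powr_realpow)
 also have "... = er (\<Sum>n. (2 powr (- c))^n)" using r by (intro suminf_ennreal2) (auto intro: summable_geometric)
 finally have n: "zsum (%l. ?f l*ind {0..} l) < top" by simp
 have "zsum ?f <= zsum (%l. ?f l*ind {0..} l + ?f (- l)*ind {0..} (- l))" by (rule zsum_mono) (auto simp: indicator_def)
 also have "... = zsum (%l. ?f l*ind {0..} l) + zsum (%l. ?f (- l)*ind {0..} (- l))" by (rule nn_integral_add) auto
 also have "zsum (%l. ?f (- l)*ind {0..} (- l)) = zsum (%l. ?f l*ind {0..} l)" by (rule zsum_uminus)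
 also have "zsum (%l. ?f l*ind {0..} l) + zsum (%l. ?f l*ind {0..} l) < top" using n by simp
 finally show ?thesis .
qed

definition geo :: "real => real" where "geo c = enn2real (zsum (%l. er (2 powr (- (c*\<bar>ri l\<bar>)))))"

lemma geo: "0 < c ==> zsum (%l. er (2 powr (- (c*\<bar>ri l\<bar>)))) = er (geo c)" "0 <= geo c" using zsum_geo[of c] by (simp_all add: geo_def less_top)

lemma geo_pos: "0 < c ==> 0 < geo c"
proof -
 assume "0 < c"
 hence "er 1 <= er (geo c)" using zsum_ge[of "%l. er (2 powr (- (c*\<bar>ri l\<bar>)))" 0] geo(1)[of c] by simp
 thus ?thesis using geo(2)[of c] by (subst (asm) ennreal_le_iff) auto
qed

definition hed :: "real => real => real" where "hed a b = 2 powr (min a b)*geo (min a b)"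

text \<open>One bound decays in \<open>l\<close> and the other grows, so the sum is comparable with
  the value where they cross, up to geometric series on both sides. The exponents are those for
  which the powers of 2 cancel at the crossing.\<close>

lemma Hedberg:
 assumes ab: "0 < a" "0 < b"
  and yV: "!!l. y l <= er (2 powr (- (a*ri l)))*V" and yB: "!!l. y l <= er (pw b l)*B"
 shows "zsum y <= er (hed a b)*(V^.(b/(a + b))*B^.(a/(a + b)))"
proof -
 define c where "c = min a b"
 have c: "0 < c" "c <= a" "c <= b" using ab by (auto simp: c_def)
 have hp: "0 < hed a b" unfolding hed_def c_def[symmetric] using geo_pos[OF c(1)] by simp
 consider "V = 0 | B = 0" | "V ~= 0" "B ~= 0" "V = top | B = top" | "V ~= 0" "B ~= 0" "V ~= top" "B ~= top" by blast
 thus ?thesis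
 proof cases
  case 1
  hence "y l = 0" for l using yV[of l] yB[of l] by auto
  thus ?thesis by simp
 next
  case 2
  hence "V^.(b/(a + b))*B^.(a/(a + b)) = top" by (auto simp: ennreal_top_mult ennreal_mult_top)
  thus ?thesis using hp by (simp add: ennreal_mult_top)
 next
  case 3
  define v where "v = enn2real V"
  define w where "w = enn2real B"
  have vw: "V = er v" "B = er w" "0 < v" "0 < w" using 3 by (simp_all add: v_def w_def less_top enn2real_positive_iff zero_less_iff_neq_zero)
  \<comment> \<open>The real scale at which the two bounds cross; \<open>A\<close> is their common
    value there.\<close>
  define L where "L = log 2 (v/w)/(a + b)"
  define A where "A = v powr (b/(a + b))*w powr (a/(a + b))"
  have A0: "0 < A" using vw by (simp add: A_def)
  have pL: "2 powr (r*L) = v powr (r/(a + b))/w powr (r/(a + b))" for r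
  proof -
   have "2 powr (r*L) = (2 powr log 2 (v/w)) powr (r/(a + b))" by (simp add: L_def powr_powr mult.commute)
   also have "2 powr log 2 (v/w) = v/w" using vw by simp
   finally show ?thesis using vw by (simp add: powr_divide)
  qed
  have e: "b/(a + b) + a/(a + b) = 1" using ab by (simp flip: add_divide_distrib)
  have vv: "v = v powr (b/(a + b)) * v powr (a/(a + b))" using e vw by (simp flip: powr_add)
  have ww: "w = w powr (b/(a + b))*w powr (a/(a + b))" using e vw by (simp flip: powr_add)
  have "A*2 powr (a*L) = v" unfolding pL A_def using vw vv by simp
  hence 1: "2 powr (- (a*l)) * v = A*2 powr (- (a*(l - L)))" for l by (simp add: right_diff_distrib powr_diff powr_minus field_simps flip: powr_add)
  have "A = w*2 powr (b*L)"
  proof -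
   have "w/w powr (b/(a + b)) = w powr (a/(a + b))" using nonzero_mult_div_cancel_left[of "w powr (b/(a + b))" "w powr (a/(a + b))"] vw unfolding ww[symmetric] by simp
   hence "A = v powr (b/(a + b))*(w/w powr (b/(a + b)))" unfolding A_def by (rule ssubst[of _ _ "%q. _ = _*q"]) simp
   thus ?thesis unfolding pL by (simp only: times_divide_eq_right mult.commute)
  qed
  hence 2: "2 powr (b*l)*w = A*2 powr (b*(l - L))" for l by (simp add: right_diff_distrib powr_diff)
  have bd: "y l <= er (A*2 powr c)*er (2 powr (- (c*\<bar>ri (l + (- \<lfloor>L\<rfloor>))\<bar>)))" for l
  proof -
   \<comment> \<open>Replacing \<open>L\<close> by its floor changes distances by at most 1, which
     is the factor \<open>2 powr c\<close> in \<open>hed\<close>.\<close>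
   have m: "2 powr (- (c*\<bar>l - L\<bar>)) <= 2 powr (c - c*\<bar>ri (l + (- \<lfloor>L\<rfloor>))\<bar>)"
   proof (rule powr_mono)
    have "\<bar>ri (l + (- \<lfloor>L\<rfloor>))\<bar> <= \<bar>ri l - L\<bar> + 1" by (simp add: abs_if) linarith
    from mult_left_mono[OF this, of c] show "- (c*\<bar>ri l - L\<bar>) <= c - c*\<bar>ri (l + (- \<lfloor>L\<rfloor>))\<bar>" using c by (simp add: algebra_simps)
   qed simp
   have "y l <= er (A*2 powr (- (c*\<bar>l - L\<bar>)))"
   proof (cases "L <= l")
    case True
    have "y l <= er (A*2 powr (- (a*(l - L))))" using yV[of l] 1[of l] vw by (simp flip: ennreal_mult)
    also have "... <= er (A*2 powr (- (c*\<bar>l - L\<bar>)))" using True A0 c by (intro ennreal_leI mult_left_mono powr_mono) (auto intro: mult_right_mono)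
    finally show ?thesis .
   next
    case False
    have "y l <= er (A*2 powr (b*(l - L)))" using yB[of l] 2[of l] vw by (simp flip: ennreal_mult)
    also have "... <= er (A*2 powr (- (c*\<bar>l - L\<bar>)))"
    proof (intro ennreal_leI mult_left_mono powr_mono)
     show "b*(l - L) <= - (c*\<bar>l - L\<bar>)" using False c mult_right_mono[of c b "L - l"] by (simp add: algebra_simps)
    qed (use A0 in auto)
    finally show ?thesis .
   qed
   also have "... <= er (A*(2 powr c*2 powr (- (c*\<bar>ri (l + (- \<lfloor>L\<rfloor>))\<bar>))))"
    using m A0 by (intro ennreal_leI mult_left_mono) (auto simp flip: powr_add)
   finally show ?thesis using A0 by (simp add: mult.assoc flip: ennreal_mult)
  qed
  have "zsum y <= zsum (%l. er (A*2 powr c)*er (2 powr (- (c*\<bar>ri (l + (- \<lfloor>L\<rfloor>))\<bar>))))" by (rule zsum_mono[OF bd])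
  also have "... = er (A*2 powr c)*er (geo c)"
   using zsum_shift[of "%l. er (2 powr (- (c*\<bar>ri l\<bar>)))" "- \<lfloor>L\<rfloor>"] geo(1)[OF c(1)] by (simp add: nn_cmult)
  also have "... = er (hed a b)*(V^.(b/(a + b))*B^.(a/(a + b)))" using vw A0 geo(2)[of c] by (simp add: hed_def c_def[symmetric] A_def mult_ac flip: ennreal_mult)
  finally show ?thesis .
 qed
qed

section \<open>Weighted sequence norms and tail sums\<close>

definition wl2 :: "real => (int => ennreal) => ennreal" where "wl2 tau f = (zsum (%l. (er (pw tau l)*f l)^.2))^.(1/2)"

lemma wl2_Minkowski: "wl2 tau (%l. zsum (f l)) <= zsum (%m. wl2 tau (%l. f l m))"
proof -
 have "(%(l, m). er (pw tau l)*f l m) : borel_measurable (count_space (UNIV :: int set) \<Otimes>\<^sub>M count_space (UNIV :: int set))"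
  by (simp add: pair_measure_countable)
 from nn_integral_Minkowski[OF sigma_finite_measure_count_space_countable sigma_finite_measure_count_space_countable this, of 2]
 show ?thesis unfolding wl2_def by (simp add: nn_cmult)
qed

lemma wl2_add: "wl2 tau (%l. f l + g l) <= wl2 tau f + wl2 tau g"
proof -
 let ?N = "count_space (UNIV :: bool set)"
 have [simp]: "(\<integral>\<^sup>+z. h z \<partial>?N) = h True + h False" for h :: "bool => ennreal"
  by (simp add: nn_integral_count_space_finite UNIV_bool add.commute)
 have "(%(l, z). er (pw tau l)*(if z then f l else g l)) : borel_measurable (count_space (UNIV :: int set) \<Otimes>\<^sub>M ?N)" by (simp add: pair_measure_countable)
 from nn_integral_Minkowski[OF sigma_finite_measure_count_space_countable sigma_finite_measure_count_space_countable this, of 2]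
 show ?thesis unfolding wl2_def by (simp add: distrib_left)
qed

lemma wl2_mono: "(!!l. f l <= g l) ==> wl2 tau f <= wl2 tau g" unfolding wl2_def by (intro epowr_mono zsum_mono mult_left_mono) auto

lemma wl2_cmult: "wl2 tau (%l. c*f l) = c*wl2 tau f"
proof -
 have "(er (pw tau l)*(c*f l))^.2 = c^.2*(er (pw tau l)*f l)^.2" for l by (simp only: epowr_mult mult.left_commute)
 thus ?thesis unfolding wl2_def by (simp only: nn_cmult[OF borel_measurable_count_space] epowr_mult epowr_powr) simp
qed

lemma wl2_shift: "wl2 tau (%l. f (l + m)) = er (2 powr (- (tau*ri m)))*wl2 tau f"
proof -
 have "wl2 tau (%l. f (l + m)) = (zsum (%l. (er (2 powr (tau*ri ((l + m) - m)))*f (l + m))^.2))^.(1/2)" by (simp add: wl2_def)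
 also have "... = (zsum (%l. (er (2 powr (tau*ri (l - m)))*f l)^.2))^.(1/2)" by (subst zsum_shift[of "%l. (er (2 powr (tau*ri (l - m)))*f l)^.2"]) simp
 also have "... = wl2 tau (%l. er (2 powr (- (tau*ri m)))*f l)"
 proof -
  have "er (2 powr (tau*ri (l - m)))*f l = er (pw tau l)*(er (2 powr (- (tau*ri m)))*f l)" for l
   unfolding mult.assoc[symmetric] by (simp add: right_diff_distrib powr_diff powr_minus divide_inverse flip: ennreal_mult)
  thus ?thesis by (simp add: wl2_def)
 qed
 finally show ?thesis by (simp only: wl2_cmult)
qed

definition tailsum :: "int => (int => ennreal) => int => ennreal" where "tailsum N f l = zsum (%j. f j*ind {l - N..} j)"

text \<open>Bounds the sum of \<open>2 powr (- (tau*m))\<close> over \<open>m >= - N\<close>, the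
  norm of a tail sum in the weighted sequence space; the exponent \<open>2*tau*N\<close> comes from
  \<open>abs m - m <= 2*N\<close>.\<close>

definition Ak :: "real => int => real" where "Ak tau N = 2 powr (2*tau*ri N)*geo tau"

lemma tailsum_alt: "tailsum N f l = zsum (%m. f (l + m)*ind {- N..} m)"
proof -
 have "tailsum N f l = zsum (%m. f (m + l)*ind {l - N..} (m + l))" unfolding tailsum_def by (rule zsum_shift[symmetric])
 also have "... = zsum (%m. f (l + m)*ind {- N..} m)" by (intro nn_cong) (auto simp: indicator_def add.commute)
 finally show ?thesis .
qed

lemma geo_tail:
 assumes "0 < tau" "0 <= N"
 shows "zsum (%m. er (2 powr (- (tau*ri m)))*ind {- N..} m) <= er (Ak tau N)"
proof -
 have "zsum (%m. er (2 powr (- (tau*ri m)))*ind {- N..} m) <= zsum (%m. er (2 powr (2*tau*ri N))*er (2 powr (- (tau*\<bar>ri m\<bar>))))"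
 proof (rule zsum_mono)
  fix m :: int
  show "er (2 powr (- (tau*ri m)))*ind {- N..} m <= er (2 powr (2*tau*ri N))*er (2 powr (- (tau*\<bar>ri m\<bar>)))"
  proof (cases "- N <= m")
   case True
   hence "\<bar>ri m\<bar> - ri m <= 2*ri N" using assms(2) by linarith
   from mult_left_mono[OF this, of tau] assms have "2 powr (- (tau*ri m)) <= 2 powr (2*tau*ri N + - (tau*\<bar>ri m\<bar>))"
    by (intro powr_mono) (auto simp: algebra_simps)
   thus ?thesis using True by (simp only: powr_add ennreal_mult'' powr_ge_zero indicator_simps mult_1_right atLeast_iff if_True ennreal_leI flip: ennreal_mult'')
  qed simp
 qed
 also have "... = er (Ak tau N)" using assms geo by (simp add: Ak_def nn_cmult ennreal_mult)
 finally show ?thesis .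
qed

lemma wl2_tailsum:
 assumes "0 < tau" "0 <= N"
 shows "wl2 tau (tailsum N f) <= er (Ak tau N)*wl2 tau f"
proof -
 have "wl2 tau (tailsum N f) <= zsum (%m. wl2 tau (%l. f (l + m)*ind {- N..} m))" unfolding tailsum_alt[abs_def] by (rule wl2_Minkowski)
 also have "... = zsum (%m. (er (2 powr (- (tau*ri m)))*ind {- N..} m)*wl2 tau f)" unfolding mult.commute[of "f _"] wl2_cmult wl2_shift by (simp add: mult_ac)
 also have "... = zsum (%m. er (2 powr (- (tau*ri m)))*ind {- N..} m)*wl2 tau f" by (rule nn_multc) simp
 also have "... <= er (Ak tau N)*wl2 tau f" by (intro mult_right_mono geo_tail assms) simp
 finally show ?thesis .
qed

text \<open>Iterating \<open>x <= c + eps tailsum N x\<close> from the a priori bound, every step halves the remainder, so that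
 \<open>x\<close> inherits the weighted \<open>\<ell>\<^sup>2\<close> bound of \<open>c\<close>.\<close>

lemma wl2_absorb:
 assumes tau: "0 < tau" and sg: "0 < sg" and N: "0 <= N" and eps: "0 <= eps" "eps*Ak tau N <= 1/2" "eps*Ak sg N <= 1/2"
  and x: "!!l. x l <= c l + er eps*tailsum N x l" and M: "!!l. x l <= er (M*2 powr (- (sg*ri l)))" "0 <= M"
 shows "wl2 tau x <= 2*wl2 tau c"
proof -
 let ?x = "%l. er (pw tau l)*x l"
 \<comment> \<open>Picard iteration of the inequality, started at 0. The two conditions on
   \<open>eps\<close> serve two different norms: the one with \<open>sg\<close> shrinks the
   pointwise remainder \<open>?r n\<close>, the one with \<open>tau\<close> keeps
   \<open>wl2 tau (z n)\<close> below \<open>2*wl2 tau c\<close>.\<close>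
 define z where "z = rec_nat (%l. 0) (%n z l. c l + er eps*tailsum N z l)"
 have z0: "z 0 = (%l. 0)" and zS: "z (Suc n) = (%l. c l + er eps*tailsum N (z n) l)" for n by (simp_all add: z_def)
 have Ak0: "0 <= Ak tau N" for tau using geo(2)[of tau] by (simp add: Ak_def)
 let ?r = "%n l. er (M*(1/2)^n*2 powr (- (sg*ri l)))"
 have it: "x l <= z n l + ?r n l" for n l
 proof (induction n arbitrary: l)
  case 0 thus ?case using M by (simp add: z0)
 next
  case (Suc n)
  have "tailsum N x l <= zsum (%m. z n (l + m)*ind {- N..} m + ?r n (l + m)*ind {- N..} m)"
   unfolding tailsum_alt distrib_right[symmetric] by (intro zsum_mono mult_right_mono Suc.IH) simp
  also have "... = tailsum N (z n) l + zsum (%m. ?r n (l + m)*ind {- N..} m)" unfolding tailsum_alt by (rule nn_integral_add) auto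
  also have "zsum (%m. ?r n (l + m)*ind {- N..} m) = zsum (%m. ?r n l*(er (2 powr (- (sg*ri m)))*ind {- N..} m))"
  proof (rule nn_cong)
   fix m :: int
   have "?r n (l + m) = ?r n l*er (2 powr (- (sg*ri m)))"
   proof -
    have "2 powr (- (sg*ri (l + m))) = 2 powr (- (sg*ri l))*2 powr (- (sg*ri m))" unfolding powr_add[symmetric] by (simp add: distrib_left)
    thus ?thesis using M(2) by (subst ennreal_mult[symmetric]) auto
   qed
   thus "?r n (l + m)*ind {- N..} m = ?r n l*(er (2 powr (- (sg*ri m)))*ind {- N..} m)" by (simp only: mult.assoc)
  qed
  also have "... <= ?r n l*er (Ak sg N)" by (subst nn_cmult, simp) (intro mult_left_mono geo_tail sg N, simp)
  finally have T: "tailsum N x l <= tailsum N (z n) l + ?r n l*er (Ak sg N)" by (simp only: add_left_mono)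
  have "x l <= c l + er eps*(tailsum N (z n) l + ?r n l*er (Ak sg N))" by (rule order_trans[OF x add_left_mono[OF mult_left_mono[OF T]]]) simp
  also have "... = z (Suc n) l + er (eps*Ak sg N)*?r n l" using eps(1) Ak0 by (simp add: zS distrib_left add.assoc ennreal_mult mult_ac)
  also have "er (eps*Ak sg N)*?r n l <= er (1/2)*?r n l" by (intro mult_right_mono ennreal_leI eps) simp
  also have "... = ?r (Suc n) l" using M(2) by (subst ennreal_mult[symmetric]) auto
  finally show ?case by (simp add: add_left_mono)
 qed
 have zb: "wl2 tau (z n) <= 2*wl2 tau c" for n
 proof (induction n)
  case 0 thus ?case by (simp add: z0 wl2_def)
 next
  case (Suc n)
  have "wl2 tau (z (Suc n)) <= wl2 tau c + wl2 tau (%l. er eps*tailsum N (z n) l)" unfolding zS by (rule wl2_add)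
  also have "wl2 tau (%l. er eps*tailsum N (z n) l) <= er eps*(er (Ak tau N)*(2*wl2 tau c))"
   unfolding wl2_cmult by (intro mult_left_mono order_trans[OF wl2_tailsum[OF tau N]] Suc.IH) auto
  also have "... = er (eps*Ak tau N)*(2*wl2 tau c)" using eps(1) Ak0 by (simp add: ennreal_mult mult.assoc)
  also have "... <= er (1/2)*(2*wl2 tau c)" by (intro mult_right_mono ennreal_leI eps) simp
  also have "... = wl2 tau c"
  proof -
   have "er (1/2)*2 = 1" unfolding ennreal_numeral[symmetric] by (subst ennreal_mult[symmetric]) auto
   thus ?thesis by (simp add: mult.assoc[symmetric])
  qed
  finally show ?case by (simp add: mult_2 add_left_mono)
 qed
 \<comment> \<open>Over all scales the remainder may have infinite weighted norm. On a finite set of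
   scales it is finite and tends to 0 with \<open>n\<close>; the finite sets exhaust the integers
   afterwards.\<close>
 have fin: "zsum (%l. ?x l^.2*ind F l) <= (2*wl2 tau c)^.2" if F: "finite F" for F
 proof -
  define K where "K = wl2 tau (%l. ?r 0 l*ind F l)"
  have i2: "(a*(b*ind F l))^.2 = (a*b)^.2*ind F l" for a b l by (simp add: mult.assoc[symmetric] indicator_powr)
  have "K < top" unfolding K_def wl2_def i2 by (simp add: nn_integral_count_space_indicator[symmetric] nn_integral_count_space_finite F ennreal_mult_less_top)
  hence K: "K = er (enn2real K)" by (simp add: less_top)
  have "wl2 tau (%l. x l*ind F l) <= 2*wl2 tau c + er ((1/2)^n*enn2real K)" for n
  proof -
   have "wl2 tau (%l. x l*ind F l) <= wl2 tau (%l. z n l + er ((1/2)^n)*(?r 0 l*ind F l))"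
   proof (rule wl2_mono)
    fix l show "x l*ind F l <= z n l + er ((1/2)^n)*(?r 0 l*ind F l)" using it[of l n] M(2) by (cases "l : F") (simp_all add: mult_ac flip: ennreal_mult)
   qed
   also have "... <= wl2 tau (z n) + er ((1/2)^n)*K" unfolding K_def wl2_cmult[symmetric] by (rule wl2_add)
   also have "... <= 2*wl2 tau c + er ((1/2)^n)*er (enn2real K)" using zb[of n] K by (intro add_mono) auto
   finally show ?thesis by (simp add: ennreal_mult)
  qed
  moreover have "(%n. 2*wl2 tau c + er ((1/2)^n*enn2real K)) ----> 2*wl2 tau c + er (0*enn2real K)"
   by (intro tendsto_add tendsto_ennrealI tendsto_mult LIMSEQ_realpow_zero tendsto_const) auto
  ultimately have "wl2 tau (%l. x l*ind F l) <= 2*wl2 tau c + er (0*enn2real K)" by (intro LIMSEQ_le_const) auto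
  hence "wl2 tau (%l. x l*ind F l)^.2 <= (2*wl2 tau c)^.2" by (intro epowr_mono) auto
  thus ?thesis unfolding wl2_def epowr_powr i2 by simp
 qed
 have "zsum (%l. ?x l^.2) = zsum (%l. liminf (%n. ?x l^.2*ind {- int n..int n} l))"
 proof (rule nn_cong)
  fix l :: int
  have "(%n. ?x l^.2*ind {- int n..int n} l) ----> ?x l^.2"
   by (intro tendsto_eventually eventually_sequentiallyI[of "nat (abs l)"]) (auto simp: indicator_def)
  from lim_imp_Liminf[OF sequentially_bot this]
  show "?x l^.2 = liminf (%n. ?x l^.2*ind {- int n..int n} l)" by simp
 qed
 also have "... <= (2*wl2 tau c)^.2" by (rule nn_integral_le_liminf) (auto intro: fin)
 finally have "zsum (%l. ?x l^.2)^.(1/2) <= ((2*wl2 tau c)^.2)^.(1/2)" by (rule epowr_mono) simp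
 thus ?thesis by (simp add: wl2_def[of tau x] epowr_powr)
qed

text \<open>The powers are arranged so that the \<open>q\<close>-th power of \<open>f\<close>
  contains exactly \<open>V^.2\<close> under the time integral and the outer integral is left with
  \<open>B^.4\<close>. It accepts other pairs \<open>p\<close>, \<open>q\<close> than the
  interpolation line of \<open>mx_from_endpoints\<close>.\<close>

lemma mx_VB:
 assumes Vm [measurable]: "mm V" and Bm [measurable]: "bml B" and pq: "0 < p" "0 < q"
  and f: "!!t x. f t x <= C*(V t x^.(2/q)*B x^.(4/p))"
  and V: "!!x. (NN t. V t x^.2) <= kappa" and B: "(NN x. B x^.4) <= m"
 shows "mx p q f <= C*(kappa^.(p/q)*m)^.(1/p)"
proof -
 have "(NN t. f t x^.q)^.(p/q) <= C^.p*(kappa^.(p/q)*B x^.4)" for x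
 proof -
  note [measurable] = mm_section(1)[OF Vm, of x]
  have "(NN t. f t x^.q) <= (NN t. (C^.q*B x^.(4*q/p))*V t x^.2)"
  proof (rule nn_mono)
   fix t
   have "f t x^.q <= (C*(V t x^.(2/q)*B x^.(4/p)))^.q" using pq by (intro epowr_mono f) auto
   also have "... = (C^.q*B x^.(4*q/p))*V t x^.2" using pq by (simp add: epowr_mult epowr_powr mult_ac)
   finally show "f t x^.q <= (C^.q*B x^.(4*q/p))*V t x^.2" .
  qed
  also have "... = (C^.q*B x^.(4*q/p))*(NN t. V t x^.2)" by (rule nn_cmult) measurable
  also have "... <= (C^.q*B x^.(4*q/p))*kappa" by (intro mult_left_mono V) simp
  finally have "(NN t. f t x^.q)^.(p/q) <= ((C^.q*B x^.(4*q/p))*kappa)^.(p/q)" using pq by (intro epowr_mono) auto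
  also have "... = C^.p*(kappa^.(p/q)*B x^.4)" using pq by (simp add: epowr_mult epowr_powr mult_ac)
  finally show ?thesis .
 qed
 hence "mx p q f <= (NN x. C^.p*(kappa^.(p/q)*B x^.4))^.(1/p)" unfolding mx_def using pq by (intro epowr_mono nn_mono) auto
 also have "... = (C^.p*(kappa^.(p/q)*(NN x. B x^.4)))^.(1/p)" by (simp add: nn_cmult)
 also have "... <= (C^.p*(kappa^.(p/q)*m))^.(1/p)" using pq by (intro epowr_mono mult_left_mono B) auto
 also have "... = C*(kappa^.(p/q)*m)^.(1/p)" using pq by (simp add: epowr_mult[of "C^.p"] epowr_powr)
 finally show ?thesis .
qed

lemma mx_triangle:
 assumes [measurable]: "mm f" "mm g" and p: "1 < p" "1 < q"
 shows "mx p q (%t x. f t x + g t x) <= mx p q f + mx p q g"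
proof -
 let ?N = "count_space (UNIV :: bool set)"
 have [simp]: "(\<integral>\<^sup>+z. h z \<partial>?N) = h True + h False" for h :: "bool => ennreal"
  by (simp add: nn_integral_count_space_finite UNIV_bool add.commute)
 have "(%(z, t, x). if z then f t x else g t x) : borel_measurable (?N \<Otimes>\<^sub>M LL)" by measurable
 from mx_Minkowski[OF sigma_finite_measure_count_space_countable this p] show ?thesis by simp
qed

text \<open>Young's inequality in \<open>x\<close> alone: Minkowski over the translation parameter,
  under which the mixed norm is invariant.\<close>

lemma mx_conv:
 assumes fm [measurable]: "mm f" and [measurable]: "bm k" and p: "1 < p" "1 < q"
 shows "mx p q (%t y. (NN x. f t x*k (y - x))) <= (NN z. k z)*mx p q f"
proof -
 have fs [measurable]: "bm (%x. f t x)" for t using mm_section(2)[OF fm] by simp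
 have "(NN x. f t x*k (y - x)) = (NN z. f t (y - z)*k z)" for t y by (subst nn_integral_real_affine[of _ "-1" y]) auto
 hence "mx p q (%t y. (NN x. f t x*k (y - x))) = mx p q (%t y. (NN z. f t (y - z)*k z))" by simp
 also have "... <= (NN z. mx p q (%t y. f t (y - z)*k z))"
 proof (rule mx_Minkowski)
  have "(%w. (%(t, x). f t x) (fst (snd w), snd (snd w) - fst w)) : borel_measurable (lborel \<Otimes>\<^sub>M LL)"
   by (rule measurable_compose[of _ _ "LL", OF _ fm]) measurable
  hence "(%w. f (fst (snd w)) (snd (snd w) - fst w)*k (fst w)) : borel_measurable (lborel \<Otimes>\<^sub>M LL)" by simp
  thus "(%(z, t, y). f t (y - z)*k z) : borel_measurable (lborel \<Otimes>\<^sub>M LL)" by (simp add: split_beta')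
 qed (use p in "auto intro: sigma_lborel")
 also have "... = (NN z. k z*mx p q f)"
 proof (rule nn_cong)
  fix z :: real
  have "bmL (%w. (%(t, x). f t x) (fst w, snd w - z))" by (rule measurable_compose[of _ _ "LL", OF _ fm]) measurable
  hence m: "mm (%t y. f t (y - z))" by (simp add: split_beta')
  have "bm (%x. (NN t. f t x^.q)^.(p/q))" using mm_swap[OF fm] by measurable
  hence "mx p q (%t y. f t (y - z)) = mx p q f" unfolding mx_def by (subst (2) nn_integral_real_affine[of _ 1 "- z"]) (auto simp: add.commute)
  thus "mx p q (%t y. f t (y - z)*k z) = k z*mx p q f" using mx_cmult[OF m, of p q "k z"] p by (simp add: mult.commute)
 qed
 also have "... = (NN z. k z)*mx p q f" by (rule nn_multc) simp
 finally show ?thesis .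
qed

section \<open>Compactly supported multipliers as convolutions\<close>

definition bump :: "(real => complex) => bool" where "bump b \<longleftrightarrow> smooth_on UNIV b & (\<exists>R. \<forall>x. R < (abs x) --> b x = 0)"

lemma bump_schwartz: "bump b ==> schwartz b" unfolding bump_def using smooth_supp_schwartz by blast

lemma bump_mult: "bump b ==> smooth_on UNIV c ==> bump (%x. c x*b x)" unfolding bump_def using smooth_mult by fastforce

lemma bump_mult_away: "bump b ==> smooth_on (- {0}) c ==> 0 < delta ==> (!!x. (abs x) < delta ==> b x = 0) ==> bump (%x. c x*b x)"
 unfolding bump_def using smooth_away_mult by fastforce

lemma bump_integrable: "bump b ==> integrable lborel b" using bump_schwartz schwartz_props(2) by blast

lemma bump_measurable: "bump b ==> b : borel_measurable borel" using bump_schwartz schwartz_measurable by blast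

lemma bump_continuous: "bump b ==> isCont b x" using schwartz_props(1)[OF bump_schwartz] by (simp add: continuous_on_eq_continuous_at)

lemma vector_derivative_zero:
 assumes "open S" "x : S" "!!y. y : S ==> b y = 0"
 shows "vector_derivative b (at x) = 0" by (rule vector_derivative_at, rule has_vector_derivative_transform_within_open[OF has_vector_derivative_const[of 0] assms(1,2)])
  (use assms(3) in simp)

lemma bump_deriv:
 assumes "bump b"
 shows "bump (%x. vector_derivative b (at x))" "vd b (vector_derivative b (at x)) x"
proof -
 obtain R where R: "!!x. R < (abs x) ==> b x = 0" and s: "smooth_on UNIV b" using assms by (auto simp: bump_def)
 have "vector_derivative b (at x) = 0" if "R < (abs x)" for x
  by (rule vector_derivative_zero[of "{x. R < (abs x)}"]) (use that R in "auto intro!: open_Collect_less continuous_intros")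
 thus "bump (%x. vector_derivative b (at x))" using smooth_deriv(1)[OF open_UNIV s] by (auto simp: bump_def)
 show "vd b (vector_derivative b (at x)) x" using smooth_deriv(2)[OF open_UNIV s] by (simp add: vector_derivative_works)
qed

lemma om_has_derivative:
 assumes "xi ~= 0"
 shows "(om alpha has_real_derivative (alpha + 1)*(abs xi) powr alpha) (at xi)"
proof (cases "0 < xi")
 case True
 have "((%xi. xi powr alpha*xi) has_real_derivative (alpha + 1)*xi powr alpha) (at xi)" using True by (auto intro!: derivative_eq_intros simp: powr_diff algebra_simps)
 thus ?thesis unfolding om_def using True by (auto elim!: has_field_derivative_transform_within_open[where S="{0<..}"])
next
 case False
 hence n: "0 < - xi" using assms by simp
 have "((%xi. (- xi) powr alpha*xi) has_real_derivative (alpha + 1)*(- xi) powr alpha) (at xi)"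
  using n by (auto intro!: derivative_eq_intros simp: powr_diff divide_simps algebra_simps)
 thus ?thesis unfolding om_def using n by (auto elim!: has_field_derivative_transform_within_open[where S="{..<0}"])
qed

lemma cis_has_vector_derivative:
 assumes "(f has_real_derivative f') (at x)"
 shows "vd ((%x. cis (f x))) ((\<i> * of_real f')*cis (f x)) x"
proof -
 have "vd ((%x. exp (\<i> * of_real (f x)))) ((\<i> * of_real f')*exp (\<i> * of_real (f x))) x"
  using field_vector_diff_chain_at[of "%x. \<i> * of_real (f x)" "\<i> * of_real f'" x exp "exp (\<i> * of_real (f x))"]
   has_vector_derivative_mult_right[OF has_vector_derivative_of_real[OF assms], of \<i>] DERIV_exp by (auto simp: o_def)
 thus ?thesis by (simp add: cis_conv_exp)
qed

text \<open>By \<open>fourier_decay\<close>, as the second derivative of \<open>b xi * cis (- sg * om alpha xi)\<close> is bounded uniformly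
 for bounded \<open>sg\<close>.\<close>

lemma Aop_decay:
 assumes b: "bump b" and z: "0 < delta" "!!xi. (abs xi) < delta ==> b xi = 0" and T: "0 <= T"
 obtains D where "0 <= D" "!!sg z. (abs sg) <= T ==> norm (Aop alpha b sg z) <= D/(1 + z^2)"
proof -
 \<comment> \<open>The derivative of \<open>om alpha\<close>, smooth only away from 0, which is why
   \<open>b\<close> has to vanish near 0. Each derivative of the phase factor brings down one factor
   \<open>- \<i> * sg * c\<close>, so \<open>sg\<close> enters polynomially.\<close>
 define c where "c xi = cor (alpha + 1)*abspow alpha xi" for xi
 have cs: "smooth_on (- {0}) c" unfolding c_def[abs_def] by (intro smooth_mult smooth_abspow) (simp add: smooth_on_def Csm_const)
 let ?d = "%f x. vector_derivative f (at x)"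
 have dz: "?d f xi = 0" if "!!xi. (abs xi) < delta ==> f xi = 0" "(abs xi) < delta" for f :: "real => complex" and xi
  by (rule vector_derivative_zero[of "{xi. (abs xi) < delta}"]) (use that in "auto intro!: open_Collect_less continuous_intros")
 define e1 where "e1 xi = c xi*b xi" for xi
 define d1 where "d1 xi = c xi*?d b xi" for xi
 define e2 where "e2 xi = c xi*e1 xi" for xi
 have b1: "bump (?d b)" by (rule bump_deriv(1)[OF b])
 have e1: "bump e1" unfolding e1_def[abs_def] by (rule bump_mult_away[OF b cs z])
 have e1z: "(abs xi) < delta ==> e1 xi = 0" for xi using z by (simp add: e1_def)
 have d1: "bump d1" unfolding d1_def[abs_def] by (rule bump_mult_away[OF b1 cs z(1) dz[OF z(2)]])
 have e2: "bump e2" unfolding e2_def[abs_def] by (rule bump_mult_away[OF e1 cs z(1) e1z])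
 have b2: "bump (?d (?d b))" by (rule bump_deriv(1)[OF b1])
 have e1': "bump (?d e1)" by (rule bump_deriv(1)[OF e1])
 define D where "D = (LI xi. norm (b xi)) + (LI xi. norm (?d (?d b) xi) + T*norm (?d e1 xi) + T*norm (d1 xi) + T^2*norm (e2 xi))"
 note bi = bump_integrable[OF b] bump_integrable[OF b1] bump_integrable[OF e1] bump_integrable[OF d1] bump_integrable[OF e2] bump_integrable[OF b2] bump_integrable[OF e1']
 note bm [measurable] = bump_measurable[OF b] bump_measurable[OF b1] bump_measurable[OF e1] bump_measurable[OF d1] bump_measurable[OF e2] bump_measurable[OF b2] bump_measurable[OF e1']
 show thesis
 proof (rule that[of D])
  show "0 <= D" unfolding D_def using T by (intro add_nonneg_nonneg Bochner_Integration.integral_nonneg) auto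
  fix sg x :: real assume sg: "(abs sg) <= T"
  define s where "s = - \<i>*cor sg"
  have ns: "norm s <= T" "norm (s * s) <= T^2" using sg mult_mono[OF sg sg T] by (auto simp: s_def norm_mult power2_eq_square)
  define E where "E xi = cis (- (sg * om alpha xi))" for xi
  have Em [measurable]: "bm E" unfolding E_def by measurable
  have nE: "norm (E xi) = 1" for xi by (simp add: E_def)
  have dE: "vd E ((s*c xi)*E xi) xi" if "xi ~= 0" for xi
  proof -
   have "((%xi. - (sg * om alpha xi)) has_real_derivative - (sg*((alpha + 1)*(abs xi) powr alpha))) (at xi)"
    by (intro derivative_intros DERIV_cmult om_has_derivative that)
   from cis_has_vector_derivative[OF this] show ?thesis unfolding E_def by (simp add: s_def c_def abspow_def mult_ac)
  qed
  have dfE: "vd (%xi. f xi*E xi) ((?d f xi + s*(c xi*f xi))*E xi) xi" if f: "bump f" "!!xi. (abs xi) < delta ==> f xi = 0" for f xi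
  proof (cases "xi = 0")
   case False
   from has_vector_derivative_mult[OF bump_deriv(2)[OF f(1)] dE[OF False]]
   show ?thesis by (simp add: algebra_simps)
  next
   case True
   have "vd (%xi. f xi*E xi) 0 xi"
    by (rule has_vector_derivative_transform_within_open[OF has_vector_derivative_const[of 0], of "{xi. (abs xi) < delta}"])
     (use True z f in "auto intro!: open_Collect_less continuous_intros")
   moreover have "?d f xi = 0" by (rule dz[OF f(2)]) (use True z(1) in simp_all)
   ultimately show ?thesis using True f(2)[of xi] z(1) by simp
  qed
  define p0 where "p0 xi = b xi*E xi" for xi
  define p1 where "p1 xi = (?d b xi + s*e1 xi)*E xi" for xi
  define p2 where "p2 xi = (?d (?d b) xi + s*?d e1 xi + s*d1 xi + (s * s)*e2 xi)*E xi" for xi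
  have h1: "vd p0 (p1 xi) xi" for xi using dfE[OF b z(2), of xi] by (simp add: p0_def[abs_def] p1_def e1_def)
  have h2: "vd p1 (p2 xi) xi" for xi
  proof -
   have "vd ((%xi. ?d b xi*E xi + s*(e1 xi*E xi))) ((?d (?d b) xi + s*(c xi*?d b xi))*E xi + s*((?d e1 xi + s*(c xi*e1 xi))*E xi)) xi"
    by (intro has_vector_derivative_add has_vector_derivative_mult_right dfE b1 e1 dz[OF z(2)] e1z)
   moreover have "p1 = (%xi. ?d b xi*E xi + s*(e1 xi*E xi))" by (simp add: p1_def[abs_def] algebra_simps)
   ultimately show ?thesis by (simp add: p2_def d1_def e2_def algebra_simps)
  qed
  have pm [measurable]: "bm p0" "bm p1" "bm p2" unfolding p0_def[abs_def] p1_def[abs_def] p2_def[abs_def] by measurable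
  have n2: "norm (p2 xi) <= norm (?d (?d b) xi) + T*norm (?d e1 xi) + T*norm (d1 xi) + T^2*norm (e2 xi)" for xi
  proof -
   have "norm (p2 xi) <= norm (?d (?d b) xi) + norm (s*?d e1 xi) + norm (s*d1 xi) + norm ((s * s)*e2 xi)"
    unfolding p2_def norm_mult[of _ "E xi"] nE mult_1_right by (intro norm_triangle_le add_mono norm_triangle_ineq order_refl)
   also have "... <= norm (?d (?d b) xi) + T*norm (?d e1 xi) + T*norm (d1 xi) + T^2*norm (e2 xi)"
    unfolding norm_mult[of s "?d e1 xi"] norm_mult[of s "d1 xi"] norm_mult[of "s * s"] by (intro add_mono mult_right_mono ns order_refl norm_ge_zero)
   finally show ?thesis .
  qed
  have di: "integrable lborel (%xi. norm (?d (?d b) xi) + T*norm (?d e1 xi) + T*norm (d1 xi) + T^2*norm (e2 xi))"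
   by (intro Bochner_Integration.integrable_add integrable_mult_right integrable_norm bi)
  have i0: "integrable lborel p0" using bi(1) by (rule LI_bound) (auto simp: p0_def norm_mult nE)
  have i1: "integrable lborel p1"
  proof (rule integrable_le[of lborel "%xi. norm (?d b xi) + T*norm (e1 xi)"])
   show "integrable lborel (%xi. norm (?d b xi) + T*norm (e1 xi))" by (intro Bochner_Integration.integrable_add integrable_mult_right integrable_norm bi)
   fix xi
   have "norm (p1 xi) <= norm (?d b xi) + norm (s*e1 xi)" unfolding p1_def norm_mult[of _ "E xi"] nE mult_1_right by (rule norm_triangle_ineq)
   also have "... <= norm (?d b xi) + T*norm (e1 xi)" unfolding norm_mult[of s] by (intro add_mono mult_right_mono ns order_refl norm_ge_zero)
   finally show "norm (p1 xi) <= norm (?d b xi) + T*norm (e1 xi)" .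
  qed simp
  have i2: "integrable lborel p2" by (rule integrable_le[OF di _ n2]) measurable
  obtain R where R: "!!x. R < (abs x) ==> b x = 0" using b by (auto simp: bump_def)
  have far: "(abs xi) > R ==> p0 xi = 0" "(abs xi) > R ==> p1 xi = 0" for xi
  proof -
   assume R': "(abs xi) > R"
   show "p0 xi = 0" using R R' by (simp add: p0_def)
   have "?d b xi = 0" by (rule vector_derivative_zero[of "{xi. R < (abs xi)}"]) (use R R' in "auto intro!: open_Collect_less continuous_intros")
   thus "p1 xi = 0" using R R' by (simp add: p1_def e1_def)
  qed
  have c2: "continuous_on UNIV p2"
  proof -
   have cE: "continuous_on UNIV (%xi. f xi*E xi)" if "bump f" "!!xi. (abs xi) < delta ==> f xi = 0" for f
    using dfE[OF that] by (auto intro!: continuous_at_imp_continuous_on dest: has_vector_derivative_continuous)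
   have zd: "d1 xi = 0" "e2 xi = 0" if "(abs xi) < delta" for xi using dz[of b, OF z(2)] e1z that by (simp_all add: d1_def e2_def)
   note cc = cE[OF b2 dz[OF dz[OF z(2)]]] cE[OF e1' dz[OF e1z]] cE[OF d1 zd(1)] cE[OF e2 zd(2)]
   have "continuous_on UNIV (%xi. ?d (?d b) xi*E xi + s*(?d e1 xi*E xi) + s*(d1 xi*E xi) + (s * s)*(e2 xi*E xi))"
    by (intro continuous_on_add continuous_on_mult[OF continuous_on_const] cc)
   thus ?thesis by (rule continuous_on_eq) (simp add: p2_def algebra_simps)
  qed
  have top: "(p \<longlongrightarrow> 0) at_top" if "!!xi. (abs xi) > R ==> p xi = 0" for p :: "real => complex"
   by (rule tendsto_eventually, rule eventually_mono[OF eventually_gt_at_top[of "(abs R)"]], rule that, linarith)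
  have bot: "(p \<longlongrightarrow> 0) at_bot" if "!!xi. (abs xi) > R ==> p xi = 0" for p :: "real => complex"
   by (rule tendsto_eventually, rule eventually_mono[OF eventually_gt_at_bot[of "- (abs R)"]], rule that, linarith)
  note l = top[OF far(1)] bot[OF far(1)] top[OF far(2)] bot[OF far(2)]
  have "Aop alpha b sg x = fourier p0 (- x)" unfolding Aop_def fourier_cis p0_def E_def by (simp add: mult.assoc cis_mult)
  hence "norm (Aop alpha b sg x) <= ((LI xi. norm (p0 xi)) + (LI xi. norm (p2 xi)))/(1 + x^2)" using fourier_decay[OF h1 h2 c2 i0 i1 i2 l, of "- x"] by simp
  also have "... <= D/(1 + x^2)"
  proof (rule divide_right_mono)
   have "(LI xi. norm (p2 xi)) <= (LI xi. norm (?d (?d b) xi) + T*norm (?d e1 xi) + T*norm (d1 xi) + T^2*norm (e2 xi))"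
    by (intro integral_mono integrable_norm i2 di n2)
   thus "(LI xi. norm (p0 xi)) + (LI xi. norm (p2 xi)) <= D" unfolding D_def by (simp add: p0_def norm_mult nE)
  qed (simp add: add_nonneg_nonneg)
  finally show "norm (Aop alpha b sg x) <= D/(1 + x^2)" .
 qed
qed

definition ker :: "(real => complex) => real => complex" where "ker b z = (LI xi. b xi*cis (z*xi))"

lemma ker_fourier: "ker b z = fourier b (- z)" by (simp add: ker_def fourier_cis)

lemma ker_fourier_shift: "fourier (%xi. b xi*cis (y*xi)) x = ker b (y - x)" unfolding ker_def fourier_cis mult.assoc cis_mult by (simp add: algebra_simps)

lemma ker_bound:
 assumes "schwartz b"
 shows "\<exists>C\<ge>0. \<forall>z. norm (ker b z) <= C/(1 + z^2)"
proof -
 obtain C where C: "0 <= C" "!!x. norm (fourier b x) <= C/(1 + x^2)" using schwartz_props(4)[OF assms] by blast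
 have "norm (ker b z) <= C/(1 + z^2)" for z using C(2)[of "- z"] by (simp add: ker_fourier)
 thus ?thesis using C(1) by blast
qed

lemma ker_measurable [measurable]: "b : borel_measurable borel ==> ker b : borel_measurable borel"
proof -
 assume [measurable]: "bm b"
 have "bml (%z. LI xi. b xi*cis (z*xi))" by (rule lborel.borel_measurable_lebesgue_integral) measurable
 thus ?thesis by (simp add: ker_def[abs_def])
qed

text \<open>The \<open>L^1\<close> norm of the kernel of a multiplier, hence a bound for its norm on
  every mixed norm space with exponents above 1; see \<open>cv_mx\<close>.\<close>

definition kn :: "(real => complex) => ennreal" where "kn b = (NN z. en (ker b z))"

lemma kn_finite: "schwartz b ==> kn b < top"
proof -
 assume b: "schwartz b"
 have [measurable]: "bm b" by (rule schwartz_measurable[OF b])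
 obtain C where "0 <= C" and C: "!!z. norm (ker b z) <= C/(1 + z^2)" using ker_bound[OF b] by blast
 have "integrable lborel (ker b)" by (rule integrable_decay[OF _ C]) measurable
 thus ?thesis unfolding kn_def by (simp add: nn_integral_norm_eq)
qed

text \<open>A dilation of the symbol dilates the kernel and preserves its \<open>L^1\<close> norm,
  so one constant serves all dyadic scales.\<close>

lemma kn_scale:
 assumes [measurable]: "bm b" and "0 < r"
 shows "kn (%xi. b (xi/r)) = kn b"
proof -
 have "ker (%xi. b (xi/r)) z = r *\<^sub>R ker b (r*z)" for z unfolding ker_def using assms(2) by (subst lborel_integral_real_affine[of r _ 0]) (auto simp: mult_ac)
 hence "kn (%xi. b (xi/r)) = er r*(NN z. en (ker b (r*z)))" unfolding kn_def using assms(2) by (simp add: ennreal_mult nn_cmult)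
 also have "... = kn b" unfolding kn_def using assms(2) by (subst (2) nn_integral_real_affine[of _ r 0]) auto
 finally show ?thesis .
qed

lemma kn_cmult: "b : borel_measurable borel ==> kn (%xi. c*b xi) = en c*kn b"
 unfolding kn_def ker_def by (simp add: mult.assoc norm_mult ennreal_mult nn_cmult ker_measurable[unfolded ker_def])

text \<open>The multiplier \<open>b\<close> applied to \<open>f\<close>, written as a convolution so
  that it is defined at every point and jointly measurable in time and space. That it acts as a
  multiplier is \<open>cv_pair\<close>.\<close>

definition cv :: "(real => complex) => (real => complex) => real => complex" where "cv b f y = (1/cor (2*pi))*(LI x. f x*ker b (y - x))"

lemma bump_cis: "bump b ==> bump (%xi. b xi*cis (y*xi))" using bump_mult[OF _ smooth_cis[of UNIV y], of b] by (simp only: mult.commute[of "b _"])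

lemma cv_pair:
 assumes "fourier_pair f F" "bump b"
 shows "cv b f y = (1/cor (2*pi))*(LI xi. (F xi*b xi)*cis (y*xi))"
  and "integrable lborel (%xi. F xi*b xi)"
proof -
 show "cv b f y = (1/cor (2*pi))*(LI xi. (F xi*b xi)*cis (y*xi))" using assms(1) bump_schwartz[OF bump_cis[OF assms(2)], of y]
  unfolding fourier_pair_def cv_def ker_fourier_shift[symmetric] by (simp add: mult.assoc)
 show "integrable lborel (%xi. F xi*b xi)" using assms bump_schwartz unfolding fourier_pair_def by blast
qed

lemma cv_bound: "en (cv b f y) <= (NN x. en (f x)*en (ker b (y - x)))"
proof -
 have "norm (cv b f y) <= norm (LI x. f x*ker b (y - x))" using mult_right_mono[of "1/(2*pi)" 1 "norm (LI x. f x*ker b (y - x))"] pi_gt3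
  by (simp add: cv_def norm_mult norm_divide)
 hence "en (cv b f y) <= en (LI x. f x*ker b (y - x))" by (rule ennreal_leI)
 also have "... <= (NN x. en (f x*ker b (y - x)))" by (rule norm_integral_le_nn)
 finally show ?thesis by (simp add: norm_mult ennreal_mult)
qed

lemma cv_mx:
 fixes f :: "real => real => complex"
 assumes [measurable]: "mm f" "bm b" and p: "1 < p" "1 < q"
 shows "mx p q (%t y. en (cv b (f t) y)) <= kn b*mx p q (%t x. en (f t x))"
proof -
 have "mx p q (%t y. en (cv b (f t) y)) <= mx p q (%t y. (NN x. en (f t x)*en (ker b (y - x))))" using p by (intro mx_mono cv_bound) auto
 also have "... <= kn b*mx p q (%t x. en (f t x))" unfolding kn_def using p by (intro mx_conv[of _ "%z. en (ker b z)"]) auto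
 finally show ?thesis .
qed

lemma cv_measurable [measurable]:
 fixes f :: "real => real => complex"
 assumes [measurable]: "mm f" "bm b"
 shows "mm (%t. cv b (f t))"
proof -
 have "(%w. (%(t, x). f t x) (fst (fst w), snd w)) : borel_measurable (LL \<Otimes>\<^sub>M lborel)" by (rule measurable_compose[OF _ assms(1)]) measurable
 hence [measurable]: "(%w. f (fst (fst w)) (snd w)) : borel_measurable (LL \<Otimes>\<^sub>M lborel)" by simp
 have "bmL (%w. LI x. f (fst w) x*ker b (snd w - x))" by (rule lborel.borel_measurable_lebesgue_integral) measurable
 thus ?thesis unfolding cv_def by (simp add: split_beta')
qed

text \<open>If \<open>g\<close> has frequencies at most \<open>r\<close> then \<open>g ^ n\<close> has frequencies at most \<open>n * r\<close>.\<close>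

lemma bandlimited:
 assumes G: "integrable lborel G" "!!xi. r < (abs xi) ==> G xi = 0" and r: "0 <= r"
  and p: "integrable lborel psi" "!!xi. norm (psi xi) <= C" "!!xi. isCont psi xi" "integrable lborel (fourier psi)"
  and z: "!!xi. (abs xi) <= real n*r ==> psi xi = 0"
 shows "integrable lborel (%x. ker G x^n*fourier psi x) & (LI x. ker G x^n*fourier psi x) = 0" using p z
proof (induction n arbitrary: psi)
 case 0
 have "(LI x. fourier psi x*cis (x*0)) = 2*pi*psi 0" by (rule fourier_inversion_at) (use 0 in auto)
 thus ?case using 0 by simp
next
 case (Suc n)
 have [measurable]: "bm G" using G(1) by (auto dest: bmi)
 have [measurable]: "bm (fourier psi)" using Suc.prems(4) by (auto dest: bmi)
 have gi: "integrable lborel (%x. ker G x^n*fourier psi x)"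
  by (rule conjunct1[OF Suc.IH[OF Suc.prems(1-4)]]) (use Suc.prems(5) r in "auto simp: algebra_simps")
 have gb: "norm (ker G x) <= (LI xi. norm (G xi))" for x unfolding ker_def by (rule norm_integral_cis_le[OF G(1)])
 have gi': "integrable lborel (%x. ker G x^Suc n*fourier psi x)"
 proof (rule integrable_le[OF integrable_mult_right[OF integrable_norm[OF gi], of "LI xi. norm (G xi)"]])
  fix x
  have "norm (ker G x^Suc n*fourier psi x) = norm (ker G x)*norm (ker G x^n*fourier psi x)" by (simp add: norm_mult)
  also have "... <= (LI xi. norm (G xi))*norm (ker G x^n*fourier psi x)" by (intro mult_right_mono gb) simp
  finally show "norm (ker G x^Suc n*fourier psi x) <= (LI xi. norm (G xi))*norm (ker G x^n*fourier psi x)" .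
 qed measurable
 \<comment> \<open>Multiplying by a frequency \<open>xi\<close> translates \<open>psi\<close> by
   \<open>xi\<close>. As \<open>abs xi <= r\<close>, the translate still vanishes on the band of
   radius \<open>n*r\<close>, so the induction hypothesis applies to it.\<close>
 have sh: "(LI x. (ker G x^n*fourier psi x)*cis (x*xi)) = 0" if xi: "(abs xi) <= r" for xi
 proof -
  have f: "fourier (%eta. psi (eta + xi)) x = fourier psi x*cis (x*xi)" for x
  proof -
   have "fourier psi x = (LI eta. psi (eta + xi)*cis (- (x*(eta + xi))))"
    unfolding fourier_cis by (subst lborel_integral_real_affine[of 1 _ xi]) (auto simp: add.commute)
   hence "fourier psi x*cis (x*xi) = (LI eta. psi (eta + xi)*cis (- (x*(eta + xi))))*cis (x*xi)" by simp
   also have "... = (LI eta. psi (eta + xi)*cis (- (x*eta)))"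
    unfolding Bochner_Integration.integral_mult_left_zero[symmetric] mult.assoc cis_mult by (simp add: algebra_simps)
   finally show ?thesis by (simp add: fourier_cis)
  qed
  have "(LI x. ker G x^n*fourier (%eta. psi (eta + xi)) x) = 0"
  proof (rule conjunct2[OF Suc.IH])
   show "integrable lborel (%eta. psi (eta + xi))" using lborel_integrable_real_affine[OF Suc.prems(1), of 1 xi] by (simp add: add.commute)
   show "isCont (%eta. psi (eta + xi)) eta" for eta by (rule isCont_o2[OF _ Suc.prems(3)]) (intro continuous_intros)
   show "integrable lborel (fourier (%eta. psi (eta + xi)))" unfolding f[abs_def] by (rule integrable_mult_cis[OF Suc.prems(4)]) simp
   show "psi (eta + xi) = 0" if "(abs eta) <= real n*r" for eta using that xi by (intro Suc.prems(5)) (simp add: algebra_simps abs_le_iff)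
  qed (rule Suc.prems(2))
  thus ?thesis by (simp add: f mult.assoc)
 qed
 have "(LI x. ker G x^Suc n*fourier psi x) = (LI x. (ker G x^n*fourier psi x)*(LI xi. G xi*cis (x*xi)))" by (simp add: ker_def mult_ac)
 also have "... = (LI xi. G xi*(LI x. (ker G x^n*fourier psi x)*cis (x*xi)))" by (rule kernel_Fubini[where C=1]) (use gi G in auto)
 also have "... = (LINT xi|(lborel :: real measure). 0)"
 proof (rule LI_cong[OF refl])
  fix xi
  show "G xi*(LI x. (ker G x^n*fourier psi x)*cis (x*xi)) = 0" using sh[of xi] G(2)[of xi] by (cases "(abs xi) <= r") auto
 qed
 finally show ?case using gi' by simp
qed

section \<open>The dyadic decomposition\<close>

definition chi :: "int => real => real" where "chi l xi = cutoff (xi/2 powr (l + 1)) - cutoff (xi/2 powr l)"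

lemma chi_eq_0: "xi ~: Lam (2 powr l) ==> chi l xi = 0"
 using cutoff_eq_1[of "xi/2 powr (l + 1)"] cutoff_eq_1[of "xi/2 powr l"] cutoff_eq_0[of "xi/2 powr (l + 1)"] cutoff_eq_0[of "xi/2 powr l"]
 by (auto simp: chi_def Lam_def powr_add divide_simps)

lemma chi_bounds: "0 <= chi l xi" "chi l xi <= 1"
proof -
 show "chi l xi <= 1" using cutoff_bounds(2)[of "xi/2 powr (l + 1)"] cutoff_bounds(1)[of "xi/2 powr l"] by (simp add: chi_def)
 show "0 <= chi l xi"
 proof (cases "(abs xi) <= 2 powr (l + 1)")
  case True
  hence "cutoff (xi/2 powr (l + 1)) = 1" by (intro cutoff_eq_1) (simp add: divide_simps)
  thus ?thesis using cutoff_bounds(2)[of "xi/2 powr l"] by (simp add: chi_def)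
 next
  case False
  hence "cutoff (xi/2 powr l) = 0" by (intro cutoff_eq_0) (simp add: powr_add divide_simps)
  thus ?thesis using cutoff_bounds(1)[of "xi/2 powr (l + 1)"] by (simp add: chi_def)
 qed
qed

lemma chi_telescope: "a <= b ==> (\<Sum>l\<in>{a..<b}. chi l xi) = cutoff (xi/2 powr b) - cutoff (xi/2 powr a)"
proof (induction b rule: int_ge_induct)
 case (step b)
 have "{a..<b + 1} = insert b {a..<b}" using step(1) by auto
 thus ?case using step(2) by (simp add: chi_def)
qed simp

lemma chi_scale: "chi l xi = chi 0 (xi/2 powr l)" by (simp add: chi_def powr_add)

text \<open>The symbol of \<open>D^sg\<close> on the annulus at scale \<open>l\<close>. It is smooth
  with compact support for every real \<open>sg\<close>, because the annulus avoids 0.\<close>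

definition bw :: "real => int => real => complex" where "bw sg l xi = abspow sg xi * of_real (chi l xi)"

definition lowp :: "int => real => complex" where "lowp J xi = of_real (cutoff (xi/2 powr J))"

lemma smooth_scale: "smooth_on UNIV f ==> smooth_on UNIV (%x. f (x/c))" using Csm_scale[of _ f "inverse c"] by (auto simp: smooth_on_def divide_inverse mult.commute)

lemma bump_lowp: "bump (lowp J)" unfolding bump_def
proof (intro conjI exI allI impI)
 show "smooth_on UNIV (lowp J)" unfolding lowp_def[abs_def] by (rule smooth_scale[OF smooth_cutoff])
 show "lowp J xi = 0" if "2*2 powr J < (abs xi)" for xi using that cutoff_eq_0[of "xi/2 powr J"] by (simp add: lowp_def divide_simps)
qed

lemma lowp_eq_0: "2*2 powr ri J < (abs xi) ==> lowp J xi = 0" using cutoff_eq_0[of "xi/2 powr J"] by (simp add: lowp_def divide_simps)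

lemma bw_eq_0: "xi ~: Lam (2 powr l) ==> bw sg l xi = 0" by (simp add: bw_def chi_eq_0)

lemma bw_near_0: "(abs xi) < 2 powr ri l ==> bw sg l xi = 0" by (rule bw_eq_0) (simp add: Lam_def)

lemma bump_chi: "bump (%xi. cor (chi l xi))" unfolding bump_def
proof (intro conjI exI allI impI)
 have "smooth_on UNIV (%xi. lowp (l + 1) xi + (-1)*lowp l xi)"
  unfolding smooth_on_def by (intro allI Csm_add Csm_mult Csm_const) (use bump_lowp in "simp_all add: bump_def smooth_on_def")
 thus "smooth_on UNIV (%xi. cor (chi l xi))" by (simp add: chi_def lowp_def)
 show "cor (chi l xi) = 0" if "4*2 powr l < (abs xi)" for xi using that chi_eq_0[of xi l] by (simp add: Lam_def)
qed

lemma bump_bw: "bump (bw sg l)" unfolding bw_def[abs_def] by (rule bump_mult_away[OF bump_chi smooth_abspow, of "2 powr l"]) (auto simp: chi_eq_0 Lam_def)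

lemma bump_ibw: "bump (%xi. \<i> * of_real xi*bw sg l xi)"
proof (rule bump_mult[OF bump_bw])
 show "smooth_on UNIV (%xi. \<i>*cor xi)" unfolding smooth_on_def by (auto intro!: Csm_mult Csm_const Csm_id)
qed

lemma bw_scale: "bw sg l xi = of_real (pw sg l)*bw sg 0 (xi/2 powr ri l)"
proof -
 have "(abs xi) powr sg = (2 powr ri l) powr sg*\<bar>xi/2 powr ri l\<bar> powr sg" by (subst powr_mult[symmetric]) (auto simp: abs_divide)
 thus ?thesis unfolding bw_def abspow_def chi_scale[of l] by (simp add: powr_powr mult.commute)
qed

text \<open>Bernstein's inequality: by \<open>bw_scale\<close> all scales are dilates of scale 0,
  and only the factor \<open>2 powr (sg*l)\<close> distinguishes them.\<close>

lemma kn_bw: "kn (bw sg l) = er (pw sg l)*kn (bw sg 0)"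
proof -
 note [measurable] = bump_measurable[OF bump_bw]
 have "kn (bw sg l) = er (pw sg l)*kn (%xi. bw sg 0 (xi/2 powr ri l))" unfolding bw_scale[of sg l, abs_def] by (subst kn_cmult) auto
 thus ?thesis by (simp add: kn_scale)
qed

lemma kn_lowp: "kn (lowp J) = kn (lowp 0)" unfolding lowp_def[of J, abs_def] using kn_scale[OF bump_measurable[OF bump_lowp[of 0]], of "2 powr J"] by (simp add: lowp_def)

lemma powr_Lam_le: "xi : Lam a ==> 0 < a ==> (abs xi) powr sg <= 4 powr (abs sg)*a powr sg"
proof -
 assume x: "xi : Lam a" and a: "0 < a"
 hence r: "1 <= (abs xi)/a" "(abs xi)/a <= 4" by (auto simp: Lam_def divide_simps)
 have "(abs xi) powr sg = ((abs xi)/a) powr sg*a powr sg" using a by (subst powr_mult[symmetric]) auto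
 also have "((abs xi)/a) powr sg <= ((abs xi)/a) powr (abs sg)" using r by (intro powr_mono) auto
 also have "... <= 4 powr (abs sg)" using r by (intro powr_mono2) auto
 finally show ?thesis by (simp add: mult_right_mono)
qed

lemma bw_bound: "norm (bw sg l xi) <= 4 powr (abs sg)*pw sg l"
proof (cases "xi : Lam (2 powr ri l)")
 case True
 have "norm (bw sg l xi) = (abs xi) powr sg*chi l xi" using chi_bounds by (simp add: bw_def abspow_def norm_mult)
 also have "... <= (4 powr (abs sg)*(2 powr ri l) powr sg)*1" using True by (intro mult_mono powr_Lam_le chi_bounds) auto
 finally show ?thesis by (simp add: powr_powr mult.commute)
qed (simp add: bw_eq_0)

lemma ibw_bound: "norm (\<i> * of_real xi*bw sg l xi) <= 4 powr ((abs sg) + 1)*pw (sg + 1) l"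
proof (cases "xi : Lam (2 powr ri l)")
 case True
 hence "(abs xi)*norm (bw sg l xi) <= (4*2 powr ri l)*(4 powr (abs sg)*pw sg l)" by (intro mult_mono bw_bound) (auto simp: Lam_def)
 also have "... = 4 powr ((abs sg) + 1)*pw (sg + 1) l" by (simp add: powr_add distrib_right)
 finally show ?thesis by (simp add: norm_mult)
qed (simp add: bw_eq_0)

text \<open>\<open>None\<close> stands for all scales and \<open>Some J\<close> for the scales from \<open>J\<close> on.\<close>

definition tailsym :: "int option => real => real" where "tailsym J xi = (case J of None => 1 | Some j => 1 - cutoff (xi/2 powr ri j))"

definition scales :: "int option => int set" where "scales J = (case J of None => UNIV | Some j => {j..})"

text \<open>At a fixed nonzero frequency the sum is finite and telescopes, and the cutoff at the top
  is 1. Allowing every finite set that contains \<open>{-N..N}\<close> makes the result fit any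
  enumeration of the scales.\<close>

lemma chi_sum:
 assumes "xi ~= 0"
 obtains N where "0 <= N" "!!F. finite F ==> {-N..N} \<subseteq> F ==> (\<Sum>l\<in>F. chi l xi*ind (scales J) l) = tailsym J xi"
proof -
 obtain n :: nat where n: "\<bar>log 2 (abs xi)\<bar> < real n" using reals_Archimedean2 by blast
 define N where "N = int n + (case J of None => 0 | Some j => (abs j)) + 3"
 have N3: "int n + 3 <= N" "!!j. J = Some j ==> (abs j) <= N" by (auto simp: N_def split: option.split)
 have lo: "2 powr (- real n) <= (abs xi)" and hi: "(abs xi) <= 2 powr real n" using n assms by (auto simp: le_log_iff[symmetric] log_le_iff[symmetric] abs_less_iff)
 have z: "chi l xi = 0" if "l ~: {-N..<N}" for l
 proof (rule chi_eq_0)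
  consider "real n < l" | "l + 2 < - real n" using \<open>l \<notin> {-N..<N}\<close> N3 by force
  thus "xi ~: Lam (2 powr l)"
  proof cases
   case 1 hence "2 powr real n < 2 powr l" by simp
   thus ?thesis using hi unfolding Lam_def mem_Collect_eq by linarith
  next
   case 2 hence "2 powr (ri l + 2) < 2 powr (- real n)" by (intro powr_less_mono) auto
   thus ?thesis using lo by (auto simp: Lam_def powr_add)
  qed
 qed
 have hiN: "cutoff (xi/2 powr N) = 1"
 proof (rule cutoff_eq_1)
  have "2 powr real n <= 2 powr ri N" using N3(1) by (intro powr_mono) auto
  hence "(abs xi) <= 2 powr N" using hi by linarith
  thus "\<bar>xi/2 powr N\<bar> <= 1" by (simp add: abs_divide)
 qed
 have loN: "cutoff (xi/2 powr (- N)) = 0"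
 proof (rule cutoff_eq_0)
  have "2*2 powr (- N) = 2 powr (1 + - ri N)" by (simp only: powr_add) simp
  also have "... <= 2 powr (- real n)" using N3(1) by (intro powr_mono) auto
  finally show "2 <= \<bar>xi/2 powr (- N)\<bar>" using lo by (simp add: abs_divide pos_le_divide_eq)
 qed
 have "(\<Sum>l\<in>F. chi l xi*ind (scales J) l) = tailsym J xi" if F: "finite F" "{-N..N} \<subseteq> F" for F
 proof (cases J)
  case None
  have "(\<Sum>l\<in>F. chi l xi) = (\<Sum>l\<in>{-N..<N}. chi l xi)" using F z by (intro sum.mono_neutral_right) auto
  also have "... = 1" using hiN loN N3(1) by (subst chi_telescope) auto
  finally show ?thesis by (simp add: None scales_def tailsym_def)
 next
  case (Some j)
  have j: "- N <= j" "j <= N" using N3(2)[OF Some] by auto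
  have "(\<Sum>l\<in>F. chi l xi*ind (scales J) l) = (\<Sum>l\<in>{j..<N}. chi l xi*ind (scales J) l)"
   using F z j by (intro sum.mono_neutral_right) (auto simp: Some scales_def)
  also have "... = (\<Sum>l\<in>{j..<N}. chi l xi)" by (intro sum.cong) (auto simp: Some scales_def)
  also have "... = 1 - cutoff (xi/2 powr j)" using hiN j by (subst chi_telescope) auto
  finally show ?thesis by (simp add: Some tailsym_def)
 qed
 thus thesis using that[of N] by (simp add: N_def split: option.split)
qed

lemma chi_sum_le:
 assumes "finite F"
 shows "0 <= (\<Sum>l\<in>F. chi l xi*ind (scales J) l)" "(\<Sum>l\<in>F. chi l xi*ind (scales J) l) <= (if xi = 0 then 0 else tailsym J xi)"
proof -
 show "0 <= (\<Sum>l\<in>F. chi l xi*ind (scales J) l)" using chi_bounds by (intro sum_nonneg) auto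
 show "(\<Sum>l\<in>F. chi l xi*ind (scales J) l) <= (if xi = 0 then 0 else tailsym J xi)"
 proof (cases "xi = 0")
  case True
  hence "chi l xi = 0" for l using chi_eq_0[of xi l] by (simp add: Lam_def)
  thus ?thesis using True by simp
 next
  case False
  obtain N where N: "0 <= N" "!!F. finite F ==> {-N..N} \<subseteq> F ==> (\<Sum>l\<in>F. chi l xi*ind (scales J) l) = tailsym J xi" using chi_sum[OF False] by blast
  have "(\<Sum>l\<in>F. chi l xi*ind (scales J) l) <= (\<Sum>l\<in>F \<union> {-N..N}. chi l xi*ind (scales J) l)" using assms chi_bounds by (intro sum_mono2) auto
  also have "... = tailsym J xi" using assms by (intro N) auto
  finally show ?thesis using False by simp
 qed
qed

text \<open>Hoelder against the weight on the bounded time interval, then Fubini. It provides the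
  times at which a series of pieces can be tested against Schwartz functions.\<close>

lemma weight_AE:
 fixes g :: "real => real => ennreal"
 assumes gm [measurable]: "mm g" and fin: "mx p q g < top" and p: "1 < p" "1 < q" and T: "0 <= T" and z: "!!t x. t ~: {0..T} ==> g t x = 0"
 shows "AEL t. (NN x. g t x*er (1/(1 + x^2))) < top"
proof -
 let ?w = "%x::real. er (1/(1 + x^2))"
 let ?h = "%t x. ?w x*ind {0..T} t"
 define p2 q2 where "p2 = p/(p - 1)" and "q2 = q/(q - 1)"
 have p2: "1 < p2" "1 < q2" "1/1 = 1/p + 1/p2" "1/1 = 1/q + 1/q2" using p by (auto simp: p2_def q2_def field_simps)
 have h: "mx p2 q2 ?h < top" by (rule mx_weight[OF p2(1,2) T])
 have "(NN t. (NN x. g t x*?w x)) = mx 1 1 (%t x. g t x*?w x)" unfolding mx_1 by (rule lborel_pair.Fubini') measurable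
 also have "... = mx 1 1 (%t x. g t x*?h t x)" using z by (intro arg_cong[where f="mx 1 1"] ext) (auto simp: indicator_def)
 also have "... <= mx p q g*mx p2 q2 ?h" using p p2 by (intro mx_Holder) auto
 also have "... < top" using fin h by (simp add: ennreal_mult_less_top)
 finally have "(NN t. (NN x. g t x*?w x)) ~= top" by simp
 moreover have "bml (%t. (NN x. g t x*?w x))" by measurable
 ultimately show ?thesis using nn_integral_PInf_AE[of "%t. (NN x. g t x*?w x)" lborel] by (simp add: less_top)
qed

lemma fourier_pair_cong_AE:
 assumes p: "fourier_pair f F" and ae: "AEL x. F x = G x" and [measurable]: "bm G"
 shows "fourier_pair f G" unfolding fourier_pair_def
proof (intro allI impI)
 fix psi assume s: "schwartz psi"
 note [measurable] = schwartz_measurable[OF s] fp_measurable[OF p]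
 have e: "AEL x. F x*psi x = G x*psi x" using ae by eventually_elim simp
 have m: "bml (%x. F x*psi x)" "bml (%x. G x*psi x)" by measurable
 show "integrable lborel (%x. f x*fourier psi x) & integrable lborel (%x. G x*psi x) & (LI x. f x*fourier psi x) = (LI x. G x*psi x)"
  using p s Bochner_Integration.integrable_cong_AE[OF m e] integral_cong_AE[OF m e] by (simp add: fourier_pair_def)
qed

lemma fourier_pair_diff:
 assumes "fourier_pair f F" "fourier_pair g G"
 shows "fourier_pair (%x. f x - g x) (%x. F x - G x)" using assms by (simp add: fourier_pair_def left_diff_distrib)

lemma fourier_pair_ker:
 assumes G: "integrable lborel G"
 shows "fourier_pair (%y. (1/cor (2*pi))*ker G y) G" unfolding fourier_pair_def
proof (intro allI impI conjI)
 have [measurable]: "bm G" using G by (auto dest: bmi)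
 fix psi assume s: "schwartz psi"
 note [measurable] = schwartz_measurable[OF s] schwartz_props(5)[OF s]
 obtain C where C: "!!x. norm (psi x) <= C/(1 + x^2)" "0 <= C" using schwartz_props(3)[OF s] by blast
 show "integrable lborel (%x. ((1/cor (2*pi))*ker G x)*fourier psi x)"
 proof (rule integrable_le[OF integrable_mult_right[OF integrable_norm[OF schwartz_props(6)[OF s]], of "(LI xi. norm (G xi))"]])
  fix x
  have k: "norm (ker G x) <= (LI xi. norm (G xi))" unfolding ker_def by (rule norm_integral_cis_le[OF G])
  have "norm ((1/cor (2*pi))*ker G x) <= 1*norm (ker G x)" unfolding norm_mult using pi_gt3 by (intro mult_right_mono) (auto simp: norm_divide)
  hence "norm ((1/cor (2*pi))*ker G x) <= (LI xi. norm (G xi))" using k by linarith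
  thus "norm (((1/cor (2*pi))*ker G x)*fourier psi x) <= (LI xi. norm (G xi))*norm (fourier psi x)"
   unfolding norm_mult[of _ "fourier psi x"] by (rule mult_right_mono) simp
 qed measurable
 have Cb: "norm (psi x) <= C" for x
 using decay_le[OF C(2), of x] C(1)[of x] by linarith
 show "integrable lborel (%x. G x*psi x)"
 by (rule integrable_le[OF integrable_mult_right[OF integrable_norm[OF G], of C]])
   (measurable, use mult_right_mono[OF Cb norm_ge_zero] in \<open>simp add: norm_mult mult.commute[of "norm (G _)"]\<close>)
 have "(LI x. fourier psi x*(LI xi. G xi*cis (x*xi))) = (LI xi. G xi*(LI x. fourier psi x*cis (x*xi)))"
  by (rule kernel_Fubini[where C=1]) (use G schwartz_props(6)[OF s] in auto)
 also have "... = (LI xi. cor (2*pi)*(G xi*psi xi))" unfolding schwartz_inversion[OF s] by (simp add: mult_ac)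
 also have "... = cor (2*pi)*(LI xi. G xi*psi xi)" by (rule LI_mult)
 finally have e: "(LI x. fourier psi x*ker G x) = cor (2*pi)*(LI xi. G xi*psi xi)" unfolding ker_def .
 have "(LI x. ((1/cor (2*pi))*ker G x)*fourier psi x) = (LI x. (1/cor (2*pi))*(fourier psi x*ker G x))" by (simp add: mult_ac)
 also have "... = (1/cor (2*pi))*(LI x. fourier psi x*ker G x)" by (rule LI_mult)
 finally show "(LI x. ((1/cor (2*pi))*ker G x)*fourier psi x) = (LI x. G x*psi x)" unfolding e by simp
qed

lemma cv_fourier_pair:
 assumes "fourier_pair f F" "bump b"
 shows "fourier_pair (cv b f) (%xi. F xi*b xi)" using fourier_pair_ker[OF cv_pair(2)[OF assms]] unfolding cv_pair(1)[OF assms, abs_def] ker_def .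

lemma bump_phase:
 assumes b: "bump b" "0 < delta" "!!xi. (abs xi) < delta ==> b xi = 0"
 shows "bump (%xi. cis (- (r * om alpha xi))*b xi)"
proof (rule bump_mult_away[OF b(1) _ b(2,3)])
 have "smooth_on (- {0}) (%xi. exp ((- \<i>*cor r)*(abspow alpha xi*cor xi)))"
  using smooth_abspow unfolding smooth_on_def by (intro allI Csm_exp Csm_mult Csm_const Csm_id) blast
 thus "smooth_on (- {0}) (%xi. cis (- (r * om alpha xi)))" by (simp add: cis_conv_exp abspow_def om_def mult.assoc)
qed

text \<open>\<open>fourier_pair_series\<close> with the integers enumerated by
  \<open>int_decode\<close>. The partial sums of the \<open>chi l\<close> are nonnegative and at
  most \<open>tailsym J\<close>, so no constant is lost in the domination.\<close>

lemma fourier_series_scales: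
 assumes pr: "fourier_pair f F"
  and fin: "(NN y. zsum (%l. en (cv (bw sg l) f y)*ind (scales J) l)*er (1/(1 + y^2))) < top"
  and int: "!!psi. schwartz psi ==> integrable lborel (%xi. (abspow sg xi * of_real (tailsym J xi))*F xi*psi xi)"
 shows "fourier_pair (%y. \<Sum>i. cv (bw sg (int_decode i)) f y*ind (scales J) (int_decode i)) (%xi. (abspow sg xi * of_real (tailsym J xi))*F xi)"
proof (rule fourier_pair_series[where b="%i xi. bw sg (int_decode i) xi*ind (scales J) (int_decode i)" and C=1])
 note Fm [measurable] = fp_measurable[OF pr]
 show "bm F" by (rule Fm)
 show "bm (%xi. bw sg (int_decode i) xi*ind (scales J) (int_decode i))" for i using bump_measurable[OF bump_bw] by measurable
 show bF: "integrable lborel (%xi. F xi*(bw sg (int_decode i) xi*ind (scales J) (int_decode i)))" for i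
  unfolding mult.assoc[symmetric] by (rule integrable_mult_left[OF cv_pair(2)[OF pr bump_bw]])
 show "cv (bw sg (int_decode i)) f y*ind (scales J) (int_decode i) = 1/cor (2*pi) *
   (LI xi. (F xi*(bw sg (int_decode i) xi*ind (scales J) (int_decode i)))*cis (y*xi))" for i y unfolding cv_pair(1)[OF pr bump_bw] by (simp add: indicator_def)
 have "(\<Sum>i. en (cv (bw sg (int_decode i)) f y*ind (scales J) (int_decode i))) = zsum (%l. en (cv (bw sg l) f y)*ind (scales J) l)" for y
  unfolding zsum_nat by (intro arg_cong[where f=suminf] ext) (simp add: indicator_def)
 thus "(NN y. (\<Sum>i. en (cv (bw sg (int_decode i)) f y*ind (scales J) (int_decode i)))*er (1/(1 + y^2))) < top" using fin by simp
 have bs: "(\<Sum>i<n. bw sg (int_decode i) xi*ind (scales J) (int_decode i)) = abspow sg xi * of_real (\<Sum>l\<in>int_decode ` {..<n}. chi l xi*ind (scales J) l)" for n xi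
  unfolding sum.reindex[OF inj_int_decode] by (simp only: o_def of_real_sum sum_distrib_left of_real_mult indicator_complex_eq bw_def mult.assoc)
 show "AEL xi. (%n. \<Sum>i<n. bw sg (int_decode i) xi*ind (scales J) (int_decode i)) ----> abspow sg xi * of_real (tailsym J xi)" using AE_lborel_singleton[of 0]
 proof eventually_elim
  case (elim xi)
  obtain N where N: "!!F. finite F ==> {-N..N} \<subseteq> F ==> (\<Sum>l\<in>F. chi l xi*ind (scales J) l) = tailsym J xi" using chi_sum[OF elim] by blast
  have "{-N..N} \<subseteq> int_decode ` {..<n}" if n: "Max (int_encode ` {-N..N}) < n" for n
  proof
   fix l assume l: "l : {-N..N}"
   hence "int_encode l <= Max (int_encode ` {-N..N})" by (intro Max_ge) auto
   thus "l : int_decode ` {..<n}" using n by (intro image_eqI[of _ _ "int_encode l"]) auto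
  qed
  thus ?case unfolding bs
   by (intro tendsto_eventually eventually_sequentiallyI[of "Suc (Max (int_encode ` {-N..N}))"], intro arg_cong[where f="%z. abspow sg xi * of_real z"] N) auto
 qed
 show "bm (%xi. abspow sg xi * of_real (tailsym J xi))"
 proof -
  have "bm (%xi. cor (cutoff (xi/2 powr ri j)))" for j using bump_measurable[OF bump_lowp[of j]] by (simp add: lowp_def[abs_def])
  thus ?thesis unfolding abspow_def tailsym_def by (cases J) simp_all
 qed
 show "norm (\<Sum>i<n. bw sg (int_decode i) xi*ind (scales J) (int_decode i)) <= 1*norm (abspow sg xi*cor (tailsym J xi))" for n xi
 proof (cases "xi = 0")
  case False
  thus ?thesis using chi_sum_le[where F="int_decode ` {..<n}" and J=J and xi=xi] unfolding bs norm_mult mult_1_left norm_of_real by (intro mult_left_mono) auto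
 qed (simp add: bs abspow_def)
 show "integrable lborel (%xi. abspow sg xi*cor (tailsym J xi)*F xi*psi xi)" if "schwartz psi" for psi by (rule int[OF that])
qed

section \<open>Homogeneous Sobolev norms on the Fourier side\<close>

lemma Lebesgue_norm_2: "Lebesgue_norm lborel 2 (%x. en (g x)) = sqn g^.(1/2)"
proof -
 have "enn2real 2 = 2" by (metis enn2real_numeral)
 thus ?thesis by (simp add: Lebesgue_norm_def sqn_def epowr_numeral)
qed

lemma D_symbol_abspow: "D_symbol s = abspow s" by (simp add: fun_eq_iff D_symbol_def abspow_def)

text \<open>A square integrable \<open>abspow s * F\<close> is the transform of some
  \<open>L^2\<close> function, and this function is admissible in the infimum.\<close>

lemma Hdot_upper:
 assumes F: "fourier_pair (%x. cor (f x)) F" and fin: "sqn (%xi. abspow s xi*F xi) < top"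
 shows "Hdot_norm s f <= sqn (%xi. abspow s xi*F xi)^.(1/2)"
proof -
 have "bm (%xi. abspow s xi*F xi)" using fp_measurable(2)[OF F] unfolding abspow_def by measurable
 then obtain g where g: "fourier_pair g (%xi. abspow s xi*F xi)" "sqn g <= sqn (%xi. abspow s xi*F xi)" using L2_fourier_pair_exists[OF _ fin] by blast
 have "Hdot_norm s f <= Lebesgue_norm lborel 2 (%x. en (g x))"
  unfolding Hdot_norm_def by (rule INF_lower) (use F g in "auto simp: fourier_multiplier_def D_symbol_abspow")
 also have "... <= sqn (%xi. abspow s xi*F xi)^.(1/2)" unfolding Lebesgue_norm_2 by (intro epowr_mono g) simp
 finally show ?thesis .
qed

text \<open>By uniqueness of transforms every admissible function has the transform
  \<open>abspow s * F\<close> almost everywhere; 3 rounds up the Plancherel constant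
  \<open>sqrt (2*pi)\<close> of this normalisation.\<close>

lemma Hdot_lower:
 assumes F: "fourier_pair (%x. cor (f x)) F"
 shows "sqn (%xi. abspow s xi*F xi)^.(1/2) <= 3*Hdot_norm s f"
proof -
 let ?S = "sqn (%xi. abspow s xi*F xi)^.(1/2)"
 have "er (1/3)*?S <= Hdot_norm s f" unfolding Hdot_norm_def
 proof (rule INF_greatest, clarsimp simp: fourier_multiplier_def D_symbol_abspow Lebesgue_norm_2)
  fix g G assume G: "fourier_pair (%x. cor (f x)) G" "fourier_pair g (%xi. abspow s xi*G xi)"
  have "sqn (%xi. abspow s xi*F xi) = sqn (%xi. abspow s xi*G xi)"
   unfolding sqn_def by (rule nn_integral_cong_AE) (use fourier_pair_unique[OF F G(1)] in eventually_elim, simp)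
  also have "... <= er 9 * sqn g"
  proof (cases "sqn g < top")
   case True
   have "sqn (%xi. abspow s xi*G xi) <= er (2*pi) * sqn g" by (rule fourier_pair_L2[OF G(2) True])
   also have "... <= er 9 * sqn g" using pi_less_4 by (intro mult_right_mono ennreal_leI) auto
   finally show ?thesis .
  next
   case False
   thus ?thesis by (simp add: less_top[symmetric] ennreal_mult_top)
  qed
  finally have "?S <= (er 9 * sqn g)^.(1/2)" by (rule epowr_mono) simp
  also have "... = er 3 * sqn g^.(1/2)" by (simp add: epowr_mult powr_half_sqrt del: ennreal_numeral)
  finally have "er (1/3)*?S <= er (1/3)*(er 3 * sqn g^.(1/2))" by (rule mult_left_mono) simp
  also have "... = sqn g^.(1/2)" unfolding mult.assoc[symmetric] by (subst ennreal_mult[symmetric]) auto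
  finally show "er (1/3)*?S <= sqn g^.(1/2)" .
 qed
 hence "er 3*(er (1/3)*?S) <= er 3*Hdot_norm s f" by (rule mult_left_mono) simp
 moreover have "er 3*(er (1/3)*?S) = ?S" unfolding mult.assoc[symmetric] by (subst ennreal_mult[symmetric]) auto
 ultimately show ?thesis by simp
qed

lemma mx_zsum:
 assumes f: "!!j. mm (f j)" and p: "1 < p" "1 < q"
 shows "mx p q (%t x. zsum (%j. f j t x)) <= zsum (%j. mx p q (f j))"
proof (rule mx_Minkowski[OF sigma_finite_measure_count_space_countable _ p])
 show "(%(z, t, x). f z t x) : borel_measurable (count_space UNIV \<Otimes>\<^sub>M LL)"
  by (rule measurable_pair_measure_countable1) (use f in "simp_all add: split_beta'")
qed simp

text \<open>Fourier identities hold at almost every time for almost every \<open>x\<close>, whereas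
  mixed norms need the quantifiers in the other order.\<close>

lemma AE_swap_le:
 fixes f g :: "real => real => ennreal"
 assumes [measurable]: "mm f" "mm g" and a: "AEL t. AEL x. f t x <= g t x"
 shows "AEL x. AEL t. f t x <= g t x"
proof (rule lborel_pair.AE_commute[THEN iffD1, OF _ a])
 have [measurable]: "bmL (%z. f (fst z) (snd z))" "bmL (%z. g (fst z) (snd z))" using assms(1,2) by (simp_all add: split_beta')
 show "{z : space LL. f (fst z) (snd z) <= g (fst z) (snd z)} : sets LL" by measurable
qed

lemma en_suminf_le: "en (suminf a) <= (\<Sum>i. en (a i))" for a :: "nat => complex"
proof (cases "(\<Sum>i. en (a i)) < top")
 case True
 hence s: "summable (%i. norm (a i))" by (intro summable_suminf_not_top[OF norm_ge_zero]) (simp only: less_top)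
 have "en (suminf a) <= er (\<Sum>i. norm (a i))" by (rule ennreal_leI[OF summable_norm[OF s]])
 also have "... = (\<Sum>i. en (a i))" by (rule suminf_ennreal2[OF norm_ge_zero s, symmetric])
 finally show ?thesis .
next
 case False
 hence "(\<Sum>i. en (a i)) = top" by (simp only: less_top[symmetric] not_not)
 thus ?thesis by simp
qed

lemma norm_power_diff_le:
 fixes a b :: complex
 shows "norm (a^(n + 1) - b^(n + 1)) <= real (n + 1)*(norm (a - b)*(norm a + norm b)^n)"
proof -
 have t: "norm (a^i*b^(n - i)) <= (norm a + norm b)^n" if "i < Suc n" for i
 proof -
  have "norm (a^i*b^(n - i)) <= (norm a + norm b)^i*(norm a + norm b)^(n - i)" unfolding norm_mult norm_power by (intro mult_mono power_mono) auto
  also have "... = (norm a + norm b)^n" using that by (simp flip: power_add)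
  finally show ?thesis .
 qed
 have "norm (a^Suc n - b^Suc n) <= norm (a - b)*(\<Sum>i<Suc n. (norm a + norm b)^n)" unfolding diff_power_eq_sum norm_mult by (intro mult_left_mono sum_norm_le t) auto
 thus ?thesis by (simp add: mult_ac add.commute)
qed

lemma cv_indicator: "cv b (%x. f x*ind I (t::real)) y = cv b f y*ind I t" by (cases "t : I") (simp_all add: cv_def)

lemma en_indicator: "en (z*ind I t) = en z*ind I (t::real)" for z :: complex by (simp add: indicator_def)

section \<open>Persistence of regularity\<close>

text \<open>The solution is extended by 0 outside \<open>{0..T}\<close>, \<open>F t\<close> is its
  transform and \<open>F0\<close> that of the data. \<open>ap\<close> records what the critical norm
  says about the dyadic pieces, to be instantiated with \<open>sg0 = s_crit alpha k + 1/2\<close>;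
  \<open>p\<close> and \<open>q\<close> are the exponents of the critical space.\<close>

locale sol = disp +
 fixes k :: nat and T c p q sg0 M0 :: real and u F :: "real => real => complex" and F0 :: "real => complex"
 assumes k: "4 <= k" and T: "0 < T" and c: "(abs c) <= 1" and p_def: "p = (2*alpha + 1)*k/(alpha + 2)" and q_def: "q = (2*alpha + 1)*k/(2*(alpha - 1))"
  and um [measurable]: "mm u" and u0: "!!t x. t ~: {0..T} ==> u t x = 0"
  and pr: "!!t. t : {0..T} ==> fourier_pair (u t) (F t)"
  and uS: "mx p q (%t x. en (u t x)) < top"
  and ap: "0 < sg0" "0 <= M0" "!!l. mx P Q (%t y. en (cv (bw 0 l) (u t) y)) <= er (M0*2 powr (- (sg0*ri l)))"
  and F0: "!!psi. schwartz psi ==> integrable lborel (%xi. F0 xi*psi xi)" and F0m [measurable]: "bm F0"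
  and Duh: "!!t psi. t : {0..T} ==> schwartz psi ==>
   integrable (restrict_space lborel {0..t} \<Otimes>\<^sub>M lborel) (%(tau, x). u tau x^(k + 1)*fourier (%xi. V_symbol alpha (t - tau) xi*(\<i> * of_real xi)*psi xi) x) &
   (LI x. u t x*fourier psi x) = (LI xi. V_symbol alpha t xi*F0 xi*psi xi) -
    c*(LINT tau|restrict_space lborel {0..t}. LI x. u tau x^(k + 1)*fourier (%xi. V_symbol alpha (t - tau) xi*(\<i> * of_real xi)*psi xi) x)"
begin

text \<open>The two middle identities are the exponents for Hoelder: one factor in the
  \<open>P\<close>, \<open>Q\<close> norm and \<open>k\<close> factors in the critical space give
  the norm dual to \<open>P\<close>, \<open>Q\<close>.\<close>

lemma pq: "1 < p" "1 < q" "1/P' = 1/P + k/p" "1/Q' = 1/Q + k/q" "0 < k"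
proof -
 have k4: "4 <= real k" "0 < k" using k by auto
 thus "0 < k" by simp
 have kp: "k/p = (alpha + 2)/(2*alpha + 1)" "k/q = 2*(alpha - 1)/(2*alpha + 1)" using k4 by (simp_all add: p_def q_def)
 have d: "0 < 2*alpha + 1" using alpha by simp
 have pp: "1/P' = (3*alpha + 3)/(2*(2*alpha + 1))" "1/P = (alpha - 1)/(2*(2*alpha + 1))" "1/Q' = (4*alpha - 1)/(2*(2*alpha + 1))" "1/Q = 3/(2*(2*alpha + 1))"
  by (simp_all add: P_def P'_def Q_def Q'_def)
 have "k/p = (2*alpha + 4)/(2*(2*alpha + 1))" "k/q = (4*alpha - 4)/(2*(2*alpha + 1))"
  unfolding kp using mult_divide_mult_cancel_left[of 2 "alpha + 2" "2*alpha + 1"] mult_divide_mult_cancel_left[of 2 "2*(alpha - 1)" "2*alpha + 1"]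
  by (simp_all add: algebra_simps)
 thus "1/P' = 1/P + k/p" "1/Q' = 1/Q + k/q" unfolding pp by (simp_all flip: add_divide_distrib)
 have "(2*alpha + 1)*4 <= (2*alpha + 1)*k" using d k4 by (intro mult_left_mono) auto
 thus "1 < p" "1 < q" unfolding p_def q_def using alpha by (simp_all add: less_divide_eq)
qed

section \<open>Frequency pieces of the solution and the truncated nonlinearity\<close>

definition U :: "real => int => real => real => complex" where "U sg l t = cv (bw sg l) (u t)"
definition SJ :: "int => real => real => complex" where "SJ J t = cv (lowp J) (u t)"
text \<open>Origin of the shift: \<open>SJ J\<close> has frequencies up to
  \<open>2*2 powr J\<close>, its power up to \<open>(k + 1)*(2*2 powr J)\<close>, and
  \<open>k + 1 < 2 powr (k + 1)\<close> keeps this below \<open>2 powr l\<close> for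
  \<open>J = l - (k + 2)\<close>.\<close>

definition Rl :: "int => real => real => complex" where "Rl l t x = u t x^(k + 1) - SJ (l - (int k + 2)) t x^(k + 1)"
definition ib :: "real => int => real => complex" where "ib sg l xi = \<i> * of_real xi*bw sg l xi"
definition hJ :: "int => real => real => ennreal" where "hJ J t x = zsum (%j. en (U 0 j t x)*ind {J..} j)"

lemma UmS [measurable]: "mm (U sg l)" "mm (SJ J)" unfolding U_def SJ_def using bump_measurable[OF bump_bw] bump_measurable[OF bump_lowp] by measurable

lemma Rlm [measurable]: "mm (Rl l)" unfolding Rl_def by measurable

lemma off: "t ~: {0..T} ==> U sg l t x = 0" "t ~: {0..T} ==> SJ J t x = 0" "t ~: {0..T} ==> Rl l t x = 0" using u0 by (simp_all add: U_def SJ_def Rl_def cv_def)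

lemma hJm [measurable]: "mm (hJ J)"
proof -
 have "mm (%t x. \<Sum>n. en (U 0 (int_decode n) t x)*ind {J..} (int_decode n))" by measurable
 thus ?thesis by (simp add: hJ_def zsum_nat)
qed

definition nl :: "real set => int => ennreal" where "nl I l = mx P Q (%t x. en (U 0 l t x)*ind I t)"
definition uI :: "real set => ennreal" where "uI I = mx p q (%t x. en (u t x)*ind I t)"

lemma hJ_mx:
 assumes [measurable]: "I : sets borel"
 shows "mx P Q (%t x. hJ J t x*ind I t) <= zsum (%j. nl I j*ind {J..} j)"
proof -
 have "mx P Q (%t x. hJ J t x*ind I t) = mx P Q (%t x. zsum (%j. ind {J..} j*(en (U 0 j t x)*ind I t)))"
 proof -
  have "hJ J t x*ind I t = zsum (%j. ind {J..} j*(en (U 0 j t x)*ind I t))" for t x unfolding hJ_def by (subst nn_multc[symmetric]) (auto simp: mult_ac)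
  thus ?thesis by simp
 qed
 also have "... <= zsum (%j. mx P Q (%t x. ind {J..} j*(en (U 0 j t x)*ind I t)))" by (rule mx_zsum) (use PQ in auto)
 also have "... = zsum (%j. nl I j*ind {J..} j)" unfolding nl_def using PQ by (intro nn_cong) (subst mx_cmult, auto simp: mult.commute)
 finally show ?thesis .
qed

lemma nl_le: "nl I l <= er (M0*2 powr (- (sg0*ri l)))"
proof -
 have "nl I l <= mx P Q (%t x. en (U 0 l t x))" unfolding nl_def using PQ by (intro mx_mono) (auto simp: indicator_def)
 also have "... <= er (M0*2 powr (- (sg0*ri l)))" unfolding U_def by (rule ap)
 finally show ?thesis .
qed

text \<open>The a priori decay is summable towards high frequencies only. For this reason the pieces
  are collected from \<open>J\<close> upwards, and everything below stays together in
  \<open>SJ J\<close>.\<close>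

lemma hJ_finite: "mx P Q (hJ J) < top"
proof -
 have "mx P Q (hJ J) <= zsum (%j. nl UNIV j*ind {J..} j)" using hJ_mx[of UNIV J] by simp
 also have "... = zsum (%m. nl UNIV (J + m)*ind {- 0..} m)" using tailsum_alt[of 0 "nl UNIV" J] by (simp add: tailsum_def)
 also have "... <= zsum (%m. er (M0*2 powr (- (sg0*ri J)))*(er (2 powr (- (sg0*ri m)))*ind {- 0..} m))"
 proof (rule zsum_mono)
  fix m :: int
  have "2 powr (- (sg0*ri (J + m))) = 2 powr (- (sg0*ri J))*2 powr (- (sg0*ri m))" unfolding powr_add[symmetric] by (simp add: distrib_left)
  hence "nl UNIV (J + m) <= er (M0*2 powr (- (sg0*ri J)))*er (2 powr (- (sg0*ri m)))" using nl_le[of UNIV "J + m"] ap(2) by (simp add: mult.assoc flip: ennreal_mult)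
  thus "nl UNIV (J + m)*ind {- 0..} m <= er (M0*2 powr (- (sg0*ri J)))*(er (2 powr (- (sg0*ri m)))*ind {- 0..} m)"
   unfolding mult.assoc[symmetric] by (rule mult_right_mono) simp
 qed
 also have "... <= er (M0*2 powr (- (sg0*ri J)))*er (Ak sg0 0)" by (subst nn_cmult, simp) (intro mult_left_mono geo_tail ap, simp_all)
 also have "... < top" by (simp add: ennreal_mult_less_top)
 finally show ?thesis .
qed

lemma series_AE:
 assumes fin: "mx p1 q1 (%t x. zsum (%l. en (U sg l t x)*ind (scales J) l)) < top" and p: "1 < p1" "1 < q1"
  and int: "!!t psi. t : {0..T} ==> schwartz psi ==> integrable lborel (%xi. (abspow sg xi * of_real (tailsym J xi))*F t xi*psi xi)"
 shows "AEL t. t : {0..T} --> fourier_pair (%y. \<Sum>i. U sg (int_decode i) t y*ind (scales J) (int_decode i)) (%xi. (abspow sg xi * of_real (tailsym J xi))*F t xi)"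
proof -
 have "mm (%t x. \<Sum>n. en (U sg (int_decode n) t x)*ind (scales J) (int_decode n))" by measurable
 hence "mm (%t x. zsum (%l. en (U sg l t x)*ind (scales J) l))" by (simp add: zsum_nat)
 from weight_AE[OF this fin p, of T]
 have "AEL t. (NN x. zsum (%l. en (U sg l t x)*ind (scales J) l)*er (1/(1 + x^2))) < top" using T off by simp
 thus ?thesis
 proof eventually_elim
  case (elim t)
  show ?case
  proof
   assume t: "t : {0..T}"
   show "fourier_pair (%y. \<Sum>i. U sg (int_decode i) t y*ind (scales J) (int_decode i)) (%xi. (abspow sg xi * of_real (tailsym J xi))*F t xi)"
    unfolding U_def using elim int[OF t] by (intro fourier_series_scales pr t) (simp add: U_def)
  qed
 qed
qed

lemma en_series_le: "en (\<Sum>i. U sg (int_decode i) t y*ind (scales J) (int_decode i)) <= zsum (%l. en (U sg l t y)*ind (scales J) l)"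
proof -
 have "(\<Sum>i. en (U sg (int_decode i) t y*ind (scales J) (int_decode i))) = zsum (%l. en (U sg l t y)*ind (scales J) l)"
  unfolding zsum_nat by (intro arg_cong[where f=suminf] ext) (simp add: indicator_def)
 thus ?thesis using en_suminf_le[of "%i. U sg (int_decode i) t y*ind (scales J) (int_decode i)"] by simp
qed

definition SS :: "int option => real => real => complex" where "SS J t x = (case J of None => 0 | Some j => SJ j t x)"

text \<open>At almost every time \<open>u - SS J\<close> and the series of pieces have the same
  transform and hence agree almost everywhere. Finiteness of the mixed norm is what allows the
  series to be read as a tempered function. For \<open>J = None\<close> this bounds \<open>u\<close>
  itself.\<close>

lemma diff_le:
 assumes fin: "mx p1 q1 (%t x. zsum (%l. en (U 0 l t x)*ind (scales J) l)) < top" and p1: "1 < p1" "1 < q1"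
 shows "AEL x. AEL t. en (u t x - SS J t x) <= zsum (%l. en (U 0 l t x)*ind (scales J) l)"
proof (rule AE_swap_le)
 let ?S = "%t y. \<Sum>i. U 0 (int_decode i) t y*ind (scales J) (int_decode i)"
 have [measurable]: "bm (%xi. cor (tailsym J xi))" using bump_measurable[OF bump_lowp] by (cases J) (simp_all add: lowp_def[abs_def] tailsym_def)
 have "mm (%t x. \<Sum>n. en (U 0 (int_decode n) t x)*ind (scales J) (int_decode n))" by measurable
 thus "mm (%t x. zsum (%l. en (U 0 l t x)*ind (scales J) l))" by (simp add: zsum_nat)
 show "mm (%t x. en (u t x - SS J t x))" unfolding SS_def by (cases J) simp_all
 have tb: "norm (abspow 0 xi*cor (tailsym J xi)) <= 1" for xi
  using cutoff_bounds by (cases J) (auto simp: norm_mult abspow_def tailsym_def abs_le_iff simp del: of_real_diff)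
 have "AEL t. t : {0..T} --> fourier_pair (?S t) (%xi. (abspow 0 xi * of_real (tailsym J xi))*F t xi)"
 proof (rule series_AE[OF fin p1])
  fix t psi assume t: "t : {0..T}" and s: "schwartz psi"
  note [measurable] = fp_measurable[OF pr[OF t]] schwartz_measurable[OF s]
  show "integrable lborel (%xi. (abspow 0 xi * of_real (tailsym J xi))*F t xi*psi xi)"
  proof (rule integrable_le)
   show "integrable lborel (%xi. norm (F t xi*psi xi))" using pr[OF t] s by (simp add: fourier_pair_def)
   fix xi show "norm ((abspow 0 xi * of_real (tailsym J xi))*F t xi*psi xi) <= norm (F t xi*psi xi)"
    using mult_right_mono[OF tb, of "norm (F t xi*psi xi)" xi] by (simp add: norm_mult mult.assoc)
  qed (simp add: abspow_def)
 qed
 thus "AEL t. AEL x. en (u t x - SS J t x) <= zsum (%l. en (U 0 l t x)*ind (scales J) l)"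
 proof eventually_elim
  case (elim t)
  show ?case
  proof (cases "t : {0..T}")
   case True
   note [measurable] = fp_measurable[OF pr[OF True]]
   have "fourier_pair (%x. u t x - SS J t x) (%xi. of_real (tailsym J xi)*F t xi)"
   proof (cases J)
    case None thus ?thesis using pr[OF True] by (simp add: SS_def tailsym_def)
   next
    case (Some j)
    have "fourier_pair (%x. u t x - SJ j t x) (%xi. F t xi - F t xi*lowp j xi)" unfolding SJ_def by (intro fourier_pair_diff cv_fourier_pair pr True bump_lowp)
    thus ?thesis by (simp add: Some SS_def tailsym_def lowp_def algebra_simps)
   qed
   moreover have "fourier_pair (?S t) (%xi. of_real (tailsym J xi)*F t xi)"
   proof (rule fourier_pair_cong_AE)
    show "fourier_pair (?S t) (%xi. (abspow 0 xi * of_real (tailsym J xi))*F t xi)" using elim True by blast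
    show "AEL xi. (abspow 0 xi * of_real (tailsym J xi))*F t xi = of_real (tailsym J xi)*F t xi"
     using AE_lborel_singleton[of 0] by eventually_elim (simp add: abspow_def)
   qed measurable
   ultimately have "AEL x. u t x - SS J t x = ?S t x" by (rule fourier_pair_unique_left)
   thus ?thesis
   proof eventually_elim
    case (elim x)
    show ?case unfolding elim by (rule en_series_le)
   qed
  next
   case False
   hence "u t x - SS J t x = 0" for x by (cases J) (simp_all add: u0 off SS_def)
   thus ?thesis by simp
  qed
 qed
qed

lemma diff_le_hJ: "AEL x. AEL t. en (u t x - SJ J t x) <= hJ J t x"
 using diff_le[of P Q "Some J"] hJ_finite[of J, unfolded hJ_def[abs_def]] PQ by (simp add: SS_def scales_def hJ_def)

definition CS :: "real set => ennreal" where "CS I = er (k + 1)*((1 + kn (lowp 0))*uI I)^.k"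

text \<open>The difference of the powers contains one factor \<open>u - SJ J\<close>, bounded by the
  pieces from \<open>J\<close> on, and \<open>k\<close> factors bounded by \<open>u\<close> and
  \<open>SJ J\<close>. The low-pass filter costs \<open>kn (lowp 0)\<close>, whatever the
  scale.\<close>

lemma Rl_mx:
 assumes [measurable]: "I : sets borel"
 shows "mx P' Q' (%t x. en (Rl l t x)*ind I t) <= CS I*tailsum (int k + 2) (nl I) l"
proof -
 define J where "J = l - (int k + 2)"
 let ?G = "%t x. en (u t x)*ind I t + en (SJ J t x)*ind I t"
 have "mx P' Q' (%t x. en (Rl l t x)*ind I t) <= mx P' Q' (%t x. er (k + 1)*((hJ J t x*ind I t)*?G t x^.k))"
 proof (rule mx_mono_AE)
  show "AEL x. AEL t. en (Rl l t x)*ind I t <= er (k + 1)*((hJ J t x*ind I t)*?G t x^.k)" using diff_le_hJ[of J]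
  proof eventually_elim
   case (elim x)
   thus ?case
   proof eventually_elim
    case (elim t)
    have "en (Rl l t x) <= er ((k + 1)*(norm (u t x - SJ J t x)*(norm (u t x) + norm (SJ J t x))^k))"
     unfolding Rl_def J_def[symmetric] by (intro ennreal_leI norm_power_diff_le)
    also have "... = er (k + 1)*(en (u t x - SJ J t x)*(en (u t x) + en (SJ J t x))^.k)"
     by (simp add: ennreal_mult powr_realpow' pq(5)[THEN less_imp_neq, symmetric] flip: ennreal_plus)
    also have "... <= er (k + 1)*(hJ J t x*(en (u t x) + en (SJ J t x))^.k)" by (intro mult_left_mono mult_right_mono elim) auto
    finally show ?case by (cases "t : I") auto
   qed
  qed
 qed (use PQ in auto)
 also have "... = er (k + 1)*mx P' Q' (%t x. (hJ J t x*ind I t)*?G t x^.k)" using PQ by (intro mx_cmult) auto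
 also have "mx P' Q' (%t x. (hJ J t x*ind I t)*?G t x^.k) <= mx P Q (%t x. hJ J t x*ind I t)*mx (p/k) (q/k) (%t x. ?G t x^.k)" using PQ pq by (intro mx_Holder) auto
 also have "mx (p/k) (q/k) (%t x. ?G t x^.k) = mx p q ?G^.k" using pq by (intro mx_power) auto
 finally have 1: "mx P' Q' (%t x. en (Rl l t x)*ind I t) <= er (k + 1)*(mx P Q (%t x. hJ J t x*ind I t)*mx p q ?G^.k)" by (simp add: mult_left_mono)
 have 2: "mx P Q (%t x. hJ J t x*ind I t) <= tailsum (int k + 2) (nl I) l" unfolding tailsum_def J_def[symmetric] by (rule hJ_mx) measurable
 have "mx p q ?G <= uI I + mx p q (%t x. en (SJ J t x)*ind I t)" unfolding uI_def by (intro mx_triangle pq) measurable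
 also have "mx p q (%t x. en (SJ J t x)*ind I t) = mx p q (%t y. en (cv (lowp J) (%x. u t x*ind I t) y))" by (simp add: SJ_def cv_indicator en_indicator)
 also have "... <= kn (lowp J)*mx p q (%t x. en (u t x*ind I t))" by (rule cv_mx[OF _ bump_measurable[OF bump_lowp] pq(1,2)]) measurable
 also have "... = kn (lowp 0)*uI I" by (simp add: kn_lowp[of J] uI_def en_indicator)
 finally have 3: "mx p q ?G <= (1 + kn (lowp 0))*uI I" by (simp add: distrib_right add_left_mono)
 have "mx P' Q' (%t x. en (Rl l t x)*ind I t) <= er (k + 1)*(tailsum (int k + 2) (nl I) l*((1 + kn (lowp 0))*uI I)^.k)"
  by (rule order_trans[OF 1 mult_left_mono[OF mult_mono[OF 2 epowr_mono[OF 3 of_nat_0_le_iff] zero_le zero_le] zero_le]])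
 thus ?thesis unfolding CS_def mult.assoc mult.commute[of "tailsum (int k + 2) (nl I) l"] .
qed

lemma ker_phase: "fourier (%xi. V_symbol alpha r xi*(\<i> * of_real xi)*(bw sg l xi*cis (y*xi))) x = A (ib sg l) r (y - x)"
proof -
 have "V_symbol alpha r xi = cis (- (r * om alpha xi))" for xi by (simp add: V_symbol_def om_def cis_conv_exp mult.assoc)
 hence "V_symbol alpha r xi*(\<i> * of_real xi)*(bw sg l xi*cis (y*xi))*cis (- (x*xi)) = ib sg l xi*cis ((y - x)*xi - r * om alpha xi)" for xi
  by (simp add: ib_def cis_mult mult_ac) (simp add: algebra_simps cis_mult)
 thus ?thesis unfolding Aop_def fourier_cis by simp
qed

lemma ib: "bump (ib sg l)" "(abs xi) < 2 powr ri l ==> ib sg l xi = 0" "xi ~: Lam (2 powr l) ==> ib sg l xi = 0"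
 "norm (ib sg l xi) <= 4 powr ((abs sg) + 1)*pw (sg + 1) l" "bm (ib sg l)"
 using bump_ibw[of sg l] bw_near_0[of xi l sg] bw_eq_0[of xi l sg] ibw_bound[of xi sg l] bump_measurable[OF bump_ibw[of sg l]] by (simp_all add: ib_def[abs_def])

text \<open>The kernel at \<open>y - x\<close> is the transform of a bump \<open>psi\<close> that
  vanishes for frequencies below \<open>2 powr l\<close>, beyond the reach of the power of
  \<open>SJ\<close>; thus \<open>bandlimited\<close> applies.\<close>

lemma SJ_kernel_zero:
 assumes t: "t : {0..T}"
 shows "integrable lborel (%x. SJ (l - (int k + 2)) t x^(k + 1)*A (ib sg l) r (y - x)) & (LI x. SJ (l - (int k + 2)) t x^(k + 1)*A (ib sg l) r (y - x)) = 0"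
proof -
 define J where "J = l - (int k + 2)"
 define G where "G xi = (1/cor (2*pi))*(F t xi*lowp J xi)" for xi
 define psi where "psi xi = (cis (- (r * om alpha xi))*ib sg l xi)*cis (y*xi)" for xi
 have b: "bump psi" unfolding psi_def by (intro bump_cis bump_phase[where delta="2 powr ri l"] ib) auto
 have SG: "SJ J t x = ker G x" for x unfolding SJ_def cv_pair(1)[OF pr[OF t] bump_lowp] ker_def G_def by (simp add: mult.assoc)
 have fpsi: "fourier psi x = A (ib sg l) r (y - x)" for x
  unfolding fourier_cis Aop_def psi_def by (intro LI_cong refl) (simp add: cis_mult mult_ac, simp add: algebra_simps cis_mult)
 obtain C where C: "0 <= C" "!!x. norm (psi x) <= C/(1 + x^2)" using schwartz_props(3)[OF bump_schwartz[OF b]] by blast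
 have pC: "norm (psi x) <= C" for x
 using decay_le[OF C(1), of x] C(2)[of x] by linarith
 have Gz: "G xi = 0" if "2*2 powr J < (abs xi)" for xi using lowp_eq_0[of J xi] that by (simp add: G_def)
 have pz: "psi xi = 0" if x: "(abs xi) <= real (k + 1)*(2*2 powr ri J)" for xi
 proof -
  have "real (k + 1)*(2*2 powr ri J) < 2 powr ri l"
  proof -
   have "2 powr ri l = 2 powr ri J*(2*2 powr real (k + 1))" by (simp add: J_def powr_diff powr_add)
   moreover have "real (k + 1) < 2 powr real (k + 1)" using of_nat_less_two_power[of "k + 1", where 'a=real] by (simp only: powr_realpow zero_less_numeral)
   ultimately show ?thesis by (simp add: mult_ac)
  qed
  thus ?thesis using x ib(2)[of xi l sg] by (simp add: psi_def)
 qed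
 have Gi: "integrable lborel G" unfolding G_def by (intro integrable_mult_right cv_pair(2)[OF pr[OF t] bump_lowp])
 show ?thesis unfolding J_def[symmetric] SG fpsi[symmetric]
  by (rule bandlimited[OF Gi Gz _ bump_integrable[OF b] pC bump_continuous[OF b] schwartz_props(6)[OF bump_schwartz[OF b]] pz]) simp_all
qed

text \<open>The test function \<open>bw sg l xi * cis (y*xi)\<close> turns the tested Duhamel
  formula into a pointwise identity at \<open>y\<close>. Under the space integral
  \<open>SJ_kernel_zero\<close> exchanges the power of \<open>u\<close> for \<open>Rl l\<close> at
  almost every \<open>tau\<close>.\<close>

lemma duh:
 assumes t: "t : {0..T}" and R: "mx P' Q' (%t x. en (Rl l t x)) < top"
 shows "cor (2*pi)*U sg l t y = A (%xi. F0 xi*bw sg l xi) t y - c*ret (ib sg l) (Rl l) t y"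
proof -
 define psi where "psi xi = bw sg l xi*cis (y*xi)" for xi
 have s: "schwartz psi" unfolding psi_def by (intro bump_schwartz bump_cis bump_bw)
 let ?K = "%tau x. A (ib sg l) (t - tau) (y - x)" and ?r = "restrict_space lborel {0..t}"
 note ibm [measurable] = ib(5)
 have Km [measurable]: "mm ?K"
 proof -
  have "bmL (%z. case (t - fst z, y - snd z) of (t, x) => A (ib sg l) t x)" by (rule measurable_compose[of _ _ "LL"]) measurable
  thus ?thesis by (simp add: split_beta')
 qed
 have D: "integrable (?r \<Otimes>\<^sub>M lborel) (%(tau, x). u tau x^(k + 1)*?K tau x)"
  "(LI x. u t x*fourier psi x) = (LI xi. V_symbol alpha t xi*F0 xi*psi xi) - c*(LINT tau|?r. LI x. u tau x^(k + 1)*?K tau x)"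
  using Duh[OF t s] unfolding psi_def ker_phase by auto
 have L: "(LI x. u t x*fourier psi x) = cor (2*pi)*U sg l t y" unfolding psi_def ker_fourier_shift by (simp add: U_def cv_def)
 have V: "(LI xi. V_symbol alpha t xi*F0 xi*psi xi) = A (%xi. F0 xi*bw sg l xi) t y"
 proof -
  have "V_symbol alpha t xi = cis (- (t * om alpha xi))" for xi by (simp add: V_symbol_def om_def cis_conv_exp mult.assoc)
  hence "V_symbol alpha t xi*F0 xi*psi xi = (F0 xi*bw sg l xi)*cis (y*xi - t * om alpha xi)" for xi by (simp add: psi_def mult_ac cis_mult)
  thus ?thesis unfolding Aop_def by (rule LI_cong[OF refl])
 qed
 have p: "0 < 2 powr ri l" by simp
 obtain Dc where Dc: "0 <= Dc" "!!r z. (abs r) <= T ==> norm (A (ib sg l) r z) <= Dc/(1 + z^2)"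
  using Aop_decay[OF ib(1)[of sg l] p ib(2)[of _ l sg] less_imp_le[OF T], of alpha] by blast
 define rho where "rho = enn2real (mx P' Q' (%t x. en (Rl l t x)))"
 have rho: "0 <= rho" "mx P' Q' (%t x. en (Rl l t x)) <= er rho" using R by (simp_all add: rho_def ennreal_enn2real)
 have ri: "integrable LL (%z. Rl l (fst z) (snd z)*ind {..t} (fst z)*?K (fst z) (snd z))"
  by (rule retarded(4)[where a="2 powr ri l", OF bump_integrable[OF ib(1)] ib(3,4) _ _ _ Dc Rlm off(3) rho t]) (use T in auto)
 interpret r: sigma_finite_measure ?r by (rule sigma_finite_measure_restrict_space) (auto simp: sigma_lborel)
 interpret rp: pair_sigma_finite ?r lborel ..
 have inn: "AE tau in ?r. (LI x. u tau x^(k + 1)*?K tau x) = (LI x. Rl l tau x*?K tau x)" using rp.AE_integrable_fst[OF D(1)] AE_space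
 proof eventually_elim
  case (elim tau)
  hence tau: "tau : {0..T}" using t by (auto simp: space_restrict_space)
  note z = SJ_kernel_zero[OF tau, of l sg "t - tau" y]
  have "(LI x. Rl l tau x*?K tau x) = (LI x. u tau x^(k + 1)*?K tau x - SJ (l - (int k + 2)) tau x^(k + 1)*?K tau x)" by (simp add: Rl_def left_diff_distrib)
  also have "... = (LI x. u tau x^(k + 1)*?K tau x) - 0" using elim(1) z by (subst Bochner_Integration.integral_diff) auto
  finally show ?case by simp
 qed
 have "(LINT tau|?r. LI x. u tau x^(k + 1)*?K tau x) = (LINT tau|?r. LI x. Rl l tau x*?K tau x)"
 proof (rule integral_cong_AE[OF _ _ inn])
  show "(%tau. LI x. u tau x^(k + 1)*?K tau x) : borel_measurable ?r" by (intro measurable_restrict_space1) measurable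
  show "(%tau. LI x. Rl l tau x*?K tau x) : borel_measurable ?r" by (intro measurable_restrict_space1) measurable
 qed
 also have "... = (LI tau. ind {0..t} tau *\<^sub>R (LI x. Rl l tau x*?K tau x))" by (rule integral_restrict_space) simp
 also have "... = (LI tau. LI x. Rl l tau x*ind {..t} tau*?K tau x)" by (intro LI_cong refl) (auto simp: indicator_def off)
 also have "... = ret (ib sg l) (Rl l) t y" unfolding ret_def using lborel_pair.integral_fst'[OF ri] by simp
 finally have "(LINT tau|?r. LI x. u tau x^(k + 1)*?K tau x) = ret (ib sg l) (Rl l) t y" .
 thus ?thesis by (rule trans[OF D(2)[unfolded L V] arg_cong[where f="%z. _ - _*z"]])
qed

end

lemma KB_dom:
 assumes I: "I : sets borel" and m: "mm g" "mm h" and K: "KB I kappa g" "KB I gamma h" and p: "0 <= kappa" "0 <= gamma"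
  and le: "!!t x. t : I ==> norm (f t x) <= norm (g t x) + norm (h t x)"
 shows "KB I (kappa + gamma) f"
proof -
 have "KB I (kappa + gamma) (%t x. cor (norm (g t x)) + cor (norm (h t x)))"
  by (rule KB_add[OF I _ _ _ _ p]) (use m K in "simp_all add: KB_def split_beta'")
 hence a: "(NN t. en (cor (norm (g t x) + norm (h t x)))^2*ind I t) <= er ((kappa + gamma)^2)" for x by (simp add: KB_def)
 show ?thesis unfolding KB_def
 proof (rule allI, rule order_trans[OF nn_mono a])
  fix x t show "en (f t x)^2*ind I t <= en (cor (norm (g t x) + norm (h t x)))^2*ind I t"
   by (cases "t : I") (auto intro!: power_mono ennreal_leI simp: le simp del: of_real_add ennreal_plus)
 qed
qed

lemma MB_dom:
 assumes M: "MB I kappa g" "MB I gamma h" and p: "0 <= kappa" "0 <= gamma" and le: "!!t x. t : I ==> norm (f t x) <= norm (g t x) + norm (h t x)"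
 shows "MB I (kappa + gamma) f"
proof -
 have "MB I (kappa + gamma) (%t x. cor (norm (g t x)) + cor (norm (h t x)))" by (rule MB_add[OF _ _ p]) (use M in "simp_all add: MB_def")
 then obtain B where B: "bm B" "!!t x. t : I ==> en (cor (norm (g t x) + norm (h t x))) <= B x"
  "(NN x. B x^4) <= er ((kappa + gamma)^4)" unfolding MB_def by (auto simp del: ennreal_plus)
 have "en (f t x) <= B x" if "t : I" for t x by (rule order_trans[OF ennreal_leI B(2)[OF that]]) (use le[OF that, of x] in "simp del: of_real_add")
 thus ?thesis by (rule MB_I[OF B(1) _ B(3)])
qed

lemma zsum_Lam: "zsum (%l. ind (Lam (2 powr ri l)) xi) <= 3"
proof (cases "xi = 0")
 case False
 define m where "m = \<lfloor>log 2 (abs xi)\<rfloor>"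
 have "zsum (%l. ind (Lam (2 powr ri l)) xi) <= zsum (ind {m - 2..m})"
 proof (rule zsum_mono)
  fix l :: int
  have "l : {m - 2..m}" if "xi : Lam (2 powr ri l)"
  proof -
   have x: "2 powr ri l <= (abs xi)" "(abs xi) <= 2 powr (ri l + 2)" using that by (simp_all add: Lam_def powr_add)
   hence "ri l <= log 2 (abs xi)" "log 2 (abs xi) <= ri l + 2" using False by (simp_all add: le_log_iff log_le_iff)
   thus ?thesis unfolding m_def by (auto simp: le_floor_iff) linarith
  qed
  thus "ind (Lam (2 powr ri l)) xi <= (ind {m - 2..m} l :: ennreal)" by (auto simp: indicator_def)
 qed
 also have "... = 3" by simp
 finally show ?thesis .
qed (simp add: Lam_def)

lemma zsum_nn_integral:
 assumes "!!l. f l : borel_measurable M"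
 shows "(\<integral>\<^sup>+x. zsum (%l. f l x) \<partial>M) = zsum (%l. \<integral>\<^sup>+x. f l x \<partial>M)"
 unfolding zsum_nat using assms by (rule nn_integral_suminf)

lemma wl2_weight: "wl2 s (%l. er (pw r l)*f l) = wl2 (s + r) f"
proof -
 have "er (pw s l)*(er (pw r l)*f l) = er (pw (s + r) l)*f l" for l unfolding mult.assoc[symmetric] by (simp add: distrib_right powr_add ennreal_mult)
 thus ?thesis by (simp add: wl2_def)
qed

section \<open>Propagation of the weighted sequence norm in time\<close>

locale sols = sol +
 fixes s :: real
 assumes s: "0 <= s" and F0s: "sqn (%xi. abspow s xi*F0 xi) < top"
begin

definition FL :: "int => ennreal" where "FL l = sqn (%xi. F0 xi*ind (Lam (2 powr ri l)) xi)"
definition fl :: "int => real" where "fl l = sqrt (enn2real (FL l))"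
definition rho :: "int => real" where "rho l = enn2real (mx P' Q' (%t x. en (Rl l t x)))"

lemma wFL: "er (2 powr (2 * s*ri l))*FL l <= (NN xi. en (abspow s xi*F0 xi)^2*ind (Lam (2 powr ri l)) xi)"
proof -
 have "er (2 powr (2 * s*ri l))*en (F0 xi*ind (Lam (2 powr ri l)) xi)^2 <= en (abspow s xi*F0 xi)^2*ind (Lam (2 powr ri l)) xi" for xi
 proof (cases "xi : Lam (2 powr ri l)")
  case True
  hence "(2 powr ri l) powr s <= (abs xi) powr s" using s by (intro powr_mono2) (auto simp: Lam_def)
  hence "(pw s l*norm (F0 xi))^2 <= (norm (abspow s xi*F0 xi))^2"
   by (intro power_mono) (auto simp: norm_mult abspow_def powr_powr mult.commute intro: mult_right_mono mult_left_mono)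
  moreover have "(pw s l)^2 = 2 powr (2 * s*ri l)" by (simp add: power2_eq_square mult.assoc flip: powr_add)
  ultimately show ?thesis using True
   by (simp only: ennreal_power norm_ge_zero indicator_simps mult_1_right power_mult_distrib flip: ennreal_mult'') (simp add: ennreal_leI flip: ennreal_mult)
 qed simp
 hence "(NN xi. er (2 powr (2 * s*ri l))*en (F0 xi*ind (Lam (2 powr ri l)) xi)^2) <= (NN xi. en (abspow s xi*F0 xi)^2*ind (Lam (2 powr ri l)) xi)" by (rule nn_mono)
 thus ?thesis unfolding FL_def sqn_def by (simp add: nn_cmult)
qed

lemma FL_finite: "FL l < top"
proof -
 have "er (2 powr (2 * s*ri l))*FL l <= sqn (%xi. abspow s xi*F0 xi)" by (rule order_trans[OF wFL]) (auto simp: sqn_def indicator_def intro!: nn_mono)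
 hence "er (2 powr (2 * s*ri l))*FL l < top" using F0s by (rule order_le_less_trans)
 thus ?thesis by (auto simp: ennreal_mult_less_top)
qed

lemma FL_fl: "FL l = er ((fl l)^2)" "0 <= fl l" using FL_finite[of l] by (simp_all add: fl_def less_top)

lemma wl2_fl: "wl2 s (%l. er (fl l)) < top"
proof -
 have "zsum (%l. (er (pw s l)*er (fl l))^.2) <= zsum (%l. (NN xi. en (abspow s xi*F0 xi)^2*ind (Lam (2 powr ri l)) xi))"
 proof (rule zsum_mono, rule order_trans[OF _ wFL])
  fix l :: int
  have "(pw s l)^2 = 2 powr (2 * s*ri l)" by (simp add: power2_eq_square mult.assoc flip: powr_add)
  thus "(er (pw s l)*er (fl l))^.2 <= er (2 powr (2 * s*ri l))*FL l"
   unfolding FL_fl(1) epowr_numeral using FL_fl(2)[of l] by (simp add: power_mult_distrib ennreal_power)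
 qed
 also have "... = (NN xi. en (abspow s xi*F0 xi)^2*zsum (%l. ind (Lam (2 powr ri l)) xi))" by (subst zsum_nn_integral[symmetric]) (auto simp: nn_cmult abspow_def)
 also have "... <= (NN xi. 3*en (abspow s xi*F0 xi)^2)" by (intro nn_mono) (simp add: mult.commute[of 3] mult_left_mono zsum_Lam)
 also have "... = 3 * sqn (%xi. abspow s xi*F0 xi)" unfolding sqn_def by (rule nn_cmult) (simp add: abspow_def)
 also have "... < top" using F0s by (simp add: ennreal_mult_less_top)
 finally show ?thesis by (simp add: wl2_def)
qed

lemma CS_finite: "CS I < top"
proof -
 have "uI I <= mx p q (%t x. en (u t x))" unfolding uI_def using pq by (intro mx_mono) (auto simp: indicator_def)
 hence "uI I < top" using uS by (rule order_le_less_trans)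
 thus ?thesis using kn_finite[OF bump_schwartz[OF bump_lowp[of 0]]] by (simp add: CS_def ennreal_mult_less_top)
qed

lemma R_finite: "mx P' Q' (%t x. en (Rl l t x)) < top"
proof -
 have "tailsum (int k + 2) (nl UNIV) l <= zsum (%m. er (M0*2 powr (- (sg0*ri l)))*(er (2 powr (- (sg0*ri m)))*ind {- (int k + 2)..} m))" unfolding tailsum_alt
 proof (rule zsum_mono)
  fix m :: int
  have "2 powr (- (sg0*ri (l + m))) = 2 powr (- (sg0*ri l))*2 powr (- (sg0*ri m))" unfolding powr_add[symmetric] by (simp add: distrib_left)
  hence "nl UNIV (l + m) <= er (M0*2 powr (- (sg0*ri l)))*er (2 powr (- (sg0*ri m)))" using nl_le[of UNIV "l + m"] ap(2) by (simp add: mult.assoc flip: ennreal_mult)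
  thus "nl UNIV (l + m)*ind {- (int k + 2)..} m <= er (M0*2 powr (- (sg0*ri l)))*(er (2 powr (- (sg0*ri m)))*ind {- (int k + 2)..} m)"
   unfolding mult.assoc[symmetric] by (rule mult_right_mono) simp
 qed
 also have "... <= er (M0*2 powr (- (sg0*ri l)))*er (Ak sg0 (int k + 2))" by (subst nn_cmult, simp) (intro mult_left_mono geo_tail ap, simp_all)
 also have "... < top" by (simp add: ennreal_mult_less_top)
 finally have "CS UNIV*tailsum (int k + 2) (nl UNIV) l < top" using CS_finite[of UNIV] by (simp add: ennreal_mult_less_top)
 moreover have "mx P' Q' (%t x. en (Rl l t x)) <= CS UNIV*tailsum (int k + 2) (nl UNIV) l" using Rl_mx[of UNIV l] by simp
 ultimately show ?thesis by (rule order_le_less_trans[rotated])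
qed

lemma rho: "mx P' Q' (%t x. en (Rl l t x)) = er (rho l)" "0 <= rho l" using R_finite[of l] by (simp_all add: rho_def less_top)

definition Hc :: "real => real" where "Hc sg = 180*4 powr ((abs sg) + 1)"

lemma Hc: "4 powr (abs sg) <= Hc sg" "0 < Hc sg"
proof -
 have "1*4 powr (abs sg) <= (180*4)*(4 powr (abs sg) :: real)" by (intro mult_right_mono) auto
 thus "4 powr (abs sg) <= Hc sg" by (simp add: Hc_def powr_add)
qed (simp add: Hc_def)

text \<open>The derivative in the nonlinearity costs \<open>sg + 1\<close> powers of the frequency,
  and the dual estimate returns half a power.\<close>

lemma beta_eq: "(4 powr ((abs sg) + 1)*pw (sg + 1) l)*(180*(2 powr ri l) powr (-1/2)) = Hc sg*pw (sg + 1/2) l"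
proof -
 have "pw (sg + 1) l*(2 powr ri l) powr (-1/2) = pw (sg + 1/2) l" unfolding powr_powr powr_add[symmetric] by (simp add: algebra_simps)
 thus ?thesis by (simp add: Hc_def mult_ac)
qed

lemma ret_bounds:
 fixes sg :: real and l :: int
 assumes R: "mm R" "!!t x. t ~: {0..T} ==> R t x = 0" "0 <= r" "mx P' Q' (%t x. en (R t x)) <= er r"
 defines "H \<equiv> Hc sg*pw (sg + 1/2) l" and "a \<equiv> 2 powr ri l"
 shows "KB {0..T} (3*a powr (- alpha/2)*(ck*H*r)) (ret (ib sg l) R)"
  and "MB {0..T} (60*a powr (1/4)*(ck*H*r)) (ret (ib sg l) R)"
  and "!!t. t : {0..T} ==> sqn (ret (ib sg l) R t) <= er ((3*H*r)^2)"
  and "!!t x. t : {0..T} ==> integrable LL (%z. uc R z*ind {..t} (fst z)*A (ib sg l) (t - fst z) (x - snd z))"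
proof -
 have p: "0 < 2 powr ri l" by simp
 obtain Dc where Dc: "0 <= Dc" "!!r z. (abs r) <= T ==> norm (A (ib sg l) r z) <= Dc/(1 + z^2)"
  using Aop_decay[OF ib(1)[of sg l] p ib(2)[of _ l sg] less_imp_le[OF T], of alpha] by blast
 have beta: "0 < 4 powr ((abs sg) + 1)*pw (sg + 1) l" by simp
 note rr = retarded[where a="2 powr ri l", OF bump_integrable[OF ib(1)] ib(3) ib(4)[of sg l] p beta less_imp_le[OF T] Dc R, unfolded beta_eq, folded H_def a_def]
 show "KB {0..T} (3*a powr (- alpha/2)*(ck*H*r)) (ret (ib sg l) R)" using rr(1) by (simp add: mult_ac)
 show "MB {0..T} (60*a powr (1/4)*(ck*H*r)) (ret (ib sg l) R)" using rr(2) by (simp add: mult_ac)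
 show "!!t. t : {0..T} ==> sqn (ret (ib sg l) R t) <= er ((3*H*r)^2)" using rr(3) by simp
 show "!!t x. t : {0..T} ==> integrable LL (%z. uc R z*ind {..t} (fst z)*A (ib sg l) (t - fst z) (x - snd z))" by (rule rr(4))
qed

definition C1 :: real where "C1 = 180*ck*Hc 0"

lemma C1: "0 < C1" using ck_ratio(3) Hc(2)[of 0] by (simp add: C1_def)

text \<open>The derivative costs \<open>2 powr l\<close>, and the dual and the direct estimate
  return half of it each. Hence \<open>C1\<close> does not depend on the scale, as the absorption
  argument requires.\<close>

lemma ret_PQ:
 assumes R: "mm R" "!!t x. t ~: {0..T} ==> R t x = 0" "mx P' Q' (%t x. en (R t x)) < top"
 shows "mx P Q (%t x. en (ret (ib 0 l) R t x)*ind {0..T} t) <= er C1*mx P' Q' (%t x. en (R t x))"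
proof -
 define r where "r = enn2real (mx P' Q' (%t x. en (R t x)))"
 have r: "mx P' Q' (%t x. en (R t x)) = er r" "0 <= r" using R(3) by (simp_all add: r_def less_top)
 define H where "H = ck*(Hc 0*pw (0 + 1/2) l)*r"
 have H0: "0 <= H" using ck_ratio(3) Hc(2)[of 0] r by (simp add: H_def)
 note b = ret_bounds[where sg=0 and l=l, OF R(1,2) r(2) order_eq_refl[OF r(1)], folded H_def]
 have "mx P Q (%t x. en (ret (ib 0 l) R t x)*ind {0..T} t) <= er ((60*(2 powr ri l) powr (1/4)*H) powr (4/P)*(3*(2 powr ri l) powr (- alpha/2)*H) powr (2/Q))"
  by (rule PQ_bound[OF ret_measurable[OF ib(5) R(1)] b(1,2)]) (use H0 in auto)
 also have "... <= er (180*(2 powr ri l) powr (-1/2)*H)" by (intro ennreal_leI PQ_const H0) simp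
 also have "180*(2 powr ri l) powr (-1/2)*H = C1*r"
 proof -
  have "(2 powr ri l) powr (-1/2)*pw (0 + 1/2) l = 1" unfolding powr_powr powr_add[symmetric] by simp
  moreover have "180*(2 powr ri l) powr (-1/2)*H = (C1*r)*((2 powr ri l) powr (-1/2)*pw (0 + 1/2) l)" unfolding H_def C1_def by (simp only: mult_ac)
  ultimately show ?thesis by (simp only: mult_1_right)
 qed
 also have "er (C1*r) = er C1*mx P' Q' (%t x. en (R t x))" unfolding r(1) using C1 r by (simp add: ennreal_mult)
 finally show ?thesis .
qed

lemma free_bounds:
 shows "integrable lborel (%xi. F0 xi*bw sg l xi)" "sqn (%xi. F0 xi*bw sg l xi) <= er ((Hc sg*pw sg l*fl l)^2)"
proof -
 show "integrable lborel (%xi. F0 xi*bw sg l xi)" by (rule F0[OF bump_schwartz[OF bump_bw]])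
 have "sqn (%xi. F0 xi*bw sg l xi) <= (NN xi. er ((Hc sg*pw sg l)^2)*en (F0 xi*ind (Lam (2 powr ri l)) xi)^2)" unfolding sqn_def
 proof (rule nn_mono)
  fix xi
  have "norm (bw sg l xi) <= Hc sg*pw sg l" by (rule order_trans[OF bw_bound]) (intro mult_right_mono Hc, simp)
  hence "norm (F0 xi*bw sg l xi) <= (Hc sg*pw sg l)*norm (F0 xi*ind (Lam (2 powr ri l)) xi)"
   using bw_eq_0[of xi l sg] by (cases "xi : Lam (2 powr ri l)") (simp_all add: norm_mult mult.commute mult_left_mono)
  hence "en (F0 xi*bw sg l xi)^2 <= er ((Hc sg*pw sg l)*norm (F0 xi*ind (Lam (2 powr ri l)) xi))^2" by (intro power_mono ennreal_leI) auto
  also have "... = er ((Hc sg*pw sg l)^2)*en (F0 xi*ind (Lam (2 powr ri l)) xi)^2"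
  proof -
   have K: "0 <= Hc sg*pw sg l" using Hc(2)[of sg] by simp
   show ?thesis unfolding ennreal_mult[OF K norm_ge_zero] power_mult_distrib[of "er _"] ennreal_power[OF K] ..
  qed
  finally show "en (F0 xi*bw sg l xi)^2 <= er ((Hc sg*pw sg l)^2)*en (F0 xi*ind (Lam (2 powr ri l)) xi)^2" .
 qed
 also have "... = er ((Hc sg*pw sg l)^2)*FL l" unfolding FL_def sqn_def by (rule nn_cmult) measurable
 also have "... = er ((Hc sg*pw sg l*fl l)^2)" unfolding FL_fl(1) by (simp add: power_mult_distrib flip: ennreal_mult)
 finally show "sqn (%xi. F0 xi*bw sg l xi) <= er ((Hc sg*pw sg l*fl l)^2)" .
qed

lemma U_le:
 assumes "t : {0..T}"
 shows "norm (U sg l t y) <= norm (A (%xi. F0 xi*bw sg l xi) t y) + norm (ret (ib sg l) (Rl l) t y)"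
proof -
 have "2*pi*norm (U sg l t y) = norm (A (%xi. F0 xi*bw sg l xi) t y - c*ret (ib sg l) (Rl l) t y)" unfolding duh[OF assms R_finite, symmetric] by (simp add: norm_mult)
 also have "... <= norm (A (%xi. F0 xi*bw sg l xi) t y) + (abs c)*norm (ret (ib sg l) (Rl l) t y)" by (rule order_trans[OF norm_triangle_ineq4]) (simp add: norm_mult)
 also have "... <= norm (A (%xi. F0 xi*bw sg l xi) t y) + norm (ret (ib sg l) (Rl l) t y)"
  using c mult_right_mono[of "(abs c)" 1 "norm (ret (ib sg l) (Rl l) t y)"] by simp
 finally have "2*pi*norm (U sg l t y) <= norm (A (%xi. F0 xi*bw sg l xi) t y) + norm (ret (ib sg l) (Rl l) t y)" .
 moreover have "1*norm (U sg l t y) <= 2*pi*norm (U sg l t y)" using pi_gt3 by (intro mult_right_mono) auto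
 ultimately show ?thesis by linarith
qed

text \<open>The forcing is split at time \<open>a\<close>. The part from the past is already
  controlled and joins the free evolution; only the part from \<open>{a<..b}\<close> contains the
  unknown, with a factor that is small for a short interval.\<close>

lemma nl_step:
 assumes ab: "0 <= a" "a <= b" "b <= T"
 shows "nl {a<..b} l <= (er (180*Hc 0)*(er (pw (-1/2) l)*er (fl l)) + er C1*CS {0..a}*tailsum (int k + 2) (nl {0..a}) l)
   + er C1*CS {a<..b}*tailsum (int k + 2) (nl {a<..b}) l"
proof -
 define R1 R2 where "R1 = (%t x. Rl l t x*ind {0..a} t)" and "R2 = (%t x. Rl l t x*ind {a<..b} t)"
 have m [measurable]: "mm R1" "mm R2" unfolding R1_def R2_def by measurable
 have z: "t ~: {0..T} ==> R1 t x = 0" "t ~: {0..T} ==> R2 t x = 0" for t x by (simp_all add: R1_def R2_def off)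
 have n: "mx P' Q' (%t x. en (R1 t x)) <= CS {0..a}*tailsum (int k + 2) (nl {0..a}) l" "mx P' Q' (%t x. en (R2 t x)) <= CS {a<..b}*tailsum (int k + 2) (nl {a<..b}) l"
  unfolding R1_def R2_def en_indicator by (rule Rl_mx, simp)+
 have f: "mx P' Q' (%t x. en (R1 t x)) < top" "mx P' Q' (%t x. en (R2 t x)) < top"
  by (rule order_le_less_trans[OF _ R_finite[of l]], use PQ in "auto simp: R1_def R2_def indicator_def intro!: mx_mono")+
 let ?h = "%xi. F0 xi*bw 0 l xi"
 note [measurable] = bump_measurable[OF bump_bw] ib(5)
 have m3: "mm (%t x. en (A ?h t x))" "mm (%t x. en (ret (ib 0 l) R1 t x)*ind {0..T} t)" "mm (%t x. en (ret (ib 0 l) R2 t x)*ind {0..T} t)" by measurable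
 have P1: "1 < P" "1 < Q" using PQ by auto
 let ?r1 = "ret (ib 0 l) R1" and ?r2 = "ret (ib 0 l) R2"
 let ?s1 = "%t x. en (?r1 t x)*ind {0..T} t" and ?s2 = "%t x. en (?r2 t x)*ind {0..T} t"
 have le: "en (U 0 l t x)*ind {a<..b} t <= en (A ?h t x) + (en (?r1 t x)*ind {0..T} t + en (?r2 t x)*ind {0..T} t)" for t x
 proof (cases "t : {a<..b}")
  case True
  hence t: "t : {0..T}" using ab by auto
  have i: "integrable LL (%z. uc R z*ind {..t} (fst z)*A (ib 0 l) (t - fst z) (x - snd z))"
   if "mm R" "!!t x. t ~: {0..T} ==> R t x = 0" "mx P' Q' (%t x. en (R t x)) < top" for R
   by (rule ret_bounds(4)[OF that(1,2) enn2real_nonneg[of "mx P' Q' (%t x. en (R t x))"] _ t]) (use ennreal_enn2real[OF that(3)] in simp_all)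
  have "ret (ib 0 l) (Rl l) t x = (LINT z|LL. uc R1 z*ind {..t} (fst z)*A (ib 0 l) (t - fst z) (x - snd z)
    + uc R2 z*ind {..t} (fst z)*A (ib 0 l) (t - fst z) (x - snd z))"
   unfolding ret_def R1_def R2_def by (rule LI_cong) (use True ab in "auto simp: indicator_def off")
  also have "... = ret (ib 0 l) R1 t x + ret (ib 0 l) R2 t x" unfolding ret_def by (rule Bochner_Integration.integral_add[OF i[OF m(1) z(1) f(1)] i[OF m(2) z(2) f(2)]])
  finally have "norm (U 0 l t x) <= norm (A ?h t x) + (norm (?r1 t x) + norm (?r2 t x))"
   using U_le[OF t, of 0 l x] norm_triangle_ineq[of "ret (ib 0 l) R1 t x" "ret (ib 0 l) R2 t x"] by simp
  from ennreal_leI[OF this] show ?thesis using True t by simp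
 qed simp
 have "nl {a<..b} l <= mx P Q (%t x. en (A ?h t x) + (en (?r1 t x)*ind {0..T} t + en (?r2 t x)*ind {0..T} t))"
  unfolding nl_def using PQ by (intro mx_mono le) auto
 also have "... <= mx P Q (%t x. en (A ?h t x)) + (mx P Q ?s1 + mx P Q ?s2)"
  by (rule order_trans[OF mx_triangle[OF m3(1) _ P1] add_left_mono[OF mx_triangle[OF m3(2,3) P1]]]) (use m3(2,3) in measurable)
 also have "... <= er (180*(2 powr ri l) powr (-1/2)*(Hc 0*pw 0 l*fl l)) + (er C1*(CS {0..a}*tailsum (int k + 2) (nl {0..a}) l) + er C1*(CS {a<..b}*tailsum (int k + 2) (nl {a<..b}) l))"
 proof (intro add_mono)
  show "mx P Q (%t x. en (A ?h t x)) <= er (180*(2 powr ri l) powr (-1/2)*(Hc 0*pw 0 l*fl l))"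
   by (rule A_PQ[OF free_bounds(1) _ _ free_bounds(2)]) (use bw_eq_0[of _ l 0] Hc(2)[of 0] FL_fl(2)[of l] in auto)
  show "mx P Q ?s1 <= er C1*(CS {0..a}*tailsum (int k + 2) (nl {0..a}) l)"
   by (rule order_trans[OF ret_PQ[OF m(1) z(1) f(1)]], assumption, intro mult_left_mono n, simp)
  show "mx P Q ?s2 <= er C1*(CS {a<..b}*tailsum (int k + 2) (nl {a<..b}) l)"
   by (rule order_trans[OF ret_PQ[OF m(2) z(2) f(2)]], assumption, intro mult_left_mono n, simp)
 qed
 also have "er (180*(2 powr ri l) powr (-1/2)*(Hc 0*pw 0 l*fl l)) = er (180*Hc 0)*(er (pw (-1/2) l)*er (fl l))"
  using Hc(2)[of 0] FL_fl(2)[of l] by (simp add: powr_powr mult_ac flip: ennreal_mult)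
 finally show ?thesis by (simp only: add.assoc mult.assoc)
qed

text \<open>\<open>wl2_absorb\<close> on the new interval, with the data and the past as the known
  term. The weight \<open>s + 1/2\<close> matches the \<open>-1/2\<close> in the direct estimate for
  data of order \<open>s\<close>.\<close>

lemma wl2_nl_step:
 assumes ab: "0 <= a" "a <= b" "b <= T" and fin: "wl2 (s + 1/2) (nl {0..a}) < top"
  and eps: "0 <= eps" "eps*Ak (s + 1/2) (int k + 2) <= 1/2" "eps*Ak sg0 (int k + 2) <= 1/2" and C: "er C1*CS {a<..b} <= er eps"
 shows "wl2 (s + 1/2) (nl {0..b}) < top"
proof -
 let ?c = "%l. er (180*Hc 0)*(er (pw (-1/2) l)*er (fl l)) + er C1*CS {0..a}*tailsum (int k + 2) (nl {0..a}) l"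
 have t: "0 < s + 1/2" "0 <= int k + 2" using s by auto
 have "wl2 (s + 1/2) (nl {a<..b}) <= 2*wl2 (s + 1/2) ?c"
 proof (rule wl2_absorb[OF t(1) ap(1) t(2) eps _ nl_le ap(2)])
  fix l
  show "nl {a<..b} l <= ?c l + er eps*tailsum (int k + 2) (nl {a<..b}) l" by (rule order_trans[OF nl_step[OF ab]]) (intro add_left_mono mult_right_mono C, simp)
 qed
 also have "... < top"
 proof -
  have "wl2 (s + 1/2) ?c <= wl2 (s + 1/2) (%l. er (180*Hc 0)*(er (pw (-1/2) l)*er (fl l))) + wl2 (s + 1/2) (%l. er C1*CS {0..a}*tailsum (int k + 2) (nl {0..a}) l)"
   by (rule wl2_add)
  also have "... <= er (180*Hc 0)*wl2 (s + 1/2 + -1/2) (%l. er (fl l)) + er C1*CS {0..a}*(er (Ak (s + 1/2) (int k + 2))*wl2 (s + 1/2) (nl {0..a}))"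
   unfolding wl2_cmult wl2_weight by (intro add_mono mult_left_mono wl2_tailsum t) auto
  also have "... < top" using wl2_fl fin CS_finite by (simp add: ennreal_mult_less_top)
  finally show ?thesis by (simp add: ennreal_mult_less_top)
 qed
 finally have 1: "wl2 (s + 1/2) (nl {a<..b}) < top" .
 have "nl {0..b} l <= nl {0..a} l + nl {a<..b} l" for l
 proof -
  have "nl {0..b} l = mx P Q (%t x. en (U 0 l t x)*ind {0..a} t + en (U 0 l t x)*ind {a<..b} t)"
   unfolding nl_def using ab by (intro arg_cong[where f="mx P Q"] ext) (auto simp: indicator_def)
  also have "... <= nl {0..a} l + nl {a<..b} l" unfolding nl_def by (rule mx_triangle) (use PQ in auto)
  finally show ?thesis .
 qed
 hence "wl2 (s + 1/2) (nl {0..b}) <= wl2 (s + 1/2) (nl {0..a}) + wl2 (s + 1/2) (nl {a<..b})" by (intro order_trans[OF wl2_mono wl2_add])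
 also have "... < top" using fin 1 by simp
 finally show ?thesis .
qed

lemma wl2_nl: "wl2 (s + 1/2) (nl {0..T}) < top"
proof -
 define N where "N = int k + 2"
 have Ak0: "0 <= Ak r N" for r using geo(2)[of r] by (simp add: Ak_def)
 \<comment> \<open>Small enough for \<open>wl2_absorb\<close> with both weights at once:
   \<open>s + 1/2\<close>, to be propagated, and \<open>sg0\<close>, that of the a priori
   bound.\<close>
 define eps where "eps = 1/(2*(Ak (s + 1/2) N + Ak sg0 N + 1))"
 have eps: "0 < eps" "eps*Ak (s + 1/2) N <= 1/2" "eps*Ak sg0 N <= 1/2" using Ak0[of "s + 1/2"] Ak0[of sg0] by (auto simp: eps_def divide_simps)
 define K where "K = enn2real (kn (lowp 0))"
 have K: "kn (lowp 0) = er K" "0 <= K" using kn_finite[OF bump_schwartz[OF bump_lowp[of 0]]] by (simp_all add: K_def less_top)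
 \<comment> \<open>Solves \<open>C1*((k + 1)*((1 + K)*eta) powr k) = eps\<close>: an interval on
   which the critical norm of \<open>u\<close> is at most \<open>eta\<close> then has
   \<open>C1 * CS\<close> at most \<open>eps\<close>.\<close>
 define eta where "eta = (eps/(C1*(k + 1))) powr (1/k)/(1 + K)"
 have eta0: "0 < eta" using eps(1) C1 K(2) by (simp add: eta_def add_pos_nonneg)
 have eta: "C1*((k + 1)*((1 + K)*eta) powr k) = eps"
 proof -
  have "(1 + K)*eta = (eps/(C1*(k + 1))) powr (1/k)" using K(2) by (simp add: eta_def)
  hence "((1 + K)*eta) powr k = eps/(C1*(k + 1))" using pq(5) eps(1) C1 by (simp add: powr_powr)
  hence "C1*((k + 1)*((1 + K)*eta) powr k) = (C1*(k + 1))*(eps/(C1*(k + 1)))" by (simp only: mult.assoc)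
  also have "... = eps" using C1 by simp
  finally show ?thesis .
 qed
 show ?thesis
 proof (rule mx_interval_induct[where f="%t x. en (u t x)" and p=p and q=q and eta=eta and T=T and P="%b. wl2 (s + 1/2) (nl {0..b}) < top"])
  show "mm (%t x. en (u t x))" by measurable
  have "(2*alpha + 1)*k/(alpha + 2) < (2*alpha + 1)*k/(2*(alpha - 1))" using alpha pq(5) by (intro divide_strict_left_mono) auto
  thus "p < q" unfolding p_def q_def .
  have "nl {0..0} l = 0" for l unfolding nl_def using mx_null[of P Q "%t x. en (U 0 l t x)" 0] PQ by simp
  thus "wl2 (s + 1/2) (nl {0..0}) < top" by (simp add: wl2_def)
  fix a b assume ab: "0 <= a" "a <= b" "b <= T" "wl2 (s + 1/2) (nl {0..a}) < top" "mx p q (%t x. en (u t x)*ind {a<..b} t) <= er eta"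
  show "wl2 (s + 1/2) (nl {0..b}) < top"
  proof (rule wl2_nl_step[OF ab(1-4) less_imp_le[OF eps(1)] eps(2,3)[unfolded N_def]])
   have "CS {a<..b} <= er (k + 1)*(er (1 + K)*er eta)^.k" unfolding CS_def K(1) using K(2) ab(5) by (intro mult_left_mono epowr_mono mult_mono) (auto simp: uI_def)
   also have "... = er ((k + 1)*((1 + K)*eta) powr k)" using K(2) eta0 by (simp add: ennreal_mult del: ennreal_plus flip: ennreal_mult)
   finally have "er C1*CS {a<..b} <= er C1*er ((k + 1)*((1 + K)*eta) powr k)" by (rule mult_left_mono) simp
   also have "... = er eps" unfolding eta[symmetric] using C1 by (subst ennreal_mult) auto
   finally show "er C1*CS {a<..b} <= er eps" .
  qed
 qed (use pq uS eta0 T in auto)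
qed

text \<open>The total size at scale \<open>l\<close> in units of an \<open>L^2\<close> norm of data;
  by duality forcing of size \<open>rho l\<close> counts as
  \<open>2 powr (l/2) * rho l\<close>.\<close>

definition DD :: "int => real" where "DD l = fl l + pw (1/2) l*rho l"

lemma DD: "0 <= DD l" "wl2 s (%l. er (DD l)) < top"
proof -
 show "0 <= DD l" using FL_fl(2)[of l] rho(2)[of l] by (simp add: DD_def)
 have r: "er (rho l) <= CS {0..T}*tailsum (int k + 2) (nl {0..T}) l" for l
 proof -
  have "er (rho l) = mx P' Q' (%t x. en (Rl l t x)*ind {0..T} t)" unfolding rho(1)[symmetric] by (intro arg_cong[where f="mx P' Q'"] ext) (auto simp: indicator_def off)
  also have "... <= CS {0..T}*tailsum (int k + 2) (nl {0..T}) l" by (rule Rl_mx) simp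
  finally show ?thesis .
 qed
 have "wl2 s (%l. er (DD l)) <= wl2 s (%l. er (fl l) + er (pw (1/2) l)*er (rho l))" using FL_fl(2) rho(2) by (intro wl2_mono) (simp add: DD_def ennreal_mult)
 also have "... <= wl2 s (%l. er (fl l)) + wl2 (s + 1/2) (%l. er (rho l))" unfolding wl2_weight[symmetric] by (rule wl2_add)
 also have "wl2 (s + 1/2) (%l. er (rho l)) <= CS {0..T}*(er (Ak (s + 1/2) (int k + 2))*wl2 (s + 1/2) (nl {0..T}))"
  by (rule order_trans[OF wl2_mono[OF r]]) (unfold wl2_cmult, intro mult_left_mono wl2_tailsum, use s in auto)
 also have "wl2 s (%l. er (fl l)) + CS {0..T}*(er (Ak (s + 1/2) (int k + 2))*wl2 (s + 1/2) (nl {0..T})) < top"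
  using wl2_fl wl2_nl CS_finite by (simp add: ennreal_mult_less_top)
 finally show "wl2 s (%l. er (DD l)) < top" by (simp add: add_left_mono)
qed

definition CU :: "real => real" where "CU sg = 60*Hc sg*(1 + ck)"

lemma CU_pos: "0 < CU sg" using Hc(2)[of sg] ck_ratio(3) by (simp add: CU_def)

text \<open>Free part and retarded part are estimated separately and carry the same power of the
  frequency once the forcing is counted as in \<open>DD\<close>. The powers
  \<open>- alpha/2\<close>, \<open>1/4\<close> and 0 are those of the smoothing, maximal and energy
  estimates.\<close>

lemma U_bounds:
 shows "KB {0..T} (CU sg*pw (sg - alpha/2) l*DD l) (U sg l)"
  and "MB {0..T} (CU sg*pw (sg + 1/4) l*DD l) (U sg l)"
  and "!!t. t : {0..T} ==> sqn (U sg l t) <= er ((CU sg*pw sg l*DD l)^2)"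
proof -
 let ?h = "%xi. F0 xi*bw sg l xi" and ?a = "2 powr ri l" and ?H = "Hc sg*pw (sg + 1/2) l" and ?f = "Hc sg*pw sg l*fl l"
 note [measurable] = bump_measurable[OF bump_bw] ib(5)
 have a: "0 < ?a" by simp
 have hz: "xi ~: Lam ?a ==> ?h xi = 0" for xi by (simp add: bw_eq_0)
 have f0: "0 <= ?f" "0 <= ck*?H*rho l" "0 <= 3*?H*rho l" using Hc(2)[of sg] FL_fl(2)[of l] rho(2)[of l] ck_ratio(3) by simp_all
 note rb = ret_bounds[where sg=sg and l=l, OF Rlm[of l] off(3) rho(2) order_eq_refl[OF rho(1)]]
 have tot: "x*(2 powr r*?f) + x*(2 powr r*(ck*?H*rho l)) <= CU sg*2 powr (r + sg*ri l)*DD l" if x: "0 <= x" "x <= 60" for x r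
 proof -
  let ?g = "2 powr (r + sg*ri l)" and ?r = "pw (1/2) l*rho l"
  have "x*(2 powr r*?f) + x*(2 powr r*(ck*?H*rho l)) = x*(Hc sg*?g*(fl l + ck*?r))" by (simp add: powr_add distrib_right distrib_left mult_ac)
  also have "... <= 60*(Hc sg*?g*((1 + ck)*(fl l + ?r)))"
  proof (intro mult_mono mult_left_mono)
   show "fl l + ck*?r <= (1 + ck)*(fl l + ?r)" using ck_ratio(3) FL_fl(2)[of l] rho(2)[of l] by (simp add: distrib_left distrib_right)
  qed (use x Hc(2)[of sg] ck_ratio(3) FL_fl(2)[of l] rho(2)[of l] in auto)
  also have "... = CU sg*?g*DD l" by (simp add: CU_def DD_def algebra_simps)
  finally show ?thesis .
 qed
 have KA: "KB {0..T} (3*?a powr (- alpha/2)*?f) (A ?h)" by (rule KB_subset[OF Kato[OF free_bounds(1) hz a _ free_bounds(2)]]) (use alpha in auto)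
 have "KB {0..T} (3*?a powr (- alpha/2)*?f + 3*?a powr (- alpha/2)*(ck*?H*rho l)) (U sg l)"
  by (rule KB_dom[OF _ _ _ KA rb(1) _ _ U_le]) (use f0 in "auto intro!: ret_measurable Aop_measurable")
 moreover have "3*?a powr (- alpha/2)*?f + 3*?a powr (- alpha/2)*(ck*?H*rho l) <= CU sg*pw (sg - alpha/2) l*DD l"
  using tot[of 3 "ri l*(- alpha/2)"] by (simp add: powr_powr algebra_simps)
 ultimately show "KB {0..T} (CU sg*pw (sg - alpha/2) l*DD l) (U sg l)" using f0 by (elim KB_mono) auto
 have MA: "MB {0..T} (60*?a powr (1/4)*?f) (A ?h)" by (rule MB_subset[OF maximal[OF free_bounds(1) hz a _ _ free_bounds(2) f0(1)]]) (use alpha in auto)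
 have "MB {0..T} (60*?a powr (1/4)*?f + 60*?a powr (1/4)*(ck*?H*rho l)) (U sg l)" by (rule MB_dom[OF MA rb(2) _ _ U_le]) (use f0 in auto)
 moreover have "60*?a powr (1/4)*?f + 60*?a powr (1/4)*(ck*?H*rho l) <= CU sg*pw (sg + 1/4) l*DD l" using tot[of 60 "ri l*(1/4)"] by (simp add: powr_powr algebra_simps)
 ultimately show "MB {0..T} (CU sg*pw (sg + 1/4) l*DD l) (U sg l)" using f0 by (elim MB_mono) auto
 fix t assume t: "t : {0..T}"
 \<comment> \<open>A function of \<open>x\<close> alone is put in the place of the time variable, so
   that \<open>KB_dom\<close> serves as the triangle inequality for \<open>sqn\<close>.\<close>
 have kb: "KB UNIV r (%t x. g t) \<longleftrightarrow> sqn g <= er (r^2)" for r g by (simp add: KB_def sqn_def)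
 have sA: "sqn (A ?h t) <= er ((3*?f)^2)"
 proof -
  have "sqn (A ?h t) = sqn (%x. LI xi. (?h xi*cis (- (t * om alpha xi)))*cis (x*xi))" by (simp add: sqn_def Aop_def mult.assoc cis_mult)
  also have "... <= er ((3*?f)^2)" by (rule cis_L2[OF free_bounds(1) _ free_bounds(2)]) measurable
  finally show ?thesis .
 qed
 have "KB UNIV (3*?f + 3*?H*rho l) (%r x. U sg l t r)" by (rule KB_dom[OF _ _ _ sA[folded kb] rb(3)[OF _ t, folded kb]])
   (use f0 U_le[OF t] mm_section(2)[OF Aop_measurable[of ?h], of t] mm_section(2)[OF ret_measurable[OF ib(5) Rlm[of l]], of t] in "auto")
 hence 1: "sqn (U sg l t) <= er ((3*?f + 3*?H*rho l)^2)" unfolding kb .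
 have "3*?f + 3*?H*rho l <= CU sg*pw sg l*DD l"
 proof -
  have "3*?f + 3*?H*rho l = (3*1)*(Hc sg*pw sg l*DD l)" by (simp add: DD_def powr_add distrib_right algebra_simps)
  also have "... <= (60*(1 + ck))*(Hc sg*pw sg l*DD l)" using Hc(2)[of sg] ck_ratio(3) DD(1)[of l] by (intro mult_right_mono mult_mono) auto
  finally show ?thesis by (simp add: CU_def mult_ac)
 qed
 thus "sqn (U sg l t) <= er ((CU sg*pw sg l*DD l)^2)" using f0 by (intro order_trans[OF 1] ennreal_leI power_mono) auto
qed

end

lemma chi_half:
 assumes "xi ~= 0"
 obtains l where "1/2 <= chi l xi"
proof -
 define l where "l = \<lfloor>log 2 (abs xi)\<rfloor> - 1"
 have "ri (l + 1) <= log 2 (abs xi)" "log 2 (abs xi) < ri (l + 2)" unfolding l_def by linarith+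
 hence b: "2 powr ri (l + 1) <= (abs xi)" "(abs xi) < 2 powr ri (l + 2)" using assms by (simp_all add: le_log_iff log_less_iff)
 have "cutoff (xi/2 powr ri (l + 2)) = 1" by (rule cutoff_eq_1) (use b(2) in "simp add: abs_divide")
 moreover have "cutoff (xi/2 powr ri l) = 0" by (rule cutoff_eq_0) (use b(1) in "simp add: abs_divide pos_le_divide_eq powr_add")
 ultimately have "chi l xi + chi (l + 1) xi = 1" by (simp add: chi_def add.assoc)
 thus thesis using that[of l] that[of "l + 1"] by linarith
qed

text \<open>Neighbouring symbols add up to 1, so each nonzero frequency has a scale with
  \<open>chi l xi >= 1/2\<close>, and this single term already controls the left-hand side.\<close>

lemma dyadic_L2:
 assumes [measurable]: "bm G"
 shows "sqn (%xi. abspow s xi*G xi) <= er ((2*4 powr (abs s))^2)*zsum (%l. er ((pw s l)^2) * sqn (%xi. G xi*bw 0 l xi))"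
proof -
 let ?q = "%xi l. er ((pw s l)^2)*en (G xi*bw 0 l xi)^2" and ?C = "er ((2*4 powr (abs s))^2)"
 note [measurable] = bump_measurable[OF bump_bw]
 have "en (abspow s xi*G xi)^2 <= ?C*zsum (?q xi)" for xi
 proof (cases "xi = 0")
  case False
  obtain l where l: "1/2 <= chi l xi" using chi_half[OF False] by blast
  hence "xi : Lam (2 powr ri l)" using chi_eq_0[of xi l] by (cases "xi : Lam (2 powr ri l)") auto
  hence "(abs xi) powr s <= 4 powr (abs s)*pw s l" using powr_Lam_le[of xi "2 powr ri l" s] by (simp add: powr_powr mult.commute)
  moreover have "norm (G xi) <= 2*norm (G xi*bw 0 l xi)"
   using mult_left_mono[OF l, of "norm (G xi)"] False chi_bounds(1)[of l xi] by (simp add: bw_def abspow_def norm_mult)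
  ultimately have "(abs xi) powr s*norm (G xi) <= (4 powr (abs s)*pw s l)*(2*norm (G xi*bw 0 l xi))" by (intro mult_mono) auto
  hence "norm (abspow s xi*G xi) <= (2*4 powr (abs s))*(pw s l*norm (G xi*bw 0 l xi))" by (simp add: norm_mult abspow_def mult_ac)
  hence "en (abspow s xi*G xi)^2 <= er (((2*4 powr (abs s))*(pw s l*norm (G xi*bw 0 l xi)))^2)"
   unfolding ennreal_power[OF norm_ge_zero] by (intro ennreal_leI power_mono) auto
  also have "... = ?C*(er ((pw s l)^2)*en (G xi*bw 0 l xi)^2)"
   unfolding ennreal_power[OF norm_ge_zero] power_mult_distrib[of "2*4 powr (abs s)"] power_mult_distrib[of "pw s l"]
   by (subst ennreal_mult, simp, simp, subst ennreal_mult, simp_all)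
  also have "... <= ?C*zsum (?q xi)"
   by (intro mult_left_mono zsum_ge[of "%l. er ((pw s l)^2)*en (G xi*bw 0 l xi)^2"]) simp
  finally show ?thesis .
 qed (simp add: abspow_def)
 hence "sqn (%xi. abspow s xi*G xi) <= (NN xi. ?C*zsum (?q xi))" unfolding sqn_def by (rule nn_mono)
 also have "... = ?C*(NN xi. zsum (?q xi))" by (rule nn_cmult) (unfold zsum_nat, measurable)
 also have "(NN xi. zsum (?q xi)) = zsum (%l. er ((pw s l)^2) * sqn (%xi. G xi*bw 0 l xi))"
  unfolding sqn_def by (subst zsum_nn_integral) (simp_all add: nn_cmult)
 finally show ?thesis .
qed

section \<open>Sobolev regularity, continuity in time and the smoothing norm\<close>

context sols
begin

lemma F_chi: "t : {0..T} ==> sqn (%xi. F t xi*bw 0 l xi) <= er ((3*CU 0*DD l)^2)"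
proof -
 assume t: "t : {0..T}"
 have 1: "sqn (U 0 l t) <= er ((CU 0*DD l)^2)" using U_bounds(3)[OF t, of 0 l] by simp
 have "sqn (%xi. F t xi*bw 0 l xi) <= er (2*pi) * sqn (U 0 l t)"
  using cv_fourier_pair[OF pr[OF t] bump_bw[of 0 l]] order_le_less_trans[OF 1 ennreal_less_top] unfolding U_def by (rule fourier_pair_L2)
 also have "... <= er (2*pi)*er ((CU 0*DD l)^2)" by (intro mult_left_mono 1) simp
 also have "... <= er ((3*CU 0*DD l)^2)" unfolding mult.assoc[of 3] by (rule two_pi_le)
 finally show ?thesis .
qed

lemma DD2: "zsum (%l. er ((pw s l)^2)*er ((C*DD l)^2)) = er (C^2)*wl2 s (%l. er (DD l))^.2"
proof -
 have "er ((pw s l)^2)*er ((C*DD l)^2) = er (C^2)*(er (pw s l)*er (DD l))^.2" for l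
  using DD(1)[of l] unfolding epowr_numeral by (simp add: power_mult_distrib ennreal_power mult_ac flip: ennreal_mult)
 thus ?thesis by (simp add: nn_cmult wl2_def epowr_powr)
qed

lemma Hs_bound: "\<exists>M<top. \<forall>t\<in>{0..T}. sqn (%xi. abspow s xi*F t xi) <= M"
proof (intro exI conjI ballI)
 fix t assume t: "t : {0..T}"
 show "sqn (%xi. abspow s xi*F t xi) <= er ((2*4 powr (abs s))^2)*(er ((3*CU 0)^2)*wl2 s (%l. er (DD l))^.2)"
  unfolding DD2[symmetric] by (rule order_trans[OF dyadic_L2[OF fp_measurable(2)[OF pr[OF t]]]]) (intro mult_left_mono zsum_mono F_chi t, simp_all)
qed (use DD(2) in "simp add: ennreal_mult_less_top")

text \<open>Dominated convergence over the scales: the squares of the \<open>DD l\<close> supply a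
  summable majorant uniform in time, and on one annulus all Sobolev norms are equivalent, so
  convergence of order \<open>r\<close> is enough for each term.\<close>

lemma Hs_continuous:
 assumes X: "!!n. X n : {0..T}" and t: "t : {0..T}" and l: "(%n. sqn (%xi. abspow r xi*(F (X n) xi - F t xi))) ----> 0"
 shows "(%n. sqn (%xi. abspow s xi*(F (X n) xi - F t xi))) ----> 0"
proof -
 note [measurable] = bump_measurable[OF bump_bw] fp_measurable(2)[OF pr[OF t]] fp_measurable(2)[OF pr[OF X]]
 let ?G = "%n xi. F (X n) xi - F t xi"
 let ?w = "%l. er ((pw s l)^2)" and ?d = "%l. er ((3*CU 0*DD l)^2)" and ?C = "er ((2*4 powr (abs s))^2)"
 let ?q = "%n l. ?w l * sqn (%xi. ?G n xi*bw 0 l xi)"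
 have "(%n. zsum (?q n)) ----> zsum (%l. 0)"
 proof (rule nn_integral_dominated_convergence[where w="%l. er 4*(?w l*?d l)"])
  show "zsum (%l. er 4*(?w l*?d l)) < \<infinity>" using DD(2) by (subst nn_cmult) (simp_all add: DD2 ennreal_mult_less_top)
  show "AE l in count_space UNIV. ?q n l <= er 4*(?w l*?d l)" for n
  proof (rule AE_I2)
   fix l
   have "sqn (%xi. ?G n xi*bw 0 l xi) <= (NN xi. er 2*en (F (X n) xi*bw 0 l xi)^2 + er 2*en (F t xi*bw 0 l xi)^2)" unfolding sqn_def
   proof (rule nn_mono)
    fix xi
    let ?a = "F (X n) xi*bw 0 l xi" and ?b = "F t xi*bw 0 l xi"
    have "(norm (?a - ?b))^2 <= (norm ?a + norm ?b)^2" by (intro power_mono norm_triangle_ineq4) simp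
    also have "... <= 2*(norm ?a)^2 + 2*(norm ?b)^2" using zero_le_power2[of "norm ?a - norm ?b"] by (simp add: power2_sum power2_diff)
    finally have "er ((norm (?a - ?b))^2) <= er (2*(norm ?a)^2 + 2*(norm ?b)^2)" by (rule ennreal_leI)
    also have "... = er 2*er ((norm ?a)^2) + er 2*er ((norm ?b)^2)" by (subst ennreal_plus, simp, simp, subst (1 2) ennreal_mult, simp_all)
    finally show "en (?G n xi*bw 0 l xi)^2 <= er 2*en ?a^2 + er 2*en ?b^2" unfolding ennreal_power[OF norm_ge_zero] left_diff_distrib .
   qed
   also have "... = er 2 * sqn (%xi. F (X n) xi*bw 0 l xi) + er 2 * sqn (%xi. F t xi*bw 0 l xi)"
    unfolding sqn_def by (subst nn_integral_add; (subst (1 2) nn_cmult)?; (rule refl | measurable))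
   also have "... <= er 2*?d l + er 2*?d l" by (intro add_mono mult_left_mono F_chi X t) auto
   also have "... = er 4*?d l" unfolding distrib_right[symmetric] by (subst ennreal_plus[symmetric]) auto
   finally show "?q n l <= er 4*(?w l*?d l)" unfolding mult.left_commute[of "er 4"] by (rule mult_left_mono) simp
  qed
  \<comment> \<open>On the annulus at scale \<open>l\<close> the weight \<open>abspow r\<close> is
    bounded below by \<open>1/c\<close>.\<close>
  show "AE l in count_space UNIV. (%n. ?q n l) ----> 0"
  proof (rule AE_I2)
   fix l
   define c where "c = 4 powr \<bar>- r\<bar>*(2 powr ri l) powr (- r)"
   have up: "sqn (%xi. ?G n xi*bw 0 l xi) <= er (c^2) * sqn (%xi. abspow r xi*?G n xi)" for n
   proof -
    have "sqn (%xi. ?G n xi*bw 0 l xi) <= (NN xi. er (c^2)*en (abspow r xi*?G n xi)^2)" unfolding sqn_def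
    proof (rule nn_mono)
     fix xi
     have "norm (?G n xi*bw 0 l xi) <= c*norm (abspow r xi*?G n xi)"
     proof (cases "xi : Lam (2 powr ri l)")
      case True
      have x0: "(abs xi) > 0" using True by (cases "xi = 0") (auto simp: Lam_def)
      have "norm (bw 0 l xi) <= 1" using chi_bounds[of l xi] by (simp add: bw_def abspow_def norm_mult)
      hence "norm (?G n xi*bw 0 l xi) <= norm (?G n xi)" using mult_left_mono[of _ 1 "norm (?G n xi)"] by (simp add: norm_mult)
      also have "... = (abs xi) powr (- r)*((abs xi) powr r*norm (?G n xi))" using x0 by (simp add: mult.assoc[symmetric] flip: powr_add)
      also have "... <= c*((abs xi) powr r*norm (?G n xi))" unfolding c_def by (intro mult_right_mono powr_Lam_le True) auto
      finally show ?thesis by (simp add: norm_mult abspow_def)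
     qed (simp add: bw_eq_0 c_def)
     hence "er ((norm (?G n xi*bw 0 l xi))^2) <= er (c^2*(norm (abspow r xi*?G n xi))^2)"
      unfolding power_mult_distrib[symmetric] by (intro ennreal_leI power_mono) auto
     thus "en (?G n xi*bw 0 l xi)^2 <= er (c^2)*en (abspow r xi*?G n xi)^2" unfolding ennreal_power[OF norm_ge_zero] by (subst ennreal_mult[symmetric]) auto
    qed
    also have "... = er (c^2) * sqn (%xi. abspow r xi*?G n xi)" unfolding sqn_def abspow_def by (rule nn_cmult) measurable
    finally show ?thesis .
   qed
   have "(%n. ?w l*(er (c^2) * sqn (%xi. abspow r xi*?G n xi))) ----> ?w l*(er (c^2)*0)" by (intro ennreal_tendsto_cmult l) simp_all
   hence z: "(%n. ?w l*(er (c^2) * sqn (%xi. abspow r xi*?G n xi))) ----> 0" by simp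
   show "(%n. ?q n l) ----> 0" by (rule tendsto_sandwich[OF _ _ tendsto_const z]) (auto intro!: always_eventually mult_left_mono up)
  qed
 qed simp_all
 hence "(%n. ?C*zsum (?q n)) ----> ?C*zsum (%l. 0)" by (rule ennreal_tendsto_cmult[rotated]) simp
 hence z: "(%n. ?C*zsum (?q n)) ----> 0" by simp
 show ?thesis
  by (rule tendsto_sandwich[OF _ _ tendsto_const z]) (rule always_eventually, rule allI, rule zero_le, rule always_eventually, rule allI, rule dyadic_L2, measurable)
qed

text \<open>\<open>V\<close> is a weighted square sum of the pieces and \<open>B\<close> a weighted
  fourth power sum of their maximal functions. Each dominates every single piece, with opposite
  signs of the scale as in \<open>Hedberg\<close>, and their norms are finite by the weighted bound
  on \<open>DD\<close>.\<close>

lemma VB: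
 obtains V B kappa m where "mm V" "bml B" "kappa < top" "m < top" "!!x. (NN t. V t x^.2) <= kappa" "(NN x. B x^.4) <= m"
  "!!l t x. en (U sg l t x) <= er (2 powr (- ((s - sg + alpha/2)*ri l)))*V t x" "!!l t x. en (U sg l t x) <= er (pw (sg - s + 1/4) l)*B x"
proof -
 let ?e' = "%l. er (2 powr (- ((s - sg + alpha/2)*ri l)))" and ?g' = "%l. er (2 powr (- (- ((sg - s + 1/4)*ri l))))"
 define W where "W = er ((CU sg)^2)*wl2 s (%l. er (DD l))^.2"
 have W: "W < top" using DD(2) by (simp add: W_def ennreal_mult_less_top)
 have Wd: "zsum (%l. er ((CU sg*pw s l*DD l)^2)) = W" unfolding W_def DD2[symmetric] by (intro nn_cong) (simp add: power_mult_distrib mult_ac flip: ennreal_mult)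
 let ?e = "%l. er (pw (s - sg + alpha/2) l)" and ?g = "%l. er (2 powr (- ((sg - s + 1/4)*ri l)))"
 define V where "V t x = (zsum (%l. (?e l*en (U sg l t x))^.2))^.(1/2)" for t x
 have "mm (%t x. (\<Sum>n. (?e (int_decode n)*en (U sg (int_decode n) t x))^.2)^.(1/2))" by measurable
 hence Vm: "mm V" unfolding V_def zsum_nat .
 have V2: "(NN t. V t x^.2) <= W" for x
 proof -
  note [measurable] = mm_section(1)[OF UmS(1)]
  have "(NN t. V t x^.2) = zsum (%l. (NN t. (?e l*en (U sg l t x))^.2))" unfolding V_def epowr_powr by (subst zsum_nn_integral[symmetric]) simp_all
  also have "... <= zsum (%l. er ((CU sg*pw s l*DD l)^2))"
  proof (rule zsum_mono)
   fix l
   have "(NN t. (?e l*en (U sg l t x))^.2) = ?e l^2*(NN t. en (U sg l t x)^2*ind {0..T} t)"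
    unfolding epowr_numeral power_mult_distrib by (subst nn_cmult[symmetric]) (measurable, intro nn_cong, auto simp: indicator_def off)
   also have "... <= ?e l^2*er ((CU sg*pw (sg - alpha/2) l*DD l)^2)" using U_bounds(1)[of sg l] unfolding KB_def by (intro mult_left_mono) auto
   also have "... = er ((CU sg*(pw (s - sg + alpha/2) l*pw (sg - alpha/2) l)*DD l)^2)" by (simp add: ennreal_power power_mult_distrib mult_ac flip: ennreal_mult)
   also have "pw (s - sg + alpha/2) l*pw (sg - alpha/2) l = pw s l" unfolding powr_add[symmetric] by (simp add: algebra_simps)
   finally show "(NN t. (?e l*en (U sg l t x))^.2) <= er ((CU sg*pw s l*DD l)^2)" .
  qed
  finally show ?thesis unfolding Wd .
 qed
 have "\<forall>l. \<exists>B. B : borel_measurable borel & (\<forall>t\<in>{0..T}. \<forall>x. en (U sg l t x) <= B x) &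
   (NN x. B x^4) <= er ((CU sg*pw (sg + 1/4) l*DD l)^4)" using U_bounds(2)[of sg] unfolding MB_def by blast
 then obtain b where bm [measurable]: "!!l. bm (b l)" and b: "!!l t x. t : {0..T} ==> en (U sg l t x) <= b l x"
  and b4: "!!l. (NN x. b l x^4) <= er ((CU sg*pw (sg + 1/4) l*DD l)^4)" by metis
 have b': "en (U sg l t x) <= b l x" for l t x using b[of t l x] by (cases "t : {0..T}") (simp_all add: off)
 define B where "B x = (zsum (%l. (?g l*b l x)^.4))^.(1/4)" for x
 have "bml (%x. (\<Sum>n. (?g (int_decode n)*b (int_decode n) x)^.4)^.(1/4))" by measurable
 hence Bm: "bml B" unfolding B_def[abs_def] zsum_nat .
 have B4: "(NN x. B x^.4) <= W^.2"
 proof -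
  have "(NN x. B x^.4) = zsum (%l. (NN x. (?g l*b l x)^.4))" unfolding B_def epowr_powr by (subst zsum_nn_integral[symmetric]) simp_all
  also have "... <= zsum (%l. er ((CU sg*pw s l*DD l)^2)*W)"
  proof (rule zsum_mono)
   fix l
   let ?d = "CU sg*pw s l*DD l"
   have "(NN x. (?g l*b l x)^.4) = ?g l^4*(NN x. b l x^4)" unfolding epowr_numeral power_mult_distrib by (rule nn_cmult) measurable
   also have "... <= ?g l^4*er ((CU sg*pw (sg + 1/4) l*DD l)^4)" by (intro mult_left_mono b4) simp
   also have "... = er ((CU sg*(2 powr (- ((sg - s + 1/4)*ri l))*pw (sg + 1/4) l)*DD l)^4)" by (simp add: ennreal_power power_mult_distrib mult_ac flip: ennreal_mult)
   also have "2 powr (- ((sg - s + 1/4)*ri l))*pw (sg + 1/4) l = pw s l" unfolding powr_add[symmetric] by (simp add: algebra_simps)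
   \<comment> \<open>A sum of fourth powers is at most the square of the sum of squares: one of the
     two factors is replaced by the total \<open>W\<close>.\<close>
   also have "er (?d^4) = er (?d\<^sup>2)*er (?d\<^sup>2)" by (subst ennreal_mult[symmetric]) (simp_all flip: power_add)
   also have "... <= er (?d\<^sup>2)*W" unfolding Wd[symmetric] by (intro mult_left_mono zsum_ge[of "%l. er ((CU sg*pw s l*DD l)^2)"]) simp
   finally show "(NN x. (?g l*b l x)^.4) <= er (?d\<^sup>2)*W" .
  qed
  also have "... = W^.2" unfolding epowr_numeral by (subst nn_multc) (simp_all only: Wd power2_eq_square[of W], simp_all)
  finally show ?thesis .
 qed
 have root: "x <= (zsum f)^.(1/r)" if "x^.r <= f l" "0 < r" for x f l r
 proof -
  have "(x^.r)^.(1/r) <= (zsum f)^.(1/r)" using that by (intro epowr_mono order_trans[OF that(1) zsum_ge[of f l]]) auto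
  thus ?thesis using that(2) by (simp add: epowr_powr)
 qed
 have inv: "x = er (2 powr (- r))*(er (2 powr r)*x)" for x r by (simp add: mult.assoc[symmetric] powr_minus flip: ennreal_mult)
 show thesis
 proof (rule that[OF Vm Bm W _ V2 B4])
  show "W^.2 < top" using W by simp
  fix l t x
  have "?e l*en (U sg l t x) <= V t x" unfolding V_def by (rule root[where l=l]) simp_all
  hence "?e' l*(?e l*en (U sg l t x)) <= ?e' l*V t x" by (rule mult_left_mono) simp
  thus "en (U sg l t x) <= ?e' l*V t x" using inv by simp
  have "?g l*en (U sg l t x) <= ?g l*b l x" by (intro mult_left_mono b') simp
  also have "... <= B x" unfolding B_def by (rule root[where l=l]) simp_all
  finally have "?g' l*(?g l*en (U sg l t x)) <= ?g' l*B x" by (rule mult_left_mono) simp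
  thus "en (U sg l t x) <= er (pw (sg - s + 1/4) l)*B x" unfolding inv[of "en (U sg l t x)" "- ((sg - s + 1/4)*ri l)", symmetric] by simp
 qed
qed

text \<open>\<open>abspow s * F t\<close> is in \<open>L^2\<close>, and the remaining half
  derivative falls on the Schwartz function, where \<open>abs x <= 1 + x^2\<close> keeps it square
  integrable.\<close>

lemma integrable_weighted:
 assumes t: "t : {0..T}" and psi: "schwartz psi"
 shows "integrable lborel (%xi. abspow (s + 1/2) xi*F t xi*psi xi)"
proof -
 obtain C where C: "0 <= C" "!!x. norm (psi x) <= C/(1 + x^2)" using schwartz_props(3)[OF psi] by blast
 have [measurable]: "bm (F t)" "bm psi" "!!r. bm (abspow r)"
  using fp_measurable(2)[OF pr[OF t]] schwartz_measurable[OF psi] by (simp_all add: abspow_def[abs_def])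
 have "sqn (%xi. abspow (1/2) xi*psi xi) <= (NN x. er (C*C/(1 + x^2)))" unfolding sqn_def
 proof (rule nn_mono)
  fix x :: real
  have "(norm (abspow (1/2) x*psi x))^2 <= (sqrt (abs x)*(C/(1 + x^2)))^2"
   by (intro power_mono) (use mult_left_mono[OF C(2)[of x], of "sqrt (abs x)"] in "simp_all add: norm_mult abspow_def powr_half_sqrt")
  also have "... = (abs x)/(1 + x^2)*(C*C/(1 + x^2))" by (simp add: power_mult_distrib power2_eq_square)
  also have "... <= 1*(C*C/(1 + x^2))"
  proof (rule mult_right_mono)
   have "0 < 1 + x^2" using zero_le_power2[of x] by linarith
   moreover have "(abs x) <= 1 + x^2" using zero_le_power2[of "(abs x) - 1"] by (simp add: power2_diff)
   ultimately show "(abs x)/(1 + x^2) <= 1" by simp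
  qed simp
  finally show "en (abspow (1/2) x*psi x)^2 <= er (C*C/(1 + x^2))" unfolding ennreal_power[OF norm_ge_zero] by (intro ennreal_leI) simp
 qed
 also have "... < top" using integrable_inverse_1_plus_sq[of "C*C"] unfolding integrable_iff_bounded by (simp add: abs_mult top.not_eq_extremum)
 finally have 1: "sqn (%xi. abspow (1/2) xi*psi xi) < top" .
 have 2: "sqn (%xi. abspow s xi*F t xi) < top" using Hs_bound t by (auto intro: order_le_less_trans)
 have "abspow (s + 1/2) xi*F t xi*psi xi = abspow s xi*F t xi*(abspow (1/2) xi*psi xi)" for xi by (simp add: abspow_def powr_add)
 thus ?thesis using integrable_mult_L2(1)[OF _ _ 2 1] by (simp only:) measurable
qed

definition W :: "real => real => complex" where "W t y = (\<Sum>i. U (s + 1/2) (int_decode i) t y)"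

text \<open>The series is the candidate for the derivative of order \<open>s + 1/2\<close> of
  \<open>u\<close>. \<open>Hedberg\<close> bounds its absolute sum by
  \<open>V^.(2/Q) * B^.(4/P)\<close>, exactly the product that \<open>mx_VB\<close> takes for the
  exponents \<open>P\<close>, \<open>Q\<close>.\<close>

lemma W: "mm W" "mx P Q (%t x. en (W t x)) < top" "AEL t. t : {0..T} --> fourier_pair (W t) (%xi. abspow (s + 1/2) xi*F t xi)"
proof -
 let ?S = "%t x. zsum (%l. en (U (s + 1/2) l t x))"
 obtain V B kappa m where VB: "mm V" "bml B" "kappa < top" "m < top" "!!x. (NN t. V t x^.2) <= kappa" "(NN x. B x^.4) <= m"
  and y: "!!l t x. en (U (s + 1/2) l t x) <= er (2 powr (- ((s - (s + 1/2) + alpha/2)*ri l)))*V t x"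
  "!!l t x. en (U (s + 1/2) l t x) <= er (pw (s + 1/2 - s + 1/4) l)*B x" using VB[of "s + 1/2"] by blast
 \<comment> \<open>The decay \<open>(alpha - 1)/2\<close> is positive because
   \<open>alpha > 1\<close>: smoothing by \<open>alpha/2\<close> exceeds the extra half
   derivative.\<close>
 have e: "s - (s + 1/2) + alpha/2 = (alpha - 1)/2" "s + 1/2 - s + 1/4 = 3/4" by (simp_all add: field_simps)
 have ex: "3/4/((alpha - 1)/2 + 3/4) = 2/Q" "(alpha - 1)/2/((alpha - 1)/2 + 3/4) = 4/P"
  unfolding P_def Q_def using alpha by (simp_all add: divide_simps) (simp_all add: algebra_simps)
 have S: "?S t x <= er (hed ((alpha - 1)/2) (3/4))*(V t x^.(2/Q)*B x^.(4/P))" for t x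
  using Hedberg[of "(alpha - 1)/2" "3/4" "%l. en (U (s + 1/2) l t x)", OF _ _ y[of _ t x, unfolded e]] alpha unfolding ex by simp
 have "mx P Q ?S <= er (hed ((alpha - 1)/2) (3/4))*(kappa^.(P/Q)*m)^.(1/P)" by (rule mx_VB[OF VB(1,2) _ _ S VB(5,6)]) (use PQ in auto)
 also have "... < top" using VB(3,4) by (simp add: ennreal_mult_less_top)
 finally have fin: "mx P Q ?S < top" .
 show "mm W" unfolding W_def by measurable
 have WS: "en (W t x) <= ?S t x" for t x using en_series_le[of "s + 1/2" t x None] by (simp add: W_def scales_def)
 have "mx P Q (%t x. en (W t x)) <= mx P Q ?S" by (rule mx_mono[OF WS]) (use PQ in auto)
 thus "mx P Q (%t x. en (W t x)) < top" using fin by (rule order_le_less_trans)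
 show "AEL t. t : {0..T} --> fourier_pair (W t) (%xi. abspow (s + 1/2) xi*F t xi)" using series_AE[of P Q "s + 1/2" None] fin PQ integrable_weighted
  by (simp add: W_def[abs_def] scales_def tailsym_def)
qed

text \<open>Bernstein from \<open>L^2\<close> to the supremum: Cauchy-Schwarz on an annulus of
  measure at most \<open>8*2 powr l\<close> costs half a power of the frequency, and single terms of
  a weighted square sum are bounded.\<close>

lemma U_sup:
 obtains E where "0 <= E" "!!l t x. en (U 0 l t x) <= er (pw (1/2 - s) l)*er E"
proof -
 define w where "w = enn2real (wl2 s (%l. er (DD l)))"
 have w: "0 <= w" "wl2 s (%l. er (DD l)) = er w" using DD(2) by (simp_all add: w_def less_top)
 have Dw: "pw s l*DD l <= w" for l
 proof -
  have "(er (pw s l*DD l))^.2 <= wl2 s (%l. er (DD l))^.2"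
   unfolding wl2_def epowr_powr using zsum_ge[of "%l. (er (pw s l)*er (DD l))^.2" l] DD(1)[of l] by (simp add: ennreal_mult)
  hence "er (pw s l*DD l) <= er w" unfolding w(2) by (subst (asm) epowr_le_iff) auto
  thus ?thesis using w(1) by simp
 qed
 define E where "E = 3*CU 0*w*4"
 have "en (U 0 l t x) <= er (pw (1/2 - s) l*E)" for l t x
 proof (cases "t : {0..T}")
  case True
  let ?h = "%xi. F t xi*bw 0 l xi" and ?g = "%xi. cor (ind (Lam (2 powr ri l)) xi)*cis (x*xi)" and ?a = "2 powr (ri l)"
  note [measurable] = fp_measurable(2)[OF pr[OF True]] bump_measurable[OF bump_bw]
  have Lm [measurable]: "Lam ?a : sets borel" unfolding Lam_def by measurable
  have "sqn ?g = (NN xi. ind (Lam ?a) xi)" unfolding sqn_def by (intro nn_cong) (simp add: norm_mult indicator_def)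
  also have "... <= (NN xi. ind {- (4*?a)..4*?a} xi)" by (intro nn_mono) (auto simp: Lam_def indicator_def)
  also have "... = er (8*?a)" by (simp add: emeasure_lborel_Icc_eq)
  finally have g: "sqn ?g <= er (8*?a)" .
  note h = F_chi[OF True, of l]
  have "en (LI xi. ?h xi*?g xi)^2 <= er ((3*CU 0*DD l)^2)*er (8*?a)"
   by (rule order_trans[OF integrable_mult_L2(2) mult_mono[OF h g]]) (use order_le_less_trans[OF h ennreal_less_top] order_le_less_trans[OF g ennreal_less_top] in auto)
  also have "... <= er ((3*CU 0*DD l)^2)*er ((4*pw (1/2) l)^2)" by (intro mult_left_mono ennreal_leI) (simp_all add: power_mult_distrib power2_eq_square flip: powr_add)
  also have "... = er (3*CU 0*DD l*(4*pw (1/2) l))^2" using CU_pos[of 0] DD(1)[of l] by (simp add: ennreal_power power_mult_distrib flip: ennreal_mult)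
  finally have 1: "norm (LI xi. ?h xi*?g xi) <= 3*CU 0*DD l*(4*pw (1/2) l)"
   using CU_pos[of 0] DD(1)[of l] unfolding epowr_numeral[symmetric] by (subst (asm) epowr_le_iff) auto
  have "U 0 l t x = (1/cor (2*pi))*(LI xi. ?h xi*cis (x*xi))" unfolding U_def by (rule cv_pair(1)[OF pr[OF True] bump_bw])
  also have "(LI xi. ?h xi*cis (x*xi)) = (LI xi. ?h xi*?g xi)" by (intro LI_cong refl) (auto simp: indicator_def bw_eq_0)
  finally have U: "U 0 l t x = (1/cor (2*pi))*(LI xi. ?h xi*?g xi)" .
  have "norm (U 0 l t x) <= 1*norm (LI xi. ?h xi*?g xi)" unfolding U norm_mult using pi_gt3 by (intro mult_right_mono) (auto simp: norm_divide)
  also have "... <= 3*CU 0*DD l*(4*pw (1/2) l)" using 1 by simp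
  also have "... = pw (1/2 - s) l*(12*CU 0*(pw s l*DD l))"
  proof -
   have "pw (1/2) l = pw (1/2 - s) l*pw s l" unfolding powr_add[symmetric] by (simp add: algebra_simps)
   thus ?thesis by simp
  qed
  also have "... <= pw (1/2 - s) l*(12*CU 0*w)" using CU_pos[of 0] by (intro mult_left_mono Dw) auto
  finally show ?thesis unfolding E_def by (intro ennreal_leI) simp
 qed (simp add: off)
 moreover have "0 <= E" using CU_pos[of 0] w by (simp add: E_def)
 ultimately show thesis by (intro that[of E]) (simp_all add: ennreal_mult)
qed

text \<open>For \<open>s < 1/2\<close> the supremum bound grows with the scale and can be the second
  bound in \<open>Hedberg\<close>. The decay rate is chosen so that the exponent of \<open>X\<close>
  becomes \<open>gamma\<close>.\<close>

lemma zsum_U: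
 assumes s: "s < 1/2" and gamma: "0 < gamma" "gamma < 1"
 obtains C where "C < top" "!!t x X. (!!l. en (U 0 l t x) <= er (2 powr (- ((1/2 - s)*(1 - gamma)/gamma*ri l)))*X) ==> zsum (%l. en (U 0 l t x)) <= C*X^.gamma"
proof -
 obtain E where E: "0 <= E" "!!l t x. en (U 0 l t x) <= er (pw (1/2 - s) l)*er E" using U_sup by blast
 let ?a = "(1/2 - s)*(1 - gamma)/gamma" and ?b = "1/2 - s"
 have ab: "0 < ?a" "0 < ?b" using s gamma by auto
 have "?a + ?b = ?b/gamma" using gamma by (simp add: field_simps)
 hence x: "?b/(?a + ?b) = gamma" using ab by simp
 show thesis
 proof (rule that[of "er (hed ?a ?b)*er E^.(?a/(?a + ?b))"])
  fix t x X assume "!!l. en (U 0 l t x) <= er (2 powr (- (?a*ri l)))*X"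
  from Hedberg[OF ab this E(2)]
  show "zsum (%l. en (U 0 l t x)) <= er (hed ?a ?b)*er E^.(?a/(?a + ?b))*X^.gamma" unfolding x by (simp add: mult_ac)
 qed (use E(1) in "simp add: ennreal_mult_less_top")
qed

lemma u_le_zsum:
 assumes "mx p1 q1 (%t x. zsum (%l. en (U 0 l t x))) < top" "1 < p1" "1 < q1"
 shows "AEL x. AEL t. en (u t x) <= zsum (%l. en (U 0 l t x))" using diff_le[of p1 q1 None] assms by (simp add: SS_def scales_def)

section \<open>The norm with exponents \<open>p\<close> and \<open>q_s\<close>\<close>

definition sc :: real where "sc = 1/2 - alpha/k"
definition d :: real where "d = 2*(alpha^2 - 1) - (s - sc)*(2*alpha + 1)*k"
text \<open>The time exponent \<open>q_s\<close> as a real number. For \<open>d = 0\<close> division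
  by zero gives \<open>1/r = 0\<close>, the correct value for an infinite exponent, so
  \<open>exps\<close> covers that case too.\<close>

definition r :: real where "r = (2*alpha + 1)*(alpha + 1)*k/d"

lemma d_eq: "d = (alpha + 1)*(2*(alpha - 1)) - (s - sc)*((2*alpha + 1)*k)" unfolding d_def by (simp add: algebra_simps power2_eq_square)

lemma q_d: "1/q = 2*(alpha - 1)/((2*alpha + 1)*k)" "1/r = d/((alpha + 1)*((2*alpha + 1)*k))" by (simp_all add: q_def r_def mult_ac)

lemma r_q: "1/r = 1/q - (s - sc)/(alpha + 1)"
proof -
 have "d/((alpha + 1)*((2*alpha + 1)*k)) = (alpha + 1)*(2*(alpha - 1))/((alpha + 1)*((2*alpha + 1)*k)) - (s - sc)*((2*alpha + 1)*k)/((alpha + 1)*((2*alpha + 1)*k))"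
  unfolding d_eq by (rule diff_divide_distrib)
 thus ?thesis unfolding q_d using alpha k by simp
qed

text \<open>Below the critical order \<open>r <= q\<close>, and Hoelder in time on the bounded
  interval \<open>{0..T}\<close> is enough.\<close>

lemma S_low:
 assumes "s <= sc"
 shows "0 < r" "mx p r (%t x. en (u t x)) < top"
proof -
 have rq: "1/q <= 1/r" unfolding r_q using assms alpha by (simp add: divide_nonpos_pos)
 hence "0 < 1/r" using pq(2) by (intro order_less_le_trans[OF _ rq]) simp
 thus r0: "0 < r" by (simp add: zero_less_divide_iff)
 have qr: "r <= q" using rq r0 pq(2) by (simp add: divide_simps split: if_splits)
 show "mx p r (%t x. en (u t x)) < top"
 proof (cases "r = q")
  case False
  hence th: "0 < r/q" "r/q < 1" using qr r0 pq(2) by auto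
  define c where "c = er T^.(1 - r/q)"
  have "(NN t. en (u t x)^.r) <= (NN t. en (u t x)^.q)^.(r/q)*c" for x
  proof -
   note [measurable] = mm_section(1)[OF um, of x]
   have "(NN t. en (u t x)^.r) = (NN t. (en (u t x)^.q)^.(r/q)*(ind {0..T} t)^.(1 - r/q))"
    using pq(2) u0 by (intro nn_cong) (auto simp: epowr_powr indicator_def simp del: epowr_ennreal)
   also have "... <= (NN t. en (u t x)^.q)^.(r/q)*(NN t. ind {0..T} t)^.(1 - r/q)" by (rule nn_integral_Holder[OF _ _ th]) measurable
   finally show ?thesis using T by (simp add: c_def)
  qed
  hence "(NN t. en (u t x)^.r)^.(p/r) <= c^.(p/r)*(NN t. en (u t x)^.q)^.(p/q)" for x
   using epowr_mono[of "(NN t. en (u t x)^.r)" "(NN t. en (u t x)^.q)^.(r/q)*c" "p/r"] r0 pq(1) by (simp add: epowr_mult epowr_powr mult.commute[of _ "c^.(p/r)"] del: epowr_ennreal)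
  hence "mx p r (%t x. en (u t x)) <= (NN x. c^.(p/r)*(NN t. en (u t x)^.q)^.(p/q))^.(1/p)" unfolding mx_def using pq(1) by (intro epowr_mono nn_mono) auto
  also have "... = (c^.(p/r))^.(1/p)*mx p q (%t x. en (u t x))"
  proof -
   have [measurable]: "bmL (%(x, t). u t x)" by (rule mm_swap) (rule um)
   show ?thesis unfolding mx_def by (subst nn_cmult) (simp_all add: epowr_mult)
  qed
  also have "... < top" using uS by (simp add: c_def ennreal_mult_less_top)
  finally show ?thesis .
 qed (use uS in simp)
qed

text \<open>A nonnegative denominator means \<open>s - sc < alpha/k\<close>, and
  \<open>sc + alpha/k = 1/2\<close>.\<close>

lemma s_half: assumes "0 <= d" shows "s < 1/2"
proof -
 have K: "0 < (2*alpha + 1)*k" using alpha k by simp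
 have "alpha/k*((2*alpha + 1)*k) = (alpha + 1)*(2*(alpha - 1)) + (alpha + 2)" using k by (simp add: field_simps)
 hence "(s - sc)*((2*alpha + 1)*k) < alpha/k*((2*alpha + 1)*k)" using assms alpha unfolding d_eq by linarith
 thus ?thesis using K unfolding sc_def by (simp only: mult_less_cancel_right_disj) auto
qed

text \<open>\<open>gamma\<close> is the total power of the pieces spent on \<open>V\<close> and
  \<open>B\<close> in \<open>V^.(2/r) * B^.(4/p)\<close>; the remaining \<open>1 - gamma\<close>
  goes to the supremum bound. The third equation is the scaling relation: the powers of 2 from the
  three bounds balance.\<close>

lemma exps:
 assumes s: "sc < s" and d: "0 <= d"
 defines "gamma \<equiv> 2/r + 4/p"
 shows "0 < gamma" "gamma < 1" "(s + alpha/2)*(2/r) - (1/4 - s)*(4/p) = (1/2 - s)*(1 - gamma)" "0 <= 1/r" "1/r < 1"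
proof -
 define K X R Y Z where "K = (2*alpha + 1)*k" and "X = (s - sc)/(alpha + 1)" and "R = 1/r" and "Y = 1/p" and "Z = 1/q"
 have K: "0 < K" and X: "0 < X" using alpha k s by (simp_all add: K_def X_def)
 note qr = q_d[folded K_def R_def Z_def] and rq = r_q[folded X_def R_def Z_def]
 have Y: "Y = (alpha + 2)/K" by (simp add: Y_def p_def K_def)
 have gamma: "gamma = 2*R + 4*Y" by (simp add: gamma_def R_def Y_def)
 show r0: "0 <= 1/r" unfolding R_def[symmetric] qr using d alpha K by simp
 thus "0 < gamma" using pq(1) unfolding gamma by (simp add: add_nonneg_pos R_def Y_def)
 have "2*Z + 4*Y = 4*(2*alpha + 1)/K" unfolding qr Y by (simp add: algebra_simps flip: add_divide_distrib)
 also have "... = 4/k"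
 proof -
  have "4*z/(z*real k) = 4/real k" if "0 < z" for z :: real using that by simp
  thus ?thesis using alpha by (simp only: K_def)
 qed
 also have "... <= 1" using k by simp
 finally show "gamma < 1" using X unfolding gamma rq by (simp add: right_diff_distrib)
 have "Z < 1" using pq(2) by (simp add: Z_def)
 thus "1/r < 1" using X rq unfolding R_def[symmetric] by linarith
 have "(alpha + 1)*R = d/K" unfolding qr using alpha by simp
 hence "(alpha + 1)*R + Y = (d + (alpha + 2))/K" unfolding Y by (simp add: add_divide_distrib)
 also have "d + (alpha + 2) = (alpha/k - (s - sc))*K" unfolding d_eq K_def using k by (simp add: field_simps)
 also have ".../K = 1/2 - s" using K by (simp add: sc_def)
 finally have e: "(alpha + 1)*R + Y = 1/2 - s" .
 have "2/r = 2*R" "4/p = 4*Y" by (simp_all add: R_def Y_def)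
 thus "(s + alpha/2)*(2/r) - (1/4 - s)*(4/p) = (1/2 - s)*(1 - gamma)" using e unfolding gamma by (simp add: algebra_simps)
qed

text \<open>The target \<open>V^.(2/r) * B^.(4/p)\<close> has total power \<open>gamma < 1\<close>,
  so two bounds do not suffice. Each piece is split as \<open>U^.v * U^.b\<close> with
  \<open>v + b = 1\<close> to combine smoothing and maximal bound into one decaying bound, and
  \<open>zsum_U\<close> plays it against the supremum bound.\<close>

lemma S_high:
 assumes s: "sc < s" and d: "0 < d"
 shows "0 < r" "mx p r (%t x. en (u t x)) < top"
proof -
 note e = exps[OF s less_imp_le[OF d]]
 define gamma where "gamma = 2/r + 4/p"
 note e = e[folded gamma_def]
 have "0 < 1/r" unfolding q_d using d alpha k by simp
 thus r0: "0 < r" by (simp add: zero_less_divide_iff)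
 obtain C where C: "C < top" "!!t x X. (!!l. en (U 0 l t x) <= er (2 powr (- ((1/2 - s)*(1 - gamma)/gamma*ri l)))*X) ==> zsum (%l. en (U 0 l t x)) <= C*X^.gamma"
  using zsum_U[OF s_half e(1,2)] d by auto
 obtain V B kappa m where VB: "mm V" "bml B" "kappa < top" "m < top" "!!x. (NN t. V t x^.2) <= kappa" "(NN x. B x^.4) <= m"
  and y: "!!l t x. en (U 0 l t x) <= er (2 powr (- ((s - 0 + alpha/2)*ri l)))*V t x" "!!l t x. en (U 0 l t x) <= er (pw (0 - s + 1/4) l)*B x" using VB[of 0] by blast
 define v b where "v = 2/r/gamma" and "b = 4/p/gamma"
 have vb: "0 < v" "0 < b" "v + b = 1" using r0 pq(1) e(1) unfolding v_def b_def add_divide_distrib[symmetric] gamma_def[symmetric] by simp_all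
 have ex: "(s + alpha/2) * v - (1/4 - s)*b = (1/2 - s)*(1 - gamma)/gamma" unfolding e(3)[symmetric] by (simp add: v_def b_def diff_divide_distrib)
 have S: "zsum (%l. en (U 0 l t x)) <= C*(V t x^.(2/r)*B x^.(4/p))" for t x
 proof -
  have "zsum (%l. en (U 0 l t x)) <= C*(V t x^.v * B x^.b)^.gamma"
  proof (rule C(2))
   fix l
   have "en (U 0 l t x) = en (U 0 l t x)^.v * en (U 0 l t x)^.b" by (simp only: epowr_add vb(3) epowr_1)
   also have "... <= (er (2 powr (- ((s - 0 + alpha/2)*ri l)))*V t x)^.v * (er (pw (0 - s + 1/4) l)*B x)^.b" by (intro mult_mono epowr_mono y) (use vb in auto)
   also have "... = (er ((2 powr (- ((s - 0 + alpha/2)*ri l))) powr v)*er ((pw (0 - s + 1/4) l) powr b))*(V t x^.v * B x^.b)"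
    by (simp only: epowr_mult epowr_ennreal powr_ge_zero mult_ac)
   also have "er ((2 powr (- ((s - 0 + alpha/2)*ri l))) powr v)*er ((pw (0 - s + 1/4) l) powr b) = er (2 powr (- (((s + alpha/2) * v - (1/4 - s)*b)*ri l)))"
    by (subst ennreal_mult[symmetric], simp, simp, unfold powr_powr powr_add[symmetric], simp add: algebra_simps)
   finally show "en (U 0 l t x) <= er (2 powr (- ((1/2 - s)*(1 - gamma)/gamma*ri l)))*(V t x^.v * B x^.b)" unfolding ex .
  qed
  thus ?thesis using e(1) by (simp add: epowr_mult epowr_powr v_def b_def)
 qed
 have "mx p r (%t x. zsum (%l. en (U 0 l t x))) <= C*(kappa^.(p/r)*m)^.(1/p)" by (rule mx_VB[OF VB(1,2) _ r0 S VB(5,6)]) (use pq in auto)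
 also have "... < top" using VB(3,4) C(1) by (simp add: ennreal_mult_less_top)
 finally have fin: "mx p r (%t x. zsum (%l. en (U 0 l t x))) < top" .
 have r1: "1 < r" using e(5) r0 by simp
 have "mx p r (%t x. en (u t x)) <= mx p r (%t x. zsum (%l. en (U 0 l t x)))" by (rule mx_mono_AE[OF u_le_zsum[OF fin pq(1) r1]]) (use pq r0 in auto)
 thus "mx p r (%t x. en (u t x)) < top" using fin by (rule order_le_less_trans)
qed

text \<open>The time exponent is infinite here, so the power of \<open>V\<close> drops out and the
  maximal bound alone supplies the decay, at rate \<open>s - 1/4\<close>. The majorant then depends
  on \<open>x\<close> only.\<close>

lemma S_end:
 assumes s: "sc < s" and d: "d = 0"
 obtains C B where "C < top" "bml B" "(NN x. B x^.4) < top" "AEL x. AEL t. en (u t x) <= C*B x^.(4/p)"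
proof -
 have d0: "0 <= d" using d by simp
 have r: "1/r = 0" unfolding q_d d by simp
 note e = exps[OF s d0]
 have e: "0 < 4/p" "4/p < 1" "(s - 1/4)*(4/p) = (1/2 - s)*(1 - 4/p)" using e r by (simp_all add: algebra_simps)
 obtain C where C: "C < top" "!!t x X. (!!l. en (U 0 l t x) <= er (2 powr (- ((1/2 - s)*(1 - 4/p)/(4/p)*ri l)))*X) ==> zsum (%l. en (U 0 l t x)) <= C*X^.(4/p)"
  using zsum_U[OF s_half[OF d0] e(1,2)] by auto
 obtain V B kappa m where VB: "mm V" "bml B" "kappa < top" "m < top" "!!x. (NN t. V t x^.2) <= kappa" "(NN x. B x^.4) <= m"
  and y: "!!l t x. en (U 0 l t x) <= er (2 powr (- ((s - 0 + alpha/2)*ri l)))*V t x" "!!l t x. en (U 0 l t x) <= er (pw (0 - s + 1/4) l)*B x" using VB[of 0] by blast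
 have ex: "(1/2 - s)*(1 - 4/p)/(4/p) = s - 1/4" unfolding e(3)[symmetric] using e(1) by simp
 have S: "zsum (%l. en (U 0 l t x)) <= C*B x^.(4/p)" for t x
 proof (rule C(2))
  fix l
  have "0 - s + 1/4 = - (s - 1/4)" by simp
  thus "en (U 0 l t x) <= er (2 powr (- ((1/2 - s)*(1 - 4/p)/(4/p)*ri l)))*B x" using y(2)[of l t x] unfolding ex by (simp only: minus_mult_left)
 qed
 \<comment> \<open>The exponent 2 in time is auxiliary: \<open>u_le_zsum\<close> needs some finite
   mixed norm of the absolute sum, and on \<open>{0..T}\<close> a majorant in \<open>x\<close> alone
   provides it.\<close>
 have "mx p 2 (%t x. zsum (%l. en (U 0 l t x))) <= C*(er T^.(p/2)*m)^.(1/p)"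
 proof (rule mx_VB[OF _ VB(2) _ _ _ _ VB(6)])
  show "mm (%t x. ind {0..T} t :: ennreal)" by measurable
  show "zsum (%l. en (U 0 l t x)) <= C*(ind {0..T} t^.(2/2)*B x^.(4/p))" for t x using S[of t x] by (cases "t : {0..T}") (simp_all add: off)
  show "(NN t. ind {0..T} t^.2) <= er T" for x :: real
  proof -
   have "(ind {0..T} t :: ennreal)^.2 = ind {0..T} t" for t by (simp add: indicator_def)
   thus ?thesis using T by simp
  qed
 qed (use pq in auto)
 also have "... < top" using VB(4) C(1) by (simp add: ennreal_mult_less_top)
 finally have fin: "mx p 2 (%t x. zsum (%l. en (U 0 l t x))) < top" .
 show thesis
 proof (rule that[OF C(1) VB(2)])
  show "(NN x. B x^.4) < top" using VB(6,4) by (rule order_le_less_trans)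
  show "AEL x. AEL t. en (u t x) <= C*B x^.(4/p)" using u_le_zsum[OF fin pq(1)] by (force elim: eventually_mono intro: order_trans[OF _ S])
 qed
qed

end

section \<open>Passage from the given spaces to the setting of the estimates\<close>

lemma spacetime_mm:
 fixes u :: "real => real => 'b::real_normed_vector"
 assumes "spacetime_measurable I u" and I [measurable]: "I : sets borel"
 shows "mm (%t x. ind I t *\<^sub>R u t x)"
proof -
 let ?r = "restrict_space LL (I \<times> UNIV)" and ?i = "%z :: real \<times> real. (fst z, snd z)"
 have "?i : measurable ?r (restrict_space lborel I \<Otimes>\<^sub>M lborel)"
 proof (rule measurable_Pair)
  show "fst : measurable ?r (restrict_space lborel I)" by (rule measurable_restrict_space2) (auto simp: space_restrict_space intro!: measurable_restrict_space1)
  show "snd : measurable ?r lborel" by (rule measurable_restrict_space1) measurable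
 qed
 hence "(%z. u (fst z) (snd z)) : borel_measurable ?r"
  using measurable_comp[OF _ assms(1)[unfolded spacetime_measurable_def], of ?i ?r] by (simp add: comp_def split_beta')
 moreover have "I \<times> UNIV \<inter> space LL : sets (lborel \<Otimes>\<^sub>M (lborel :: real measure))"
  using pair_measureI[of I lborel UNIV "lborel :: real measure"] by (simp add: space_pair_measure)
 ultimately have "bmL (%z. ind (I \<times> UNIV) z *\<^sub>R u (fst z) (snd z))" by (simp only: borel_measurable_restrict_space_iff)
 moreover have "ind (I \<times> UNIV) z = (ind I (fst z) :: real)" for z :: "real \<times> real" by (cases z) (simp add: indicator_def)
 ultimately show ?thesis by (simp add: split_beta')
qed

lemma mm_spacetime:
 assumes "mm w" "I : sets borel"
 shows "spacetime_measurable I w"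
proof -
 let ?M = "restrict_space lborel I \<Otimes>\<^sub>M (lborel :: real measure)"
 have "id : measurable (restrict_space lborel I) (lborel :: real measure)" by (intro measurable_restrict_space1 measurable_ident)
 from measurable_compose[OF measurable_fst this] have 1: "fst : measurable ?M lborel" by simp
 have "(%z. case (fst z, snd z) of (t, x) => w t x) : borel_measurable ?M" by (rule measurable_compose[OF measurable_Pair[OF 1 measurable_snd] assms(1)])
 thus ?thesis by (simp add: spacetime_measurable_def)
qed

lemma Hdot_fourier_pair:
 assumes "f : Hdot s"
 shows "\<exists>F. fourier_pair (%x. cor (f x)) F"
proof (rule ccontr)
 assume "\<not> ?thesis"
 hence "{g. fourier_multiplier (D_symbol s) (%x. cor (f x)) g} = {}" by (auto simp: fourier_multiplier_def)
 hence "Hdot_norm s f = top" unfolding Hdot_norm_def by (simp only: image_empty Inf_empty)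
 thus False using assms by (simp add: Hdot_def)
qed

text \<open>On an annulus the symbol of \<open>D^sg\<close> is invertible, so a piece of
  \<open>f\<close> is a piece of order \<open>- sg\<close> of its derivative.\<close>

lemma cv_D:
 assumes F: "fourier_pair f F" and g: "fourier_pair g (%xi. abspow sg xi*F xi)"
 shows "cv (bw 0 l) f y = cv (bw (- sg) l) g y"
proof -
 have "F xi*bw 0 l xi = abspow sg xi*F xi*bw (- sg) l xi" for xi
 proof (cases "xi = 0")
  case True thus ?thesis by (simp add: bw_def abspow_def)
 next
  case False
  hence "abspow sg xi*abspow (- sg) xi = abspow 0 xi" by (simp add: abspow_def flip: powr_add of_real_mult)
  thus ?thesis by (simp add: bw_def mult_ac)
 qed
 thus ?thesis unfolding cv_pair(1)[OF F bump_bw] cv_pair(1)[OF g bump_bw] by (simp only:)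
qed

text \<open>By \<open>cv_D\<close> the piece at scale \<open>l\<close> is a multiplier of norm
  proportional to \<open>2 powr (- (sg*l))\<close> applied to the derivative of order
  \<open>sg\<close>. At critical order this is the a priori bound \<open>ap\<close>.\<close>

lemma D_mixed_norm_scales:
 fixes u :: "real => real => real"
 assumes fin: "D_mixed_norm sg (er p) (er q) {0..T} u < top" and pq: "1 < p" "1 < q"
 obtains M where "0 <= M" "!!l. mx p q (%t y. en (cv (bw 0 l) (%x. cor (u t x)*ind {0..T} t) y)) <= er (M*2 powr (- (sg*ri l)))"
proof -
 let ?c = "%l t y. en (cv (bw 0 l) (%x. cor (u t x)*ind {0..T} t) y)"
 obtain w where w: "spacetime_measurable {0..T} w" "AEL t. t : {0..T} --> fourier_multiplier (D_symbol sg) (%x. cor (u t x)) (w t)"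
  "mixed_norm (er p) (er q) {0..T} w < top" using fin unfolding D_mixed_norm_def by (auto simp: INF_less_iff)
 let ?w = "%t x. ind {0..T} t *\<^sub>R w t x"
 have wm: "mm ?w" by (rule spacetime_mm[OF w(1)]) simp
 have "(%t x. en (?w t x)) = (%t x. en (w t x)*ind {0..T} t)" by (auto simp: fun_eq_iff indicator_def)
 hence N: "mx p q (%t x. en (?w t x)) < top" using w(3) pq by (simp add: mixed_norm_mx)
 define M where "M = enn2real (kn (bw (- sg) 0)*mx p q (%t x. en (?w t x)))"
 have M: "kn (bw (- sg) 0)*mx p q (%t x. en (?w t x)) = er M" "0 <= M" using N kn_finite[OF bump_schwartz[OF bump_bw]] by (simp_all add: M_def ennreal_mult_less_top)
 show thesis
 proof (rule that[OF M(2)])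
  fix l
  have "mx p q (?c l) <= mx p q (%t y. en (cv (bw (- sg) l) (?w t) y))"
  proof (rule mx_mono_AE)
   show "AEL y. AEL t. ?c l t y <= en (cv (bw (- sg) l) (?w t) y)"
   proof (rule AE_I2)
    fix y show "AEL t. ?c l t y <= en (cv (bw (- sg) l) (?w t) y)" using w(2)
    proof eventually_elim
     case (elim t)
     show ?case
     proof (cases "t : {0..T}")
      case True
      then obtain F where "fourier_pair (%x. cor (u t x)) F" "fourier_pair (w t) (%xi. abspow sg xi*F xi)"
       using elim by (auto simp: fourier_multiplier_def D_symbol_abspow)
      from cv_D[OF this] True show ?thesis by simp
     qed (simp add: cv_def)
    qed
   qed
  qed (use pq in auto)
  also have "... <= kn (bw (- sg) l)*mx p q (%t x. en (?w t x))" by (rule cv_mx[OF wm bump_measurable[OF bump_bw] pq])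
  also have "... = er (2 powr (- sg*ri l))*er M" unfolding kn_bw[of "- sg" l] M(1)[symmetric] by (simp only: mult.assoc)
  also have "... = er (M*2 powr (- (sg*ri l)))" using M(2) by (simp add: ennreal_mult mult.commute)
  finally show "mx p q (?c l) <= er (M*2 powr (- (sg*ri l)))" .
 qed
qed

text \<open>The Fourier transforms at the single times and of the data exist because the Sobolev
  norms are finite. The free evolution in the Duhamel formula is moved to the frequency side, where
  uniqueness identifies the transform it uses with \<open>F0\<close>.\<close>

lemma critical_sols:
 fixes alpha \<mu> s T :: real and k :: nat and u0 :: "real => real" and u :: "real => real => real"
 assumes alpha: "1 < alpha" "alpha <= 2" and k: "4 <= k" and \<mu>: "\<mu> : {1, -1}" and s: "0 <= s" and u0: "u0 : Hdot s" and T: "0 < T"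
  and crit: "critical_solution alpha k \<mu> u0 T u"
 obtains F F0 M where "sols alpha k T (\<mu>/(k + 1)) ((2*alpha + 1)*k/(alpha + 2)) ((2*alpha + 1)*k/(2*(alpha - 1))) (s_crit alpha k + 1/2) M
   (%t x. cor (u t x)*ind {0..T} t) F F0 s"
proof -
 interpret disp alpha by unfold_locales (use alpha in auto)
 define sg where "sg = s_crit alpha k"
 have k4: "4 <= real k" using k by simp
 have sg0: "0 <= sg" using alpha k4 by (simp add: sg_def s_crit_def field_simps)
 let ?I = "{0..T}" and ?u = "%t x. cor (u t x)*ind {0..T} t" and ?p = "(2*alpha + 1)*k/(alpha + 2)" and ?q = "(2*alpha + 1)*k/(2*(alpha - 1))"
 have X: "spacetime_measurable ?I u" "!!t. t : ?I ==> u t : Hdot sg" "X_norm alpha sg ?I u < \<infinity>" and S: "S_norm alpha k sg ?I u < \<infinity>"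
  and D: "solves_Duhamel alpha k \<mu> u0 T u" using crit by (simp_all add: critical_solution_def X_space_def S_space_def sg_def)
 have "\<exists>F. \<forall>t\<in>?I. fourier_pair (%x. cor (u t x)) (F t)" by (rule bchoice) (use X(2) Hdot_fourier_pair in blast)
 then obtain F where F: "!!t. t : ?I ==> fourier_pair (%x. cor (u t x)) (F t)" by blast
 obtain F0 where F0: "fourier_pair (%x. cor (u0 x)) F0" using Hdot_fourier_pair[OF u0] by blast
 have "X_norm alpha sg ?I u = (SUP t\<in>?I. Hdot_norm sg (u t)) + D_mixed_norm (sg + 1/2) (er P) (er Q) ?I u" by (simp add: X_norm_def P_def Q_def)
 hence "D_mixed_norm (sg + 1/2) (er P) (er Q) ?I u < top" using X(3) by (simp add: less_top)
 then obtain M where M: "0 <= M" "!!l. mx P Q (%t y. en (cv (bw 0 l) (%x. cor (u t x)*ind {0..T} t) y)) <= er (M*2 powr (- ((sg + 1/2)*ri l)))"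
  by (rule D_mixed_norm_scales) (use PQ in auto)
 have pq: "p_exp alpha k = er ?p" "q_exp alpha k sg = er ?q" "0 < ?p" "0 < ?q"
 proof -
  have "q_denom alpha k sg = (alpha + 1)*(2*(alpha - 1))" by (simp add: q_denom_def sg_def algebra_simps power2_eq_square)
  moreover have "(2*alpha + 1)*(alpha + 1)*k/((alpha + 1)*(2*(alpha - 1))) = ?q"
   using nonzero_mult_divide_mult_cancel_left[of "alpha + 1" "(2*alpha + 1)*k" "2*(alpha - 1)"] alpha by (simp add: mult_ac)
  ultimately show "q_exp alpha k sg = er ?q" using alpha by (simp add: q_exp_def)
 qed (use alpha k in "simp_all add: p_exp_def")
 obtain v where v: "free_evolution alpha u0 ?I v" and Duh: "!!t psi. t : ?I ==> schwartz psi ==>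
     integrable (restrict_space lborel {0..t} \<Otimes>\<^sub>M lborel) (%(tau, x). Duhamel_integrand alpha k u t psi tau x) &
     (LI x. of_real (u t x)*fourier psi x) = (LI x. v t x*fourier psi x) -
      of_real (\<mu>/real (k + 1))*(LINT tau|restrict_space lborel {0..t}. LI x. Duhamel_integrand alpha k u t psi tau x)"
  using D unfolding solves_Duhamel_def by blast
 have "sols alpha k T (\<mu>/(k + 1)) ?p ?q (sg + 1/2) M ?u F F0 s"
 proof unfold_locales
  show "\<bar>\<mu>/(k + 1)\<bar> <= 1" using \<mu> by auto
  show "mm ?u"
  proof -
   have "?u = (%t x. cor (ind ?I t *\<^sub>R u t x))" by (auto simp: fun_eq_iff indicator_def)
   moreover have [measurable]: "mm (%t x. ind ?I t *\<^sub>R u t x)" by (rule spacetime_mm[OF X(1)]) simp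
   have "mm (%t x. cor (ind ?I t *\<^sub>R u t x))" by measurable
   ultimately show ?thesis by simp
  qed
  show "mx ?p ?q (%t x. en (?u t x)) < top"
  proof -
   have "(%t x. en (?u t x)) = (%t x. en (u t x)*ind ?I t)" by (auto simp: fun_eq_iff indicator_def)
   thus ?thesis using S pq(3,4) by (simp add: S_norm_def pq(1,2) mixed_norm_mx)
  qed
  show "bm F0" by (rule fp_measurable(2)[OF F0])
  show "integrable lborel (%xi. F0 xi*psi xi)" if "schwartz psi" for psi using F0 that by (simp add: fourier_pair_def)
  show "sqn (%xi. abspow s xi*F0 xi) < top"
  proof -
   have "sqn (%xi. abspow s xi*F0 xi)^.(1/2) < top" using u0 by (intro order_le_less_trans[OF Hdot_lower[OF F0, of s]]) (simp add: Hdot_def ennreal_mult_less_top)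
   thus ?thesis by simp
  qed
  show "fourier_pair (?u t) (F t)" if "t : ?I" for t using F[OF that] that by simp
  fix t psi assume t: "t : ?I" and psi: "schwartz psi"
  let ?r = "restrict_space lborel {0..t}"
  let ?G = "%tau x. ?u tau x^(k + 1)*fourier (%xi. V_symbol alpha (t - tau) xi*(\<i> * of_real xi)*psi xi) x"
  have G: "?G tau x = Duhamel_integrand alpha k u t psi tau x" if "tau : {0..t}" for tau x using that t by (simp add: Duhamel_integrand_def)
  have 1: "integrable (?r \<Otimes>\<^sub>M lborel) (%(tau, x). ?G tau x)"
  proof -
   have "integrable (?r \<Otimes>\<^sub>M lborel) (%(tau, x). ?G tau x) = integrable (?r \<Otimes>\<^sub>M lborel) (%(tau, x). Duhamel_integrand alpha k u t psi tau x)"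
    by (rule Bochner_Integration.integrable_cong[OF refl]) (use G in "auto simp: space_pair_measure space_restrict_space")
   thus ?thesis using Duh[OF t psi] by simp
  qed
  have 2: "(LINT tau|?r. LI x. ?G tau x) = (LINT tau|?r. LI x. Duhamel_integrand alpha k u t psi tau x)"
   by (intro LI_cong refl) (use G in "auto simp: space_restrict_space")
  obtain F' where F': "fourier_pair (%x. cor (u0 x)) F'" "fourier_pair (v t) (%xi. V_symbol alpha t xi*F' xi)"
   using v t unfolding free_evolution_def fourier_multiplier_def by blast
  have "(LI x. v t x*fourier psi x) = (LI xi. V_symbol alpha t xi*F' xi*psi xi)" using F'(2) psi by (simp add: fourier_pair_def)
  also have "... = (LI xi. V_symbol alpha t xi*F0 xi*psi xi)"
  proof -
   have [measurable]: "bm F0" "bm F'" "bm psi" "bm (V_symbol alpha t)"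
    by (simp_all add: fp_measurable(2)[OF F0] fp_measurable(2)[OF F'(1)] schwartz_measurable[OF psi] V_symbol_def[abs_def])
   show ?thesis by (rule integral_cong_AE) (measurable, use fourier_pair_unique[OF F'(1) F0] in eventually_elim, simp)
  qed
  finally have 3: "(LI x. v t x*fourier psi x) = (LI xi. V_symbol alpha t xi*F0 xi*psi xi)" .
  have 4: "(LI x. ?u t x*fourier psi x) = (LI x. of_real (u t x)*fourier psi x)" using t by simp
  show "integrable (?r \<Otimes>\<^sub>M lborel) (%(tau, x). ?G tau x) &
   (LI x. ?u t x*fourier psi x) = (LI xi. V_symbol alpha t xi*F0 xi*psi xi) - cor (\<mu>/real (k + 1))*(LINT tau|?r. LI x. ?G tau x)"
   unfolding 2 3 4 by (rule conjI[OF 1 Duh[OF t psi, THEN conjunct2, unfolded 3]])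
 qed (use k T s M(1) sg0 in "simp_all add: M(2)")
 thus thesis unfolding sg_def by (rule that)
qed

lemma Hdot_tendsto:
 assumes F: "!!n. fourier_pair (%x. cor (f n x)) (F n)" and lim: "(%n. sqn (%xi. abspow s xi*F n xi)) ----> 0"
 shows "(%n. Hdot_norm s (f n)) ----> 0"
proof -
 have z: "(%n. sqn (%xi. abspow s xi*F n xi)^.(1/2)) ----> 0" using tendsto_ennreal_powr[OF lim, of "1/2"] by simp
 have "eventually (%n. sqn (%xi. abspow s xi*F n xi) < top) sequentially" by (rule order_tendstoD(2)[OF lim]) simp
 hence "eventually (%n. Hdot_norm s (f n) <= sqn (%xi. abspow s xi*F n xi)^.(1/2)) sequentially" by eventually_elim (rule Hdot_upper[OF F])
 thus ?thesis by (rule tendsto_sandwich[OF _ _ tendsto_const z, rotated]) simp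
qed

lemma tendsto_Hdot:
 assumes F: "!!n. fourier_pair (%x. cor (f n x)) (F n)" and lim: "(%n. Hdot_norm s (f n)) ----> 0"
 shows "(%n. sqn (%xi. abspow s xi*F n xi)) ----> 0"
proof -
 have "(%n. 3*Hdot_norm s (f n)) ----> 0" using ennreal_tendsto_cmult[OF _ lim, of 3] by simp
 hence "(%n. sqn (%xi. abspow s xi*F n xi)^.(1/2)) ----> 0" by (rule tendsto_sandwich[OF _ _ tendsto_const, rotated 2]) (use Hdot_lower[OF F] in auto)
 from tendsto_ennreal_powr[OF this, of 2] show ?thesis by (simp add: epowr_powr)
qed

theorem proposition1p4:
  fixes \<alpha> \<mu> s T :: real and k :: nat
    and u0 :: "real \<Rightarrow> real" and u :: "real \<Rightarrow> real \<Rightarrow> real" and \<epsilon>0 :: "real \<Rightarrow> real"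
  assumes "1 < \<alpha>" and "\<alpha> \<le> 2" and "k \<ge> 4" and "\<mu> \<in> {1, -1}" and "s \<ge> 0"
    and "u0 \<in> Hdot s \<inter> Hdot (s_crit \<alpha> k)"
    and "critical_local_theory \<alpha> k \<mu> \<epsilon>0"
    and "admissible_time \<alpha> k (\<epsilon>0 (enn2real (Hdot_norm (s_crit \<alpha> k) u0))) u0 T"
    and "critical_solution \<alpha> k \<mu> u0 T u"
  shows "u \<in> X_space \<alpha> s {0..T} \<and> (q_denom \<alpha> k s \<ge> 0 \<longrightarrow> u \<in> S_space \<alpha> k s {0..T})"
proof -
 have T: "0 < T" using assms(8) by (simp add: admissible_time_def)
 let ?I = "{0..T}" and ?u = "%t x. cor (u t x)*ind {0..T} t"
 have u0: "u0 : Hdot s" using assms(6) by simp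
 define p q where "p = (2*\<alpha> + 1)*k/(\<alpha> + 2)" and "q = (2*\<alpha> + 1)*k/(2*(\<alpha> - 1))"
 obtain F F0 M where "sols \<alpha> k T (\<mu>/(k + 1)) p q (s_crit \<alpha> k + 1/2) M ?u F F0 s"
  by (rule critical_sols[OF assms(1-5) u0 T assms(9), folded p_def q_def])
 then interpret sols \<alpha> k T "\<mu>/(k + 1)" p q "s_crit \<alpha> k + 1/2" M ?u F F0 s .
 have um: "spacetime_measurable ?I u" and X: "!!t. t : ?I ==> ((%r. Hdot_norm (s_crit \<alpha> k) (%x. u r x - u t x)) \<longlongrightarrow> 0) (at t within ?I)"
  using assms(9) by (simp_all add: critical_solution_def X_space_def)
 have F: "fourier_pair (%x. cor (u t x)) (F t)" if "t : ?I" for t using pr[OF that] that by simp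
 have Fd: "fourier_pair (%x. cor (u r x - u t x)) (%\<xi>. F r \<xi> - F t \<xi>)" if "r : ?I" "t : ?I" for r t
  using fourier_pair_diff[OF F[OF that(1)] F[OF that(2)]] by simp
 obtain N where N: "N < top" "!!t. t : ?I ==> sqn (%\<xi>. abspow s \<xi>*F t \<xi>) <= N" using Hs_bound by blast
 have H: "Hdot_norm s (u t) <= N^.(1/2)" if t: "t : ?I" for t
 proof -
  have "Hdot_norm s (u t) <= sqn (%\<xi>. abspow s \<xi>*F t \<xi>)^.(1/2)" by (rule Hdot_upper[OF F[OF t]]) (rule order_le_less_trans[OF N(2)[OF t] N(1)])
  also have "... <= N^.(1/2)" by (intro epowr_mono N t) simp
  finally show ?thesis .
 qed
 have Hf: "u t : Hdot s" if "t : ?I" for t unfolding Hdot_def using order_le_less_trans[OF H[OF that]] N(1) by simp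
 \<comment> \<open>Sequences suffice: \<open>tendsto_Hdot\<close> brings the given critical
   continuity to the frequency side, \<open>Hs_continuous\<close> raises the order to
   \<open>s\<close>, and \<open>Hdot_tendsto\<close> returns.\<close>
 have cont: "((%r. Hdot_norm s (%x. u r x - u t x)) \<longlongrightarrow> 0) (at t within ?I)" if t: "t : ?I" for t unfolding tendsto_at_iff_sequentially
 proof (intro allI impI)
  fix X assume Xd: "\<forall>i. X i : ?I - {t}" and Xt: "X ----> t"
  have Xi: "X i : ?I" for i using Xd by blast
  have "((%r. Hdot_norm (s_crit \<alpha> k) (%x. u r x - u t x)) \<circ> X) ----> 0"
   using X[OF t] Xd Xt unfolding tendsto_at_iff_sequentially by (elim allE[of _ X] impE)
  hence "(%n. Hdot_norm (s_crit \<alpha> k) (%x. u (X n) x - u t x)) ----> 0" by (simp add: comp_def)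
  from Hdot_tendsto[OF Fd[OF Xi t] Hs_continuous[OF Xi t tendsto_Hdot[OF Fd[OF Xi t] this]]]
  show "((%r. Hdot_norm s (%x. u r x - u t x)) \<circ> X) ----> 0" by (simp add: comp_def)
 qed
 have "D_mixed_norm (s + 1/2) (er P) (er Q) ?I u <= mixed_norm (er P) (er Q) ?I W" unfolding D_mixed_norm_def
 proof (rule INF_lower, simp only: mem_Collect_eq, intro conjI)
  show "spacetime_measurable ?I W" by (rule mm_spacetime[OF W(1)]) simp
  show "AEL t. t : ?I --> fourier_multiplier (D_symbol (s + 1/2)) (%x. cor (u t x)) (W t)"
   using W(3) by eventually_elim (use F in "auto simp: fourier_multiplier_def D_symbol_abspow")
 qed
 also have "... <= mx P Q (%t x. en (W t x))" using PQ by (subst mixed_norm_mx) (auto intro!: mx_mono simp: indicator_def)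
 also have "... < top" by (rule W(2))
 finally have D: "D_mixed_norm (s + 1/2) (er P) (er Q) ?I u < top" .
 have "(SUP t\<in>?I. Hdot_norm s (u t)) <= N^.(1/2)" by (rule SUP_least) (rule H)
 hence sup: "(SUP t\<in>?I. Hdot_norm s (u t)) < top" using N(1) by (auto intro: order_le_less_trans)
 have Xs: "u : X_space \<alpha> s ?I" unfolding X_space_def X_norm_def P_def[symmetric] Q_def[symmetric] using um cont D sup Hf by simp
 have Ss: "u : S_space \<alpha> k s ?I" if d0: "0 <= q_denom \<alpha> k s"
 proof -
  have p: "p_exp \<alpha> k = er p" "0 < p" using pq(1) by (simp_all add: p_exp_def p_def)
  have qd: "q_denom \<alpha> k s = d" by (simp add: q_denom_def d_def sc_def s_crit_def)
  have en_u: "(%t x. en (?u t x)) = (%t x. en (u t x)*ind ?I t)" by (auto simp: fun_eq_iff indicator_def)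
  have "S_norm \<alpha> k s ?I u < top"
  \<comment> \<open>The time exponent is infinite only for \<open>d = 0\<close>.
    \<open>S_low\<close> and \<open>S_high\<close> yield \<open>0 < r\<close>, which excludes
    \<open>d = 0\<close> in the complementary case, as division by zero would make \<open>r\<close>
    vanish.\<close>
  proof (cases "d = 0 & sc < s")
   case False
   hence r: "0 < r" "mx p r (%t x. en (u t x)*ind ?I t) < top" using S_low S_high d0 unfolding qd en_u by (cases "s <= sc"; simp)+
   hence "d ~= 0" by (auto simp: r_def)
   hence "q_exp \<alpha> k s = er r" by (simp add: q_exp_def qd r_def)
   thus ?thesis using r p(2) by (simp add: S_norm_def p(1) mixed_norm_mx)
  next
   case True
   hence q: "q_exp \<alpha> k s = \<infinity>" by (simp add: q_exp_def qd)
   obtain C B where CB: "C < top" "bml B" "(NN x. B x^.4) < top" "AEL x. AEL t. en (?u t x) <= C*B x^.(4/p)" by (rule S_end) (use True in auto)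
   let ?e = "%x. esssup (restrict_space lborel ?I) (%t. en (u t x))"
   have "AEL x. ?e x <= C*B x^.(4/p)" using CB(4)
   proof eventually_elim
    case (elim x)
    have "bml (%t. ind ?I t *\<^sub>R u t x)" by (rule mm_section(1)[OF spacetime_mm[OF um]]) simp
    hence "(%t. u t x) : borel_measurable (restrict_space lborel ?I)" by (simp add: borel_measurable_restrict_space_iff)
    moreover have "AE t in restrict_space lborel ?I. en (u t x) <= C*B x^.(4/p)" using elim by (auto simp: AE_restrict_space_iff elim: eventually_mono)
    ultimately show ?case by (intro esssup_I) auto
   qed
   hence "(NN x. ?e x^.p) <= (NN x. C^.p*B x^.4)"
   proof (rule nn_integral_mono_AE[OF AE_mp], intro AE_I2 impI)
    fix x assume "?e x <= C*B x^.(4/p)"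
    hence "?e x^.p <= (C*B x^.(4/p))^.p" using p(2) by (intro epowr_mono) auto
    thus "?e x^.p <= C^.p*B x^.4" using p(2) by (simp add: epowr_mult epowr_powr)
   qed
   also have "... = C^.p*(NN x. B x^.4)" using CB(2) by (intro nn_cmult) simp
   also have "... < top" using CB(1,3) by (simp add: ennreal_mult_less_top)
   finally show ?thesis using p by (simp add: S_norm_def mixed_norm_def q Lebesgue_norm_def)
  qed
  thus ?thesis using um by (simp add: S_space_def)
 qed
 show ?thesis using Xs Ss by blast
qed

end
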